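(* There exist numerical constants $c$ such that the following holds. Let $\bm{y}_t := \bm{\ell}_t + \bm{w}_t + \bm{v}_t$, $t=1,\dots,\alpha$, with $\bm{\ell}_t = \bm{P}\bm{a}_t$, $\bm{w}_t = \bm{M}_t \bm{\ell}_t$, and $\bm{v}_t,\bm{\ell}_t$ uncorrelated (basic model of the context), and let $\bm{D} := \frac{1}{\alpha}\sum_{t=1}^\alpha \bm{y}_t\bm{y}_t'$. Define the estimate of the subspace dimension $r$ $$\hat r := \arg\max_j\,[\lambda_j(\bm{D})-\lambda_{j+1}(\bm{D})].$$ Assume that the bounded signal and noise assumption holds and that for some $b<1$, $q<1$ the matrices $\bm{M}_t$ satisfy the data-dependency assumption with parameters $(q,b)$. Let $$\Delta := d_{\mathrm{denom}}(\alpha)+d(\alpha)+3\sqrt{b}\,q f+\frac{\lambda_{v,\mathrm{rest}}^+}{\lambda^-},$$ where $d(\alpha) := c\sqrt{\eta}\max\left(q f\sqrt{\frac{r\log n}{\alpha}},\ g\sqrt{\frac{\max(r_v,r)\log n}{\alpha}}\right)$ and $d_{\mathrm{denom}}(\alpha) := c\,\eta f\sqrt{\frac{r+\log n}{\alpha}}$. If $$\max_{j<r}\left(\lambda_j(\bm{\Lambda}+\bm{P}'\bm{\Sigma}_v\bm{P})-\lambda_{j+1}(\bm{\Lambda}+\bm{P}'\bm{\Sigma}_v\bm{P})\right)\le(1-4\Delta)\lambda^-+\lambda_{v,\bm{P}}^-,$$ then with probability at least $1-10n^{-10}$, $\hat r=r$. The result also holds if the bounded signal and noise assumption is replaced by the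 sub-Gaussian signal and noise assumption, provided $d(\alpha)$ is replaced by $c\max\left(\frac{\lambda_v^+}{\lambda^-},f\right)\sqrt{\frac n\alpha}$ (and $\eta$ in $d_{\mathrm{denom}}(\alpha)$ is absorbed into $c$).
   Context: Notation: $\bm{A}'$ is the transpose; $\|\cdot\|_2$ is the Euclidean vector norm or induced operator norm; $\lambda_j(\cdot)$ is the $j$-th largest eigenvalue of a symmetric matrix; $\lambda_{\min},\lambda_{\max}$ are smallest and largest eigenvalues. A basis matrix is a tall matrix with orthonormal columns. The letter $c$ (also $C$) is re-used for different numerical constants, i.e. positive constants not depending on $n,r,r_v,\alpha,q,b$ or the eigenvalue parameters; $\eta$ (below) is also regarded as a numerical constant. Basic model: $\bm{P}$ is an $n\times r$ basis matrix, $r \ll n$. $\bm{\ell}_t=\bm{P}\bm{a}_t$, where the $\bm{a}_t\in\mathbb{R}^r$ are zero mean, mutually independent random vectors with diagonal covariance $\bm{\Lambda}:=\mathbb{E}[\bm{a}_t\bm{a}_t']$. The $\bm{v}_t\in\mathbb{R}^n$ are zero mean, mutually independent random vectors with covariance $\bm{\Sigma}_v:=\mathbb{E}[\bm{v}_t\bm{v}_t']$, and $\mathbb{E}[\bm{\ell}_t\bm{v}_t']=0$ for all $t$. $\bm{w}_t=\bm{M}_t\bm{\ell}_t$ with unknown $n\times n$ data-dependency matrices $\bm{M}_t$. Parameters: $\lambda^-:=\lambda_{\min}(\bm{\Lambda})$, $\lambda^+:=\lambda_{\max}(\bm{\Lambda})$, $f:=\lambda^+/\lambda^-$; $\lambda_{v,\bm{P}}^-:=\lambda_{\min}(\bm{P}'\bm{\Sigma}_v\bm{P})$,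 $\lambda_{v,\mathrm{rest}}^+:=\lambda_{\max}(\bm{\Sigma}_v-\bm{P}\bm{P}'\bm{\Sigma}_v\bm{P}\bm{P}')$, $\lambda_v^+:=\|\bm{\Sigma}_v\|_2$, and $g:=\max\left(\frac{\lambda_v^+}{\lambda^-},\sqrt{\frac{\lambda_v^+}{\lambda^-}f}\right)$. It is assumed that $\lambda_v^+$ and $\lambda^+$ are $O(1)$ as functions of $n$. Bounded signal and noise assumption: the basic model holds; $\max_{j=1,\dots,r}\max_t \frac{(\bm{a}_t)_j^2}{\lambda_j(\bm{\Lambda})}\le\eta$ for a numerical constant $\eta$ ($\lambda_j(\bm{\Lambda})$ here being the $j$-th eigenvalue, i.e. $j$-th diagonal entry, of $\bm{\Lambda}$); and there is an integer $r_v\le Cn$ with $\max_t\|\bm{v}_t\|_2^2\le r_v\lambda_v^+$. Sub-Gaussian signal and noise assumption: the basic model holds and the $\bm{a}_t$ and $\bm{v}_t$ are sub-Gaussian random vectors with sub-Gaussian norms at most $C\sqrt{\lambda^+}$ and $C\sqrt{\lambda_v^+}$, respectively. (Sub-Gaussian norm of a scalar $x$: $\sup_{p\ge1}p^{-1/2}(\mathbb{E}|x|^p)^{1/p}$; of a vector: the supremum of the norms of its one-dimensional projections onto unit vectors.) Data-dependency assumption with parameters $(q,b)$: each $\bm{M}_t$ can be decomposed as $\bm{M}_t=\bm{M}_{2,t}\bm{M}_{1,t}$ with $\max_t\|\bm{M}_{1,t}\bm{P}\|_2\le q$, $\|\bm{M}_{2,t}\|_2\le1$ for all $t$, and $\left\|\frac1\alpha\sum_{t=1}^\alpha\bm{M}_{2,t}\bm{M}_{2,t}'\right\|_2\le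 b$.
   Formalization: Bounded case also assumes a_t has sub-Gaussian norm at most C√(ηλ⁺), c depending on C (false without: signed random Hadamard rows); the pairs (a_t,v_t) are independent over t; the empty maximum for r=1 is 0; c is stated per sample-space type (one type suffices, by passing to laws). *)

theory Defs
  imports "HOL-Probability.Probability" "Jordan_Normal_Form.Spectral_Radius"
begin

unbundle no vec_syntax
hide_const (open) Determinants.det Finite_Cartesian_Product.vec Finite_Cartesian_Product.mat

definition vec_norm2 :: "real vec \<Rightarrow> real" where
  "vec_norm2 x = sqrt (scalar_prod x x)"

definition mat_norm2 :: "real mat \<Rightarrow> real" where
  "mat_norm2 A = (SUP x \<in> {x \<in> carrier_vec (dim_col A). vec_norm2 x \<le> 1}. vec_norm2 (A *\<^sub>v x))"

text \<open>
  The index \<open>j\<close> of \<open>eig A j\<close> is 1-based: \<open>eig A 1 \<ge> eig A 2 \<ge> \<dots>\<close> are the real eigenvalues of \<open>A\<close>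
  with multiplicity. It is only meaningful for symmetric \<open>A\<close> and \<open>1 \<le> j \<le> dim_row A\<close>.
\<close>
definition eig :: "real mat \<Rightarrow> nat \<Rightarrow> real" where
  "eig A j = rev (sorted_list_of_multiset (proots (char_poly A))) ! (j - 1)"

definition lam_min :: "real mat \<Rightarrow> real" where
  "lam_min A = Min (spectrum A)"

definition lam_max :: "real mat \<Rightarrow> real" where
  "lam_max A = Max (spectrum A)"

definition basis_matrix :: "nat \<Rightarrow> nat \<Rightarrow> real mat \<Rightarrow> bool" where
  "basis_matrix n r P \<longleftrightarrow> r < n \<and> P \<in> carrier_mat n r \<and> P\<^sup>T * P = 1\<^sub>m r"

definition outer :: "real vec \<Rightarrow> real vec \<Rightarrow> real mat" where
  "outer x y = Matrix.mat (dim_vec x) (dim_vec y) (\<lambda>(i, j). x $ i * y $ j)"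

definition avg_mat :: "nat \<Rightarrow> nat \<Rightarrow> (nat \<Rightarrow> real mat) \<Rightarrow> real mat" where
  "avg_mat n \<alpha> F = Matrix.mat n n (\<lambda>(i, j). (1 / real \<alpha>) * (\<Sum>t = 1..\<alpha>. F t $$ (i, j)))"

definition random_vec :: "'w measure \<Rightarrow> nat \<Rightarrow> ('w \<Rightarrow> real vec) \<Rightarrow> bool" where
  "random_vec M d X \<longleftrightarrow>
     (\<forall>\<omega> \<in> space M. X \<omega> \<in> carrier_vec d) \<and> (\<forall>i < d. (\<lambda>\<omega>. X \<omega> $ i) \<in> borel_measurable M)"

definition square_integrable_vec :: "'w measure \<Rightarrow> nat \<Rightarrow> ('w \<Rightarrow> real vec) \<Rightarrow> bool" where
  "square_integrable_vec M d X \<longleftrightarrow> (\<forall>i < d. integrable M (\<lambda>\<omega>. (X \<omega> $ i)\<^sup>2))"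

definition zero_mean_vec :: "'w measure \<Rightarrow> nat \<Rightarrow> ('w \<Rightarrow> real vec) \<Rightarrow> bool" where
  "zero_mean_vec M d X \<longleftrightarrow> (\<forall>i < d. integral\<^sup>L M (\<lambda>\<omega>. X \<omega> $ i) = 0)"

text \<open>\<open>cross_moment M k l X Y\<close> is the \<open>k \<times> l\<close> matrix \<open>E[X Y']\<close>.\<close>
definition cross_moment ::
  "'w measure \<Rightarrow> nat \<Rightarrow> nat \<Rightarrow> ('w \<Rightarrow> real vec) \<Rightarrow> ('w \<Rightarrow> real vec) \<Rightarrow> real mat" where
  "cross_moment M k l X Y =
     Matrix.mat k l (\<lambda>(i, j). integral\<^sup>L M (\<lambda>\<omega>. outer (X \<omega>) (Y \<omega>) $$ (i, j)))"

text \<open>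
  The type \<open>real vec\<close> carries no \<open>\<sigma>\<close>-algebra, so independence is expressed through the tuple of
  coordinates in the product space.
\<close>
definition coords :: "nat \<Rightarrow> real vec \<Rightarrow> nat \<Rightarrow> real" where
  "coords d x = restrict (\<lambda>i. x $ i) {..<d}"

text \<open>
  The pairs \<open>(a\<^sub>t, v\<^sub>t)\<close> are mutually independent over \<open>t\<close>; \<open>a\<^sub>t\<close> and \<open>v\<^sub>t\<close> may depend on each other
  for the same \<open>t\<close>.
\<close>
definition indep_pairs ::
  "'w measure \<Rightarrow> nat \<Rightarrow> nat \<Rightarrow> nat \<Rightarrow> (nat \<Rightarrow> 'w \<Rightarrow> real vec) \<Rightarrow> (nat \<Rightarrow> 'w \<Rightarrow> real vec) \<Rightarrow> bool" where
  "indep_pairs M r n \<alpha> a v \<longleftrightarrow>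
     prob_space.indep_vars M
       (\<lambda>_. (\<Pi>\<^sub>M i \<in> {..<r}. borel) \<Otimes>\<^sub>M (\<Pi>\<^sub>M i \<in> {..<n}. borel))
       (\<lambda>t \<omega>. (coords r (a t \<omega>), coords n (v t \<omega>))) {1..\<alpha>}"

text \<open>Sub-Gaussian norm: infinite as soon as some absolute moment is infinite.\<close>
definition subgauss_norm :: "'w measure \<Rightarrow> ('w \<Rightarrow> real) \<Rightarrow> ereal" where
  "subgauss_norm M X =
     (SUP p \<in> {1::real..}.
        if integrable M (\<lambda>\<omega>. \<bar>X \<omega>\<bar> powr p)
        then ereal (p powr (- 1 / 2) * (integral\<^sup>L M (\<lambda>\<omega>. \<bar>X \<omega>\<bar> powr p)) powr (1 / p))
        else \<infinity>)"

definition subgauss_norm_vec :: "'w measure \<Rightarrow> nat \<Rightarrow> ('w \<Rightarrow> real vec) \<Rightarrow> ereal" where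
  "subgauss_norm_vec M d X =
     (SUP u \<in> {u \<in> carrier_vec d. vec_norm2 u = 1}. subgauss_norm M (\<lambda>\<omega>. scalar_prod u (X \<omega>)))"

definition signal :: "real mat \<Rightarrow> (nat \<Rightarrow> 'w \<Rightarrow> real vec) \<Rightarrow> nat \<Rightarrow> 'w \<Rightarrow> real vec" where
  "signal P a t \<omega> = P *\<^sub>v a t \<omega>"

definition observation ::
  "real mat \<Rightarrow> (nat \<Rightarrow> real mat) \<Rightarrow> (nat \<Rightarrow> 'w \<Rightarrow> real vec) \<Rightarrow> (nat \<Rightarrow> 'w \<Rightarrow> real vec)
     \<Rightarrow> nat \<Rightarrow> 'w \<Rightarrow> real vec" where
  "observation P Mt a v t \<omega> = signal P a t \<omega> + Mt t *\<^sub>v signal P a t \<omega> + v t \<omega>"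

definition sample_cov :: "nat \<Rightarrow> nat \<Rightarrow> (nat \<Rightarrow> 'w \<Rightarrow> real vec) \<Rightarrow> 'w \<Rightarrow> real mat" where
  "sample_cov n \<alpha> y \<omega> = avg_mat n \<alpha> (\<lambda>t. outer (y t \<omega>) (y t \<omega>))"

definition dim_estimate :: "nat \<Rightarrow> real mat \<Rightarrow> nat" where
  "dim_estimate n D = (ARG_MAX (\<lambda>j. eig D j - eig D (j + 1)) j. j \<in> {1..<n})"

definition basic_model ::
  "'w measure \<Rightarrow> nat \<Rightarrow> nat \<Rightarrow> nat \<Rightarrow> real mat \<Rightarrow> (nat \<Rightarrow> 'w \<Rightarrow> real vec) \<Rightarrow> (nat \<Rightarrow> 'w \<Rightarrow> real vec)
     \<Rightarrow> real mat \<Rightarrow> real mat \<Rightarrow> bool" where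
  "basic_model M n r \<alpha> P a v \<Lambda> \<Sigma>v \<longleftrightarrow>
     prob_space M \<and> 1 \<le> r \<and> 1 \<le> \<alpha> \<and> basis_matrix n r P \<and>
     (\<forall>t \<in> {1..\<alpha>}.
        random_vec M r (a t) \<and> square_integrable_vec M r (a t) \<and> zero_mean_vec M r (a t) \<and>
        random_vec M n (v t) \<and> square_integrable_vec M n (v t) \<and> zero_mean_vec M n (v t) \<and>
        \<Lambda> = cross_moment M r r (a t) (a t) \<and>
        \<Sigma>v = cross_moment M n n (v t) (v t) \<and>
        cross_moment M n n (signal P a t) (v t) = 0\<^sub>m n n) \<and>
     diagonal_mat \<Lambda> \<and> 0 < lam_min \<Lambda> \<and>
     indep_pairs M r n \<alpha> a v"

definition data_dependency ::
  "nat \<Rightarrow> nat \<Rightarrow> real mat \<Rightarrow> (nat \<Rightarrow> real mat) \<Rightarrow> real \<Rightarrow> real \<Rightarrow> bool" where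
  "data_dependency n \<alpha> P Mt q b \<longleftrightarrow>
     (\<exists>m M1 M2.
        (\<forall>t \<in> {1..\<alpha>}.
           M1 t \<in> carrier_mat (m t) n \<and> M2 t \<in> carrier_mat n (m t) \<and> Mt t = M2 t * M1 t \<and>
           mat_norm2 (M1 t * P) \<le> q \<and> mat_norm2 (M2 t) \<le> 1) \<and>
        mat_norm2 (avg_mat n \<alpha> (\<lambda>t. M2 t * (M2 t)\<^sup>T)) \<le> b)"

definition cond_f :: "real mat \<Rightarrow> real" where
  "cond_f \<Lambda> = lam_max \<Lambda> / lam_min \<Lambda>"

definition lam_v :: "real mat \<Rightarrow> real" where
  "lam_v \<Sigma>v = mat_norm2 \<Sigma>v"

definition lam_vP :: "real mat \<Rightarrow> real mat \<Rightarrow> real" where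
  "lam_vP P \<Sigma>v = lam_min (P\<^sup>T * \<Sigma>v * P)"

definition lam_vrest :: "real mat \<Rightarrow> real mat \<Rightarrow> real" where
  "lam_vrest P \<Sigma>v = lam_max (\<Sigma>v - P * P\<^sup>T * \<Sigma>v * P * P\<^sup>T)"

definition noise_g :: "real mat \<Rightarrow> real mat \<Rightarrow> real" where
  "noise_g \<Lambda> \<Sigma>v = max (lam_v \<Sigma>v / lam_min \<Lambda>) (sqrt (lam_v \<Sigma>v / lam_min \<Lambda> * cond_f \<Lambda>))"

text \<open>
  Since \<open>\<Lambda>\<close> is diagonal, its \<open>j\<close>-th eigenvalue is its \<open>j\<close>-th diagonal entry. The parameter \<open>C\<close> is the
  constant of the condition \<open>r\<^sub>v \<le> C n\<close>.

  Bounded, merely uncorrelated entries give no dimension-free bound on the sub-Gaussian norm of the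
  vector \<open>a\<^sub>t\<close> (take a random row of an \<open>r \<times> r\<close> Hadamard matrix with a random sign), and then
  \<open>(1/\<alpha>) \<Sum>\<^sub>t a\<^sub>t a\<^sub>t'\<close> need not concentrate at the rate \<open>\<surd>((r + log n)/\<alpha>)\<close>. A bound on that norm is
  therefore not part of, and does not follow from, this definition.
\<close>
definition bounded_signal_noise ::
  "real \<Rightarrow> 'w measure \<Rightarrow> nat \<Rightarrow> nat \<Rightarrow> nat \<Rightarrow> (nat \<Rightarrow> 'w \<Rightarrow> real vec) \<Rightarrow> (nat \<Rightarrow> 'w \<Rightarrow> real vec)
     \<Rightarrow> real mat \<Rightarrow> real mat \<Rightarrow> real \<Rightarrow> nat \<Rightarrow> bool" where
  "bounded_signal_noise C M n r \<alpha> a v \<Lambda> \<Sigma>v \<eta> rv \<longleftrightarrow>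
     (\<forall>t \<in> {1..\<alpha>}. \<forall>j < r. AE \<omega> in M. (a t \<omega> $ j)\<^sup>2 / \<Lambda> $$ (j, j) \<le> \<eta>) \<and>
     real rv \<le> C * real n \<and>
     (\<forall>t \<in> {1..\<alpha>}. AE \<omega> in M. (vec_norm2 (v t \<omega>))\<^sup>2 \<le> real rv * lam_v \<Sigma>v)"

definition subgaussian_signal_noise ::
  "real \<Rightarrow> 'w measure \<Rightarrow> nat \<Rightarrow> nat \<Rightarrow> nat \<Rightarrow> (nat \<Rightarrow> 'w \<Rightarrow> real vec) \<Rightarrow> (nat \<Rightarrow> 'w \<Rightarrow> real vec)
     \<Rightarrow> real mat \<Rightarrow> real mat \<Rightarrow> bool" where
  "subgaussian_signal_noise C M n r \<alpha> a v \<Lambda> \<Sigma>v \<longleftrightarrow>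
     (\<forall>t \<in> {1..\<alpha>}.
        subgauss_norm_vec M r (a t) \<le> ereal (C * sqrt (lam_max \<Lambda>)) \<and>
        subgauss_norm_vec M n (v t) \<le> ereal (C * sqrt (lam_v \<Sigma>v)))"

definition d_bounded ::
  "real \<Rightarrow> real \<Rightarrow> nat \<Rightarrow> nat \<Rightarrow> nat \<Rightarrow> nat \<Rightarrow> real \<Rightarrow> real \<Rightarrow> real \<Rightarrow> real" where
  "d_bounded c \<eta> n r rv \<alpha> q f g =
     c * sqrt \<eta> * max (q * f * sqrt (real r * ln (real n) / real \<alpha>))
                      (g * sqrt (real (max rv r) * ln (real n) / real \<alpha>))"

definition d_denom_bounded :: "real \<Rightarrow> real \<Rightarrow> nat \<Rightarrow> nat \<Rightarrow> nat \<Rightarrow> real \<Rightarrow> real" where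
  "d_denom_bounded c \<eta> n r \<alpha> f = c * \<eta> * f * sqrt ((real r + ln (real n)) / real \<alpha>)"

definition d_subgaussian :: "real \<Rightarrow> nat \<Rightarrow> nat \<Rightarrow> real mat \<Rightarrow> real mat \<Rightarrow> real" where
  "d_subgaussian c n \<alpha> \<Lambda> \<Sigma>v =
     c * max (lam_v \<Sigma>v / lam_min \<Lambda>) (cond_f \<Lambda>) * sqrt (real n / real \<alpha>)"

definition d_denom_subgaussian :: "real \<Rightarrow> nat \<Rightarrow> nat \<Rightarrow> nat \<Rightarrow> real \<Rightarrow> real" where
  "d_denom_subgaussian c n r \<alpha> f = c * f * sqrt ((real r + ln (real n)) / real \<alpha>)"

definition Delta :: "real \<Rightarrow> real \<Rightarrow> real \<Rightarrow> real \<Rightarrow> real mat \<Rightarrow> real mat \<Rightarrow> real mat \<Rightarrow> real" where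
  "Delta ddenom d q b P \<Lambda> \<Sigma>v =
     ddenom + d + 3 * sqrt b * q * cond_f \<Lambda> + lam_vrest P \<Sigma>v / lam_min \<Lambda>"

text \<open>
  The gaps are nonnegative, so inserting \<open>0\<close> changes nothing for \<open>r \<ge> 2\<close>; for \<open>r = 1\<close> it makes the
  maximum over the empty index set equal to \<open>0\<close>.
\<close>
definition max_gap :: "nat \<Rightarrow> real mat \<Rightarrow> real" where
  "max_gap r A = Max (insert 0 ((\<lambda>j. eig A j - eig A (j + 1)) ` {1..<r}))"

end

theory Submission imports Defs
begin

text \<open>
  Write \<open>D = P \<Lambda> P' + \<Sigma>\<^sub>v + B\<close>. By Weyl and Courant--Fischer, \<open>\<parallel>B\<parallel> + \<lambda>\<^sup>+\<^bsub>v,rest\<^esub> < \<Delta> \<lambda>\<^sup>-\<close> places the first \<open>r\<close>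
  eigenvalues of \<open>D\<close> near those of \<open>\<Lambda> + P' \<Sigma>\<^sub>v P\<close> and the others in a short interval at \<open>0\<close>, so under the gap
  condition the \<open>r\<close>-th gap of \<open>D\<close> is the strictly largest one.

  The mean of \<open>B\<close> is at most \<open>3 \<surd>b q \<lambda>\<^sup>+\<close>, by Cauchy--Schwarz over \<open>t\<close>. Its random part is controlled in two
  ways. For vectors with bounded sub-Gaussian norm, Chernoff bounds on a net of the sphere give the rate
  \<open>\<surd>((d + log n)/\<alpha>)\<close>. For norm-bounded vectors, a matrix Bernstein bound is obtained from the moments
  \<open>E tr (\<Sum>\<^sub>t (X\<^sub>t X\<^sub>t' - C\<^sub>t))\<^sup>2\<^sup>m\<close> with \<open>m \<approx> log n\<close>, which are estimated by peeling off one factor at a time; unlike the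
  exponential moment, this needs no Golden--Thompson inequality. The products \<open>\<ell>\<^sub>t w\<^sub>t'\<close> and
  \<open>(\<ell>\<^sub>t + w\<^sub>t) v\<^sub>t'\<close> are reduced to the symmetric case by polarization.
\<close>

unbundle no inner_syntax

section \<open>Spectral decomposition of symmetric matrices\<close>

text \<open>In the bounded case, expanding y y' with y = ell + w + v gives five blocks. Only the
  signal block must reach the rate sqrt((r + log n)/\<alpha>) of \<open>d_denom_bounded\<close>; a
  Bernstein bound would give sqrt(r log n/\<alpha>). So this block alone is treated by a net, in
  R^r, and needs a sub-Gaussian norm bound on \<open>a t\<close>. The other four may carry the
  logarithm, since \<open>d_bounded\<close> does.

  The deviation bounds are useful only for small rates, and no hypothesis states smallness directly.
  It is extracted from the gap condition: a maximal gap is nonnegative, so 4 \<Delta>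
  \<open>lam_min \<Lambda>\<close> is at most \<open>lam_min \<Lambda> + lam_v \<Sigma>v\<close>. If
  the noise dominates the signal, this says little about \<Delta> itself, but then g is at least the
  ratio of the two, and the bound on the term with g still makes its rate small.

  Two definitions force preliminary work. \<open>eig\<close> is read off the roots of the
  characteristic polynomial, so the spectral theorem has to identify it with a sorted orthonormal
  diagonalization. \<open>measure\<close> gives 0 on a set that is not an event, so the set on which
  the estimate equals r has to be shown measurable.\<close>

lemma symmetric_eigenvector:
  fixes A :: "real mat"
  assumes A: "A \<in> carrier_mat n n" and sym: "A\<^sup>T = A" and n: "n > 0"
  shows "\<exists>v k. v \<in> carrier_vec n \<and> v \<bullet> v = 1 \<and> A *\<^sub>v v = k \<cdot>\<^sub>v v"
proof -
  define Ac where "Ac = map_mat complex_of_real A"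
  have Ac: "Ac \<in> carrier_mat n n" using A unfolding Ac_def by simp
  from spectrum_non_empty[OF Ac] n obtain k where "eigenvalue Ac k"
    by (auto simp: spectrum_def)
  then obtain z where z: "z \<in> carrier_vec n" "z \<noteq> 0\<^sub>v n" "Ac *\<^sub>v z = k \<cdot>\<^sub>v z"
    using Ac unfolding eigenvalue_def eigenvector_def by auto
  define x where "x = map_vec Re z"
  define y where "y = map_vec Im z"
  have xy: "x \<in> carrier_vec n" "y \<in> carrier_vec n" using z(1) unfolding x_def y_def by auto
  have comp: "(\<Sum>j\<in>{0..<n}. complex_of_real (A $$ (i,j)) * z $ j) = k * z $ i" if i: "i < n" for i
  proof -
    have "(Ac *\<^sub>v z) $ i = (k \<cdot>\<^sub>v z) $ i" using z(3) by simp
    then show ?thesis using i A z(1) unfolding Ac_def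
      by (simp add: scalar_prod_def row_def)
  qed
  have Ax: "A *\<^sub>v x = Re k \<cdot>\<^sub>v x + (- Im k) \<cdot>\<^sub>v y"
  proof (rule eq_vecI)
    fix i assume "i < dim_vec (Re k \<cdot>\<^sub>v x + (- Im k) \<cdot>\<^sub>v y)"
    then have i: "i < n" using xy by simp
    from arg_cong[OF comp[OF i], of Re]
    show "(A *\<^sub>v x) $ i = (Re k \<cdot>\<^sub>v x + (- Im k) \<cdot>\<^sub>v y) $ i"
      using i A z(1) xy by (simp add: scalar_prod_def x_def y_def)
  qed (use A xy in auto)
  have Ay: "A *\<^sub>v y = Im k \<cdot>\<^sub>v x + Re k \<cdot>\<^sub>v y"
  proof (rule eq_vecI)
    fix i assume "i < dim_vec (Im k \<cdot>\<^sub>v x + Re k \<cdot>\<^sub>v y)"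
    then have i: "i < n" using xy by simp
    from arg_cong[OF comp[OF i], of Im]
    show "(A *\<^sub>v y) $ i = (Im k \<cdot>\<^sub>v x + Re k \<cdot>\<^sub>v y) $ i"
      using i A z(1) xy by (simp add: scalar_prod_def x_def y_def algebra_simps)
  qed (use A xy in auto)
  \<comment> \<open>The parts x, y of a complex eigenvector span a subspace invariant under A.
    Comparing the two mixed products, which are equal by symmetry, leaves Im k times |x|^2 + |y|^2
    equal to 0. So k is real, and whichever of x, y is nonzero is a real eigenvector.\<close>
  have "(A *\<^sub>v y) \<bullet> x = y \<bullet> (A *\<^sub>v x)"
    using transpose_vec_mult_scalar[OF A xy] sym by simp
  then have "Im k * (x \<bullet> x + y \<bullet> y) = 0"
    unfolding Ax Ay using xy comm_scalar_prod[OF xy]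
    by (simp add: add_scalar_prod_distrib[of _ n] scalar_prod_add_distrib[of _ n] algebra_simps)
  moreover have "x \<bullet> x + y \<bullet> y > 0"
  proof -
    from z(1,2) obtain i where i: "i < n" "z $ i \<noteq> 0" by (metis carrier_vecD eq_vecI index_zero_vec)
    have "0 < (\<Sum>j\<in>{0..<n}. (x $ j)\<^sup>2 + (y $ j)\<^sup>2)"
    proof (rule sum_pos2[of _ i])
      have "x $ i \<noteq> 0 \<or> y $ i \<noteq> 0" using i z(1) unfolding x_def y_def
        by (auto simp: complex_eq_iff)
      then show "0 < (x $ i)\<^sup>2 + (y $ i)\<^sup>2" by (simp add: sum_power2_gt_zero_iff)
    qed (use i in auto)
    then show ?thesis using xy by (simp add: scalar_prod_def sum.distrib power2_eq_square)
  qed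
  ultimately have im: "Im k = 0" and "x \<bullet> x > 0 \<or> y \<bullet> y > 0" by auto
  then obtain u where u: "u \<in> carrier_vec n" "u \<bullet> u > 0" "A *\<^sub>v u = Re k \<cdot>\<^sub>v u"
  proof -
    have "A *\<^sub>v x = Re k \<cdot>\<^sub>v x" "A *\<^sub>v y = Re k \<cdot>\<^sub>v y"
      unfolding Ax Ay im using xy by (auto intro!: eq_vecI)
    then show thesis using that xy \<open>x \<bullet> x > 0 \<or> y \<bullet> y > 0\<close> by blast
  qed
  define c where "c = 1 / sqrt (u \<bullet> u)"
  have "(c \<cdot>\<^sub>v u) \<bullet> (c \<cdot>\<^sub>v u) = 1"
    using u(1,2) by (simp add: c_def)
  moreover have "A *\<^sub>v (c \<cdot>\<^sub>v u) = Re k \<cdot>\<^sub>v (c \<cdot>\<^sub>v u)"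
    using A u by (simp add: mult_mat_vec[OF A u(1)] smult_smult_assoc mult.commute)
  ultimately show ?thesis using u(1) by (meson smult_carrier_vec)
qed

text \<open>The reflection along \<open>unit_vec n 0 - v\<close> exchanges these two unit vectors.
  If v is the first unit vector, then w = 0 and division by zero makes c = 0, so H is the identity;
  the equation \<open>c * c * (w \<bullet> w) = 2 * c\<close> covers both cases.\<close>

lemma householder:
  fixes v :: "real vec"
  assumes v: "v \<in> carrier_vec n" "v \<bullet> v = 1" and n: "n > 0"
  shows "\<exists>H \<in> carrier_mat n n. H\<^sup>T = H \<and> H * H = 1\<^sub>m n \<and> H *\<^sub>v unit_vec n 0 = v"
proof -
  define w where "w = unit_vec n 0 - v"
  define c where "c = 2 / (w \<bullet> w)"
  define H where "H = mat n n (\<lambda>(i,j). (if i = j then 1 else 0) - c * w $ i * w $ j)"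
  have w: "w \<in> carrier_vec n" using v unfolding w_def by simp
  have H: "H \<in> carrier_mat n n" unfolding H_def by simp
  have c: "c * c * (w \<bullet> w) = 2 * c" unfolding c_def by simp
  have ww: "w \<bullet> w = 2 * (1 - v $ 0)"
    using v n unfolding w_def
    by (simp add: minus_scalar_prod_distrib[of _ n] scalar_prod_minus_distrib[of _ n])
  have "H\<^sup>T = H" by (rule eq_matI) (auto simp: H_def)
  moreover have "H * H = 1\<^sub>m n"
  proof (rule eq_matI)
    fix i j assume "i < dim_row (1\<^sub>m n :: real mat)" "j < dim_col (1\<^sub>m n :: real mat)"
    then have ij: "i < n" "j < n" by auto
    have "(H * H) $$ (i,j) = (\<Sum>k<n. ((if i = k then 1 else 0) - c * w $ i * w $ k) * ((if k = j then 1 else 0) - c * w $ k * w $ j))"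
      using ij by (simp add: H_def scalar_prod_def atLeast0LessThan)
    also have "\<dots> = (\<Sum>k<n. (if i = k then (if k = j then 1 else 0) - c * w $ k * w $ j else 0)
        - (if k = j then c * w $ i * w $ k else 0) + c * c * w $ i * w $ j * (w $ k * w $ k))"
      by (intro sum.cong) (auto simp: algebra_simps)
    also have "\<dots> = ((if i = j then 1 else 0) - c * w $ i * w $ j) - c * w $ i * w $ j
        + c * c * w $ i * w $ j * (w \<bullet> w)"
      using ij w by (simp add: sum.distrib sum_subtractf sum_distrib_left [symmetric] scalar_prod_def atLeast0LessThan)
    also have "\<dots> = (if i = j then 1 else 0) - 2 * c * w $ i * w $ j + (c * c * (w \<bullet> w)) * w $ i * w $ j"
      by (simp add: algebra_simps)
    also have "\<dots> = (if i = j then 1 else 0)" unfolding c by simp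
    finally show "(H * H) $$ (i,j) = 1\<^sub>m n $$ (i,j)" using ij by simp
  qed (auto simp: H_def)
  moreover have "H *\<^sub>v unit_vec n 0 = v"
  proof (rule eq_vecI)
    fix i assume "i < dim_vec v"
    then have i: "i < n" using v by simp
    have *: "c * w $ 0 * w $ i = w $ i"
    proof (cases "w \<bullet> w = 0")
      case True
      then have "(\<Sum>j\<in>{0..<n}. (w $ j)\<^sup>2) = 0" using w by (simp add: scalar_prod_def power2_eq_square)
      then have "w $ i = 0" using i by (subst (asm) sum_nonneg_eq_0_iff) auto
      then show ?thesis by simp
    next
      case False
      have "w $ 0 = 1 - v $ 0" using n v unfolding w_def by simp
      moreover have "1 - v $ 0 \<noteq> 0" using False unfolding ww by simp
      ultimately show ?thesis unfolding c_def ww by (simp only:) (simp add: divide_simps)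
    qed
    have "(H *\<^sub>v unit_vec n 0) $ i = H $$ (i, 0)"
      using i n H by simp
    also have "\<dots> = (if i = 0 then 1 else 0) - c * w $ 0 * w $ i"
      using i n by (simp add: H_def)
    also have "\<dots> = v $ i" unfolding * using i n v by (simp add: w_def)
    finally show "(H *\<^sub>v unit_vec n 0) $ i = v $ i" .
  qed (use H v in auto)
  ultimately show ?thesis using H by blast
qed

text \<open>Deflation: the Householder matrix H moves a unit eigenvector to the first coordinate, so
  that H A H splits into a 1 by 1 block and a smaller symmetric block, to which the induction
  hypothesis applies.\<close>

lemma symmetric_diagonalization:
  fixes A :: "real mat"
  assumes "A \<in> carrier_mat n n" "A\<^sup>T = A"
  shows "\<exists>Q d. Q \<in> carrier_mat n n \<and> Q\<^sup>T * Q = 1\<^sub>m n \<and> A = Q * mat_diag n d * Q\<^sup>T"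
  using assms
proof (induction n arbitrary: A)
  case 0
  then show ?case by (intro exI[of _ "1\<^sub>m 0"] exI) (auto intro!: eq_matI)
next
  case (Suc m)
  let ?n = "Suc m"
  note A = Suc.prems(1) and sym = Suc.prems(2)
  obtain v k where v: "v \<in> carrier_vec ?n" "v \<bullet> v = 1" "A *\<^sub>v v = k \<cdot>\<^sub>v v"
    using symmetric_eigenvector[OF A sym] by auto
  obtain H where H: "H \<in> carrier_mat ?n ?n" "H\<^sup>T = H" "H * H = 1\<^sub>m ?n" "H *\<^sub>v unit_vec ?n 0 = v"
    using householder[OF v(1,2)] by auto
  define B where "B = H * A * H"
  have B: "B \<in> carrier_mat ?n ?n" using A H unfolding B_def by auto
  have symB: "B\<^sup>T = B" unfolding B_def using A H sym
    by (simp add: transpose_mult[of _ ?n ?n _ ?n] assoc_mult_mat[of _ ?n ?n _ ?n _ ?n])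
  have Hv: "H *\<^sub>v v = unit_vec ?n 0"
    using H by (metis assoc_mult_mat_vec one_mult_mat_vec unit_vec_carrier)
  have Be: "B *\<^sub>v unit_vec ?n 0 = k \<cdot>\<^sub>v unit_vec ?n 0"
  proof -
    have "B *\<^sub>v unit_vec ?n 0 = H *\<^sub>v (A *\<^sub>v (H *\<^sub>v unit_vec ?n 0))"
      unfolding B_def using A H by (simp add: assoc_mult_mat_vec[of _ ?n ?n _ ?n])
    also have "\<dots> = k \<cdot>\<^sub>v unit_vec ?n 0" unfolding H(4) v(3) using H v Hv
      by (simp add: mult_mat_vec[of _ ?n ?n])
    finally show ?thesis .
  qed
  have Bi0: "B $$ (i, 0) = (if i = 0 then k else 0)" if "i < ?n" for i
  proof -
    have "(B *\<^sub>v unit_vec ?n 0) $ i = B $$ (i, 0)" using that B by simp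
    then show ?thesis unfolding Be using that by (cases "i = 0") auto
  qed
  have B0i: "B $$ (0, i) = (if i = 0 then k else 0)" if "i < ?n" for i
    using Bi0[OF that] that B symB by (metis carrier_matD index_transpose_mat(1) zero_less_Suc)
  define A' where "A' = mat m m (\<lambda>(i,j). B $$ (Suc i, Suc j))"
  have A': "A' \<in> carrier_mat m m" unfolding A'_def by simp
  have "A'\<^sup>T = A'"
  proof (rule eq_matI)
    fix i j assume "i < dim_row A'" "j < dim_col A'"
    then have "i < m" "j < m" using A' by auto
    then show "A'\<^sup>T $$ (i, j) = A' $$ (i, j)" unfolding A'_def using B symB
      by simp (metis Suc_less_eq carrier_matD index_transpose_mat(1))
  qed (auto simp: A'_def)
  from Suc.IH[OF A' this] obtain Q d where Q: "Q \<in> carrier_mat m m" "Q\<^sup>T * Q = 1\<^sub>m m"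
    "A' = Q * mat_diag m d * Q\<^sup>T" by auto
  define d' where "d' = (\<lambda>i. case i of 0 \<Rightarrow> k | Suc i \<Rightarrow> d i)"
  define K where "K = mat 1 1 (\<lambda>_. k)"
  define F where "F = four_block_mat (1\<^sub>m 1) (0\<^sub>m 1 m) (0\<^sub>m m 1) Q"
  have F: "F \<in> carrier_mat ?n ?n" unfolding F_def using Q(1) four_block_carrier_mat[of "1\<^sub>m 1" 1 1 Q m m] by auto
  have K: "K \<in> carrier_mat 1 1" unfolding K_def by simp
  have FT: "F\<^sup>T = four_block_mat (1\<^sub>m 1) (0\<^sub>m 1 m) (0\<^sub>m m 1) Q\<^sup>T"
    unfolding F_def using Q(1) by (subst transpose_four_block_mat[of _ 1 1 _ m _ m]) auto
  have FF: "F\<^sup>T * F = 1\<^sub>m ?n"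
    unfolding FT unfolding F_def using Q
    by (subst mult_four_block_mat[of _ 1 1 _ m _ m _ _ 1 _ m]) auto
  have D: "mat_diag ?n d' = four_block_mat K (0\<^sub>m 1 m) (0\<^sub>m m 1) (mat_diag m d)"
    by (rule eq_matI) (auto simp: mat_diag_def d'_def K_def split: nat.splits)
  have Bblock: "B = four_block_mat K (0\<^sub>m 1 m) (0\<^sub>m m 1) A'"
    by (rule eq_matI) (use B Bi0 B0i in \<open>auto simp: A'_def K_def\<close>)
  have FDF: "F * mat_diag ?n d' * F\<^sup>T = B"
  proof -
    have "F * mat_diag ?n d' = four_block_mat K (0\<^sub>m 1 m) (0\<^sub>m m 1) (Q * mat_diag m d)"
      unfolding F_def D using Q K left_mult_zero_mat[OF mat_diag_dim, of 1 m d]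
      by (subst mult_four_block_mat[of _ 1 1 _ m _ m _ _ 1 _ m]) auto
    moreover have R: "Q * mat_diag m d \<in> carrier_mat m m" using mult_carrier_mat[OF Q(1) mat_diag_dim[of m d]] .
    moreover have "Q * mat_diag m d * Q\<^sup>T \<in> carrier_mat m m"
      by (rule mult_carrier_mat[OF R]) (use Q(1) in simp)
    ultimately show ?thesis unfolding FT using Q K right_mult_zero_mat[OF R, of "Suc 0"]
      by (simp add: mult_four_block_mat[of _ 1 1 _ m _ m _ _ 1 _ m] Bblock)
  qed
  have "A = H * B * H"
  proof -
    have "H * B * H = (H * H) * A * (H * H)" unfolding B_def using H(1) A
      by (simp add: assoc_mult_mat[of _ ?n ?n _ ?n _ ?n])
    then show ?thesis using H A by simp
  qed
  also have "\<dots> = (H * F) * mat_diag ?n d' * (H * F)\<^sup>T"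
    unfolding FDF[symmetric] using H(1,2) F mult_carrier_mat[OF mat_diag_dim[of ?n d'], of "F\<^sup>T" ?n]
      mult_carrier_mat[OF F mult_carrier_mat[OF mat_diag_dim[of ?n d'], of "F\<^sup>T" ?n]]
    by (simp add: transpose_mult[of _ ?n ?n _ ?n] assoc_mult_mat[of _ ?n ?n _ ?n _ ?n])
  finally have "A = (H * F) * mat_diag ?n d' * (H * F)\<^sup>T" .
  moreover have "(H * F)\<^sup>T * (H * F) = 1\<^sub>m ?n"
  proof -
    have "(H * F)\<^sup>T * (H * F) = F\<^sup>T * ((H * H) * F)"
      using H(1,2) F by (simp add: transpose_mult[of _ ?n ?n _ ?n] assoc_mult_mat[of _ ?n ?n _ ?n _ ?n])
    then show ?thesis using H F FF by simp
  qed
  ultimately show ?case using H(1) F by (metis mult_carrier_mat)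
qed


lemma conjugated_diag_index:
  fixes Q :: "real mat"
  assumes "Q \<in> carrier_mat n n" "i < n" "j < n"
  shows "(Q * mat_diag n d * Q\<^sup>T) $$ (i,j) = (\<Sum>k<n. Q $$ (i,k) * d k * Q $$ (j,k))"
  using assms by (simp add: mat_diag_mult_right[of _ n n] scalar_prod_def atLeast0LessThan)

lemma transpose_mult_self_index:
  fixes Q :: "real mat"
  assumes "Q \<in> carrier_mat n n" "i < n" "j < n"
  shows "(Q\<^sup>T * Q) $$ (i,j) = (\<Sum>k<n. Q $$ (k,i) * Q $$ (k,j))"
  using assms by (simp add: scalar_prod_def atLeast0LessThan)

text \<open>Ties the abstract diagonalization to \<open>eig\<close>. By similarity the
  characteristic polynomial is the product of the linear factors of the diagonal entries, so these
  entries are its roots with multiplicity; permuting the columns of \<open>Q0\<close> puts them in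
  the decreasing order used by \<open>eig\<close>.\<close>

lemma symmetric_eig_diagonalization:
  fixes A :: "real mat"
  assumes A: "A \<in> carrier_mat n n" and sym: "A\<^sup>T = A"
  obtains Q where "Q \<in> carrier_mat n n" "Q\<^sup>T * Q = 1\<^sub>m n" "Q * Q\<^sup>T = 1\<^sub>m n"
    "A = Q * mat_diag n (\<lambda>i. eig A (i + 1)) * Q\<^sup>T"
    "\<And>i j. i \<le> j \<Longrightarrow> j < n \<Longrightarrow> eig A (j + 1) \<le> eig A (i + 1)"
    "spectrum A = (\<lambda>i. eig A (i + 1)) ` {..<n}"
proof -
  obtain Q0 d where Q0: "Q0 \<in> carrier_mat n n" "Q0\<^sup>T * Q0 = 1\<^sub>m n" and
    A0: "A = Q0 * mat_diag n d * Q0\<^sup>T"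
    using symmetric_diagonalization[OF A sym] by auto
  have QQ0: "Q0 * Q0\<^sup>T = 1\<^sub>m n"
    using mat_mult_left_right_inverse[OF _ Q0(1) Q0(2)] Q0(1) by simp
  define ds where "ds = map d [0..<n]"
  define es where "es = rev (sort ds)"
  have "similar_mat A (mat_diag n d)"
    unfolding similar_mat_def similar_mat_wit_def Let_def
    using Q0 QQ0 A0 A by (intro exI[of _ Q0] exI[of _ "Q0\<^sup>T"]) auto
  then have "char_poly A = char_poly (mat_diag n d)" by (rule char_poly_similar)
  also have "\<dots> = (\<Prod>a\<leftarrow>diag_mat (mat_diag n d). [:- a, 1:])"
    by (rule char_poly_upper_triangular[of _ n]) (auto simp: mat_diag_def)
  also have "diag_mat (mat_diag n d) = ds"
    unfolding diag_mat_def ds_def by (auto simp: mat_diag_def)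
  finally have cp: "char_poly A = (\<Prod>a\<leftarrow>ds. [:- a, 1:])" .
  have pr: "proots (\<Prod>a\<leftarrow>xs. [:- a, 1:]) = mset xs" for xs :: "real list"
  proof (induction xs)
    case (Cons a xs)
    have "(\<Prod>a\<leftarrow>xs. [:- a, 1:]) \<noteq> 0" by (auto simp: prod_list_zero_iff)
    then show ?case using Cons by (simp add: proots_mult del: mult_pCons_left)
  qed simp
  have eig: "eig A j = es ! (j - 1)" for j
    unfolding eig_def cp pr es_def by simp
  have len: "length es = n" "length ds = n" unfolding es_def ds_def by simp_all
  have "mset es = mset ds" unfolding es_def by simp
  then obtain p where p: "p permutes {..<n}" "permute_list p ds = es"
    using mset_eq_permutation[of es ds] len by metis
  have pi: "p i < n" if "i < n" for i using p(1) that by (simp add: permutes_in_image[of p "{..<n}" i, simplified])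
  have esp: "eig A (i + 1) = d (p i)" if "i < n" for i
    unfolding eig using p len that pi[OF that] by (auto simp: permute_list_nth ds_def)
  have inj: "p i = p j \<longleftrightarrow> i = j" for i j using p(1) by (metis permutes_inj injD)
  define Q where "Q = mat n n (\<lambda>(i,j). Q0 $$ (i, p j))"
  have Q: "Q \<in> carrier_mat n n" unfolding Q_def by simp
  have QTQ: "Q\<^sup>T * Q = 1\<^sub>m n"
  proof (rule eq_matI)
    fix i j assume "i < dim_row (1\<^sub>m n :: real mat)" "j < dim_col (1\<^sub>m n :: real mat)"
    then have ij: "i < n" "j < n" by auto
    have "(Q\<^sup>T * Q) $$ (i,j) = (Q0\<^sup>T * Q0) $$ (p i, p j)"
      unfolding transpose_mult_self_index[OF Q ij]
        transpose_mult_self_index[OF Q0(1) pi[OF ij(1)] pi[OF ij(2)]]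
      using ij by (intro sum.cong) (auto simp: Q_def)
    then show "(Q\<^sup>T * Q) $$ (i,j) = 1\<^sub>m n $$ (i,j)" using ij pi inj unfolding Q0(2) by simp
  qed (use Q in auto)
  have AQ: "A = Q * mat_diag n (\<lambda>i. eig A (i + 1)) * Q\<^sup>T"
  proof (rule eq_matI)
    fix i j assume "i < dim_row (Q * mat_diag n (\<lambda>i. eig A (i + 1)) * Q\<^sup>T)"
      "j < dim_col (Q * mat_diag n (\<lambda>i. eig A (i + 1)) * Q\<^sup>T)"
    then have ij: "i < n" "j < n" using Q by auto
    have "(Q * mat_diag n (\<lambda>i. eig A (i + 1)) * Q\<^sup>T) $$ (i,j)
        = (\<Sum>k<n. Q0 $$ (i, p k) * d (p k) * Q0 $$ (j, p k))"
      unfolding conjugated_diag_index[OF Q ij] using ij by (intro sum.cong) (auto simp: Q_def esp simp flip: One_nat_def)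
    also have "\<dots> = (\<Sum>k<n. Q0 $$ (i, k) * d k * Q0 $$ (j, k))"
      using sum.permute[OF p(1), of "\<lambda>k. Q0 $$ (i, k) * d k * Q0 $$ (j, k)"] by (simp add: comp_def)
    also have "\<dots> = A $$ (i,j)" unfolding A0 conjugated_diag_index[OF Q0(1) ij] ..
    finally show "A $$ (i,j) = (Q * mat_diag n (\<lambda>i. eig A (i + 1)) * Q\<^sup>T) $$ (i,j)" ..
  qed (use Q A in auto)
  have anti: "eig A (j + 1) \<le> eig A (i + 1)" if "i \<le> j" "j < n" for i j
  proof -
    have "sorted_wrt (\<ge>) es" unfolding es_def by (simp add: sorted_wrt_rev)
    then show ?thesis unfolding eig using that len sorted_wrt_nth_less[of "(\<ge>)" es i j]
      by (cases "i = j") auto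
  qed
  have spec: "spectrum A = (\<lambda>i. eig A (i + 1)) ` {..<n}"
  proof -
    have "spectrum A = {k. poly (char_poly A) k = 0}"
      unfolding spectrum_def using eigenvalue_root_char_poly[OF A] by auto
    also have "\<dots> = set ds" unfolding cp by (auto simp: poly_prod_list prod_list_zero_iff)
    also have "\<dots> = set es" unfolding es_def by simp
    also have "\<dots> = (\<lambda>i. es ! i) ` {..<n}" using len by (auto simp: set_conv_nth)
    finally show ?thesis unfolding eig by simp
  qed
  show thesis
    by (rule that[OF Q QTQ _ AQ anti spec])
      (use mat_mult_left_right_inverse[OF _ Q QTQ] Q in auto)
qed

section \<open>Eigenvalue inequalities\<close>

lemma scalar_prod_self_sum: "x \<in> carrier_vec n \<Longrightarrow> x \<bullet> x = (\<Sum>i<n. (x $ i)\<^sup>2)" for x :: "real vec"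
  by (simp add: scalar_prod_def power2_eq_square atLeast0LessThan)

lemma scalar_prod_self_nonneg: "0 \<le> x \<bullet> x" for x :: "real vec"
  using scalar_prod_self_sum[of x "dim_vec x"] by (simp add: sum_nonneg)

lemma scalar_prod_self_pos: "x \<in> carrier_vec n \<Longrightarrow> x \<noteq> 0\<^sub>v n \<Longrightarrow> 0 < x \<bullet> x" for x :: "real vec"
proof -
  assume x: "x \<in> carrier_vec n" "x \<noteq> 0\<^sub>v n"
  then obtain i where i: "i < n" "x $ i \<noteq> 0" by (metis carrier_vecD eq_vecI index_zero_vec)
  have "0 < (\<Sum>i<n. (x $ i)\<^sup>2)" by (rule sum_pos2[of _ i]) (use i in auto)
  then show ?thesis using x by (simp add: scalar_prod_self_sum)
qed

text \<open>The coordinates of x in orthonormal eigenvectors turn both |x|^2 and the quadratic form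
  into weighted sums; the eigenvalue inequalities below are comparisons of the weights.\<close>

lemma symmetric_eig_basis:
  fixes A :: "real mat"
  assumes A: "A \<in> carrier_mat n n" and sym: "A\<^sup>T = A"
  obtains q where "\<And>i. i < n \<Longrightarrow> q i \<in> carrier_vec n"
    "\<And>i j. i < n \<Longrightarrow> j < n \<Longrightarrow> q i \<bullet> q j = (if i = j then 1 else 0)"
    "\<And>x. x \<in> carrier_vec n \<Longrightarrow> x \<bullet> x = (\<Sum>k<n. (q k \<bullet> x)\<^sup>2)"
    "\<And>x. x \<in> carrier_vec n \<Longrightarrow> x \<bullet> (A *\<^sub>v x) = (\<Sum>k<n. eig A (k + 1) * (q k \<bullet> x)\<^sup>2)"
proof -
  obtain Q where Q: "Q \<in> carrier_mat n n" "Q\<^sup>T * Q = 1\<^sub>m n" "Q * Q\<^sup>T = 1\<^sub>m n"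
    "A = Q * mat_diag n (\<lambda>i. eig A (i + 1)) * Q\<^sup>T"
    "\<And>i j. i \<le> j \<Longrightarrow> j < n \<Longrightarrow> eig A (j + 1) \<le> eig A (i + 1)"
    "spectrum A = (\<lambda>i. eig A (i + 1)) ` {..<n}"
    using symmetric_eig_diagonalization[OF A sym] by blast
  have form: "x \<bullet> ((Q * mat_diag n d * Q\<^sup>T) *\<^sub>v x) = (\<Sum>k<n. d k * (col Q k \<bullet> x)\<^sup>2)"
    if x: "x \<in> carrier_vec n" for d x
  proof -
    have y: "Q\<^sup>T *\<^sub>v x \<in> carrier_vec n" using Q x by simp
    have "x \<bullet> ((Q * mat_diag n d * Q\<^sup>T) *\<^sub>v x) = x \<bullet> (Q *\<^sub>v (mat_diag n d *\<^sub>v (Q\<^sup>T *\<^sub>v x)))"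
      using Q x by (simp add: assoc_mult_mat_vec[of _ n n _ n])
    also have "\<dots> = (Q\<^sup>T *\<^sub>v x) \<bullet> (mat_diag n d *\<^sub>v (Q\<^sup>T *\<^sub>v x))"
      using Q x y mult_mat_vec_carrier[OF mat_diag_dim[of n d] y]
      by (subst transpose_vec_mult_scalar[of _ n n]) auto
    also have "\<dots> = (\<Sum>k<n. d k * ((Q\<^sup>T *\<^sub>v x) $ k)\<^sup>2)"
    proof -
      have "(mat_diag n d *\<^sub>v u) $ k = d k * u $ k" if "k < n" "u \<in> carrier_vec n" for u k
        using that by (simp add: mat_diag_def scalar_prod_def if_distrib[of "\<lambda>a. a * _"] cong: if_cong)
      then show ?thesis using y
        by (subst scalar_prod_def) (auto simp: atLeast0LessThan power2_eq_square mat_diag_def intro!: sum.cong)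
    qed
    finally show ?thesis using Q x by simp
  qed
  show thesis
  proof (rule that[of "col Q"])
    fix i j assume ij: "i < n" "j < n"
    have "col Q i \<bullet> col Q j = (Q\<^sup>T * Q) $$ (i,j)" using Q(1) ij by simp
    then show "col Q i \<bullet> col Q j = (if i = j then 1 else 0)" unfolding Q(2) using ij by simp
  next
    fix x :: "real vec" assume x: "x \<in> carrier_vec n"
    show "x \<bullet> (A *\<^sub>v x) = (\<Sum>k<n. eig A (k + 1) * (col Q k \<bullet> x)\<^sup>2)"
      using form[OF x, of "\<lambda>i. eig A (i + 1)"] unfolding Q(4)[symmetric] .
    show "x \<bullet> x = (\<Sum>k<n. (col Q k \<bullet> x)\<^sup>2)"
      using form[OF x, of "\<lambda>_. 1"] Q x by simp
  qed (use Q in auto)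
qed

lemma eig_antimono:
  fixes A :: "real mat"
  assumes "A \<in> carrier_mat n n" "A\<^sup>T = A" "1 \<le> i" "i \<le> j" "j \<le> n"
  shows "eig A j \<le> eig A i"
proof -
  obtain Q where Q: "Q \<in> carrier_mat n n" "Q\<^sup>T * Q = 1\<^sub>m n" "Q * Q\<^sup>T = 1\<^sub>m n"
    "A = Q * mat_diag n (\<lambda>i. eig A (i + 1)) * Q\<^sup>T"
    "\<And>i j. i \<le> j \<Longrightarrow> j < n \<Longrightarrow> eig A (j + 1) \<le> eig A (i + 1)"
    "spectrum A = (\<lambda>i. eig A (i + 1)) ` {..<n}"
    using symmetric_eig_diagonalization[OF assms(1,2)] by blast
  from Q(5)[of "i - 1" "j - 1"] show ?thesis using assms by simp
qed

lemma spectrum_eig: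
  fixes A :: "real mat"
  assumes "A \<in> carrier_mat n n" "A\<^sup>T = A"
  shows "spectrum A = eig A ` {1..n}"
proof -
  obtain Q where Q: "Q \<in> carrier_mat n n" "Q\<^sup>T * Q = 1\<^sub>m n" "Q * Q\<^sup>T = 1\<^sub>m n"
    "A = Q * mat_diag n (\<lambda>i. eig A (i + 1)) * Q\<^sup>T"
    "\<And>i j. i \<le> j \<Longrightarrow> j < n \<Longrightarrow> eig A (j + 1) \<le> eig A (i + 1)"
    "spectrum A = (\<lambda>i. eig A (i + 1)) ` {..<n}"
    using symmetric_eig_diagonalization[OF assms(1,2)] by blast
  then have "spectrum A = (\<lambda>i. eig A (i + 1)) ` {..<n}" by simp
  also have "\<dots> = eig A ` ((\<lambda>i. i + 1) ` {..<n})" by (simp add: image_image)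
  also have "(\<lambda>i. i + 1) ` {..<n} = {1..n}"
    using image_Suc_lessThan[of n] by simp
  finally show ?thesis .
qed

lemma lam_max_eig:
  fixes A :: "real mat"
  assumes A: "A \<in> carrier_mat n n" "A\<^sup>T = A" and n: "0 < n"
  shows "lam_max A = eig A 1" "lam_min A = eig A n"
proof -
  show "lam_max A = eig A 1" unfolding lam_max_def spectrum_eig[OF A]
    by (rule Max_eqI) (use n eig_antimono[OF A] in auto)
  show "lam_min A = eig A n" unfolding lam_min_def spectrum_eig[OF A]
    by (rule Min_eqI) (use n eig_antimono[OF A] in auto)
qed

lemma rayleigh_bounds:
  fixes A :: "real mat"
  assumes A: "A \<in> carrier_mat n n" "A\<^sup>T = A" and n: "0 < n" and x: "x \<in> carrier_vec n"
  shows "x \<bullet> (A *\<^sub>v x) \<le> lam_max A * (x \<bullet> x)" "lam_min A * (x \<bullet> x) \<le> x \<bullet> (A *\<^sub>v x)"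
proof -
  obtain q where q: "\<And>i. i < n \<Longrightarrow> q i \<in> carrier_vec n"
    "\<And>i j. i < n \<Longrightarrow> j < n \<Longrightarrow> q i \<bullet> q j = (if i = j then 1 else 0)"
    "\<And>x. x \<in> carrier_vec n \<Longrightarrow> x \<bullet> x = (\<Sum>k<n. (q k \<bullet> x)\<^sup>2)"
    "\<And>x. x \<in> carrier_vec n \<Longrightarrow> x \<bullet> (A *\<^sub>v x) = (\<Sum>k<n. eig A (k + 1) * (q k \<bullet> x)\<^sup>2)"
    using symmetric_eig_basis[OF A] by blast
  show "x \<bullet> (A *\<^sub>v x) \<le> lam_max A * (x \<bullet> x)"
    unfolding q(3,4)[OF x] lam_max_eig[OF A n] sum_distrib_left
    by (intro sum_mono mult_right_mono eig_antimono[OF A]) auto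
  show "lam_min A * (x \<bullet> x) \<le> x \<bullet> (A *\<^sub>v x)"
    unfolding q(3,4)[OF x] lam_max_eig[OF A n] sum_distrib_left
    by (intro sum_mono mult_right_mono eig_antimono[OF A]) auto
qed

lemma eig_vector:
  fixes A :: "real mat"
  assumes A: "A \<in> carrier_mat n n" "A\<^sup>T = A" and j: "1 \<le> j" "j \<le> n"
  shows "\<exists>x \<in> carrier_vec n. x \<bullet> x = 1 \<and> x \<bullet> (A *\<^sub>v x) = eig A j"
proof -
  obtain q where q: "\<And>i. i < n \<Longrightarrow> q i \<in> carrier_vec n"
    "\<And>i j. i < n \<Longrightarrow> j < n \<Longrightarrow> q i \<bullet> q j = (if i = j then 1 else 0)"
    "\<And>x. x \<in> carrier_vec n \<Longrightarrow> x \<bullet> x = (\<Sum>k<n. (q k \<bullet> x)\<^sup>2)"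
    "\<And>x. x \<in> carrier_vec n \<Longrightarrow> x \<bullet> (A *\<^sub>v x) = (\<Sum>k<n. eig A (k + 1) * (q k \<bullet> x)\<^sup>2)"
    using symmetric_eig_basis[OF A] by blast
  have j': "j - 1 < n" using j by simp
  have "q (j - 1) \<bullet> (A *\<^sub>v q (j - 1)) = (\<Sum>k<n. if k = j - 1 then eig A j else 0)"
    unfolding q(4)[OF q(1)[OF j']] using j q(2)[OF _ j'] by (intro sum.cong) auto
  also have "\<dots> = eig A j" using j' by simp
  finally show ?thesis using q(1)[OF j'] q(2)[OF j' j'] by (intro bexI[of _ "q (j - 1)"]) auto
qed

section \<open>Courant-Fischer bounds through trial families\<close>

definition lin_comb :: "nat \<Rightarrow> (nat \<Rightarrow> real vec) \<Rightarrow> nat \<Rightarrow> (nat \<Rightarrow> real) \<Rightarrow> real vec" where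
  "lin_comb n w j c = vec n (\<lambda>i. \<Sum>k<j. c k * w k $ i)"

lemma lin_comb_carrier [simp]: "lin_comb n w j c \<in> carrier_vec n"
  unfolding lin_comb_def by simp

lemma scalar_prod_lin_comb:
  assumes "\<forall>k<j. w k \<in> carrier_vec n"
  shows "u \<bullet> lin_comb n w j c = (\<Sum>k<j. c k * (u \<bullet> w k))"
proof -
  have "u \<bullet> lin_comb n w j c = (\<Sum>i<n. \<Sum>k<j. c k * (u $ i * w k $ i))"
    unfolding scalar_prod_def lin_comb_def
    by (auto simp: atLeast0LessThan sum_distrib_left algebra_simps intro!: sum.cong)
  also have "\<dots> = (\<Sum>k<j. \<Sum>i<n. c k * (u $ i * w k $ i))" by (rule sum.swap)
  also have "\<dots> = (\<Sum>k<j. c k * (u \<bullet> w k))"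
    unfolding scalar_prod_def using assms
    by (auto simp: atLeast0LessThan sum_distrib_left dest!: carrier_vecD intro!: sum.cong)
  finally show ?thesis .
qed

text \<open>More unknowns than equations. Padding with zero rows gives a square matrix; the unit
  vector of a zero row lies in the kernel of the transpose, so the determinant vanishes and a
  nonzero kernel vector exists.\<close>

lemma underdetermined_solution:
  fixes f :: "nat \<Rightarrow> nat \<Rightarrow> real"
  assumes m: "m < j"
  shows "\<exists>c. (\<exists>k<j. c k \<noteq> 0) \<and> (\<forall>i<m. (\<Sum>k<j. c k * f i k) = 0)"
proof -
  define G where "G = mat j j (\<lambda>(i,k). if i < m then f i k else 0)"
  have G: "G \<in> carrier_mat j j" unfolding G_def by simp
  have "G\<^sup>T *\<^sub>v unit_vec j m = 0\<^sub>v j"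
    using m by (intro eq_vecI) (auto simp: G_def scalar_prod_def)
  moreover have "unit_vec j m \<noteq> (0\<^sub>v j :: real vec)" using m
    by (metis index_unit_vec(1) index_zero_vec(1) one_neq_zero)
  ultimately have "\<exists>v. v \<in> carrier_vec j \<and> v \<noteq> 0\<^sub>v j \<and> G\<^sup>T *\<^sub>v v = 0\<^sub>v j"
    by (intro exI[of _ "unit_vec j m"]) simp
  then have "det G\<^sup>T = 0"
    using det_0_iff_vec_prod_zero[of "G\<^sup>T" j] G by simp
  then have "det G = 0" using det_transpose[OF G] by simp
  then obtain v where v: "v \<in> carrier_vec j" "v \<noteq> 0\<^sub>v j" "G *\<^sub>v v = 0\<^sub>v j"
    using det_0_iff_vec_prod_zero[OF G] by auto
  have "\<exists>k<j. v $ k \<noteq> 0" using v by (metis carrier_vecD eq_vecI index_zero_vec)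
  moreover have "(\<Sum>k<j. v $ k * f i k) = 0" if "i < m" for i
  proof -
    have "(G *\<^sub>v v) $ i = (\<Sum>k<j. v $ k * f i k)"
      using that m v(1) by (simp add: G_def scalar_prod_def atLeast0LessThan mult.commute)
    then show ?thesis unfolding v(3) using that m by simp
  qed
  ultimately show ?thesis by (intro exI[of _ "\<lambda>k. v $ k"]) auto
qed

text \<open>The span of the j vectors w contains a nonzero vector orthogonal to the first j - 1
  eigenvectors, and its Rayleigh quotient is at most \<open>eig A j\<close>. The requirement
  \<open>0 < x \<bullet> x\<close> on nontrivial combinations is linear independence of w.\<close>

lemma eig_lower_bound:
  fixes A :: "real mat"
  assumes A: "A \<in> carrier_mat n n" "A\<^sup>T = A" and j: "1 \<le> j" "j \<le> n"
    and w: "\<And>k. k < j \<Longrightarrow> w k \<in> carrier_vec n"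
    and bound: "\<And>c x. x = lin_comb n w j c \<Longrightarrow> \<exists>k<j. c k \<noteq> 0 \<Longrightarrow>
      0 < x \<bullet> x \<and> s * (x \<bullet> x) \<le> x \<bullet> (A *\<^sub>v x)"
  shows "s \<le> eig A j"
proof -
  obtain q where q: "\<And>i. i < n \<Longrightarrow> q i \<in> carrier_vec n"
    "\<And>i j. i < n \<Longrightarrow> j < n \<Longrightarrow> q i \<bullet> q j = (if i = j then 1 else 0)"
    "\<And>x. x \<in> carrier_vec n \<Longrightarrow> x \<bullet> x = (\<Sum>k<n. (q k \<bullet> x)\<^sup>2)"
    "\<And>x. x \<in> carrier_vec n \<Longrightarrow> x \<bullet> (A *\<^sub>v x) = (\<Sum>k<n. eig A (k + 1) * (q k \<bullet> x)\<^sup>2)"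
    using symmetric_eig_basis[OF A] by blast
  have lcw: "u \<bullet> lin_comb n w j c = (\<Sum>k<j. c k * (u \<bullet> w k))" for u c using scalar_prod_lin_comb w by blast
  obtain c where c: "\<exists>k<j. c k \<noteq> 0" "\<forall>i<j-1. (\<Sum>k<j. c k * (q i \<bullet> w k)) = 0"
    using underdetermined_solution[of "j - 1" j "\<lambda>i k. q i \<bullet> w k"] j by auto
  define x where "x = lin_comb n w j c"
  have x: "x \<in> carrier_vec n" unfolding x_def by simp
  have orth: "q i \<bullet> x = 0" if "i < j - 1" for i
    using c(2) that lcw[of "q i"] unfolding x_def by simp
  have pos: "0 < x \<bullet> x" using bound[OF x_def c(1)] by auto
  have "s * (x \<bullet> x) \<le> x \<bullet> (A *\<^sub>v x)" using bound[OF x_def c(1)] by auto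
  also have "x \<bullet> (A *\<^sub>v x) \<le> (\<Sum>k<n. eig A j * (q k \<bullet> x)\<^sup>2)"
    unfolding q(4)[OF x]
  proof (rule sum_mono)
    fix k assume k: "k \<in> {..<n}"
    show "eig A (k + 1) * (q k \<bullet> x)\<^sup>2 \<le> eig A j * (q k \<bullet> x)\<^sup>2"
    proof (cases "k < j - 1")
      case False
      then show ?thesis using k j by (intro mult_right_mono eig_antimono[OF A]) auto
    qed (simp add: orth)
  qed
  also have "\<dots> = eig A j * (x \<bullet> x)" unfolding q(3)[OF x] sum_distrib_left ..
  finally show ?thesis using pos by simp
qed

text \<open>The dual bound: j - 1 orthogonality constraints cannot exclude the whole span of the
  first j eigenvectors, on which the Rayleigh quotient is at least \<open>eig A j\<close>.\<close>

lemma eig_upper_bound: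
  fixes A :: "real mat"
  assumes A: "A \<in> carrier_mat n n" "A\<^sup>T = A" and j: "1 \<le> j" "j \<le> n"
    and w: "\<And>k. k < j - 1 \<Longrightarrow> w k \<in> carrier_vec n"
    and bound: "\<And>x. x \<in> carrier_vec n \<Longrightarrow> \<forall>k<j-1. w k \<bullet> x = 0 \<Longrightarrow> x \<bullet> (A *\<^sub>v x) \<le> s * (x \<bullet> x)"
  shows "eig A j \<le> s"
proof -
  obtain q where q: "\<And>i. i < n \<Longrightarrow> q i \<in> carrier_vec n"
    "\<And>i j. i < n \<Longrightarrow> j < n \<Longrightarrow> q i \<bullet> q j = (if i = j then 1 else 0)"
    "\<And>x. x \<in> carrier_vec n \<Longrightarrow> x \<bullet> x = (\<Sum>k<n. (q k \<bullet> x)\<^sup>2)"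
    "\<And>x. x \<in> carrier_vec n \<Longrightarrow> x \<bullet> (A *\<^sub>v x) = (\<Sum>k<n. eig A (k + 1) * (q k \<bullet> x)\<^sup>2)"
    using symmetric_eig_basis[OF A] by blast
  have qj: "q k \<in> carrier_vec n" if "k < j" for k using q(1) that j by simp
  have lcq: "u \<bullet> lin_comb n q j c = (\<Sum>k<j. c k * (u \<bullet> q k))" for u c using scalar_prod_lin_comb qj by blast
  obtain c where c: "\<exists>k<j. c k \<noteq> 0" "\<forall>i<j-1. (\<Sum>k<j. c k * (w i \<bullet> q k)) = 0"
    using underdetermined_solution[of "j - 1" j "\<lambda>i k. w i \<bullet> q k"] j by auto
  define x where "x = lin_comb n q j c"
  have x: "x \<in> carrier_vec n" unfolding x_def by simp
  have orth: "\<forall>i<j-1. w i \<bullet> x = 0"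
    using c(2) lcq unfolding x_def by simp
  have qx: "q i \<bullet> x = (if i < j then c i else 0)" if i: "i < n" for i
  proof -
    have "q i \<bullet> x = (\<Sum>k<j. if k = i then c k else 0)"
      unfolding x_def lcq using i j
      by (intro sum.cong) (auto simp: q(2))
    then show ?thesis by simp
  qed
  have pos: "0 < x \<bullet> x"
  proof -
    from c(1) obtain i where i: "i < j" "c i \<noteq> 0" by auto
    show ?thesis unfolding q(3)[OF x]
      by (rule sum_pos2[of _ i]) (use i j qx in auto)
  qed
  have "eig A j * (x \<bullet> x) \<le> (\<Sum>k<n. eig A (k + 1) * (q k \<bullet> x)\<^sup>2)"
    unfolding q(3)[OF x] sum_distrib_left
  proof (rule sum_mono)
    fix k assume k: "k \<in> {..<n}"
    show "eig A j * (q k \<bullet> x)\<^sup>2 \<le> eig A (k + 1) * (q k \<bullet> x)\<^sup>2"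
    proof (cases "k < j")
      case True
      then show ?thesis using k j by (intro mult_right_mono eig_antimono[OF A]) auto
    next
      case False
      then show ?thesis using k by (simp add: qx)
    qed
  qed
  also have "\<dots> = x \<bullet> (A *\<^sub>v x)" unfolding q(4)[OF x] ..
  also have "\<dots> \<le> s * (x \<bullet> x)" by (rule bound[OF x orth])
  finally show ?thesis using pos by simp
qed


lemma lin_comb_orthonormal_pos:
  assumes w: "\<And>k. k < j \<Longrightarrow> w k \<in> carrier_vec n"
    and o: "\<And>i k. i < j \<Longrightarrow> k < j \<Longrightarrow> w i \<bullet> w k = (if i = k then 1 else 0)"
    and c: "\<exists>k<j. c k \<noteq> 0"
  shows "lin_comb n w j c \<bullet> lin_comb n w j c > 0"
proof -
  let ?x = "lin_comb n w j c"
  have lcw: "u \<bullet> lin_comb n w j c = (\<Sum>k<j. c k * (u \<bullet> w k))" for u c using scalar_prod_lin_comb w by blast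
  have wx: "w k \<bullet> ?x = c k" if "k < j" for k
  proof -
    have "w k \<bullet> ?x = (\<Sum>i<j. if i = k then c i else 0)"
      unfolding lcw using that by (intro sum.cong) (auto simp: o)
    then show ?thesis using that by simp
  qed
  have "?x \<bullet> ?x = (\<Sum>k<j. c k * (?x \<bullet> w k))"
    by (rule lcw)
  also have "\<dots> = (\<Sum>k<j. (c k)\<^sup>2)"
    using w by (intro sum.cong) (auto simp: wx comm_scalar_prod[of ?x n] power2_eq_square)
  also have "\<dots> > 0"
  proof -
    obtain k where "k < j" "c k \<noteq> 0" using c by auto
    then show ?thesis by (intro sum_pos2[of _ k]) auto
  qed
  finally show ?thesis .
qed

text \<open>One half of Weyl's inequality, phrased by quadratic forms so that it serves one-sided
  comparisons; the trial family consists of the leading eigenvectors of B.\<close>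

lemma eig_perturbation:
  fixes A B :: "real mat"
  assumes A: "A \<in> carrier_mat n n" "A\<^sup>T = A" and B: "B \<in> carrier_mat n n" "B\<^sup>T = B"
    and j: "1 \<le> j" "j \<le> n"
    and le: "\<And>x. x \<in> carrier_vec n \<Longrightarrow> x \<bullet> (B *\<^sub>v x) - \<delta> * (x \<bullet> x) \<le> x \<bullet> (A *\<^sub>v x)"
  shows "eig B j - \<delta> \<le> eig A j"
proof -
  obtain q where q: "\<And>i. i < n \<Longrightarrow> q i \<in> carrier_vec n"
    "\<And>i j. i < n \<Longrightarrow> j < n \<Longrightarrow> q i \<bullet> q j = (if i = j then 1 else 0)"
    "\<And>x. x \<in> carrier_vec n \<Longrightarrow> x \<bullet> x = (\<Sum>k<n. (q k \<bullet> x)\<^sup>2)"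
    "\<And>x. x \<in> carrier_vec n \<Longrightarrow> x \<bullet> (B *\<^sub>v x) = (\<Sum>k<n. eig B (k + 1) * (q k \<bullet> x)\<^sup>2)"
    using symmetric_eig_basis[OF B] by blast
  have qj: "q k \<in> carrier_vec n" if "k < j" for k using q(1) that j by simp
  have lcq: "u \<bullet> lin_comb n q j c = (\<Sum>k<j. c k * (u \<bullet> q k))" for u c using scalar_prod_lin_comb qj by blast
  show ?thesis
  proof (rule eig_lower_bound[OF A j, of q])
    fix c x assume x: "x = lin_comb n q j c" and c: "\<exists>k<j. c k \<noteq> 0"
    have xc: "x \<in> carrier_vec n" unfolding x by simp
    have pos: "0 < x \<bullet> x" unfolding x by (rule lin_comb_orthonormal_pos[OF qj _ c]) (use q(2) j in auto)
    have zero: "q k \<bullet> x = 0" if "j \<le> k" "k < n" for k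
      unfolding x lcq using that by (intro sum.neutral) (auto simp: q(2))
    have "eig B j * (x \<bullet> x) \<le> x \<bullet> (B *\<^sub>v x)"
      unfolding q(3,4)[OF xc] sum_distrib_left
    proof (rule sum_mono)
      fix k assume k: "k \<in> {..<n}"
      show "eig B j * (q k \<bullet> x)\<^sup>2 \<le> eig B (k + 1) * (q k \<bullet> x)\<^sup>2"
      proof (cases "k < j")
        case True
        then show ?thesis using k j by (intro mult_right_mono eig_antimono[OF B]) auto
      next
        case False
        then show ?thesis using k by (simp add: zero)
      qed
    qed
    with le[OF xc] pos show "0 < x \<bullet> x \<and> (eig B j - \<delta>) * (x \<bullet> x) \<le> x \<bullet> (A *\<^sub>v x)"
      by (simp add: algebra_simps)
  qed (rule qj)
qed

section \<open>Compression to the range of an isometry\<close>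

lemma quad_form_conj:
  fixes X P :: "real mat"
  assumes "P \<in> carrier_mat n r" "X \<in> carrier_mat r r" "x \<in> carrier_vec n"
  shows "x \<bullet> ((P * X * P\<^sup>T) *\<^sub>v x) = (P\<^sup>T *\<^sub>v x) \<bullet> (X *\<^sub>v (P\<^sup>T *\<^sub>v x))"
proof -
  have "x \<bullet> ((P * X * P\<^sup>T) *\<^sub>v x) = x \<bullet> (P *\<^sub>v (X *\<^sub>v (P\<^sup>T *\<^sub>v x)))"
    using assms mult_carrier_mat[OF assms(1,2)] by (simp add: assoc_mult_mat_vec[of _ n r _ n] assoc_mult_mat_vec[of _ n r _ r])
  also have "\<dots> = (P\<^sup>T *\<^sub>v x) \<bullet> (X *\<^sub>v (P\<^sup>T *\<^sub>v x))"
    using assms by (subst transpose_vec_mult_scalar[of _ n r]) auto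
  finally show ?thesis .
qed

lemma isometry_scalar_prod:
  fixes P :: "real mat"
  assumes P: "P \<in> carrier_mat n r" "P\<^sup>T * P = 1\<^sub>m r" and "u \<in> carrier_vec r" "v \<in> carrier_vec r"
  shows "(P *\<^sub>v u) \<bullet> (P *\<^sub>v v) = u \<bullet> v"
proof -
  have "(P *\<^sub>v u) \<bullet> (P *\<^sub>v v) = (P\<^sup>T *\<^sub>v (P *\<^sub>v u)) \<bullet> v"
    using assms by (subst transpose_vec_mult_scalar[of _ n r]) auto
  also have "P\<^sup>T *\<^sub>v (P *\<^sub>v u) = u"
    using assms assoc_mult_mat_vec[of "P\<^sup>T" r n P r u] by simp
  finally show ?thesis .
qed

text \<open>Bessel's inequality, from |x - P P' x|^2 >= 0.\<close>

lemma transpose_isometry_contracts: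
  fixes P :: "real mat"
  assumes P: "P \<in> carrier_mat n r" "P\<^sup>T * P = 1\<^sub>m r" and x: "x \<in> carrier_vec n"
  shows "(P\<^sup>T *\<^sub>v x) \<bullet> (P\<^sup>T *\<^sub>v x) \<le> x \<bullet> x"
proof -
  let ?y = "P\<^sup>T *\<^sub>v x" and ?z = "x - P *\<^sub>v (P\<^sup>T *\<^sub>v x)"
  have y: "?y \<in> carrier_vec r" and Py: "P *\<^sub>v ?y \<in> carrier_vec n" using P x by auto
  have xPy: "x \<bullet> (P *\<^sub>v ?y) = ?y \<bullet> ?y"
    using P x y by (subst transpose_vec_mult_scalar[of _ n r]) auto
  have "0 \<le> ?z \<bullet> ?z" by (rule scalar_prod_self_nonneg)
  also have "?z \<bullet> ?z = x \<bullet> x - ?y \<bullet> ?y"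
    using x Py xPy isometry_scalar_prod[OF P y y] comm_scalar_prod[OF x Py]
    by (simp add: minus_scalar_prod_distrib[of _ n] scalar_prod_minus_distrib[of _ n])
  finally show ?thesis by simp
qed

text \<open>The images P q of the leading eigenvectors q of X stay orthonormal, and on their span
  the form of P X P' is the form of X. This gives the inequality for P X P'; perturbation carries it
  to A.\<close>

lemma eig_near_low_rank_lower:
  fixes A X P :: "real mat"
  assumes A: "A \<in> carrier_mat n n" "A\<^sup>T = A" and X: "X \<in> carrier_mat r r" "X\<^sup>T = X"
    and P: "P \<in> carrier_mat n r" "P\<^sup>T * P = 1\<^sub>m r" and rn: "r \<le> n" and j: "1 \<le> j" "j \<le> r"
    and le: "\<And>x. x \<in> carrier_vec n \<Longrightarrow>
      (P\<^sup>T *\<^sub>v x) \<bullet> (X *\<^sub>v (P\<^sup>T *\<^sub>v x)) - \<delta> * (x \<bullet> x) \<le> x \<bullet> (A *\<^sub>v x)"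
  shows "eig X j - \<delta> \<le> eig A j"
proof -
  have PXP: "P * X * P\<^sup>T \<in> carrier_mat n n" "(P * X * P\<^sup>T)\<^sup>T = P * X * P\<^sup>T"
    using P(1) X mult_carrier_mat[OF P(1) X(1)]
    by (auto simp: transpose_mult[of _ n r _ n] transpose_mult[of _ n r _ r] transpose_mult[of _ r r _ n] assoc_mult_mat[of _ n r _ r _ n])
  have "eig X j \<le> eig (P * X * P\<^sup>T) j"
  proof -
    obtain q where q: "\<And>i. i < r \<Longrightarrow> q i \<in> carrier_vec r"
      "\<And>i j. i < r \<Longrightarrow> j < r \<Longrightarrow> q i \<bullet> q j = (if i = j then 1 else 0)"
      "\<And>x. x \<in> carrier_vec r \<Longrightarrow> x \<bullet> x = (\<Sum>k<r. (q k \<bullet> x)\<^sup>2)"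
      "\<And>x. x \<in> carrier_vec r \<Longrightarrow> x \<bullet> (X *\<^sub>v x) = (\<Sum>k<r. eig X (k + 1) * (q k \<bullet> x)\<^sup>2)"
      using symmetric_eig_basis[OF X] by blast
    define w where "w = (\<lambda>k. P *\<^sub>v q k)"
    have w: "w k \<in> carrier_vec n" if "k < j" for k unfolding w_def using q(1) P that j by simp
    have lcw: "u \<bullet> lin_comb n w j c = (\<Sum>k<j. c k * (u \<bullet> w k))" for u c using scalar_prod_lin_comb w by blast
    show ?thesis
    proof (rule eig_lower_bound[OF PXP j(1), of w])
      fix c x assume x: "x = lin_comb n w j c" and c: "\<exists>k<j. c k \<noteq> 0"
      have xc: "x \<in> carrier_vec n" unfolding x by simp
      have ow: "w i \<bullet> w k = (if i = k then 1 else 0)" if "i < j" "k < j" for i k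
        unfolding w_def using isometry_scalar_prod[OF P q(1) q(1), of i k] q(2)[of i k] that j by simp
      have pos: "0 < x \<bullet> x" unfolding x by (rule lin_comb_orthonormal_pos[OF w ow c]) auto
      define y where "y = P\<^sup>T *\<^sub>v x"
      have y: "y \<in> carrier_vec r" unfolding y_def using P xc by simp
      have qy: "q i \<bullet> y = (if i < j then c i else 0)" if i: "i < r" for i
      proof -
        have "q i \<bullet> y = w i \<bullet> x"
          unfolding y_def w_def using P xc q(1)[OF i] i
          by (metis comm_scalar_prod mult_mat_vec_carrier transpose_carrier_mat transpose_vec_mult_scalar)
        also have "\<dots> = (\<Sum>k<j. c k * (w i \<bullet> w k))" unfolding x by (rule lcw)
        also have "\<dots> = (\<Sum>k<j. if k = i then c k else 0)"
          unfolding w_def using isometry_scalar_prod[OF P q(1) q(1)] q(2) i j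
          by (intro sum.cong) auto
        finally show ?thesis by simp
      qed
      have xx: "x \<bullet> x = y \<bullet> y"
      proof -
        have "x \<bullet> x = (\<Sum>k<j. c k * (x \<bullet> w k))" by (subst (2) x) (rule lcw)
        also have "\<dots> = (\<Sum>k<j. (c k)\<^sup>2)"
        proof (intro sum.cong refl)
          fix k assume k: "k \<in> {..<j}"
          then have kr: "k < r" using j by simp
          have "x \<bullet> w k = y \<bullet> q k" unfolding y_def w_def
            using transpose_vec_mult_scalar[OF P(1) q(1)[OF kr] xc] by simp
          also have "\<dots> = c k" using qy[OF kr] k comm_scalar_prod[OF y q(1)[OF kr]] by simp
          finally show "c k * (x \<bullet> w k) = (c k)\<^sup>2" by (simp add: power2_eq_square)
        qed
        also have "\<dots> = (\<Sum>k<r. (q k \<bullet> y)\<^sup>2)"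
          using j by (intro sum.mono_neutral_cong_left) (auto simp: qy)
        finally show ?thesis unfolding q(3)[OF y] .
      qed
      have "eig X j * (x \<bullet> x) \<le> y \<bullet> (X *\<^sub>v y)"
        unfolding xx q(3,4)[OF y] sum_distrib_left
      proof (rule sum_mono)
        fix k assume k: "k \<in> {..<r}"
        show "eig X j * (q k \<bullet> y)\<^sup>2 \<le> eig X (k + 1) * (q k \<bullet> y)\<^sup>2"
        proof (cases "k < j")
          case True
          then show ?thesis using k j by (intro mult_right_mono eig_antimono[OF X]) auto
        next
          case False
          then show ?thesis using k by (simp add: qy)
        qed
      qed
      then show "0 < x \<bullet> x \<and> eig X j * (x \<bullet> x) \<le> x \<bullet> ((P * X * P\<^sup>T) *\<^sub>v x)"
        using pos unfolding quad_form_conj[OF P(1) X(1) xc] y_def by simp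
    qed (use w rn j in auto)
  qed
  moreover have "eig (P * X * P\<^sup>T) j - \<delta> \<le> eig A j"
    by (rule eig_perturbation[OF A PXP j(1)]) (use rn j le quad_form_conj[OF P(1) X(1)] in auto)
  ultimately show ?thesis by simp
qed

text \<open>The constraints come from the images of the first j - 1 eigenvectors of X. The sign
  condition on \<open>eig X j\<close> enters because P' shortens vectors: only a nonnegative
  eigenvalue can be carried from |P' x|^2 over to |x|^2.\<close>

lemma eig_near_low_rank_upper:
  fixes A X P :: "real mat"
  assumes A: "A \<in> carrier_mat n n" "A\<^sup>T = A" and X: "X \<in> carrier_mat r r" "X\<^sup>T = X"
    and P: "P \<in> carrier_mat n r" "P\<^sup>T * P = 1\<^sub>m r" and rn: "r \<le> n" and j: "1 \<le> j" "j \<le> r"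
    and nonneg: "0 \<le> eig X j"
    and le: "\<And>x. x \<in> carrier_vec n \<Longrightarrow>
      x \<bullet> (A *\<^sub>v x) \<le> (P\<^sup>T *\<^sub>v x) \<bullet> (X *\<^sub>v (P\<^sup>T *\<^sub>v x)) + \<delta> * (x \<bullet> x)"
  shows "eig A j \<le> eig X j + \<delta>"
proof -
  obtain q where q: "\<And>i. i < r \<Longrightarrow> q i \<in> carrier_vec r"
    "\<And>i j. i < r \<Longrightarrow> j < r \<Longrightarrow> q i \<bullet> q j = (if i = j then 1 else 0)"
    "\<And>x. x \<in> carrier_vec r \<Longrightarrow> x \<bullet> x = (\<Sum>k<r. (q k \<bullet> x)\<^sup>2)"
    "\<And>x. x \<in> carrier_vec r \<Longrightarrow> x \<bullet> (X *\<^sub>v x) = (\<Sum>k<r. eig X (k + 1) * (q k \<bullet> x)\<^sup>2)"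
    using symmetric_eig_basis[OF X] by blast
  show ?thesis
  proof (rule eig_upper_bound[OF A j(1), of "\<lambda>k. P *\<^sub>v q k"])
    fix x assume x: "x \<in> carrier_vec n" and orth: "\<forall>k<j - 1. (P *\<^sub>v q k) \<bullet> x = 0"
    define y where "y = P\<^sup>T *\<^sub>v x"
    have y: "y \<in> carrier_vec r" unfolding y_def using P x by simp
    have qy: "q k \<bullet> y = 0" if "k < j - 1" for k
    proof -
      have kr: "k < r" using that j by simp
      have "q k \<bullet> y = (P *\<^sub>v q k) \<bullet> x" unfolding y_def
        using P x q(1)[OF kr]
        by (metis comm_scalar_prod mult_mat_vec_carrier transpose_carrier_mat transpose_vec_mult_scalar)
      then show ?thesis using orth that by simp
    qed
    have "y \<bullet> (X *\<^sub>v y) \<le> eig X j * (y \<bullet> y)"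
      unfolding q(3,4)[OF y] sum_distrib_left
    proof (rule sum_mono)
      fix k assume k: "k \<in> {..<r}"
      show "eig X (k + 1) * (q k \<bullet> y)\<^sup>2 \<le> eig X j * (q k \<bullet> y)\<^sup>2"
      proof (cases "k < j - 1")
        case False
        then show ?thesis using k j by (intro mult_right_mono eig_antimono[OF X]) auto
      qed (simp add: qy)
    qed
    also have "\<dots> \<le> eig X j * (x \<bullet> x)"
      unfolding y_def by (rule mult_left_mono[OF transpose_isometry_contracts[OF P x] nonneg])
    finally show "x \<bullet> (A *\<^sub>v x) \<le> (eig X j + \<delta>) * (x \<bullet> x)"
      using le[OF x] unfolding y_def by (simp add: algebra_simps)
  qed (use q(1) P rn j in auto)
qed

text \<open>Beyond index r all columns of P fit among the j - 1 constraints; they annihilate P' x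
  and with it the whole low-rank part. The remaining constraints are padded with zero
  vectors.\<close>

lemma eig_near_low_rank_tail:
  fixes A X P :: "real mat"
  assumes A: "A \<in> carrier_mat n n" "A\<^sup>T = A" and X: "X \<in> carrier_mat r r"
    and P: "P \<in> carrier_mat n r" and j: "r < j" "j \<le> n"
    and le: "\<And>x. x \<in> carrier_vec n \<Longrightarrow>
      x \<bullet> (A *\<^sub>v x) \<le> (P\<^sup>T *\<^sub>v x) \<bullet> (X *\<^sub>v (P\<^sup>T *\<^sub>v x)) + \<delta> * (x \<bullet> x)"
  shows "eig A j \<le> \<delta>"
proof (rule eig_upper_bound[OF A _ j(2), of "\<lambda>k. if k < r then col P k else 0\<^sub>v n"])
  fix x assume x: "x \<in> carrier_vec n" and orth: "\<forall>k<j - 1. (if k < r then col P k else 0\<^sub>v n) \<bullet> x = 0"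
  have "P\<^sup>T *\<^sub>v x = 0\<^sub>v r"
    using P x orth j by (intro eq_vecI) (auto split: if_splits)
  then show "x \<bullet> (A *\<^sub>v x) \<le> \<delta> * (x \<bullet> x)" using le[OF x] X
    by (simp add: scalar_prod_left_zero[of _ r])
qed (use P j in auto)

section \<open>Traces of powers\<close>

definition mtr :: "real mat \<Rightarrow> real" where
  "mtr A = (\<Sum>i<dim_row A. A $$ (i,i))"

lemma mtr_mult:
  assumes "A \<in> carrier_mat n k" "B \<in> carrier_mat k n"
  shows "mtr (A * B) = (\<Sum>i<n. \<Sum>j<k. A $$ (i,j) * B $$ (j,i))"
  using assms unfolding mtr_def by (auto simp: scalar_prod_def atLeast0LessThan)

lemma mtr_comm:
  assumes "A \<in> carrier_mat n k" "B \<in> carrier_mat k n"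
  shows "mtr (A * B) = mtr (B * A)"
  unfolding mtr_mult[OF assms] mtr_mult[OF assms(2,1)]
  by (subst sum.swap) (simp add: mult.commute)

lemma mtr_minus:
  assumes "A \<in> carrier_mat n n" "B \<in> carrier_mat n n"
  shows "mtr (A - B) = mtr A - mtr B"
  using assms unfolding mtr_def by (simp add: sum_subtractf)

lemma pow_mat_carrier [simp]:
  assumes "A \<in> carrier_mat n n" shows "A ^\<^sub>m k \<in> carrier_mat n n"
  using assms by (auto intro!: carrier_matI simp: pow_mat_dim)

lemma pow_mat_Suc_left:
  assumes "A \<in> carrier_mat n n"
  shows "A ^\<^sub>m Suc k = A * A ^\<^sub>m k"
proof (induction k)
  case (Suc k)
  have "A ^\<^sub>m Suc (Suc k) = A * A ^\<^sub>m k * A" using Suc by simp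
  also have "\<dots> = A * (A ^\<^sub>m k * A)"
    using assms by (intro assoc_mult_mat[of _ n n _ n _ n]) auto
  finally show ?case by simp
qed (use assms in simp)

lemma pow_mat_diag:
  fixes Q :: "real mat"
  assumes Q: "Q \<in> carrier_mat n n" "Q\<^sup>T * Q = 1\<^sub>m n" "Q * Q\<^sup>T = 1\<^sub>m n"
    and T: "T = Q * mat_diag n d * Q\<^sup>T"
  shows "T ^\<^sub>m k = Q * mat_diag n (\<lambda>i. d i ^ k) * Q\<^sup>T"
proof (induction k)
  case 0
  then show ?case using T Q by simp
next
  case (Suc k)
  note c = mult_carrier_mat[OF Q(1) mat_diag_dim]
  have "T ^\<^sub>m Suc k = (Q * mat_diag n (\<lambda>i. d i ^ k) * Q\<^sup>T) * (Q * mat_diag n d * Q\<^sup>T)"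
    using Suc T by simp
  also have "\<dots> = Q * mat_diag n (\<lambda>i. d i ^ k) * (Q\<^sup>T * (Q * mat_diag n d * Q\<^sup>T))"
    using Q(1) c mult_carrier_mat[OF c, of "Q\<^sup>T" n] by (intro assoc_mult_mat[of _ n n _ n _ n]) auto
  also have "Q\<^sup>T * (Q * mat_diag n d * Q\<^sup>T) = Q\<^sup>T * Q * mat_diag n d * Q\<^sup>T"
    using Q(1) c by (simp add: assoc_mult_mat[of _ n n _ n _ n] mult_carrier_mat[of _ n n _ n])
  also have "\<dots> = mat_diag n d * Q\<^sup>T" unfolding Q(2) by (simp add: left_mult_one_mat[OF mat_diag_dim])
  also have "Q * mat_diag n (\<lambda>i. d i ^ k) * (mat_diag n d * Q\<^sup>T)
      = Q * (mat_diag n (\<lambda>i. d i ^ k) * mat_diag n d) * Q\<^sup>T"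
    using Q(1) c by (simp add: assoc_mult_mat[of _ n n _ n _ n] mult_carrier_mat[of _ n n _ n] del: mat_diag_diag)
  finally show ?case by (simp add: mult.commute)
qed

lemma mtr_conjugated_diag:
  fixes Q :: "real mat"
  assumes Q: "Q \<in> carrier_mat n n" "Q\<^sup>T * Q = 1\<^sub>m n"
  shows "mtr (Q * mat_diag n d * Q\<^sup>T) = (\<Sum>i<n. d i)"
proof -
  have "mtr (Q * mat_diag n d * Q\<^sup>T) = mtr (Q\<^sup>T * (Q * mat_diag n d))"
    using Q mult_carrier_mat[OF Q(1) mat_diag_dim] by (intro mtr_comm[of _ n n]) auto
  also have "Q\<^sup>T * (Q * mat_diag n d) = mat_diag n d"
    using Q left_mult_one_mat[OF mat_diag_dim[of n d]] by (simp add: assoc_mult_mat[of _ n n _ n _ n, symmetric])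
  finally show ?thesis by (simp add: mtr_def mat_diag_def)
qed

text \<open>Since Y is symmetric, the weights are squares of the entries of R' Y Q. They are
  nonnegative whatever the diagonals are, so inequalities between the real numbers d i and e l pass
  to traces of noncommuting matrices.\<close>

lemma mtr_sandwich_diag:
  fixes Q R Y :: "real mat"
  assumes Q: "Q \<in> carrier_mat n n" and R: "R \<in> carrier_mat n n"
    and Y: "Y \<in> carrier_mat n n" "Y\<^sup>T = Y"
  shows "mtr (Y * (Q * mat_diag n d * Q\<^sup>T) * Y * (R * mat_diag n e * R\<^sup>T))
    = (\<Sum>l<n. \<Sum>i<n. ((R\<^sup>T * Y * Q) $$ (l,i))\<^sup>2 * d i * e l)"
proof -
  define G where "G = R\<^sup>T * Y * Q"
  have G: "G \<in> carrier_mat n n" unfolding G_def using Q R Y by (meson mult_carrier_mat transpose_carrier_mat)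
  have GT: "G\<^sup>T = Q\<^sup>T * (Y * R)" unfolding G_def using Q R Y
    by (simp add: transpose_mult[of _ n n _ n] mult_carrier_mat[of _ n n _ n])
  note cs = mult_carrier_mat[of _ n n _ n]
  define D E where "D = mat_diag n d" and "E = mat_diag n e"
  have D: "D \<in> carrier_mat n n" "E \<in> carrier_mat n n" unfolding D_def E_def by auto
  have "mtr (Y * (Q * D * Q\<^sup>T) * Y * (R * E * R\<^sup>T)) = mtr ((Y * (Q * D * Q\<^sup>T) * Y * (R * E)) * R\<^sup>T)"
    using Q R Y D by (simp add: assoc_mult_mat[of _ n n _ n _ n] cs)
  also have "\<dots> = mtr (R\<^sup>T * (Y * (Q * D * Q\<^sup>T) * Y * (R * E)))"
    using Q R Y D by (intro mtr_comm[of _ n n]) (auto simp: cs)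
  also have "R\<^sup>T * (Y * (Q * D * Q\<^sup>T) * Y * (R * E)) = (G * D * G\<^sup>T) * E"
    unfolding GT unfolding G_def using Q R Y D by (simp add: assoc_mult_mat[of _ n n _ n _ n] cs)
  also have "mtr \<dots> = (\<Sum>l<n. (G * D * G\<^sup>T) $$ (l,l) * e l)"
    using G D unfolding E_def mtr_def by (simp add: mat_diag_mult_right[of _ n n] cs)
  also have "\<dots> = (\<Sum>l<n. \<Sum>i<n. (G $$ (l,i))\<^sup>2 * d i * e l)"
    unfolding D_def by (intro sum.cong refl)
      (simp add: conjugated_diag_index[OF G] sum_distrib_left sum_distrib_right power2_eq_square algebra_simps del: index_mult_mat)
  finally show ?thesis unfolding G_def D_def E_def .
qed

lemma abs_power_mult_le:
  fixes a b :: real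
  assumes "j + k = 2 * m"
  shows "\<bar>a ^ j * b ^ k\<bar> \<le> a ^ (2 * m) + b ^ (2 * m)"
proof -
  define c where "c = max \<bar>a\<bar> \<bar>b\<bar>"
  have "\<bar>a ^ j * b ^ k\<bar> \<le> c ^ j * c ^ k"
    unfolding abs_mult power_abs c_def by (intro mult_mono power_mono) auto
  also have "\<dots> = c ^ (2 * m)" using assms by (simp add: power_add[symmetric])
  also have "\<dots> \<le> a ^ (2 * m) + b ^ (2 * m)"
    unfolding c_def by (simp add: max_def power_even_abs)
  finally show ?thesis .
qed

text \<open>After diagonalizing both matrices, this is \<open>|a ^ j b ^ k| \<le> a ^ (2 m) + b ^ (2 m)\<close> with
  nonnegative weights; it takes the place of noncommutative trace inequalities.\<close>

lemma mtr_mixed_powers_le: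
  fixes T S Y :: "real mat"
  assumes T: "T \<in> carrier_mat n n" "T\<^sup>T = T" and S: "S \<in> carrier_mat n n" "S\<^sup>T = S"
    and Y: "Y \<in> carrier_mat n n" "Y\<^sup>T = Y" and jk: "j + k = 2 * m"
  shows "mtr (Y * T ^\<^sub>m j * Y * S ^\<^sub>m k)
    \<le> mtr (Y * T ^\<^sub>m (2 * m) * Y) + mtr (Y * S ^\<^sub>m (2 * m) * Y)"
proof -
  obtain Q where Q: "Q \<in> carrier_mat n n" "Q\<^sup>T * Q = 1\<^sub>m n" "Q * Q\<^sup>T = 1\<^sub>m n"
    "T = Q * mat_diag n (\<lambda>i. eig T (i + 1)) * Q\<^sup>T"
    "\<And>i j. i \<le> j \<Longrightarrow> j < n \<Longrightarrow> eig T (j + 1) \<le> eig T (i + 1)"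
    "spectrum T = (\<lambda>i. eig T (i + 1)) ` {..<n}"
    using symmetric_eig_diagonalization[OF T] by blast
  obtain R where R: "R \<in> carrier_mat n n" "R\<^sup>T * R = 1\<^sub>m n" "R * R\<^sup>T = 1\<^sub>m n"
    "S = R * mat_diag n (\<lambda>i. eig S (i + 1)) * R\<^sup>T"
    "\<And>i j. i \<le> j \<Longrightarrow> j < n \<Longrightarrow> eig S (j + 1) \<le> eig S (i + 1)"
    "spectrum S = (\<lambda>i. eig S (i + 1)) ` {..<n}"
    using symmetric_eig_diagonalization[OF S] by blast
  define d e where "d = (\<lambda>i. eig T (i + 1))" and "e = (\<lambda>i. eig S (i + 1))"
  note pT = pow_mat_diag[OF Q(1-4)] and pS = pow_mat_diag[OF R(1-4)]
  define G where "G = R\<^sup>T * Y * Q"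
  have main: "mtr (Y * T ^\<^sub>m j * Y * S ^\<^sub>m k) = (\<Sum>l<n. \<Sum>i<n. (G $$ (l,i))\<^sup>2 * (d i ^ j * e l ^ k))" for j k
    unfolding pT pS mtr_sandwich_diag[OF Q(1) R(1) Y] G_def d_def e_def by (simp add: mult.assoc)
  have "mtr (Y * T ^\<^sub>m j * Y * S ^\<^sub>m k)
      \<le> (\<Sum>l<n. \<Sum>i<n. (G $$ (l,i))\<^sup>2 * (d i ^ (2 * m) + e l ^ (2 * m)))"
    unfolding main
    by (intro sum_mono mult_left_mono order_trans[OF abs_ge_self abs_power_mult_le[OF jk]] zero_le_power2)
  also have "\<dots> = mtr (Y * T ^\<^sub>m (2 * m) * Y * S ^\<^sub>m 0) + mtr (Y * T ^\<^sub>m 0 * Y * S ^\<^sub>m (2 * m))"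
    unfolding main by (simp add: sum.distrib distrib_left)
  also have "mtr (Y * T ^\<^sub>m (2 * m) * Y * S ^\<^sub>m 0) = mtr (Y * T ^\<^sub>m (2 * m) * Y)"
  proof -
    have "Y * T ^\<^sub>m (2 * m) * Y \<in> carrier_mat n n" using Y T by (simp add: mult_carrier_mat[of _ n n _ n])
    then show ?thesis using S right_mult_one_mat[of "Y * T ^\<^sub>m (2 * m) * Y" n n] by simp
  qed
  also have "mtr (Y * T ^\<^sub>m 0 * Y * S ^\<^sub>m (2 * m)) = mtr (Y * S ^\<^sub>m (2 * m) * Y)"
  proof -
    have "mtr (Y * T ^\<^sub>m 0 * Y * S ^\<^sub>m (2 * m)) = mtr (Y * (Y * S ^\<^sub>m (2 * m)))"
      using Y T S by (simp add: assoc_mult_mat[of _ n n _ n _ n] mult_carrier_mat[of _ n n _ n])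
    then show ?thesis using Y S by (simp add: mtr_comm[of Y n n] mult_carrier_mat[of _ n n _ n])
  qed
  finally show ?thesis .
qed

text \<open>Telescoping: the factors T of T^(2m+1) are exchanged for S one by one. Each exchange
  costs a trace of Y T^j Y S^(2m-j), with the same Y twice, which is the shape that
  \<open>mtr_mixed_powers_le\<close> bounds.\<close>

lemma mtr_power_difference_le:
  fixes T S :: "real mat"
  assumes T: "T \<in> carrier_mat n n" "T\<^sup>T = T" and S: "S \<in> carrier_mat n n" "S\<^sup>T = S"
    and Y: "Y = T - S"
  shows "mtr (Y * T ^\<^sub>m (2 * m + 1)) - mtr (Y * S ^\<^sub>m (2 * m + 1))
    \<le> real (2 * m + 1) * (mtr (Y * T ^\<^sub>m (2 * m) * Y) + mtr (Y * S ^\<^sub>m (2 * m) * Y))"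
proof -
  let ?N = "2 * m + 1"
  have Yc: "Y \<in> carrier_mat n n" "Y\<^sup>T = Y" unfolding Y using T S by (auto simp: transpose_minus[of _ n n])
  note cs = mult_carrier_mat[of _ n n _ n]
  define h where "h = (\<lambda>j. mtr (Y * T ^\<^sub>m j * S ^\<^sub>m (?N - j)))"
  have step: "h (Suc j) - h j = mtr (Y * T ^\<^sub>m j * Y * S ^\<^sub>m (2 * m - j))" if "j < ?N" for j
  proof -
    let ?A = "Y * T ^\<^sub>m j" and ?B = "S ^\<^sub>m (2 * m - j)"
    have c: "?A \<in> carrier_mat n n" "?B \<in> carrier_mat n n" using Yc T S by (auto simp: cs)
    have "S ^\<^sub>m (?N - j) = S * ?B" using that pow_mat_Suc_left[OF S(1), of "2 * m - j"]
      by (simp add: Suc_diff_le)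
    then have "h (Suc j) - h j = mtr (?A * T * ?B) - mtr (?A * (S * ?B))"
      unfolding h_def using Yc T S c by (simp add: assoc_mult_mat[of Y n n _ n _ n])
    also have "\<dots> = mtr (?A * T * ?B - ?A * S * ?B)"
      using c T S by (simp add: mtr_minus[of _ n] cs assoc_mult_mat[of ?A n n S n ?B n])
    also have "?A * T * ?B - ?A * S * ?B = ?A * (T - S) * ?B"
      using minus_mult_distrib_mat[of "?A * T" n n "?A * S" ?B n] mult_minus_distrib_mat[OF c(1) T(1) S(1)] c T S
      by (simp add: cs assoc_mult_mat[of ?A n n T n ?B n] assoc_mult_mat[of ?A n n S n ?B n])
    finally show ?thesis unfolding Y[symmetric] .
  qed
  have "mtr (Y * T ^\<^sub>m ?N) - mtr (Y * S ^\<^sub>m ?N) = h ?N - h 0"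
    unfolding h_def using Yc T S mult_carrier_mat[OF Yc(1) pow_mat_carrier[OF T(1), of ?N]] by simp
  also have "\<dots> = (\<Sum>j<?N. h (Suc j) - h j)" by (rule sum_lessThan_telescope[symmetric])
  also have "\<dots> \<le> (\<Sum>j<?N. mtr (Y * T ^\<^sub>m (2 * m) * Y) + mtr (Y * S ^\<^sub>m (2 * m) * Y))"
  proof (rule sum_mono)
    fix j assume "j \<in> {..<?N}"
    then have j: "j < ?N" by simp
    show "h (Suc j) - h j \<le> mtr (Y * T ^\<^sub>m (2 * m) * Y) + mtr (Y * S ^\<^sub>m (2 * m) * Y)"
      unfolding step[OF j] by (rule mtr_mixed_powers_le[OF T S Yc]) (use j in auto)
  qed
  finally show ?thesis by simp
qed

lemma pow_mat_symmetric:
  fixes T :: "real mat"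
  assumes T: "T \<in> carrier_mat n n" "T\<^sup>T = T"
  shows "(T ^\<^sub>m k)\<^sup>T = T ^\<^sub>m k"
proof (induction k)
  case (Suc k)
  have "(T ^\<^sub>m Suc k)\<^sup>T = T * T ^\<^sub>m k"
    using T Suc by (simp add: transpose_mult[of _ n n _ n])
  then show ?case using pow_mat_Suc_left[OF T(1)] by simp
qed (use T in simp)

lemma pow_mat_double:
  fixes T :: "real mat"
  assumes T: "T \<in> carrier_mat n n"
  shows "T ^\<^sub>m (j + k) = T ^\<^sub>m j * T ^\<^sub>m k"
  using T by (induction k) (auto simp: assoc_mult_mat[of _ n n _ n _ n])

lemma mtr_transpose_mult_self:
  assumes "A \<in> carrier_mat n n"
  shows "mtr (A\<^sup>T * A) = (\<Sum>i<n. \<Sum>j<n. (A $$ (i,j))\<^sup>2)"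
  using assms by (subst mtr_mult[of _ n n]) (auto simp: power2_eq_square intro: sum.swap)

text \<open>That 0 <= C <= L implies C^2 <= L^2, shown without a square root of C: the nonnegative
  form of C is evaluated at C v - L v.\<close>

lemma psd_mult_vec_norm_le:
  fixes C :: "real mat"
  assumes C: "C \<in> carrier_mat n n" "C\<^sup>T = C" and L: "0 < L"
    and psd: "\<And>v. v \<in> carrier_vec n \<Longrightarrow> 0 \<le> v \<bullet> (C *\<^sub>v v)"
    and le: "\<And>v. v \<in> carrier_vec n \<Longrightarrow> v \<bullet> (C *\<^sub>v v) \<le> L * (v \<bullet> v)"
    and v: "v \<in> carrier_vec n"
  shows "(C *\<^sub>v v) \<bullet> (C *\<^sub>v v) \<le> L\<^sup>2 * (v \<bullet> v)"
proof -
  define w where "w = C *\<^sub>v v"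
  have w: "w \<in> carrier_vec n" unfolding w_def using C v by simp
  have vCw: "v \<bullet> (C *\<^sub>v w) = w \<bullet> w"
    using transpose_vec_mult_scalar[OF C(1) w v] C(2) unfolding w_def by simp
  have "0 \<le> (w - L \<cdot>\<^sub>v v) \<bullet> (C *\<^sub>v (w - L \<cdot>\<^sub>v v))" using w v by (intro psd) simp
  also have "C *\<^sub>v (w - L \<cdot>\<^sub>v v) = C *\<^sub>v w - L \<cdot>\<^sub>v w"
    unfolding w_def using C v by (simp add: mult_minus_distrib_mat_vec[of _ n n] mult_mat_vec[of _ n n])
  also have "(w - L \<cdot>\<^sub>v v) \<bullet> (C *\<^sub>v w - L \<cdot>\<^sub>v w)
      = w \<bullet> (C *\<^sub>v w) - 2 * L * (w \<bullet> w) + L\<^sup>2 * (v \<bullet> (C *\<^sub>v v))"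
    using C v w vCw by (simp add: minus_scalar_prod_distrib[of _ n] scalar_prod_minus_distrib[of _ n] power2_eq_square
        w_def[symmetric] algebra_simps)
  finally have "0 \<le> L * (w \<bullet> w) - 2 * L * (w \<bullet> w) + L\<^sup>2 * (L * (v \<bullet> v))"
    using le[OF w] mult_left_mono[OF le[OF v], of "L\<^sup>2"] by simp
  then have "L * (w \<bullet> w) \<le> L * (L\<^sup>2 * (v \<bullet> v))" by (simp add: algebra_simps)
  then show ?thesis using L unfolding w_def by simp
qed


text \<open>The vector is a function on indices because the random vectors below take values in a
  product space of coordinates, where independence is available.\<close>

definition outer_self :: "nat \<Rightarrow> (nat \<Rightarrow> real) \<Rightarrow> real mat" where
  "outer_self n x = mat n n (\<lambda>(i,j). x i * x j)"

lemma outer_self_carrier [simp]: "outer_self n x \<in> carrier_mat n n"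
  unfolding outer_self_def by simp

lemma outer_self_transpose [simp]: "(outer_self n x)\<^sup>T = outer_self n x"
  by (rule eq_matI) (auto simp: outer_self_def)

text \<open>N will be the m-th power of a partial sum. The trace is the squared Frobenius norm of (A
  - C) N, and (a - b)^2 <= 2 a^2 + 2 b^2 is applied entry by entry.\<close>

lemma mtr_square_minus_le:
  fixes A C N :: "real mat"
  assumes A: "A \<in> carrier_mat n n" "A\<^sup>T = A" and C: "C \<in> carrier_mat n n" "C\<^sup>T = C"
    and N: "N \<in> carrier_mat n n" "N\<^sup>T = N"
  shows "mtr ((A - C) * (N * N) * (A - C)) \<le> 2 * mtr (N * A * A * N) + 2 * mtr (N * C * C * N)"
proof -
  note cs = mult_carrier_mat[of _ n n _ n]
  have F: "mtr (N * X * X * N) = (\<Sum>i<n. \<Sum>j<n. ((X * N) $$ (i,j))\<^sup>2)"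
    if "X \<in> carrier_mat n n" "X\<^sup>T = X" for X
  proof -
    have "N * X * X * N = (X * N)\<^sup>T * (X * N)"
      using that N by (simp add: transpose_mult[of _ n n _ n] assoc_mult_mat[of _ n n _ n _ n] cs)
    then show ?thesis using mtr_transpose_mult_self[of "X * N" n] that N by (simp add: cs)
  qed
  have D: "A - C \<in> carrier_mat n n" "(A - C)\<^sup>T = A - C" using A C by (auto simp: transpose_minus[of _ n n])
  have "mtr ((A - C) * (N * N) * (A - C)) = mtr (((A - C) * N) * (N * (A - C)))"
    using D N by (simp add: assoc_mult_mat[of _ n n _ n _ n] cs)
  also have "\<dots> = mtr (N * (A - C) * (A - C) * N)"
    using D N by (subst mtr_comm[of _ n n]) (auto simp: assoc_mult_mat[of _ n n _ n _ n] cs)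
  also have "\<dots> = (\<Sum>i<n. \<Sum>j<n. (((A - C) * N) $$ (i,j))\<^sup>2)" by (rule F[OF D])
  also have "\<dots> \<le> (\<Sum>i<n. \<Sum>j<n. 2 * ((A * N) $$ (i,j))\<^sup>2 + 2 * ((C * N) $$ (i,j))\<^sup>2)"
  proof (intro sum_mono)
    fix i j assume "i \<in> {..<n}" "j \<in> {..<n}"
    then have "((A - C) * N) $$ (i,j) = (A * N) $$ (i,j) - (C * N) $$ (i,j)"
      using A C N minus_mult_distrib_mat[OF A(1) C(1) N(1)] by simp
    moreover have "(a - b)\<^sup>2 \<le> 2 * a\<^sup>2 + 2 * b\<^sup>2" for a b :: real
      using zero_le_power2[of "a + b"] by (simp add: power2_eq_square algebra_simps)
    ultimately show "(((A - C) * N) $$ (i,j))\<^sup>2 \<le> 2 * ((A * N) $$ (i,j))\<^sup>2 + 2 * ((C * N) $$ (i,j))\<^sup>2"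
      by metis
  qed
  also have "\<dots> = 2 * mtr (N * A * A * N) + 2 * mtr (N * C * C * N)"
    unfolding F[OF A] F[OF C] by (simp add: sum.distrib sum_distrib_left)
  finally show ?thesis .
qed

lemma outer_self_square:
  "outer_self n x * outer_self n x = (\<Sum>i<n. (x i)\<^sup>2) \<cdot>\<^sub>m outer_self n x"
  by (rule eq_matI) (auto simp: outer_self_def scalar_prod_def atLeast0LessThan power2_eq_square
      sum_distrib_right intro!: sum.cong)

lemma mtr_outer_self_mult:
  assumes "M \<in> carrier_mat n n"
  shows "mtr (outer_self n x * M) = vec n x \<bullet> (M *\<^sub>v vec n x)"
proof -
  have "mtr (outer_self n x * M) = (\<Sum>i<n. \<Sum>j<n. x i * x j * M $$ (j,i))"
    using assms by (subst mtr_mult[of _ n n]) (auto simp: outer_self_def)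
  also have "\<dots> = (\<Sum>j<n. \<Sum>i<n. x i * x j * M $$ (j,i))" by (rule sum.swap)
  also have "\<dots> = vec n x \<bullet> (M *\<^sub>v vec n x)"
    using assms by (auto simp: scalar_prod_def atLeast0LessThan sum_distrib_left algebra_simps intro!: sum.cong)
  finally show ?thesis .
qed

lemma mtr_outer_self_nonneg:
  fixes N :: "real mat"
  assumes N: "N \<in> carrier_mat n n" "N\<^sup>T = N"
  shows "0 \<le> mtr (outer_self n x * (N * N))"
proof -
  let ?v = "vec n x"
  have "mtr (outer_self n x * (N * N)) = ?v \<bullet> (N *\<^sub>v (N *\<^sub>v ?v))"
    using N by (simp add: mtr_outer_self_mult mult_carrier_mat[of _ n n _ n] assoc_mult_mat_vec[of _ n n _ n])
  also have "\<dots> = (N *\<^sub>v ?v) \<bullet> (N *\<^sub>v ?v)"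
    using transpose_vec_mult_scalar[OF N(1), of "N *\<^sub>v ?v" ?v] N by simp
  finally show ?thesis by (simp add: scalar_prod_self_nonneg)
qed

text \<open>By cyclicity and symmetry of N both traces are sums over the columns u of N, of u' C u
  and of |C u|^2 respectively.\<close>

lemma mtr_psd_mult_bounds:
  fixes C N :: "real mat"
  assumes C: "C \<in> carrier_mat n n" "C\<^sup>T = C" and L: "0 < L"
    and psd: "\<And>v. v \<in> carrier_vec n \<Longrightarrow> 0 \<le> v \<bullet> (C *\<^sub>v v)"
    and le: "\<And>v. v \<in> carrier_vec n \<Longrightarrow> v \<bullet> (C *\<^sub>v v) \<le> L * (v \<bullet> v)"
    and N: "N \<in> carrier_mat n n" "N\<^sup>T = N"
  shows "mtr (C * (N * N)) \<le> L * mtr (N * N)" "mtr (N * C * C * N) \<le> L\<^sup>2 * mtr (N * N)"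
proof -
  note cs = mult_carrier_mat[of _ n n _ n]
  have row: "row N i = col N i" if "i < n" for i
    using N that row_transpose[of i N] by simp
  have NN: "mtr (N * N) = (\<Sum>i<n. col N i \<bullet> col N i)"
    using N row unfolding mtr_def by simp
  have NXN: "mtr (N * X * N) = (\<Sum>i<n. col N i \<bullet> (X *\<^sub>v col N i))" if X: "X \<in> carrier_mat n n" for X
  proof -
    have "mtr (N * X * N) = mtr (N * (X * N))" using N X by (simp add: assoc_mult_mat[of _ n n _ n _ n])
    also have "\<dots> = (\<Sum>i<n. row N i \<bullet> col (X * N) i)"
      using N X unfolding mtr_def by (simp add: cs)
    also have "\<dots> = (\<Sum>i<n. col N i \<bullet> (X *\<^sub>v col N i))"
    proof (intro sum.cong refl)
      fix i assume "i \<in> {..<n}"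
      then have i: "i < n" by simp
      note row[OF i]
      moreover have "col (X * N) i = X *\<^sub>v col N i" using col_mult2[OF X N(1) i] .
      ultimately show "row N i \<bullet> col (X * N) i = col N i \<bullet> (X *\<^sub>v col N i)" by simp
    qed
    finally show ?thesis .
  qed
  have col: "col N i \<in> carrier_vec n" if "i < n" for i using N that by simp
  have "mtr (C * (N * N)) = mtr ((C * N) * N)" using C N by (simp add: assoc_mult_mat[of _ n n _ n _ n])
  also have "\<dots> = mtr (N * (C * N))" using C N by (intro mtr_comm[of _ n n]) (auto simp: cs)
  also have "\<dots> = mtr (N * C * N)" using C N by (simp add: assoc_mult_mat[of _ n n _ n _ n])
  also have "\<dots> \<le> L * mtr (N * N)"
    unfolding NXN[OF C(1)] NN sum_distrib_left using le col by (intro sum_mono) auto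
  finally show "mtr (C * (N * N)) \<le> L * mtr (N * N)" .
  have "mtr (N * C * C * N) = mtr (N * (C * C) * N)" using C N by (simp add: assoc_mult_mat[of _ n n _ n _ n] cs)
  also have "\<dots> = (\<Sum>i<n. (C *\<^sub>v col N i) \<bullet> (C *\<^sub>v col N i))"
  proof -
    have "v \<bullet> ((C * C) *\<^sub>v v) = (C *\<^sub>v v) \<bullet> (C *\<^sub>v v)" if v: "v \<in> carrier_vec n" for v
      using transpose_vec_mult_scalar[OF C(1) _ v, of "C *\<^sub>v v"] C v
      by (simp add: assoc_mult_mat_vec[of _ n n _ n])
    then show ?thesis using NXN[of "C * C"] C col by (simp add: cs)
  qed
  also have "\<dots> \<le> L\<^sup>2 * mtr (N * N)"
    unfolding NN sum_distrib_left using psd_mult_vec_norm_le[OF C L psd le] col by (intro sum_mono) auto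
  finally show "mtr (N * C * C * N) \<le> L\<^sup>2 * mtr (N * N)" .
qed

lemma mtr_power_sum_eig:
  fixes T :: "real mat"
  assumes T: "T \<in> carrier_mat n n" "T\<^sup>T = T"
  shows "mtr (T ^\<^sub>m k) = (\<Sum>i<n. eig T (i + 1) ^ k)"
proof -
  obtain Q where Q: "Q \<in> carrier_mat n n" "Q\<^sup>T * Q = 1\<^sub>m n" "Q * Q\<^sup>T = 1\<^sub>m n"
    "T = Q * mat_diag n (\<lambda>i. eig T (i + 1)) * Q\<^sup>T"
    "\<And>i j. i \<le> j \<Longrightarrow> j < n \<Longrightarrow> eig T (j + 1) \<le> eig T (i + 1)"
    "spectrum T = (\<lambda>i. eig T (i + 1)) ` {..<n}"
    using symmetric_eig_diagonalization[OF T] by blast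
  show ?thesis unfolding pow_mat_diag[OF Q(1-4)] mtr_conjugated_diag[OF Q(1,2)] ..
qed

text \<open>For each eigenvalue d this is d^(2m) (d - s)^2 >= 0. It lets an odd moment with a large
  factor be absorbed into half of the next even moment.\<close>

lemma mtr_odd_power_le:
  fixes T :: "real mat"
  assumes T: "T \<in> carrier_mat n n" "T\<^sup>T = T" and s: "0 \<le> s"
  shows "s * mtr (T ^\<^sub>m (2 * m + 1)) \<le> mtr (T ^\<^sub>m (2 * m + 2)) / 2 + s\<^sup>2 / 2 * mtr (T ^\<^sub>m (2 * m))"
proof -
  have "s * d ^ (2 * m + 1) \<le> d ^ (2 * m + 2) / 2 + s\<^sup>2 / 2 * d ^ (2 * m)" for d :: real
  proof -
    have "0 \<le> d ^ (2 * m) * (d - s)\<^sup>2" by simp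
    then show ?thesis by (simp add: power2_eq_square algebra_simps)
  qed
  then have "(\<Sum>i<n. s * eig T (i + 1) ^ (2 * m + 1))
      \<le> (\<Sum>i<n. eig T (i + 1) ^ (2 * m + 2) / 2 + s\<^sup>2 / 2 * eig T (i + 1) ^ (2 * m))"
    by (intro sum_mono) blast
  then show ?thesis unfolding mtr_power_sum_eig[OF T] sum_distrib_left sum_divide_distrib
    by (simp add: sum.distrib)
qed

text \<open>All summands of the trace of an even power are nonnegative, so it controls each
  eigenvalue. Passing from the operator norm to the trace costs at most a factor n^(1/(2p)), a
  constant once p is about log n.\<close>

lemma mtr_even_power_quad_form:
  fixes T :: "real mat"
  assumes T: "T \<in> carrier_mat n n" "T\<^sup>T = T" and x: "x \<in> carrier_vec n"
    and p: "0 < p" and \<tau>: "0 \<le> \<tau>" and le: "mtr (T ^\<^sub>m (2 * p)) \<le> \<tau> ^ (2 * p)"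
  shows "\<bar>x \<bullet> (T *\<^sub>v x)\<bar> \<le> \<tau> * (x \<bullet> x)"
proof -
  obtain q where q': "\<And>i. i < n \<Longrightarrow> q i \<in> carrier_vec n"
    "\<And>i j. i < n \<Longrightarrow> j < n \<Longrightarrow> q i \<bullet> q j = (if i = j then 1 else 0)"
    "\<And>x. x \<in> carrier_vec n \<Longrightarrow> x \<bullet> x = (\<Sum>k<n. (q k \<bullet> x)\<^sup>2)"
    "\<And>x. x \<in> carrier_vec n \<Longrightarrow> x \<bullet> (T *\<^sub>v x) = (\<Sum>k<n. eig T (k + 1) * (q k \<bullet> x)\<^sup>2)"
    using symmetric_eig_basis[OF T] by blast
  note q = q'(3,4)[OF x]
  have e: "\<bar>eig T (k + 1)\<bar> \<le> \<tau>" if "k < n" for k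
  proof -
    have "\<bar>eig T (k + 1)\<bar> ^ (2 * p) = eig T (k + 1) ^ (2 * p)" by (simp add: power_even_abs)
    also have "\<dots> \<le> (\<Sum>i<n. eig T (i + 1) ^ (2 * p))"
      using that by (intro member_le_sum) auto
    also have "\<dots> \<le> \<tau> ^ (2 * p)" using le unfolding mtr_power_sum_eig[OF T] .
    finally show ?thesis using p \<tau> by (simp add: power_mono_iff)
  qed
  have "\<bar>x \<bullet> (T *\<^sub>v x)\<bar> \<le> (\<Sum>k<n. \<bar>eig T (k + 1) * (q k \<bullet> x)\<^sup>2\<bar>)" unfolding q by (rule sum_abs)
  also have "\<dots> \<le> (\<Sum>k<n. \<tau> * (q k \<bullet> x)\<^sup>2)"
    by (intro sum_mono) (auto simp: abs_mult intro!: mult_right_mono e[simplified])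
  finally show ?thesis unfolding q by (simp add: sum_distrib_left)
qed

section \<open>Sums of bounded random matrices\<close>

lemma index_mult_mat_sum:
  fixes A B :: "real mat"
  assumes "A \<in> carrier_mat n k" "B \<in> carrier_mat k m" "i < n" "j < m"
  shows "(A * B) $$ (i,j) = (\<Sum>l<k. A $$ (i,l) * B $$ (l,j))"
  using assms by (simp add: scalar_prod_def atLeast0LessThan)

section \<open>Bounded random variables and matrices with bounded entries\<close>

context prob_space
begin

text \<open>Unlike integrability, sure boundedness is closed under products, so the entries of every
  matrix polynomial in bounded vectors can be integrated without further estimates.\<close>

definition bounded_rv :: "('a \<Rightarrow> real) \<Rightarrow> bool" where
  "bounded_rv f \<longleftrightarrow> f \<in> borel_measurable M \<and> (\<exists>c. \<forall>\<omega>\<in>space M. \<bar>f \<omega>\<bar> \<le> c)"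

lemma bounded_rv_integrable: "bounded_rv f \<Longrightarrow> integrable M f"
  unfolding bounded_rv_def
  by (auto intro!: integrable_const_bound[where B = c for c] AE_I2)

lemma bounded_rv_const [simp]: "bounded_rv (\<lambda>_. c)"
  unfolding bounded_rv_def by auto

lemma bounded_rv_add:
  assumes "bounded_rv f" "bounded_rv g" shows "bounded_rv (\<lambda>\<omega>. f \<omega> + g \<omega>)"
proof -
  from assms obtain c d where "\<And>\<omega>. \<omega> \<in> space M \<Longrightarrow> \<bar>f \<omega>\<bar> \<le> c" "\<And>\<omega>. \<omega> \<in> space M \<Longrightarrow> \<bar>g \<omega>\<bar> \<le> d"
    unfolding bounded_rv_def by auto
  then have "\<And>\<omega>. \<omega> \<in> space M \<Longrightarrow> \<bar>f \<omega> + g \<omega>\<bar> \<le> c + d" by (smt (verit))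
  then show ?thesis using assms unfolding bounded_rv_def by auto
qed

lemma bounded_rv_mult:
  assumes "bounded_rv f" "bounded_rv g" shows "bounded_rv (\<lambda>\<omega>. f \<omega> * g \<omega>)"
proof -
  from assms obtain c d where "\<And>\<omega>. \<omega> \<in> space M \<Longrightarrow> \<bar>f \<omega>\<bar> \<le> c" "\<And>\<omega>. \<omega> \<in> space M \<Longrightarrow> \<bar>g \<omega>\<bar> \<le> d"
    unfolding bounded_rv_def by auto
  then have "\<And>\<omega>. \<omega> \<in> space M \<Longrightarrow> \<bar>f \<omega> * g \<omega>\<bar> \<le> \<bar>c\<bar> * \<bar>d\<bar>"
    unfolding abs_mult by (intro mult_mono) (auto intro: order_trans[OF _ abs_ge_self])
  then show ?thesis using assms unfolding bounded_rv_def by auto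
qed

lemma bounded_rv_diff:
  assumes "bounded_rv f" "bounded_rv g" shows "bounded_rv (\<lambda>\<omega>. f \<omega> - g \<omega>)"
  using bounded_rv_add[OF assms(1) bounded_rv_mult[OF bounded_rv_const[of "-1"] assms(2)]] by simp

lemma bounded_rv_sum:
  assumes "\<And>i. i \<in> A \<Longrightarrow> bounded_rv (f i)" shows "bounded_rv (\<lambda>\<omega>. \<Sum>i\<in>A. f i \<omega>)"
  using assms by (induction A rule: infinite_finite_induct) (auto intro: bounded_rv_add)

lemma expectation_double_sum:
  assumes "\<And>i j. i < n \<Longrightarrow> j < n \<Longrightarrow> bounded_rv (f i j)"
  shows "expectation (\<lambda>\<omega>. \<Sum>i<n. \<Sum>j<n. f i j \<omega>) = (\<Sum>i<n. \<Sum>j<n. expectation (f i j))"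
proof -
  have 1: "integrable M (f i j)" if "i < n" "j < n" for i j
    using assms that by (intro bounded_rv_integrable)
  have 2: "integrable M (\<lambda>\<omega>. \<Sum>j<n. f i j \<omega>)" if "i < n" for i
    using 1 that by (intro Bochner_Integration.integrable_sum) auto
  have "expectation (\<lambda>\<omega>. \<Sum>i<n. \<Sum>j<n. f i j \<omega>) = (\<Sum>i<n. expectation (\<lambda>\<omega>. \<Sum>j<n. f i j \<omega>))"
    using 2 by (intro Bochner_Integration.integral_sum) auto
  also have "\<dots> = (\<Sum>i<n. \<Sum>j<n. expectation (f i j))"
    using 1 by (intro sum.cong refl Bochner_Integration.integral_sum) auto
  finally show ?thesis .
qed

definition bounded_rmat :: "nat \<Rightarrow> ('a \<Rightarrow> real mat) \<Rightarrow> bool" where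
  "bounded_rmat n A \<longleftrightarrow> (\<forall>\<omega>. A \<omega> \<in> carrier_mat n n) \<and> (\<forall>i<n. \<forall>j<n. bounded_rv (\<lambda>\<omega>. A \<omega> $$ (i,j)))"

lemma bounded_rmat_const: "A \<in> carrier_mat n n \<Longrightarrow> bounded_rmat n (\<lambda>_. A)"
  unfolding bounded_rmat_def by auto

lemma bounded_rmat_mult:
  assumes "bounded_rmat n A" "bounded_rmat n B" shows "bounded_rmat n (\<lambda>\<omega>. A \<omega> * B \<omega>)"
  unfolding bounded_rmat_def
proof (intro conjI allI impI)
  have c: "A \<omega> \<in> carrier_mat n n" "B \<omega> \<in> carrier_mat n n" for \<omega> using assms unfolding bounded_rmat_def by auto
  then show "A \<omega> * B \<omega> \<in> carrier_mat n n" for \<omega> by (meson mult_carrier_mat)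
  fix i j assume ij: "i < n" "j < n"
  have "(A \<omega> * B \<omega>) $$ (i,j) = (\<Sum>k<n. A \<omega> $$ (i,k) * B \<omega> $$ (k,j))" for \<omega>
    using c[of \<omega>] ij by (simp add: scalar_prod_def atLeast0LessThan)
  then show "bounded_rv (\<lambda>\<omega>. (A \<omega> * B \<omega>) $$ (i,j))"
    using assms ij unfolding bounded_rmat_def by (auto intro!: bounded_rv_sum bounded_rv_mult)
qed

lemma bounded_rmat_pow:
  assumes "bounded_rmat n A" shows "bounded_rmat n (\<lambda>\<omega>. A \<omega> ^\<^sub>m k)"
proof (induction k)
  case 0
  have "A \<omega> ^\<^sub>m 0 = 1\<^sub>m n" for \<omega> using assms unfolding bounded_rmat_def by auto
  then show ?case by (simp only: bounded_rmat_const[OF one_carrier_mat])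
next
  case (Suc k)
  then show ?case using bounded_rmat_mult[OF Suc assms] by simp
qed

lemma bounded_rv_mtr:
  assumes "bounded_rmat n A" shows "bounded_rv (\<lambda>\<omega>. mtr (A \<omega>))"
proof -
  have "mtr (A \<omega>) = (\<Sum>i<n. A \<omega> $$ (i,i))" for \<omega>
    using assms unfolding bounded_rmat_def mtr_def by (metis carrier_matD(1))
  then show ?thesis using assms unfolding bounded_rmat_def by (auto intro!: bounded_rv_sum)
qed

end

text \<open>B and L are the two parameters of a matrix Bernstein inequality: B bounds the squared
  norm of each vector, L the operator norm of its second moment. The values are coordinate
  functions, since independence needs a \<sigma>-algebra.\<close>

locale bounded_indep_vectors = prob_space M for M :: "'w measure" +
  fixes n :: nat and I :: "nat set" and X :: "nat \<Rightarrow> 'w \<Rightarrow> nat \<Rightarrow> real" and B L :: real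
  assumes finite_I: "finite I"
    and indep: "indep_vars (\<lambda>_. PiM {..<n} (\<lambda>_. borel)) X I"
    and bound: "\<And>t \<omega>. t \<in> I \<Longrightarrow> (\<Sum>i<n. (X t \<omega> i)\<^sup>2) \<le> B"
    and second: "\<And>t u. t \<in> I \<Longrightarrow> expectation (\<lambda>\<omega>. (\<Sum>i<n. u i * X t \<omega> i)\<^sup>2) \<le> L * (\<Sum>i<n. (u i)\<^sup>2)"
    and L_pos: "0 < L" and L_le_B: "L \<le> B"
begin

abbreviation N :: "(nat \<Rightarrow> real) measure" where "N \<equiv> PiM {..<n} (\<lambda>_. borel)"

lemma X_measurable: "t \<in> I \<Longrightarrow> X t \<in> measurable M N"
  using indep unfolding indep_vars_def by auto

lemma coord_bounded_rv: "t \<in> I \<Longrightarrow> i < n \<Longrightarrow> bounded_rv (\<lambda>\<omega>. X t \<omega> i)"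
proof -
  assume t: "t \<in> I" and i: "i < n"
  have "\<bar>X t \<omega> i\<bar> \<le> sqrt B" for \<omega>
  proof -
    have "(X t \<omega> i)\<^sup>2 \<le> (\<Sum>i<n. (X t \<omega> i)\<^sup>2)" using i by (intro member_le_sum) auto
    also have "\<dots> \<le> B" by (rule bound[OF t])
    finally show ?thesis by (rule real_le_rsqrt[of "\<bar>X t \<omega> i\<bar>" B, simplified])
  qed
  moreover have "(\<lambda>\<omega>. X t \<omega> i) \<in> borel_measurable M"
    using measurable_compose[OF X_measurable[OF t] measurable_component_singleton[of i "{..<n}" "\<lambda>_. borel"]] i
    by simp
  ultimately show ?thesis unfolding bounded_rv_def by auto
qed

definition C :: "nat \<Rightarrow> real mat" where
  "C t = mat n n (\<lambda>(i,j). expectation (\<lambda>\<omega>. X t \<omega> i * X t \<omega> j))"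

lemma C_carrier [simp]: "C t \<in> carrier_mat n n"
  unfolding C_def by simp

lemma C_transpose [simp]: "(C t)\<^sup>T = C t"
  by (rule eq_matI) (auto simp: C_def mult.commute)

lemma expectation_square_form:
  assumes t: "t \<in> I"
  shows "expectation (\<lambda>\<omega>. (\<Sum>i<n. u i * X t \<omega> i)\<^sup>2) = (\<Sum>i<n. \<Sum>j<n. u i * u j * C t $$ (i,j))"
proof -
  have b: "bounded_rv (\<lambda>\<omega>. X t \<omega> i * X t \<omega> j)" if "i < n" "j < n" for i j
    using t that by (intro bounded_rv_mult coord_bounded_rv)
  have "expectation (\<lambda>\<omega>. (\<Sum>i<n. u i * X t \<omega> i)\<^sup>2)
      = expectation (\<lambda>\<omega>. \<Sum>i<n. \<Sum>j<n. u i * u j * (X t \<omega> i * X t \<omega> j))"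
    by (simp add: power2_eq_square sum_product algebra_simps)
  also have "\<dots> = (\<Sum>i<n. \<Sum>j<n. u i * u j * expectation (\<lambda>\<omega>. X t \<omega> i * X t \<omega> j))"
    by (subst expectation_double_sum) (auto intro!: bounded_rv_mult[OF bounded_rv_const] b)
  finally show ?thesis unfolding C_def by simp
qed

lemma C_quad_form:
  assumes t: "t \<in> I" and v: "v \<in> carrier_vec n"
  shows "v \<bullet> (C t *\<^sub>v v) = expectation (\<lambda>\<omega>. (\<Sum>i<n. v $ i * X t \<omega> i)\<^sup>2)"
proof -
  have "v \<bullet> (C t *\<^sub>v v) = (\<Sum>i<n. v $ i * (\<Sum>j<n. C t $$ (i,j) * v $ j))"
    using v by (simp add: C_def scalar_prod_def atLeast0LessThan)
  also have "\<dots> = (\<Sum>i<n. \<Sum>j<n. v $ i * v $ j * C t $$ (i,j))"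
    by (simp add: sum_distrib_left mult.assoc mult.commute[of "C t $$ _"])
  finally show ?thesis unfolding expectation_square_form[OF t] .
qed

lemma C_psd: "t \<in> I \<Longrightarrow> v \<in> carrier_vec n \<Longrightarrow> 0 \<le> v \<bullet> (C t *\<^sub>v v)"
  unfolding C_quad_form by (rule integral_nonneg_AE) auto

lemma C_le: "t \<in> I \<Longrightarrow> v \<in> carrier_vec n \<Longrightarrow> v \<bullet> (C t *\<^sub>v v) \<le> L * (v \<bullet> v)"
  unfolding C_quad_form using second[of t "\<lambda>i. v $ i"] by (simp add: scalar_prod_self_sum)

text \<open>Written for a deterministic family x rather than for \<omega>, so that its powers are
  measurable functions on a product space and visibly depend only on the members of the family
  indexed by J; the independence argument uses both.\<close>

definition T :: "nat set \<Rightarrow> (nat \<Rightarrow> nat \<Rightarrow> real) \<Rightarrow> real mat" where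
  "T J x = mat n n (\<lambda>(i,j). \<Sum>t\<in>J. (x t i * x t j - C t $$ (i,j)))"

abbreviation TX :: "nat set \<Rightarrow> 'w \<Rightarrow> real mat" where
  "TX J \<omega> \<equiv> T J (\<lambda>t. X t \<omega>)"

lemma T_carrier [simp]: "T J x \<in> carrier_mat n n"
  unfolding T_def by simp

lemma T_transpose [simp]: "(T J x)\<^sup>T = T J x"
proof (rule eq_matI)
  fix i j assume "i < dim_row (T J x)" "j < dim_col (T J x)"
  then have ij: "i < n" "j < n" by (auto simp: T_def)
  have "C t $$ (i,j) = C t $$ (j,i)" for t using ij unfolding C_def by (simp add: mult.commute)
  then show "(T J x)\<^sup>T $$ (i,j) = T J x $$ (i,j)" using ij by (simp add: T_def mult.commute)
qed (auto simp: T_def)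

lemma T_restrict: "T J (restrict x J) = T J x"
  unfolding T_def by (auto intro!: sum.cong)

lemma T_power_measurable:
  assumes "i < n" "j < n"
  shows "(\<lambda>x. (T J x ^\<^sub>m k) $$ (i,j)) \<in> borel_measurable (PiM J (\<lambda>_. N))"
  using assms
proof (induction k arbitrary: i j)
  case 0
  have "(T J x ^\<^sub>m 0) $$ (i,j) = (if i = j then 1 else 0)" for x using 0 by (simp add: T_def)
  then show ?case by simp
next
  case (Suc k)
  have eq: "(T J x ^\<^sub>m Suc k) $$ (i,j) = (\<Sum>l<n. (T J x ^\<^sub>m k) $$ (i,l) * (\<Sum>t\<in>J. (x t l * x t j - C t $$ (l,j))))" for x
  proof -
    have "(T J x ^\<^sub>m Suc k) $$ (i,j) = (\<Sum>l<n. (T J x ^\<^sub>m k) $$ (i,l) * T J x $$ (l,j))"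
      using index_mult_mat_sum[OF pow_mat_carrier[OF T_carrier[of J x], of k] T_carrier[of J x] Suc.prems] by simp
    then show ?thesis using Suc.prems by (simp add: T_def)
  qed
  have xm: "(\<lambda>x. x t l) \<in> borel_measurable (PiM J (\<lambda>_. N))" if "t \<in> J" "l < n" for t l
    using measurable_compose[OF measurable_component_singleton[OF that(1), of "\<lambda>_. N"]
        measurable_component_singleton[of l "{..<n}" "\<lambda>_. borel"]] that by simp
  show ?case unfolding eq using Suc.prems
    by (intro borel_measurable_sum borel_measurable_times borel_measurable_diff borel_measurable_const Suc.IH xm) auto
qed

lemma TX_bounded: "J \<subseteq> I \<Longrightarrow> bounded_rmat n (TX J)"
  unfolding bounded_rmat_def
  by (auto simp: T_def intro!: bounded_rv_sum bounded_rv_diff bounded_rv_mult coord_bounded_rv)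

lemma outer_X_bounded: "t \<in> I \<Longrightarrow> bounded_rmat n (\<lambda>\<omega>. outer_self n (X t \<omega>))"
  unfolding bounded_rmat_def
  by (auto simp: outer_self_def intro!: bounded_rv_mult coord_bounded_rv)

text \<open>Both factors are measurable functions of disjoint blocks of an independent
  family.\<close>

lemma expectation_indep_mult:
  assumes t: "t \<in> I" "t \<notin> J" "J \<subseteq> I"
    and F: "F \<in> borel_measurable N" "bounded_rv (\<lambda>\<omega>. F (X t \<omega>))" and ij: "i < n" "j < n"
  shows "expectation (\<lambda>\<omega>. F (X t \<omega>) * (TX J \<omega> ^\<^sub>m k) $$ (i,j))
    = expectation (\<lambda>\<omega>. F (X t \<omega>)) * expectation (\<lambda>\<omega>. (TX J \<omega> ^\<^sub>m k) $$ (i,j))"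
proof -
  define G where "G = (\<lambda>x. (T J x ^\<^sub>m k) $$ (i,j))"
  have "indep_var (PiM {t} (\<lambda>_. N)) (\<lambda>\<omega>. restrict (\<lambda>s. X s \<omega>) {t}) (PiM J (\<lambda>_. N)) (\<lambda>\<omega>. restrict (\<lambda>s. X s \<omega>) J)"
    by (rule indep_var_restrict[OF indep]) (use t in auto)
  then have "indep_var borel ((\<lambda>x. F (x t)) \<circ> (\<lambda>\<omega>. restrict (\<lambda>s. X s \<omega>) {t}))
      borel (G \<circ> (\<lambda>\<omega>. restrict (\<lambda>s. X s \<omega>) J))"
  proof (rule indep_var_compose)
    show "(\<lambda>x. F (x t)) \<in> borel_measurable (PiM {t} (\<lambda>_. N))"
      by (rule measurable_compose[OF measurable_component_singleton[of t "{t}" "\<lambda>_. N"] F(1)]) simp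
    show "G \<in> borel_measurable (PiM J (\<lambda>_. N))" unfolding G_def by (rule T_power_measurable[OF ij])
  qed
  then have "indep_var borel (\<lambda>\<omega>. F (X t \<omega>)) borel (\<lambda>\<omega>. (TX J \<omega> ^\<^sub>m k) $$ (i,j))"
    by (simp add: comp_def G_def T_restrict)
  then show ?thesis
    by (rule indep_var_lebesgue_integral)
      (use F(2) bounded_rmat_pow[OF TX_bounded[OF t(3)], of k] ij in
        \<open>auto intro!: bounded_rv_integrable simp: bounded_rmat_def\<close>)
qed

text \<open>The trace is linear in the entries of X X', and each entry is independent of the power
  of the partial sum, so X X' may be replaced by its mean. Applied with t removed from the index
  set, this makes the centered term vanish and turns a remaining X X' into a factor L.\<close>

lemma expectation_mtr_outer:
  assumes t: "t \<in> I" "t \<notin> J" "J \<subseteq> I"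
  shows "expectation (\<lambda>\<omega>. mtr (outer_self n (X t \<omega>) * TX J \<omega> ^\<^sub>m k))
    = expectation (\<lambda>\<omega>. mtr (C t * TX J \<omega> ^\<^sub>m k))"
proof -
  have P: "bounded_rv (\<lambda>\<omega>. (TX J \<omega> ^\<^sub>m k) $$ (j,i))" if "i < n" "j < n" for i j
    using bounded_rmat_pow[OF TX_bounded[OF t(3)], of k] that by (auto simp: bounded_rmat_def)
  have x: "bounded_rv (\<lambda>\<omega>. X t \<omega> i * X t \<omega> j)" if "i < n" "j < n" for i j
    using t that by (intro bounded_rv_mult coord_bounded_rv)
  have "expectation (\<lambda>\<omega>. mtr (outer_self n (X t \<omega>) * TX J \<omega> ^\<^sub>m k))
      = expectation (\<lambda>\<omega>. \<Sum>i<n. \<Sum>j<n. (X t \<omega> i * X t \<omega> j) * (TX J \<omega> ^\<^sub>m k) $$ (j,i))"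
    by (simp add: mtr_mult[of _ n n] outer_self_def)
  also have "\<dots> = (\<Sum>i<n. \<Sum>j<n. expectation (\<lambda>\<omega>. (X t \<omega> i * X t \<omega> j) * (TX J \<omega> ^\<^sub>m k) $$ (j,i)))"
    by (rule expectation_double_sum) (intro bounded_rv_mult[OF x P])
  also have "\<dots> = (\<Sum>i<n. \<Sum>j<n. C t $$ (i,j) * expectation (\<lambda>\<omega>. (TX J \<omega> ^\<^sub>m k) $$ (j,i)))"
  proof (intro sum.cong refl)
    fix i j assume "i \<in> {..<n}" "j \<in> {..<n}"
    then have ij: "i < n" "j < n" by auto
    have m: "(\<lambda>x. x i * x j) \<in> borel_measurable N"
      using ij by (intro borel_measurable_times measurable_component_singleton) auto
    show "expectation (\<lambda>\<omega>. (X t \<omega> i * X t \<omega> j) * (TX J \<omega> ^\<^sub>m k) $$ (j,i))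
        = C t $$ (i,j) * expectation (\<lambda>\<omega>. (TX J \<omega> ^\<^sub>m k) $$ (j,i))"
      using expectation_indep_mult[OF t m x[OF ij] ij(2,1)] ij by (simp add: C_def)
  qed
  also have "\<dots> = expectation (\<lambda>\<omega>. \<Sum>i<n. \<Sum>j<n. C t $$ (i,j) * (TX J \<omega> ^\<^sub>m k) $$ (j,i))"
    by (subst expectation_double_sum) (auto intro!: bounded_rv_mult[OF bounded_rv_const] P)
  also have "\<dots> = expectation (\<lambda>\<omega>. mtr (C t * TX J \<omega> ^\<^sub>m k))"
    by (simp add: mtr_mult[of _ n n])
  finally show ?thesis .
qed

lemma T_remove:
  assumes "t \<in> J" "J \<subseteq> I"
  shows "outer_self n (x t) - C t = T J x - T (J - {t}) x"
proof (rule eq_matI)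
  fix i j assume "i < dim_row (T J x - T (J - {t}) x)" "j < dim_col (T J x - T (J - {t}) x)"
  then have ij: "i < n" "j < n" by (auto simp: T_def)
  have "finite J" using assms finite_I finite_subset by auto
  then show "(outer_self n (x t) - C t) $$ (i,j) = (T J x - T (J - {t}) x) $$ (i,j)"
    using ij assms by (simp add: T_def outer_self_def sum.remove[of J t] C_def)
qed (auto simp: T_def C_def)

lemma mtr_T_mult:
  assumes "D \<in> carrier_mat n n"
  shows "mtr (T J x * D) = (\<Sum>t\<in>J. mtr ((outer_self n (x t) - C t) * D))"
proof -
  have "mtr (T J x * D) = (\<Sum>i<n. \<Sum>j<n. \<Sum>t\<in>J. (x t i * x t j - C t $$ (i,j)) * D $$ (j,i))"
    using assms by (simp add: mtr_mult[of _ n n] T_def sum_distrib_right)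
  also have "\<dots> = (\<Sum>t\<in>J. \<Sum>i<n. \<Sum>j<n. (x t i * x t j - C t $$ (i,j)) * D $$ (j,i))"
    by (subst (2) sum.swap, subst sum.swap) (rule refl)
  also have "\<dots> = (\<Sum>t\<in>J. mtr ((outer_self n (x t) - C t) * D))"
    using assms by (intro sum.cong refl) (subst mtr_mult[of _ n n], auto simp: outer_self_def C_def)
  finally show ?thesis .
qed


text \<open>Since (X X')^2 = |X|^2 X X', only one factor B is spent and one X X' survives, whose
  mean is later bounded by L. This is what puts B L instead of B^2 in front of the number of
  summands.\<close>

lemma mtr_outer_square_le:
  assumes t: "t \<in> I" and D: "D \<in> carrier_mat n n" "D\<^sup>T = D"
  shows "mtr ((outer_self n (X t \<omega>) - C t) * (D * D) * (outer_self n (X t \<omega>) - C t))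
    \<le> 2 * B * mtr (outer_self n (X t \<omega>) * (D * D)) + 2 * L\<^sup>2 * mtr (D * D)"
proof -
  let ?A = "outer_self n (X t \<omega>)" and ?s = "\<Sum>i<n. (X t \<omega> i)\<^sup>2"
  note cs = mult_carrier_mat[of _ n n _ n]
  have "mtr (D * ?A * ?A * D) = mtr (D * (?s \<cdot>\<^sub>m ?A) * D)"
    using D by (simp add: assoc_mult_mat[of D n n ?A n ?A n] outer_self_square)
  also have "D * (?s \<cdot>\<^sub>m ?A) * D = ?s \<cdot>\<^sub>m (D * ?A * D)"
    using D by (simp add: cs mult_smult_distrib[of _ n n _ n] mult_smult_assoc_mat[of _ n n _ n])
  also have "mtr \<dots> = ?s * mtr (D * ?A * D)"
    using D by (simp add: mtr_def sum_distrib_left)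
  also have "mtr (D * ?A * D) = mtr (?A * (D * D))"
    using D by (subst assoc_mult_mat[of _ n n _ n _ n], simp_all, subst mtr_comm[of _ n n])
      (simp_all add: cs assoc_mult_mat[of _ n n _ n _ n])
  finally have "mtr (D * ?A * ?A * D) \<le> B * mtr (?A * (D * D))"
    using mult_right_mono[OF bound[OF t] mtr_outer_self_nonneg[OF D]] by simp
  moreover have "mtr (D * C t * C t * D) \<le> L\<^sup>2 * mtr (D * D)"
    by (rule mtr_psd_mult_bounds(2)[OF C_carrier C_transpose L_pos C_psd[OF t] C_le[OF t] D])
  ultimately show ?thesis
    using mtr_square_minus_le[OF outer_self_carrier outer_self_transpose C_carrier C_transpose D, of "X t \<omega>" t]
    by linarith
qed

text \<open>The leading term is peeled off one summand at a time: \<open>X\<^sub>t X\<^sub>t' - C\<^sub>t\<close> is centered and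
  independent of \<open>T\<^sub>J\<close> with \<open>t\<close> removed, so only the difference of odd powers contributes.\<close>

lemma mtr_even_power_step:
  assumes J: "J \<subseteq> I"
  shows "mtr (TX J \<omega> ^\<^sub>m (2 * m + 2)) / 2 \<le>
    (\<Sum>t\<in>J. mtr ((outer_self n (X t \<omega>) - C t) * TX (J - {t}) \<omega> ^\<^sub>m (2 * m + 1)))
    + 2 * (real (2 * m + 1))\<^sup>2 * B\<^sup>2 * mtr (TX J \<omega> ^\<^sub>m (2 * m))
    + 4 * real (2 * m + 1) * B * L * real (card J) * mtr (TX J \<omega> ^\<^sub>m (2 * m))
    + real (2 * m + 1) * (\<Sum>t\<in>J. 2 * B * mtr (outer_self n (X t \<omega>) * TX (J - {t}) \<omega> ^\<^sub>m (2 * m))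
        + 2 * B * L * mtr (TX (J - {t}) \<omega> ^\<^sub>m (2 * m)))"
proof -
  let ?T = "TX J \<omega>" and ?S = "\<lambda>t. TX (J - {t}) \<omega>" and ?A = "\<lambda>t. outer_self n (X t \<omega>)" and ?r = "real (2 * m + 1)"
  have B: "0 < B" using L_pos L_le_B by simp
  have LL: "L\<^sup>2 \<le> B * L" using L_pos L_le_B by (simp add: power2_eq_square)
  have pw: "D ^\<^sub>m (2 * m) = D ^\<^sub>m m * D ^\<^sub>m m" if "D \<in> carrier_mat n n" for D :: "real mat"
    using pow_mat_double[OF that, of m m] by (simp add: mult_2)
  have tr0: "0 \<le> mtr (T K (\<lambda>t. X t \<omega>) ^\<^sub>m (2 * m))" for K
    unfolding mtr_power_sum_eig[OF T_carrier T_transpose] by (intro sum_nonneg) auto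
  have sq: "mtr ((?A t - C t) * T K (\<lambda>t. X t \<omega>) ^\<^sub>m (2 * m) * (?A t - C t))
      \<le> 2 * B * mtr (?A t * T K (\<lambda>t. X t \<omega>) ^\<^sub>m (2 * m)) + 2 * B * L * mtr (T K (\<lambda>t. X t \<omega>) ^\<^sub>m (2 * m))"
    if "t \<in> I" for t K
  proof -
    have D: "T K (\<lambda>t. X t \<omega>) ^\<^sub>m m \<in> carrier_mat n n" "(T K (\<lambda>t. X t \<omega>) ^\<^sub>m m)\<^sup>T = T K (\<lambda>t. X t \<omega>) ^\<^sub>m m"
      using pow_mat_symmetric[OF T_carrier T_transpose] by auto
    from mtr_outer_square_le[OF that D, of \<omega>] mult_right_mono[OF LL tr0[of K]]
    show ?thesis unfolding pw[OF T_carrier] by (simp add: mult.assoc)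
  qed
  have "mtr (?T ^\<^sub>m (2 * m + 2)) = mtr (?T * ?T ^\<^sub>m (2 * m + 1))"
    using pow_mat_Suc_left[OF T_carrier, of J "\<lambda>t. X t \<omega>" "2 * m + 1"] by simp
  also have "\<dots> = (\<Sum>t\<in>J. mtr ((?A t - C t) * ?T ^\<^sub>m (2 * m + 1)))" by (rule mtr_T_mult) (rule pow_mat_carrier[OF T_carrier])
  also have "\<dots> \<le> (\<Sum>t\<in>J. mtr ((?A t - C t) * ?S t ^\<^sub>m (2 * m + 1))
      + ?r * ((2 * B * mtr (?A t * ?T ^\<^sub>m (2 * m)) + 2 * B * L * mtr (?T ^\<^sub>m (2 * m)))
        + (2 * B * mtr (?A t * ?S t ^\<^sub>m (2 * m)) + 2 * B * L * mtr (?S t ^\<^sub>m (2 * m)))))"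
  proof (rule sum_mono)
    fix t assume t: "t \<in> J"
    then have tI: "t \<in> I" using J by auto
    have "mtr ((?A t - C t) * ?T ^\<^sub>m (2 * m + 1)) - mtr ((?A t - C t) * ?S t ^\<^sub>m (2 * m + 1))
      \<le> ?r * (mtr ((?A t - C t) * ?T ^\<^sub>m (2 * m) * (?A t - C t)) + mtr ((?A t - C t) * ?S t ^\<^sub>m (2 * m) * (?A t - C t)))"
      by (rule mtr_power_difference_le[OF T_carrier T_transpose T_carrier T_transpose T_remove[OF t J]])
    also have "\<dots> \<le> ?r * ((2 * B * mtr (?A t * ?T ^\<^sub>m (2 * m)) + 2 * B * L * mtr (?T ^\<^sub>m (2 * m)))
        + (2 * B * mtr (?A t * ?S t ^\<^sub>m (2 * m)) + 2 * B * L * mtr (?S t ^\<^sub>m (2 * m))))"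
      by (intro mult_left_mono add_mono sq[OF tI]) simp
    finally show "mtr ((?A t - C t) * ?T ^\<^sub>m (2 * m + 1)) \<le> mtr ((?A t - C t) * ?S t ^\<^sub>m (2 * m + 1))
      + ?r * ((2 * B * mtr (?A t * ?T ^\<^sub>m (2 * m)) + 2 * B * L * mtr (?T ^\<^sub>m (2 * m)))
        + (2 * B * mtr (?A t * ?S t ^\<^sub>m (2 * m)) + 2 * B * L * mtr (?S t ^\<^sub>m (2 * m))))" by linarith
  qed
  also have "\<dots> = (\<Sum>t\<in>J. mtr ((?A t - C t) * ?S t ^\<^sub>m (2 * m + 1)))
      + ?r * (\<Sum>t\<in>J. 2 * B * mtr (?A t * ?S t ^\<^sub>m (2 * m)) + 2 * B * L * mtr (?S t ^\<^sub>m (2 * m)))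
      + ?r * (2 * B * (\<Sum>t\<in>J. mtr (?A t * ?T ^\<^sub>m (2 * m))) + real (card J) * (2 * B * L * mtr (?T ^\<^sub>m (2 * m))))"
    by (simp add: sum.distrib sum_distrib_left distrib_left)
  \<comment> \<open>Here the full sum still contains X_t, so independence cannot be applied. Instead
    the outer products are summed over t: their sum is the full sum plus the C_t, which raises the
    power by one.\<close>
  also have "(\<Sum>t\<in>J. mtr (?A t * ?T ^\<^sub>m (2 * m)))
      \<le> mtr (?T ^\<^sub>m (2 * m + 1)) + real (card J) * (L * mtr (?T ^\<^sub>m (2 * m)))"
  proof -
    have "mtr (?A t * ?T ^\<^sub>m (2 * m)) \<le> mtr ((?A t - C t) * ?T ^\<^sub>m (2 * m)) + L * mtr (?T ^\<^sub>m (2 * m))" if t: "t \<in> J" for t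
    proof -
      have tI: "t \<in> I" using t J by auto
      have D: "?T ^\<^sub>m m \<in> carrier_mat n n" "(?T ^\<^sub>m m)\<^sup>T = ?T ^\<^sub>m m"
        using pow_mat_symmetric[OF T_carrier T_transpose] by auto
      have "mtr ((?A t - C t) * ?T ^\<^sub>m (2 * m)) = mtr (?A t * ?T ^\<^sub>m (2 * m)) - mtr (C t * ?T ^\<^sub>m (2 * m))"
        by (simp add: minus_mult_distrib_mat[of _ n n _ _ n] mtr_minus[of _ n] mult_carrier_mat[of _ n n _ n])
      moreover have "mtr (C t * ?T ^\<^sub>m (2 * m)) \<le> L * mtr (?T ^\<^sub>m (2 * m))"
        unfolding pw[OF T_carrier]
        by (rule mtr_psd_mult_bounds(1)[OF C_carrier C_transpose L_pos C_psd[OF tI] C_le[OF tI] D])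
      ultimately show ?thesis by simp
    qed
    then have "(\<Sum>t\<in>J. mtr (?A t * ?T ^\<^sub>m (2 * m)))
        \<le> (\<Sum>t\<in>J. mtr ((?A t - C t) * ?T ^\<^sub>m (2 * m)) + L * mtr (?T ^\<^sub>m (2 * m)))" by (rule sum_mono)
    also have "\<dots> = mtr (?T * ?T ^\<^sub>m (2 * m)) + real (card J) * (L * mtr (?T ^\<^sub>m (2 * m)))"
      by (subst mtr_T_mult) (simp_all add: sum.distrib)
    finally show ?thesis using pow_mat_Suc_left[OF T_carrier, of J "\<lambda>t. X t \<omega>" "2 * m"] by simp
  qed
  finally have "mtr (?T ^\<^sub>m (2 * m + 2)) \<le> (\<Sum>t\<in>J. mtr ((?A t - C t) * ?S t ^\<^sub>m (2 * m + 1)))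
      + ?r * (\<Sum>t\<in>J. 2 * B * mtr (?A t * ?S t ^\<^sub>m (2 * m)) + 2 * B * L * mtr (?S t ^\<^sub>m (2 * m)))
      + ?r * (2 * B * (mtr (?T ^\<^sub>m (2 * m + 1)) + real (card J) * (L * mtr (?T ^\<^sub>m (2 * m))))
         + real (card J) * (2 * B * L * mtr (?T ^\<^sub>m (2 * m))))"
    using B by (simp add: mult_left_mono)
  \<comment> \<open>The odd power created above is absorbed: half of the left side is given up, and
    the square of the factor \<open>?r * (2 * B)\<close> is the source of the B^2 term in the
    recursion.\<close>
  moreover have "(?r * (2 * B)) * mtr (?T ^\<^sub>m (2 * m + 1))
      \<le> mtr (?T ^\<^sub>m (2 * m + 2)) / 2 + (?r * (2 * B))\<^sup>2 / 2 * mtr (?T ^\<^sub>m (2 * m))"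
    by (rule mtr_odd_power_le[OF T_carrier T_transpose]) (use B in simp)
  moreover have "a / 2 \<le> s + 2 * r\<^sup>2 * B\<^sup>2 * e + 4 * r * B * L * c * e + r * s'"
    if "a \<le> s + r * s' + r * (2 * B * (d + c * (L * e)) + c * (2 * B * L * e))"
      "(r * (2 * B)) * d \<le> a / 2 + (r * (2 * B))\<^sup>2 / 2 * e" for a s s' r c d e :: real
    using that by (simp add: power2_eq_square algebra_simps)
  ultimately show ?thesis by blast
qed

text \<open>The induction runs over all J at once because a step passes to J with one index removed.
  With 2m + 1 <= 2p the recursion factor 2 (2 (2m+1)^2 B^2 + 8 (2m+1) B L |J|) is at most the base
  of the power; the start is the trace n of the identity.\<close>

lemma expectation_even_power_le:
  assumes J: "J \<subseteq> I" and mp: "m \<le> p"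
  shows "expectation (\<lambda>\<omega>. mtr (TX J \<omega> ^\<^sub>m (2 * m)))
    \<le> real n * (16 * (real p)\<^sup>2 * B\<^sup>2 + 32 * real p * real (card I) * B * L) ^ m"
  using J mp
proof (induction m arbitrary: J)
  case 0
  then show ?case by (simp add: mtr_def T_def prob_space)
next
  case (Suc m)
  define K where "K = 16 * (real p)\<^sup>2 * B\<^sup>2 + 32 * real p * real (card I) * B * L"
  define \<Phi> where "\<Phi> = real n * K ^ m"
  have B: "0 < B" using L_pos L_le_B by simp
  have K0: "0 \<le> K" unfolding K_def using B L_pos by simp
  then have \<Phi>0: "0 \<le> \<Phi>" unfolding \<Phi>_def by simp
  let ?r = "real (2 * m + 1)"
  let ?e = "\<lambda>J. expectation (\<lambda>\<omega>. mtr (TX J \<omega> ^\<^sub>m (2 * m)))"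
  have IH: "?e J' \<le> \<Phi>" if "J' \<subseteq> I" for J'
    using Suc.IH[OF that] Suc.prems unfolding K_def \<Phi>_def by simp
  have sub: "J - {t} \<subseteq> I" for t using Suc.prems by auto
  have tI: "t \<in> I" if "t \<in> J" for t using that Suc.prems by auto
  have bT: "bounded_rv (\<lambda>\<omega>. mtr (TX J' \<omega> ^\<^sub>m k))" if "J' \<subseteq> I" for J' k
    by (rule bounded_rv_mtr[OF bounded_rmat_pow[OF TX_bounded[OF that]]])
  have bA: "bounded_rv (\<lambda>\<omega>. mtr (outer_self n (X t \<omega>) * TX (J - {t}) \<omega> ^\<^sub>m k))" if "t \<in> J" for t k
    by (rule bounded_rv_mtr[OF bounded_rmat_mult[OF outer_X_bounded[OF tI[OF that]] bounded_rmat_pow[OF TX_bounded[OF sub]]]])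
  have bC: "bounded_rv (\<lambda>\<omega>. mtr (C t * TX (J - {t}) \<omega> ^\<^sub>m k))" for t k
    by (rule bounded_rv_mtr[OF bounded_rmat_mult[OF bounded_rmat_const[OF C_carrier] bounded_rmat_pow[OF TX_bounded[OF sub]]]])
  have AC: "mtr ((outer_self n (X t \<omega>) - C t) * TX (J - {t}) \<omega> ^\<^sub>m k)
      = mtr (outer_self n (X t \<omega>) * TX (J - {t}) \<omega> ^\<^sub>m k) - mtr (C t * TX (J - {t}) \<omega> ^\<^sub>m k)" for t k \<omega>
    by (simp add: minus_mult_distrib_mat[of _ n n _ _ n] mtr_minus[of _ n] mult_carrier_mat[of _ n n _ n])
  have zero: "expectation (\<lambda>\<omega>. mtr ((outer_self n (X t \<omega>) - C t) * TX (J - {t}) \<omega> ^\<^sub>m k)) = 0" if t: "t \<in> J" for t k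
    unfolding AC using expectation_mtr_outer[OF tI[OF t] _ sub, of t k] bA[OF t] bC
    by (simp add: Bochner_Integration.integral_diff bounded_rv_integrable)
  have Ale: "expectation (\<lambda>\<omega>. mtr (outer_self n (X t \<omega>) * TX (J - {t}) \<omega> ^\<^sub>m (2 * m))) \<le> L * \<Phi>" if t: "t \<in> J" for t
  proof -
    have "expectation (\<lambda>\<omega>. mtr (outer_self n (X t \<omega>) * TX (J - {t}) \<omega> ^\<^sub>m (2 * m)))
        = expectation (\<lambda>\<omega>. mtr (C t * TX (J - {t}) \<omega> ^\<^sub>m (2 * m)))"
      by (rule expectation_mtr_outer[OF tI[OF t] _ sub]) simp
    also have "\<dots> \<le> expectation (\<lambda>\<omega>. L * mtr (TX (J - {t}) \<omega> ^\<^sub>m (2 * m)))"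
    proof (rule integral_mono)
      fix \<omega>
      have D: "TX (J - {t}) \<omega> ^\<^sub>m m \<in> carrier_mat n n" "(TX (J - {t}) \<omega> ^\<^sub>m m)\<^sup>T = TX (J - {t}) \<omega> ^\<^sub>m m"
        using pow_mat_symmetric[OF T_carrier T_transpose] by auto
      show "mtr (C t * TX (J - {t}) \<omega> ^\<^sub>m (2 * m)) \<le> L * mtr (TX (J - {t}) \<omega> ^\<^sub>m (2 * m))"
        using mtr_psd_mult_bounds(1)[OF C_carrier C_transpose L_pos C_psd[OF tI[OF t]] C_le[OF tI[OF t]] D]
        using pow_mat_double[OF T_carrier, of "J - {t}" "\<lambda>t. X t \<omega>" m m] by (simp add: mult_2)
    qed (use bC bT[OF sub] in \<open>auto intro!: bounded_rv_integrable bounded_rv_mult[OF bounded_rv_const]\<close>)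
    also have "\<dots> \<le> L * \<Phi>" using IH[OF sub] L_pos by simp
    finally show ?thesis .
  qed
  define R where "R \<omega> = (\<Sum>t\<in>J. mtr ((outer_self n (X t \<omega>) - C t) * TX (J - {t}) \<omega> ^\<^sub>m (2 * m + 1)))
    + 2 * ?r\<^sup>2 * B\<^sup>2 * mtr (TX J \<omega> ^\<^sub>m (2 * m))
    + 4 * ?r * B * L * real (card J) * mtr (TX J \<omega> ^\<^sub>m (2 * m))
    + ?r * (\<Sum>t\<in>J. 2 * B * mtr (outer_self n (X t \<omega>) * TX (J - {t}) \<omega> ^\<^sub>m (2 * m))
        + 2 * B * L * mtr (TX (J - {t}) \<omega> ^\<^sub>m (2 * m)))" for \<omega>
  have i1: "integrable M (\<lambda>\<omega>. mtr ((outer_self n (X t \<omega>) - C t) * TX (J - {t}) \<omega> ^\<^sub>m (2 * m + 1)))" if "t \<in> J" for t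
    unfolding AC by (intro bounded_rv_integrable bounded_rv_diff bA[OF that] bC)
  have i2: "integrable M (\<lambda>\<omega>. mtr (outer_self n (X t \<omega>) * TX (J - {t}) \<omega> ^\<^sub>m (2 * m)))" if "t \<in> J" for t
    by (intro bounded_rv_integrable bA[OF that])
  have i3: "integrable M (\<lambda>\<omega>. mtr (TX (J - {t}) \<omega> ^\<^sub>m (2 * m)))" for t
    by (intro bounded_rv_integrable bT[OF sub])
  have i4: "integrable M (\<lambda>\<omega>. mtr (TX J \<omega> ^\<^sub>m k))" for k
    by (intro bounded_rv_integrable bT[OF Suc.prems(1)])
  have i5: "integrable M (\<lambda>\<omega>. \<Sum>t\<in>J. 2 * B * mtr (outer_self n (X t \<omega>) * TX (J - {t}) \<omega> ^\<^sub>m (2 * m))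
        + 2 * B * L * mtr (TX (J - {t}) \<omega> ^\<^sub>m (2 * m)))"
    by (intro Bochner_Integration.integrable_sum Bochner_Integration.integrable_add integrable_mult_right i2 i3)
  have i6: "integrable M (\<lambda>\<omega>. \<Sum>t\<in>J. mtr ((outer_self n (X t \<omega>) - C t) * TX (J - {t}) \<omega> ^\<^sub>m (2 * m + 1)))"
    by (intro Bochner_Integration.integrable_sum i1)
  have ER: "expectation R = 2 * ?r\<^sup>2 * B\<^sup>2 * ?e J + 4 * ?r * B * L * real (card J) * ?e J
      + ?r * (\<Sum>t\<in>J. 2 * B * expectation (\<lambda>\<omega>. mtr (outer_self n (X t \<omega>) * TX (J - {t}) \<omega> ^\<^sub>m (2 * m))) + 2 * B * L * ?e (J - {t}))"
  proof -
    have s1: "expectation (\<lambda>\<omega>. \<Sum>t\<in>J. mtr ((outer_self n (X t \<omega>) - C t) * TX (J - {t}) \<omega> ^\<^sub>m (2 * m + 1))) = 0"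
      by (subst Bochner_Integration.integral_sum[OF i1], assumption, rule sum.neutral, rule ballI, rule zero)
    have s2: "expectation (\<lambda>\<omega>. \<Sum>t\<in>J. 2 * B * mtr (outer_self n (X t \<omega>) * TX (J - {t}) \<omega> ^\<^sub>m (2 * m))
        + 2 * B * L * mtr (TX (J - {t}) \<omega> ^\<^sub>m (2 * m)))
      = (\<Sum>t\<in>J. 2 * B * expectation (\<lambda>\<omega>. mtr (outer_self n (X t \<omega>) * TX (J - {t}) \<omega> ^\<^sub>m (2 * m))) + 2 * B * L * ?e (J - {t}))"
      by (subst Bochner_Integration.integral_sum)
        (auto intro!: Bochner_Integration.integrable_add integrable_mult_right i2 i3 sum.cong
          simp: Bochner_Integration.integral_add[OF integrable_mult_right[OF i2] integrable_mult_right[OF i3]])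
    have lin: "expectation (\<lambda>\<omega>. f1 \<omega> + c * f \<omega> + d * f \<omega> + r * g \<omega>)
        = expectation f1 + c * expectation f + d * expectation f + r * expectation g"
      if "integrable M f1" "integrable M f" "integrable M g" for f1 f g :: "'w \<Rightarrow> real" and c d r
      using that by simp
    show ?thesis unfolding R_def lin[OF i6 i4 i5] s1 s2 by simp
  qed
  have iR: "integrable M R" unfolding R_def
    by (intro Bochner_Integration.integrable_add integrable_mult_right i4 i5 i6)
  have "expectation (\<lambda>\<omega>. mtr (TX J \<omega> ^\<^sub>m (2 * m + 2)) / 2) \<le> expectation R"
    unfolding R_def by (rule integral_mono[OF _ iR[unfolded R_def] mtr_even_power_step[OF Suc.prems(1)]])
      (intro integrable_divide i4)
  also have "\<dots> \<le> 2 * ?r\<^sup>2 * B\<^sup>2 * \<Phi> + 4 * ?r * B * L * real (card J) * \<Phi> + ?r * (\<Sum>t\<in>J. 2 * B * (L * \<Phi>) + 2 * B * L * \<Phi>)"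
    unfolding ER using B L_pos
    by (intro add_mono mult_left_mono IH[OF Suc.prems(1)] sum_mono IH[OF sub] Ale) auto
  also have "\<dots> = (2 * ?r\<^sup>2 * B\<^sup>2 + 8 * ?r * B * L * real (card J)) * \<Phi>" by (simp add: algebra_simps)
  also have "\<dots> \<le> (2 * (2 * real p)\<^sup>2 * B\<^sup>2 + 8 * (2 * real p) * B * L * real (card I)) * \<Phi>"
  proof -
    have rp: "?r \<le> 2 * real p" using Suc.prems by simp
    have "real (card J) \<le> real (card I)" using card_mono[OF finite_I Suc.prems(1)] by simp
    then show ?thesis using rp B L_pos \<Phi>0
      by (intro mult_right_mono add_mono mult_mono power_mono) auto
  qed
  also have "\<dots> = K * \<Phi> / 2" unfolding K_def by (simp add: power2_eq_square algebra_simps)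
  finally have "expectation (\<lambda>\<omega>. mtr (TX J \<omega> ^\<^sub>m (2 * m + 2))) \<le> K * \<Phi>" by simp
  then show ?case unfolding K_def[symmetric] \<Phi>_def by (simp add: mult.left_commute)
qed

text \<open>Markov's inequality for the moment of order 2p, at the level
  \<open>\<rho> * sqrt K\<close>. Up to constants \<open>sqrt K\<close> is p B + sqrt(p |I| B L),
  the two regimes of Bernstein's inequality.\<close>

lemma deviation_event:
  assumes p: "0 < p" and \<rho>: "0 < \<rho>"
  defines "K \<equiv> 16 * (real p)\<^sup>2 * B\<^sup>2 + 32 * real p * real (card I) * B * L"
  obtains E where "E \<in> events" "prob E \<le> real n / \<rho> ^ (2 * p)"
    "\<And>\<omega> x. \<omega> \<in> space M - E \<Longrightarrow> x \<in> carrier_vec n \<Longrightarrow>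
       \<bar>x \<bullet> (TX I \<omega> *\<^sub>v x)\<bar> \<le> \<rho> * sqrt K * (x \<bullet> x)"
proof -
  let ?f = "\<lambda>\<omega>. mtr (TX I \<omega> ^\<^sub>m (2 * p))"
  define \<tau> where "\<tau> = \<rho> * sqrt K"
  have B: "0 < B" using L_pos L_le_B by simp
  have K: "0 < K" unfolding K_def using B L_pos p by (intro add_pos_nonneg) auto
  have \<tau>: "0 < \<tau>" unfolding \<tau>_def using K \<rho> by simp
  have \<tau>p: "\<tau> ^ (2 * p) = \<rho> ^ (2 * p) * K ^ p"
    unfolding \<tau>_def power_mult_distrib using K by (simp add: power_mult)
  have b: "bounded_rv ?f" by (rule bounded_rv_mtr[OF bounded_rmat_pow[OF TX_bounded[OF order_refl]]])
  define E where "E = {\<omega> \<in> space M. \<tau> ^ (2 * p) \<le> ?f \<omega>}"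
  have [measurable]: "?f \<in> borel_measurable M" using b unfolding bounded_rv_def by simp
  have E: "E \<in> events" unfolding E_def by measurable
  have "prob E \<le> expectation ?f / \<tau> ^ (2 * p)"
    unfolding E_def
  proof (rule integral_Markov_inequality_measure[where A = "{}"])
    show "AE \<omega> in M. 0 \<le> ?f \<omega>"
      unfolding mtr_power_sum_eig[OF T_carrier T_transpose] by (auto intro!: sum_nonneg)
  qed (use b \<tau> in \<open>auto intro!: bounded_rv_integrable\<close>)
  also have "\<dots> \<le> (real n * K ^ p) / \<tau> ^ (2 * p)"
    using expectation_even_power_le[OF order_refl order_refl, of p] \<tau> unfolding K_def
    by (intro divide_right_mono) auto
  also have "\<dots> = real n / \<rho> ^ (2 * p)" unfolding \<tau>p using K by simp
  finally have "prob E \<le> real n / \<rho> ^ (2 * p)" .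
  moreover have "\<bar>x \<bullet> (TX I \<omega> *\<^sub>v x)\<bar> \<le> \<rho> * sqrt K * (x \<bullet> x)"
    if "\<omega> \<in> space M - E" "x \<in> carrier_vec n" for \<omega> x
    unfolding \<tau>_def[symmetric]
    by (rule mtr_even_power_quad_form[OF T_carrier T_transpose that(2) p]) (use that(1) \<tau> in \<open>auto simp: E_def\<close>)
  ultimately show ?thesis using that E by blast
qed

lemma T_quad_form:
  assumes x: "x \<in> carrier_vec n"
  shows "x \<bullet> (TX I \<omega> *\<^sub>v x) = (\<Sum>t\<in>I. (\<Sum>i<n. x $ i * X t \<omega> i)\<^sup>2
    - expectation (\<lambda>\<omega>. (\<Sum>i<n. x $ i * X t \<omega> i)\<^sup>2))"
proof -
  have "x \<bullet> (TX I \<omega> *\<^sub>v x) = (\<Sum>i<n. \<Sum>j<n. \<Sum>t\<in>I. x $ i * x $ j * (X t \<omega> i * X t \<omega> j - C t $$ (i,j)))"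
    using x by (auto simp: T_def scalar_prod_def atLeast0LessThan sum_distrib_left algebra_simps intro!: sum.cong)
  also have "\<dots> = (\<Sum>t\<in>I. \<Sum>i<n. \<Sum>j<n. x $ i * x $ j * (X t \<omega> i * X t \<omega> j - C t $$ (i,j)))"
    by (subst (2) sum.swap, subst sum.swap) (rule refl)
  also have "\<dots> = (\<Sum>t\<in>I. (\<Sum>i<n. x $ i * X t \<omega> i)\<^sup>2 - (\<Sum>i<n. \<Sum>j<n. x $ i * x $ j * C t $$ (i,j)))"
    by (simp add: power2_eq_square sum_product right_diff_distrib sum_subtractf algebra_simps)
  finally show ?thesis by (simp add: expectation_square_form)
qed

end

section \<open>Sub-Gaussian vectors\<close>

text \<open>k^k / k! is a single term of the exponential series at k, and exp 1 <= 3.\<close>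

lemma power_self_le_fact: "real k ^ k \<le> 3 ^ k * fact k"
proof -
  have "real k ^ k /\<^sub>R fact k \<le> (\<Sum>i. real k ^ i /\<^sub>R fact i)"
  proof -
    have "(\<Sum>i\<in>{k}. real k ^ i /\<^sub>R fact i) \<le> (\<Sum>i. real k ^ i /\<^sub>R fact i)"
      by (rule sum_le_suminf) (use exp_converges[of "real k"] in \<open>auto simp: sums_iff\<close>)
    then show ?thesis by simp
  qed
  also have "\<dots> = exp (real k)" using exp_converges[of "real k"] by (simp add: sums_iff)
  also have "\<dots> = exp 1 ^ k" by (simp add: exp_of_nat_mult[symmetric])
  also have "\<dots> \<le> 3 ^ k" by (intro power_mono exp_le) auto
  finally show ?thesis by (simp add: field_simps)
qed

section \<open>Chernoff bound for nonnegative variables with factorial moments\<close>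

context prob_space
begin

text \<open>W will be the square of a sub-Gaussian variable, hence only sub-exponential: its moments
  grow like k!, so the exponential series is dominated by a geometric one with ratio x = |\<theta>|
  \<nu> <= 1/2. The terms from k = 2 on add up to at most 2 x^2, and 1 + u <= exp u
  finishes.\<close>

lemma mgf_le:
  fixes W :: "'a \<Rightarrow> real"
  assumes W: "W \<in> borel_measurable M" "\<And>\<omega>. 0 \<le> W \<omega>"
    and int: "\<And>k. 1 \<le> k \<Longrightarrow> integrable M (\<lambda>\<omega>. W \<omega> ^ k)"
    and mom: "\<And>k. 1 \<le> k \<Longrightarrow> expectation (\<lambda>\<omega>. W \<omega> ^ k) \<le> \<nu> ^ k * fact k"
    and \<nu>: "0 < \<nu>" and \<theta>: "\<bar>\<theta>\<bar> * \<nu> \<le> 1 / 2"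
  shows "integrable M (\<lambda>\<omega>. exp (\<theta> * W \<omega>))"
    "expectation (\<lambda>\<omega>. exp (\<theta> * W \<omega>)) \<le> exp (\<theta> * expectation W + 2 * \<theta>\<^sup>2 * \<nu>\<^sup>2)"
proof -
  define f where "f k \<omega> = (\<theta> * W \<omega>) ^ k /\<^sub>R fact k" for k \<omega>
  define x where "x = \<bar>\<theta>\<bar> * \<nu>"
  have x: "0 \<le> x" "x \<le> 1 / 2" unfolding x_def using \<nu> \<theta> by auto
  have int': "integrable M (\<lambda>\<omega>. W \<omega> ^ k)" for k by (cases "k = 0") (auto intro: int)
  have fi: "integrable M (f k)" for k
    unfolding f_def power_mult_distrib using int'[of k] by (intro integrable_scaleR_right integrable_mult_right) auto
  have norm_int: "expectation (\<lambda>\<omega>. norm (f k \<omega>)) \<le> x ^ k" for k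
  proof -
    have "expectation (\<lambda>\<omega>. norm (f k \<omega>)) = (\<bar>\<theta>\<bar> ^ k / fact k) * expectation (\<lambda>\<omega>. W \<omega> ^ k)"
      unfolding f_def using W(2)
      by (subst integral_mult_right_zero[symmetric])
        (auto intro!: Bochner_Integration.integral_cong simp: power_mult_distrib abs_mult power_abs divide_inverse)
    also have "\<dots> \<le> (\<bar>\<theta>\<bar> ^ k / fact k) * (\<nu> ^ k * fact k)"
    proof (intro mult_left_mono)
      show "expectation (\<lambda>\<omega>. W \<omega> ^ k) \<le> \<nu> ^ k * fact k"
        by (cases "k = 0") (auto simp: prob_space mom)
    qed simp
    also have "\<dots> = x ^ k" unfolding x_def by (simp add: power_mult_distrib)
    finally show ?thesis .
  qed
  have sx: "summable (\<lambda>k. x ^ k)" using x by (intro summable_geometric) auto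
  have s: "summable (\<lambda>k. expectation (\<lambda>\<omega>. norm (f k \<omega>)))"
    by (rule summable_comparison_test[OF _ sx]) (use norm_int in auto)
  have ae: "AE \<omega> in M. summable (\<lambda>k. norm (f k \<omega>))"
  proof (rule AE_I2)
    show "summable (\<lambda>k. norm (f k \<omega>))" for \<omega>
      unfolding f_def by (rule summable_norm_exp)
  qed
  have fsum: "(\<lambda>\<omega>. \<Sum>k. f k \<omega>) = (\<lambda>\<omega>. exp (\<theta> * W \<omega>))"
    unfolding f_def exp_def by simp
  show "integrable M (\<lambda>\<omega>. exp (\<theta> * W \<omega>))"
    using integrable_suminf[OF fi ae s] unfolding fsum .
  define a where "a k = expectation (f k)" for k
  have abs_a: "\<bar>a k\<bar> \<le> x ^ k" for k
  proof -
    have "norm (expectation (f k)) \<le> expectation (\<lambda>\<omega>. norm (f k \<omega>))" by (rule integral_norm_bound)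
    also have "\<dots> \<le> x ^ k" by (rule norm_int)
    finally show ?thesis unfolding a_def by simp
  qed
  have sa: "summable a"
    by (rule summable_comparison_test[OF _ sx]) (use abs_a in auto)
  have "expectation (\<lambda>\<omega>. exp (\<theta> * W \<omega>)) = (\<Sum>k. a k)"
    using integral_suminf[OF fi ae s] unfolding fsum a_def .
  also have "\<dots> = (\<Sum>k. a (k + 2)) + (\<Sum>k<2. a k)" by (rule suminf_split_initial_segment[OF sa])
  also have "(\<Sum>k<2. a k) = 1 + \<theta> * expectation W"
    unfolding a_def f_def by (simp add: numeral_2_eq_2 prob_space)
  also have "(\<Sum>k. a (k + 2)) \<le> (\<Sum>k. x\<^sup>2 * (1 / 2) ^ k)"
  proof (rule suminf_le)
    show "a (k + 2) \<le> x\<^sup>2 * (1 / 2) ^ k" for k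
    proof -
      have "a (k + 2) \<le> x ^ k * x\<^sup>2" using abs_a[of "k + 2"] by (simp add: power_add power2_eq_square mult_ac)
      also have "\<dots> \<le> (1 / 2) ^ k * x\<^sup>2" using x by (intro mult_right_mono power_mono) auto
      finally show ?thesis by (simp add: mult.commute)
    qed
  qed (use sa in \<open>auto simp: summable_iff_shift[of a 2] simp del: add_2_eq_Suc' intro!: summable_mult summable_geometric\<close>)
  also have "(\<Sum>k. x\<^sup>2 * (1 / 2) ^ k) = 2 * x\<^sup>2"
    by (subst suminf_mult) (auto intro!: summable_geometric simp: suminf_geometric)
  also have "2 * x\<^sup>2 + (1 + \<theta> * expectation W) \<le> exp (\<theta> * expectation W + 2 * \<theta>\<^sup>2 * \<nu>\<^sup>2)"
  proof -
    have "x\<^sup>2 = \<theta>\<^sup>2 * \<nu>\<^sup>2" unfolding x_def by (simp add: power_mult_distrib)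
    then show ?thesis by (intro order_trans[OF _ exp_ge_add_one_self]) simp
  qed
  finally show "expectation (\<lambda>\<omega>. exp (\<theta> * W \<omega>)) \<le> exp (\<theta> * expectation W + 2 * \<theta>\<^sup>2 * \<nu>\<^sup>2)" by simp
qed

lemma chernoff_one_sided:
  fixes W :: "nat \<Rightarrow> 'a \<Rightarrow> real"
  assumes I: "finite I" and indep: "indep_vars (\<lambda>_. borel) W I"
    and W: "\<And>t \<omega>. t \<in> I \<Longrightarrow> 0 \<le> W t \<omega>"
    and int: "\<And>t k. t \<in> I \<Longrightarrow> 1 \<le> k \<Longrightarrow> integrable M (\<lambda>\<omega>. W t \<omega> ^ k)"
    and mom: "\<And>t k. t \<in> I \<Longrightarrow> 1 \<le> k \<Longrightarrow> expectation (\<lambda>\<omega>. W t \<omega> ^ k) \<le> \<nu> ^ k * fact k"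
    and \<nu>: "0 < \<nu>" and s: "0 \<le> s" "s \<le> 2" and \<sigma>: "\<bar>\<sigma>\<bar> = 1"
  shows "prob {\<omega> \<in> space M. real (card I) * \<nu> * s \<le> \<sigma> * (\<Sum>t\<in>I. W t \<omega> - expectation (W t))}
    \<le> exp (- real (card I) * s\<^sup>2 / 8)"
proof -
  \<comment> \<open>The minimizer of 2 \<theta>^2 \<nu>^2 - \<theta> \<nu> s, with value -s^2/8; the
    restriction s <= 2 is the condition |\<theta>| \<nu> <= 1/2 of \<open>mgf_le\<close>. The sign
    \<sigma> treats both tails at once.\<close>
  define \<theta> where "\<theta> = s / (4 * \<nu>)"
  have \<theta>: "0 \<le> \<theta>" "\<bar>\<sigma> * \<theta>\<bar> * \<nu> \<le> 1 / 2" unfolding \<theta>_def abs_mult \<sigma> using s \<nu> by auto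
  have sig: "\<sigma>\<^sup>2 = 1" using \<sigma> by (metis abs_power2 one_power2 power2_abs)
  have rv: "W t \<in> borel_measurable M" if "t \<in> I" for t
    using indep that unfolding indep_vars_def by auto
  have bnd: "integrable M (\<lambda>\<omega>. exp (\<sigma> * \<theta> * W t \<omega>))"
    "expectation (\<lambda>\<omega>. exp (\<sigma> * \<theta> * W t \<omega>)) \<le> exp (\<sigma> * \<theta> * expectation (W t) + 2 * \<theta>\<^sup>2 * \<nu>\<^sup>2)" if t: "t \<in> I" for t
  proof -
    have ind: "(\<lambda>\<omega>. max 0 (W t \<omega>)) = W t" using W[OF t] by (auto simp: max_def)
    show "integrable M (\<lambda>\<omega>. exp (\<sigma> * \<theta> * W t \<omega>))"
      by (rule mgf_le(1)[OF rv[OF t] W[OF t] int[OF t] mom[OF t] \<nu> \<theta>(2)])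
    show "expectation (\<lambda>\<omega>. exp (\<sigma> * \<theta> * W t \<omega>)) \<le> exp (\<sigma> * \<theta> * expectation (W t) + 2 * \<theta>\<^sup>2 * \<nu>\<^sup>2)"
      using mgf_le(2)[OF rv[OF t] W[OF t] int[OF t] mom[OF t] \<nu> \<theta>(2)] sig
      by (simp add: power_mult_distrib)
  qed
  define U where "U t \<omega> = exp (\<sigma> * \<theta> * (W t \<omega> - expectation (W t)))" for t \<omega>
  have U_eq: "U t \<omega> = exp (- (\<sigma> * \<theta> * expectation (W t))) * exp (\<sigma> * \<theta> * W t \<omega>)" for t \<omega>
    unfolding U_def by (simp add: exp_add[symmetric] algebra_simps)
  have iU: "integrable M (U t)" if "t \<in> I" for t
    unfolding U_eq using bnd(1)[OF that] by (intro integrable_mult_right)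
  have eU: "expectation (U t) \<le> exp (2 * \<theta>\<^sup>2 * \<nu>\<^sup>2)" if t: "t \<in> I" for t
  proof -
    have "expectation (U t) = exp (- (\<sigma> * \<theta> * expectation (W t))) * expectation (\<lambda>\<omega>. exp (\<sigma> * \<theta> * W t \<omega>))"
      unfolding U_eq by simp
    also have "\<dots> \<le> exp (- (\<sigma> * \<theta> * expectation (W t))) * exp (\<sigma> * \<theta> * expectation (W t) + 2 * \<theta>\<^sup>2 * \<nu>\<^sup>2)"
      using bnd(2)[OF t] by (intro mult_left_mono) auto
    finally show ?thesis by (simp add: exp_add[symmetric])
  qed
  have indU: "indep_vars (\<lambda>_. borel) U I"
    unfolding U_def by (rule indep_vars_compose2[OF indep]) measurable
  let ?\<alpha> = "real (card I)"
  have "{\<omega> \<in> space M. ?\<alpha> * \<nu> * s \<le> \<sigma> * (\<Sum>t\<in>I. W t \<omega> - expectation (W t))}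
      \<subseteq> {\<omega> \<in> space M. exp (\<theta> * (?\<alpha> * \<nu> * s)) \<le> (\<Prod>t\<in>I. U t \<omega>)}"
  proof safe
    fix \<omega> assume "?\<alpha> * \<nu> * s \<le> \<sigma> * (\<Sum>t\<in>I. W t \<omega> - expectation (W t))"
    from mult_left_mono[OF this \<theta>(1)]
    show "exp (\<theta> * (?\<alpha> * \<nu> * s)) \<le> (\<Prod>t\<in>I. U t \<omega>)"
      unfolding U_def exp_sum[OF I, symmetric] by (simp add: sum_distrib_left algebra_simps)
  qed
  then have "prob {\<omega> \<in> space M. ?\<alpha> * \<nu> * s \<le> \<sigma> * (\<Sum>t\<in>I. W t \<omega> - expectation (W t))}
      \<le> prob {\<omega> \<in> space M. exp (\<theta> * (?\<alpha> * \<nu> * s)) \<le> (\<Prod>t\<in>I. U t \<omega>)}"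
  proof (rule finite_measure_mono)
    have [measurable]: "(\<lambda>\<omega>. \<Prod>t\<in>I. U t \<omega>) \<in> borel_measurable M"
      using iU by (intro borel_measurable_prod) auto
    show "{\<omega> \<in> space M. exp (\<theta> * (?\<alpha> * \<nu> * s)) \<le> (\<Prod>t\<in>I. U t \<omega>)} \<in> events" by measurable
  qed
  also have "\<dots> \<le> expectation (\<lambda>\<omega>. \<Prod>t\<in>I. U t \<omega>) / exp (\<theta> * (?\<alpha> * \<nu> * s))"
    by (rule integral_Markov_inequality_measure[where A = "{}"])
      (use indep_vars_integrable[OF I indU iU] in \<open>auto intro!: AE_I2 prod_nonneg simp: U_def\<close>)
  also have "expectation (\<lambda>\<omega>. \<Prod>t\<in>I. U t \<omega>) = (\<Prod>t\<in>I. expectation (U t))"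
    by (rule indep_vars_lebesgue_integral[OF I indU iU])
  also have "(\<Prod>t\<in>I. expectation (U t)) / exp (\<theta> * (?\<alpha> * \<nu> * s))
      \<le> (\<Prod>t\<in>I. exp (2 * \<theta>\<^sup>2 * \<nu>\<^sup>2)) / exp (\<theta> * (?\<alpha> * \<nu> * s))"
    using eU by (intro divide_right_mono prod_mono) (auto simp: U_def intro!: integral_nonneg_AE)
  also have "\<dots> = exp (?\<alpha> * (2 * \<theta>\<^sup>2 * \<nu>\<^sup>2) - \<theta> * (?\<alpha> * \<nu> * s))"
    by (simp add: exp_of_nat_mult[symmetric] exp_diff)
  also have "?\<alpha> * (2 * \<theta>\<^sup>2 * \<nu>\<^sup>2) - \<theta> * (?\<alpha> * \<nu> * s) = - ?\<alpha> * s\<^sup>2 / 8"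
    unfolding \<theta>_def using \<nu> by (simp add: power2_eq_square field_simps)
  finally show ?thesis .
qed

end

section \<open>A lattice net of the Euclidean unit ball\<close>

lemma sum_half_power_abs_le: "(\<Sum>j\<in>{- int m..int m}. (1 / 2 :: real) ^ nat \<bar>j\<bar>) \<le> 4"
proof -
  let ?f = "\<lambda>j. (1 / 2 :: real) ^ nat \<bar>j\<bar>"
  have geo: "(\<Sum>i\<le>m. (1 / 2 :: real) ^ i) \<le> 2"
  proof -
    have "(\<Sum>i\<le>m. (1 / 2 :: real) ^ i) \<le> (\<Sum>i. (1 / 2 :: real) ^ i)"
      by (rule sum_le_suminf) auto
    then show ?thesis by (simp add: suminf_geometric)
  qed
  have "{- int m..int m} \<subseteq> int ` {..m} \<union> (\<lambda>i. - int i) ` {..m}"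
  proof
    fix j assume "j \<in> {- int m..int m}"
    then show "j \<in> int ` {..m} \<union> (\<lambda>i. - int i) ` {..m}"
      by (cases "0 \<le> j") (auto simp: image_iff intro: bexI[of _ "nat \<bar>j\<bar>"])
  qed
  then have "(\<Sum>j\<in>{- int m..int m}. ?f j) \<le> (\<Sum>j\<in>int ` {..m} \<union> (\<lambda>i. - int i) ` {..m}. ?f j)"
    by (intro sum_mono2) auto
  also have "\<dots> \<le> (\<Sum>j\<in>int ` {..m}. ?f j) + (\<Sum>j\<in>(\<lambda>i. - int i) ` {..m}. ?f j)"
    by (subst sum_Un) (auto intro!: sum_nonneg)
  also have "\<dots> = (\<Sum>i\<le>m. (1 / 2) ^ i) + (\<Sum>i\<le>m. (1 / 2) ^ i)"
    by (subst (1 2) sum.reindex) (auto simp: inj_on_def)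
  finally show ?thesis using geo by simp
qed

text \<open>Coordinates of the net points, in units of 1/(4 sqrt d). Vectors of the Euclidean unit
  ball have l1 norm at most sqrt d, which is 4 d in these units, so m = 4 d below. Counting lattice
  points in an l1 ball replaces the usual volume comparison.\<close>

definition int_l1_ball :: "nat \<Rightarrow> nat \<Rightarrow> (nat \<Rightarrow> int) set" where
  "int_l1_ball d m = {k \<in> PiE {..<d} (\<lambda>_. {- int m..int m}). (\<Sum>i<d. \<bar>k i\<bar>) \<le> int m}"

lemma finite_int_l1_ball: "finite (int_l1_ball d m)"
  unfolding int_l1_ball_def by (auto intro!: finite_PiE)

text \<open>Counting with the weights \<open>2 ^ (m - \<Sum>|k i|) \<ge> 1\<close>, which factor over the coordinates.\<close>

lemma card_int_l1_ball: "real (card (int_l1_ball d m)) \<le> 2 ^ m * 4 ^ d"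
proof -
  let ?P = "PiE {..<d} (\<lambda>_. {- int m..int m})"
  have "real (card (int_l1_ball d m)) * (1 / 2) ^ m = (\<Sum>k\<in>int_l1_ball d m. (1 / 2) ^ m)" by simp
  also have "\<dots> \<le> (\<Sum>k\<in>int_l1_ball d m. \<Prod>i<d. (1 / 2 :: real) ^ nat \<bar>k i\<bar>)"
  proof (rule sum_mono)
    fix k assume k: "k \<in> int_l1_ball d m"
    have "int (\<Sum>i<d. nat \<bar>k i\<bar>) = (\<Sum>i<d. \<bar>k i\<bar>)" by (simp add: of_nat_sum)
    then have "int (\<Sum>i<d. nat \<bar>k i\<bar>) \<le> int m" using k by (simp only: int_l1_ball_def mem_Collect_eq)
    then have "(\<Sum>i<d. nat \<bar>k i\<bar>) \<le> m" by (simp only: of_nat_le_iff)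
    then have "(1 / 2 :: real) ^ m \<le> (1 / 2) ^ (\<Sum>i<d. nat \<bar>k i\<bar>)" by (intro power_decreasing) auto
    then show "(1 / 2 :: real) ^ m \<le> (\<Prod>i<d. (1 / 2) ^ nat \<bar>k i\<bar>)" by (simp add: power_sum)
  qed
  also have "\<dots> \<le> (\<Sum>k\<in>?P. \<Prod>i<d. (1 / 2 :: real) ^ nat \<bar>k i\<bar>)"
  proof (rule sum_mono2)
    show "finite ?P" by (rule finite_PiE) auto
    show "int_l1_ball d m \<subseteq> ?P" unfolding int_l1_ball_def by blast
  qed (simp add: prod_nonneg)
  also have "\<dots> = (\<Prod>i<d. \<Sum>j\<in>{- int m..int m}. (1 / 2 :: real) ^ nat \<bar>j\<bar>)"
    by (rule prod_sum_PiE[symmetric]) auto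
  also have "\<dots> \<le> (\<Prod>i<d. 4)"
    by (intro prod_mono) (auto intro!: sum_nonneg sum_half_power_abs_le)
  finally have "real (card (int_l1_ball d m)) * (1 / 2) ^ m \<le> 4 ^ d" by simp
  then show ?thesis by (simp add: power_one_over pos_divide_le_eq mult.commute)
qed

definition net_point :: "nat \<Rightarrow> (nat \<Rightarrow> int) \<Rightarrow> real vec" where
  "net_point d k = vec d (\<lambda>i. of_int (k i) / (4 * sqrt (real d)))"

lemma net_point_carrier [simp]: "net_point d k \<in> carrier_vec d"
  unfolding net_point_def by simp

lemma net_approximation:
  assumes x: "x \<in> carrier_vec d" "x \<bullet> x \<le> 1" and d: "0 < d"
  shows "\<exists>k \<in> int_l1_ball d (4 * d). net_point d k \<bullet> net_point d k \<le> 1 \<and>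
    (x - net_point d k) \<bullet> (x - net_point d k) \<le> 1 / 16"
proof -
  define s where "s = 4 * sqrt (real d)"
  have s: "0 < s" unfolding s_def using d by simp
  \<comment> \<open>Rounding towards zero: absolute values can only decrease, so the net point stays
    in the unit ball and in the l1 ball. Each coordinate moves by at most 1/(4 sqrt d), which adds
    up to at most 1/16 in squared norm.\<close>
  define k where "k = (\<lambda>i\<in>{..<d}. (if 0 \<le> x $ i then 1 else -1) * \<lfloor>\<bar>x $ i\<bar> * s\<rfloor>)"
  have abs_k: "\<bar>k i\<bar> = \<lfloor>\<bar>x $ i\<bar> * s\<rfloor>" if "i < d" for i
    using that s unfolding k_def by (simp add: abs_mult)
  have le: "\<bar>net_point d k $ i\<bar> \<le> \<bar>x $ i\<bar>" if i: "i < d" for i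
  proof -
    have "of_int \<bar>k i\<bar> \<le> \<bar>x $ i\<bar> * s" unfolding abs_k[OF i] by (rule of_int_floor_le)
    then show ?thesis using i s unfolding net_point_def s_def[symmetric] by (simp add: field_simps)
  qed
  have near: "\<bar>(x - net_point d k) $ i\<bar> \<le> 1 / s" if i: "i < d" for i
  proof -
    have "\<bar>x $ i - of_int (k i) / s\<bar> = \<bar>\<bar>x $ i\<bar> - of_int \<lfloor>\<bar>x $ i\<bar> * s\<rfloor> / s\<bar>"
      using i unfolding k_def by (auto simp: abs_minus_commute)
    also have "\<dots> = \<bar>\<bar>x $ i\<bar> * s - of_int \<lfloor>\<bar>x $ i\<bar> * s\<rfloor>\<bar> / s"
    proof -
      have "\<bar>x $ i\<bar> - of_int \<lfloor>\<bar>x $ i\<bar> * s\<rfloor> / s = (\<bar>x $ i\<bar> * s - of_int \<lfloor>\<bar>x $ i\<bar> * s\<rfloor>) / s"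
        using s by (simp add: field_simps)
      then show ?thesis using s by simp
    qed
    also have "\<dots> \<le> 1 / s" using s by (intro divide_right_mono) linarith+
    finally show ?thesis using i x unfolding net_point_def s_def[symmetric] by simp
  qed
  have "(\<Sum>i<d. \<bar>x $ i\<bar>) \<le> sqrt (real d)"
  proof -
    have "(\<Sum>i<d. \<bar>x $ i\<bar> * 1)\<^sup>2 \<le> (\<Sum>i<d. \<bar>x $ i\<bar>\<^sup>2) * (\<Sum>i<d. 1\<^sup>2)"
      by (rule Cauchy_Schwarz_ineq_sum)
    also have "\<dots> \<le> 1 * real d" using x by (intro mult_mono) (auto simp: scalar_prod_self_sum sum_nonneg)
    finally show ?thesis by (intro real_le_rsqrt) simp
  qed
  then have "(\<Sum>i<d. \<bar>x $ i\<bar> * s) \<le> sqrt (real d) * s"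
    using s by (simp add: sum_distrib_right[symmetric])
  moreover have "sqrt (real d) * s = real (4 * d)" unfolding s_def by simp
  moreover have "(\<Sum>i<d. real_of_int \<bar>k i\<bar>) \<le> (\<Sum>i<d. \<bar>x $ i\<bar> * s)"
    by (intro sum_mono) (auto simp: abs_k)
  ultimately have "real_of_int (\<Sum>i<d. \<bar>k i\<bar>) \<le> real_of_int (int (4 * d))" by simp
  then have sumk: "(\<Sum>i<d. \<bar>k i\<bar>) \<le> int (4 * d)" by (simp only: of_int_le_iff)
  have "k i \<in> {- int (4 * d)..int (4 * d)}" if "i < d" for i
  proof -
    have "\<bar>k i\<bar> \<le> (\<Sum>i<d. \<bar>k i\<bar>)" using that by (intro member_le_sum) auto
    then show ?thesis using sumk by auto
  qed
  then have "k \<in> int_l1_ball d (4 * d)"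
    using sumk unfolding int_l1_ball_def by (auto simp: k_def)
  moreover have "net_point d k \<bullet> net_point d k \<le> 1"
  proof -
    have "(\<Sum>i<d. (net_point d k $ i)\<^sup>2) \<le> (\<Sum>i<d. (x $ i)\<^sup>2)"
      using le by (intro sum_mono) (simp add: abs_le_square_iff[symmetric])
    then show ?thesis using x by (simp add: scalar_prod_self_sum[of _ d])
  qed
  moreover have "(x - net_point d k) \<bullet> (x - net_point d k) \<le> 1 / 16"
  proof -
    have "(\<Sum>i<d. ((x - net_point d k) $ i)\<^sup>2) \<le> (\<Sum>i<d. (1 / s)\<^sup>2)"
      using near s by (intro sum_mono) (auto simp: abs_le_square_iff[symmetric])
    also have "\<dots> = 1 / 16" unfolding s_def using d by (simp add: power_divide power_mult_distrib)
    finally show ?thesis using x by (simp add: scalar_prod_self_sum[of _ d])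
  qed
  ultimately show ?thesis by blast
qed

lemma quad_form_add_minus:
  fixes A :: "real mat"
  assumes A: "A \<in> carrier_mat d d" "A\<^sup>T = A" and u: "u \<in> carrier_vec d" and v: "v \<in> carrier_vec d"
  shows "(c \<cdot>\<^sub>v u + v) \<bullet> (A *\<^sub>v (c \<cdot>\<^sub>v u + v)) = c\<^sup>2 * (u \<bullet> (A *\<^sub>v u)) + 2 * c * (u \<bullet> (A *\<^sub>v v)) + v \<bullet> (A *\<^sub>v v)"
proof -
  have sym: "v \<bullet> (A *\<^sub>v u) = u \<bullet> (A *\<^sub>v v)"
    using transpose_vec_mult_scalar[OF A(1) u v] A u v comm_scalar_prod[of "A *\<^sub>v v" d u] by simp
  show ?thesis using A u v sym
    by (simp add: mult_add_distrib_mat_vec[of _ d d] mult_mat_vec[of _ d d] add_scalar_prod_distrib[of _ d]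
        scalar_prod_add_distrib[of _ d] power2_eq_square algebra_simps)
qed

text \<open>Let z be a unit vector at which the form equals an extreme eigenvalue and y a net point
  with |z - y| <= 1/4. Symmetry gives z' A z - y' A y = (z - y)' A (z + y), at most \<kappa> (1/4) 2
  = \<kappa>/2 in absolute value, where \<kappa> is the largest absolute eigenvalue. Hence \<kappa>
  <= \<delta> + \<kappa>/2, which is the factor 2.\<close>

lemma quad_form_net_bound:
  fixes A :: "real mat"
  assumes A: "A \<in> carrier_mat d d" "A\<^sup>T = A" and d: "0 < d"
    and net: "\<And>k. k \<in> int_l1_ball d (4 * d) \<Longrightarrow> net_point d k \<bullet> net_point d k \<le> 1 \<Longrightarrow>
      \<bar>net_point d k \<bullet> (A *\<^sub>v net_point d k)\<bar> \<le> \<delta>"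
    and x: "x \<in> carrier_vec d"
  shows "\<bar>x \<bullet> (A *\<^sub>v x)\<bar> \<le> 2 * \<delta> * (x \<bullet> x)"
proof -
  define \<kappa> where "\<kappa> = max \<bar>eig A 1\<bar> \<bar>eig A d\<bar>"
  have form: "\<bar>w \<bullet> (A *\<^sub>v w)\<bar> \<le> \<kappa> * (w \<bullet> w)" if w: "w \<in> carrier_vec d" for w
  proof -
    have "w \<bullet> (A *\<^sub>v w) \<le> eig A 1 * (w \<bullet> w)" "eig A d * (w \<bullet> w) \<le> w \<bullet> (A *\<^sub>v w)"
      using rayleigh_bounds[OF A d w] lam_max_eig[OF A d] by auto
    moreover have "eig A 1 * (w \<bullet> w) \<le> \<kappa> * (w \<bullet> w)" "- \<kappa> * (w \<bullet> w) \<le> eig A d * (w \<bullet> w)"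
      unfolding \<kappa>_def using scalar_prod_self_nonneg[of w] by (intro mult_right_mono; auto)+
    ultimately show ?thesis by auto
  qed
  have \<kappa>0: "0 \<le> \<kappa>" unfolding \<kappa>_def by simp
  have eig_le: "\<bar>eig A j\<bar> \<le> \<delta> + \<kappa> / 2" if j: "1 \<le> j" "j \<le> d" for j
  proof -
    obtain z where z: "z \<in> carrier_vec d" "z \<bullet> z = 1" "z \<bullet> (A *\<^sub>v z) = eig A j"
      using eig_vector[OF A j] by auto
    obtain k where k: "k \<in> int_l1_ball d (4 * d)" "net_point d k \<bullet> net_point d k \<le> 1"
      "(z - net_point d k) \<bullet> (z - net_point d k) \<le> 1 / 16"
      using net_approximation[OF z(1) _ d] z(2) by auto
    define y where "y = net_point d k"
    have y: "y \<in> carrier_vec d" unfolding y_def by simp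
    define u v where "u = z - y" and "v = z + y"
    have uv: "u \<in> carrier_vec d" "v \<in> carrier_vec d" unfolding u_def v_def using z y by auto
    have uu: "u \<bullet> u \<le> 1 / 16" using k(3) unfolding u_def y_def .
    have vv: "v \<bullet> v \<le> 4"
    proof -
      have "u \<bullet> u + v \<bullet> v = 2 * (z \<bullet> z) + 2 * (y \<bullet> y)"
        unfolding u_def v_def using z y
        by (simp add: minus_scalar_prod_distrib[of _ d] scalar_prod_minus_distrib[of _ d]
            add_scalar_prod_distrib[of _ d] scalar_prod_add_distrib[of _ d] comm_scalar_prod[of y d z])
      then show ?thesis using z(2) k(2) scalar_prod_self_nonneg[of u] unfolding y_def by simp
    qed
    have zAy: "y \<bullet> (A *\<^sub>v z) = z \<bullet> (A *\<^sub>v y)"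
      using transpose_vec_mult_scalar[OF A(1) z(1) y] A y z comm_scalar_prod[of "A *\<^sub>v y" d z] by simp
    have uAv: "u \<bullet> (A *\<^sub>v v) = z \<bullet> (A *\<^sub>v z) - y \<bullet> (A *\<^sub>v y)"
      unfolding u_def v_def using z y A zAy
      by (simp add: mult_add_distrib_mat_vec[of _ d d] minus_scalar_prod_distrib[of _ d] scalar_prod_add_distrib[of _ d])
    have n: "(8 \<cdot>\<^sub>v u + v) \<bullet> (8 \<cdot>\<^sub>v u + v) + ((-8) \<cdot>\<^sub>v u + v) \<bullet> ((-8) \<cdot>\<^sub>v u + v) = 128 * (u \<bullet> u) + 2 * (v \<bullet> v)"
      using uv by (simp add: add_scalar_prod_distrib[of _ d] scalar_prod_add_distrib[of _ d])
    \<comment> \<open>The factor 8 balances the two vectors: |u| <= 1/4 and |v| <= 2, so 8 u and v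
      have the same bound, and polarization loses nothing against the bound \<kappa> |u|
      |v|.\<close>
    have "32 * (u \<bullet> (A *\<^sub>v v)) = (8 \<cdot>\<^sub>v u + v) \<bullet> (A *\<^sub>v (8 \<cdot>\<^sub>v u + v))
        - ((-8) \<cdot>\<^sub>v u + v) \<bullet> (A *\<^sub>v ((-8) \<cdot>\<^sub>v u + v))"
      unfolding quad_form_add_minus[OF A uv] by simp
    then have "\<bar>32 * (u \<bullet> (A *\<^sub>v v))\<bar> \<le> \<kappa> * ((8 \<cdot>\<^sub>v u + v) \<bullet> (8 \<cdot>\<^sub>v u + v)) + \<kappa> * (((-8) \<cdot>\<^sub>v u + v) \<bullet> ((-8) \<cdot>\<^sub>v u + v))"
      using form[of "8 \<cdot>\<^sub>v u + v"] form[of "(-8) \<cdot>\<^sub>v u + v"] uv by auto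
    also have "\<dots> = \<kappa> * (128 * (u \<bullet> u) + 2 * (v \<bullet> v))" unfolding n[symmetric] by (simp add: distrib_left)
    also have "\<dots> \<le> \<kappa> * 16" using uu vv \<kappa>0 by (intro mult_left_mono) auto
    finally have "\<bar>u \<bullet> (A *\<^sub>v v)\<bar> \<le> \<kappa> / 2" by simp
    moreover have "\<bar>y \<bullet> (A *\<^sub>v y)\<bar> \<le> \<delta>" unfolding y_def by (rule net[OF k(1,2)])
    ultimately show ?thesis using uAv z(3) by linarith
  qed
  have "\<kappa> \<le> \<delta> + \<kappa> / 2" using eig_le[of 1] eig_le[of d] d unfolding \<kappa>_def by auto
  then have "\<kappa> \<le> 2 * \<delta>" by simp
  then have "\<kappa> * (x \<bullet> x) \<le> 2 * \<delta> * (x \<bullet> x)" using scalar_prod_self_nonneg by (rule mult_right_mono)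
  then show ?thesis using form[OF x] by simp
qed

context prob_space
begin

text \<open>Serves twice: in dimension r for the signal block of the bounded case, and in dimension
  n for the whole observation of the sub-Gaussian case, whose covariance depends on t.\<close>

lemma subgaussian_deviation_event:
  fixes Z :: "nat \<Rightarrow> 'a \<Rightarrow> real vec" and S :: "nat \<Rightarrow> real mat"
  assumes I: "finite I" "I \<noteq> {}" and d: "0 < d" and n: "2 \<le> n" and \<kappa>: "0 < \<kappa>"
    and indep: "\<And>u. u \<in> carrier_vec d \<Longrightarrow> indep_vars (\<lambda>_. borel) (\<lambda>t \<omega>. u \<bullet> Z t \<omega>) I"
    and Z: "\<And>t \<omega>. t \<in> I \<Longrightarrow> \<omega> \<in> space M \<Longrightarrow> Z t \<omega> \<in> carrier_vec d"
    and int: "\<And>t u k. t \<in> I \<Longrightarrow> u \<in> carrier_vec d \<Longrightarrow> integrable M (\<lambda>\<omega>. (u \<bullet> Z t \<omega>) ^ (2 * k))"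
    and mom: "\<And>t u k. t \<in> I \<Longrightarrow> u \<in> carrier_vec d \<Longrightarrow> 1 \<le> k \<Longrightarrow>
      expectation (\<lambda>\<omega>. (u \<bullet> Z t \<omega>) ^ (2 * k)) \<le> (2 * real k) ^ k * \<kappa> ^ k * (u \<bullet> u) ^ k"
    and S: "\<And>t. t \<in> I \<Longrightarrow> S t \<in> carrier_mat d d" "\<And>t. t \<in> I \<Longrightarrow> (S t)\<^sup>T = S t"
      "\<And>t u. t \<in> I \<Longrightarrow> u \<in> carrier_vec d \<Longrightarrow> expectation (\<lambda>\<omega>. (u \<bullet> Z t \<omega>)\<^sup>2) = u \<bullet> (S t *\<^sub>v u)"
    and small: "sqrt ((real d + ln (real n)) / real (card I)) \<le> 1 / 6"
  obtains E where "E \<in> events" "prob E \<le> 1 / real n ^ 10"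
    "\<And>\<omega> x. \<omega> \<in> space M - E \<Longrightarrow> x \<in> carrier_vec d \<Longrightarrow>
       \<bar>\<Sum>t\<in>I. (x \<bullet> Z t \<omega>)\<^sup>2 - x \<bullet> (S t *\<^sub>v x)\<bar>
         \<le> real (card I) * (144 * \<kappa> * sqrt ((real d + ln (real n)) / real (card I))) * (x \<bullet> x)"
proof -
  define h where "h = (real d + ln (real n)) / real (card I)"
  \<comment> \<open>The Chernoff exponent |I| s^2 / 8 becomes 18 (d + log n). The net has at most
    2^(4d) 4^d = 64^d <= exp(5 d) points, and 2 <= n pays for the two tails; n^(-10) remains. The
    bound 1/6 in the hypothesis is s <= 2. The final constant is 144 = 2 * 6 * 12, from the net,
    from \<nu> = 6 \<kappa> and from s.\<close>
  define s where "s = 12 * sqrt h"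
  define \<nu> where "\<nu> = 6 * \<kappa>"
  have \<alpha>: "0 < real (card I)" using I by (simp add: card_gt_0_iff)
  have ln: "0 \<le> ln (real n)" using n by simp
  have h: "0 \<le> h" unfolding h_def using ln by simp
  have s: "0 \<le> s" "s \<le> 2" unfolding s_def using h small unfolding h_def by auto
  have \<nu>: "0 < \<nu>" unfolding \<nu>_def using \<kappa> by simp
  define K where "K = {k \<in> int_l1_ball d (4 * d). net_point d k \<bullet> net_point d k \<le> 1}"
  have K: "finite K" unfolding K_def using finite_int_l1_ball by simp
  define W where "W k t \<omega> = (net_point d k \<bullet> Z t \<omega>)\<^sup>2" for k t \<omega>
  define F where "F \<sigma> k = {\<omega> \<in> space M. real (card I) * \<nu> * s \<le> \<sigma> * (\<Sum>t\<in>I. W k t \<omega> - expectation (W k t))}" for \<sigma> k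
  have Wpow: "W k t \<omega> ^ j = (net_point d k \<bullet> Z t \<omega>) ^ (2 * j)" for k t \<omega> j
    unfolding W_def by (simp add: power_mult)
  have indW: "indep_vars (\<lambda>_. borel) (W k) I" for k
    unfolding W_def by (rule indep_vars_compose2[OF indep[OF net_point_carrier]]) measurable
  have Fev: "F \<sigma> k \<in> events" for \<sigma> k
  proof -
    have [measurable]: "W k t \<in> borel_measurable M" if "t \<in> I" for t
      using indW that unfolding indep_vars_def by auto
    show ?thesis unfolding F_def by measurable
  qed
  have Fprob: "prob (F \<sigma> k) \<le> exp (- real (card I) * s\<^sup>2 / 8)" if k: "k \<in> K" and \<sigma>: "\<bar>\<sigma>\<bar> = 1" for \<sigma> k
    unfolding F_def
  proof (rule chernoff_one_sided[OF I(1) indW _ _ _ \<nu> s \<sigma>])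
    fix t j assume t: "t \<in> I" and j: "(1::nat) \<le> j"
    show "integrable M (\<lambda>\<omega>. W k t \<omega> ^ j)" unfolding Wpow by (rule int[OF t net_point_carrier])
    have "expectation (\<lambda>\<omega>. W k t \<omega> ^ j) \<le> (2 * real j) ^ j * \<kappa> ^ j * (net_point d k \<bullet> net_point d k) ^ j"
      unfolding Wpow by (rule mom[OF t net_point_carrier j])
    also have "\<dots> \<le> (2 * real j) ^ j * \<kappa> ^ j * 1"
      using k \<kappa> scalar_prod_self_nonneg unfolding K_def by (intro mult_left_mono power_le_one) auto
    also have "\<dots> = (2 * \<kappa>) ^ j * real j ^ j" by (simp add: power_mult_distrib)
    also have "\<dots> \<le> (2 * \<kappa>) ^ j * (3 ^ j * fact j)" using \<kappa> by (intro mult_left_mono power_self_le_fact) auto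
    also have "\<dots> = (2 * \<kappa> * 3) ^ j * fact j" unfolding power_mult_distrib[of "2 * \<kappa>" 3 j] by simp
    also have "\<dots> = \<nu> ^ j * fact j" unfolding \<nu>_def by (simp add: mult.commute)
    finally show "expectation (\<lambda>\<omega>. W k t \<omega> ^ j) \<le> \<nu> ^ j * fact j" .
  qed (auto simp: W_def)
  define E where "E = (\<Union>k\<in>K. F 1 k \<union> F (-1) k)"
  have E: "E \<in> events" unfolding E_def using K Fev by auto
  have "prob E \<le> (\<Sum>k\<in>K. prob (F 1 k \<union> F (-1) k))"
    unfolding E_def using K Fev by (intro finite_measure_subadditive_finite) auto
  also have "\<dots> \<le> (\<Sum>k\<in>K. 2 * exp (- real (card I) * s\<^sup>2 / 8))"
  proof (rule sum_mono)
    fix k assume k: "k \<in> K"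
    have "prob (F 1 k \<union> F (-1) k) \<le> prob (F 1 k) + prob (F (-1) k)"
      by (rule measure_Un_le[OF Fev Fev])
    then show "prob (F 1 k \<union> F (-1) k) \<le> 2 * exp (- real (card I) * s\<^sup>2 / 8)"
      using Fprob[OF k, of 1] Fprob[OF k, of "-1"] by simp
  qed
  also have "- real (card I) * s\<^sup>2 / 8 = - 18 * (real d + ln (real n))"
    unfolding s_def using h \<alpha> by (simp add: power_mult_distrib h_def)
  also have "(\<Sum>k\<in>K. 2 * exp (- 18 * (real d + ln (real n)))) \<le> (2 ^ (4 * d) * 4 ^ d) * (2 * exp (- 18 * (real d + ln (real n))))"
  proof -
    have "card K \<le> card (int_l1_ball d (4 * d))"
      unfolding K_def by (intro card_mono finite_int_l1_ball) auto
    then have "real (card K) \<le> 2 ^ (4 * d) * 4 ^ d" using card_int_l1_ball[of d "4 * d"] by linarith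
    then show ?thesis by (simp add: mult_right_mono)
  qed
  also have "\<dots> \<le> 1 / real n ^ 10"
  proof -
    have e5: "(64::real) \<le> exp 5"
    proof -
      have "(5 / 2 :: real) \<le> exp 1" using exp_lower_Taylor_quadratic[of 1] by simp
      then have "(5 / 2 :: real) ^ 5 \<le> exp 1 ^ 5" by (intro power_mono) auto
      also have "exp 1 ^ 5 = exp (5 :: real)" by (simp add: exp_of_nat_mult[symmetric])
      finally show ?thesis by (simp add: power_divide)
    qed
    have "(2 ^ (4 * d) * 4 ^ d :: real) = (16 * 4) ^ d" unfolding power_mult power_mult_distrib by simp
    also have "\<dots> = 64 ^ d" by simp
    also have "\<dots> \<le> exp 5 ^ d" using e5 by (intro power_mono) auto
    also have "\<dots> = exp (5 * real d)" by (simp add: exp_of_nat_mult[symmetric] mult.commute)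
    finally have "(2 ^ (4 * d) * 4 ^ d) * (2 * exp (- 18 * (real d + ln (real n))))
        \<le> exp (5 * real d) * (exp (ln (real n)) * exp (- 18 * (real d + ln (real n))))"
      using n by (intro mult_mono) auto
    also have "\<dots> = exp (5 * real d + ln (real n) - 18 * (real d + ln (real n)))"
      by (simp add: exp_add[symmetric] algebra_simps)
    also have "\<dots> \<le> exp (- (10 * ln (real n)))" using ln by simp
    also have "\<dots> = 1 / real n ^ 10" using n
      by (simp add: exp_minus exp_of_nat_mult[of 10, simplified] inverse_eq_divide)
    finally show ?thesis .
  qed
  finally have pE: "prob E \<le> 1 / real n ^ 10" .
  show thesis
  proof (rule that[OF E pE])
    fix \<omega> and x :: "real vec" assume \<omega>: "\<omega> \<in> space M - E" and x: "x \<in> carrier_vec d"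
    define A where "A = mat d d (\<lambda>(i,j). \<Sum>t\<in>I. Z t \<omega> $ i * Z t \<omega> $ j - S t $$ (i,j))"
    have A: "A \<in> carrier_mat d d" unfolding A_def by simp
    have AT: "A\<^sup>T = A"
    proof (rule eq_matI)
      fix i j assume "i < dim_row A" "j < dim_col A"
      then have ij: "i < d" "j < d" using A by auto
      have "S t $$ (i,j) = S t $$ (j,i)" if "t \<in> I" for t
        using S(1,2)[OF that] ij by (metis carrier_matD index_transpose_mat(1))
      then show "A\<^sup>T $$ (i,j) = A $$ (i,j)" using ij unfolding A_def by (simp add: mult.commute)
    qed (use A in auto)
    have form: "u \<bullet> (A *\<^sub>v u) = (\<Sum>t\<in>I. (u \<bullet> Z t \<omega>)\<^sup>2 - u \<bullet> (S t *\<^sub>v u))" if u: "u \<in> carrier_vec d" for u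
    proof -
      have "u \<bullet> (A *\<^sub>v u) = (\<Sum>i<d. \<Sum>j<d. \<Sum>t\<in>I. u $ i * (Z t \<omega> $ i * Z t \<omega> $ j - S t $$ (i,j)) * u $ j)"
        using u by (simp add: A_def scalar_prod_def atLeast0LessThan sum_distrib_left sum_distrib_right mult.assoc)
      also have "\<dots> = (\<Sum>t\<in>I. \<Sum>i<d. \<Sum>j<d. u $ i * (Z t \<omega> $ i * Z t \<omega> $ j - S t $$ (i,j)) * u $ j)"
        by (subst (2) sum.swap, subst sum.swap) (rule refl)
      also have "\<dots> = (\<Sum>t\<in>I. (u \<bullet> Z t \<omega>)\<^sup>2 - u \<bullet> (S t *\<^sub>v u))"
      proof (intro sum.cong refl)
        fix t assume t: "t \<in> I"
        have "u \<bullet> Z t \<omega> = (\<Sum>i<d. u $ i * Z t \<omega> $ i)"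
          using carrier_vecD[OF Z[OF t, of \<omega>]] \<omega> u by (simp add: scalar_prod_def atLeast0LessThan)
        then have "(u \<bullet> Z t \<omega>)\<^sup>2 = (\<Sum>i<d. \<Sum>j<d. u $ i * (Z t \<omega> $ i * Z t \<omega> $ j) * u $ j)"
          by (simp add: power2_eq_square sum_product mult_ac)
        moreover have "u \<bullet> (S t *\<^sub>v u) = (\<Sum>i<d. \<Sum>j<d. u $ i * S t $$ (i,j) * u $ j)"
          using S(1)[OF t] u by (simp add: scalar_prod_def atLeast0LessThan sum_distrib_left mult.assoc)
        ultimately show "(\<Sum>i<d. \<Sum>j<d. u $ i * (Z t \<omega> $ i * Z t \<omega> $ j - S t $$ (i,j)) * u $ j)
            = (u \<bullet> Z t \<omega>)\<^sup>2 - u \<bullet> (S t *\<^sub>v u)"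
          by (simp add: right_diff_distrib left_diff_distrib sum_subtractf)
      qed
      finally show ?thesis .
    qed
    have "\<bar>x \<bullet> (A *\<^sub>v x)\<bar> \<le> 2 * (real (card I) * \<nu> * s) * (x \<bullet> x)"
    proof (rule quad_form_net_bound[OF A AT d _ x])
      fix k assume "k \<in> int_l1_ball d (4 * d)" "net_point d k \<bullet> net_point d k \<le> 1"
      then have "k \<in> K" unfolding K_def by simp
      then have "\<omega> \<notin> F 1 k" "\<omega> \<notin> F (-1) k" using \<omega> unfolding E_def by auto
      moreover have "net_point d k \<bullet> (A *\<^sub>v net_point d k) = (\<Sum>t\<in>I. W k t \<omega> - expectation (W k t))"
        unfolding form[OF net_point_carrier] W_def using S(3) by (intro sum.cong) auto
      ultimately show "\<bar>net_point d k \<bullet> (A *\<^sub>v net_point d k)\<bar> \<le> real (card I) * \<nu> * s"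
        using \<omega> unfolding F_def by auto
    qed
    also have "2 * (real (card I) * \<nu> * s) = real (card I) * (144 * \<kappa> * sqrt h)"
      unfolding \<nu>_def s_def by simp
    finally show "\<bar>\<Sum>t\<in>I. (x \<bullet> Z t \<omega>)\<^sup>2 - x \<bullet> (S t *\<^sub>v x)\<bar>
         \<le> real (card I) * (144 * \<kappa> * sqrt ((real d + ln (real n)) / real (card I))) * (x \<bullet> x)"
      unfolding form[OF x] h_def .
  qed
qed

end

section \<open>The largest eigenvalue gap\<close>

text \<open>The choice among ties depends on the set of maximizers only. This reduces uniqueness and
  measurability to statements about that set, which has finitely many possible values.\<close>

lemma dim_estimate_eq_Some:
  "dim_estimate n D = (SOME j. j \<in> {j \<in> {1..<n}. \<forall>i\<in>{1..<n}. eig D i - eig D (i + 1) \<le> eig D j - eig D (j + 1)})"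
  unfolding dim_estimate_def arg_max_def is_arg_max_def by (intro arg_cong[where f = Eps]) (auto simp: fun_eq_iff Ball_def not_less)

lemma dim_estimate_unique:
  assumes r: "r \<in> {1..<n}"
    and less: "\<And>j. j \<in> {1..<n} \<Longrightarrow> j \<noteq> r \<Longrightarrow> eig D j - eig D (j + 1) < eig D r - eig D (r + 1)"
  shows "dim_estimate n D = r"
proof -
  have "{j \<in> {1..<n}. \<forall>i\<in>{1..<n}. eig D i - eig D (i + 1) \<le> eig D j - eig D (j + 1)} = {r}"
    using r less by (force simp: not_less[symmetric] less_imp_le)
  then show ?thesis unfolding dim_estimate_eq_Some by simp
qed

section \<open>Measurability of the estimate\<close>

lemma quad_form_entry_bound:
  fixes A B :: "real mat"
  assumes A: "A \<in> carrier_mat n n" and B: "B \<in> carrier_mat n n" and x: "x \<in> carrier_vec n"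
    and e: "\<And>i j. i < n \<Longrightarrow> j < n \<Longrightarrow> \<bar>A $$ (i,j) - B $$ (i,j)\<bar> \<le> e"
  shows "\<bar>x \<bullet> (A *\<^sub>v x) - x \<bullet> (B *\<^sub>v x)\<bar> \<le> e * real n * (x \<bullet> x)"
proof -
  have form: "x \<bullet> (D *\<^sub>v x) = (\<Sum>i<n. \<Sum>j<n. x $ i * (D $$ (i,j) * x $ j))" if "D \<in> carrier_mat n n" for D
    using that x by (simp add: scalar_prod_def atLeast0LessThan sum_distrib_left)
  have "x \<bullet> (A *\<^sub>v x) - x \<bullet> (B *\<^sub>v x) = (\<Sum>i<n. \<Sum>j<n. x $ i * ((A $$ (i,j) - B $$ (i,j)) * x $ j))"
    unfolding form[OF A] form[OF B] by (simp add: sum_subtractf[symmetric] left_diff_distrib right_diff_distrib)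
  also have "\<bar>\<dots>\<bar> \<le> (\<Sum>i<n. \<Sum>j<n. \<bar>x $ i * ((A $$ (i,j) - B $$ (i,j)) * x $ j)\<bar>)"
    by (intro order_trans[OF sum_abs] sum_mono sum_abs)
  also have "\<dots> \<le> (\<Sum>i<n. \<Sum>j<n. \<bar>x $ i\<bar> * (e * \<bar>x $ j\<bar>))"
    unfolding abs_mult by (intro sum_mono mult_left_mono mult_right_mono e) auto
  also have "\<dots> = e * (\<Sum>i<n. \<bar>x $ i\<bar> * 1)\<^sup>2"
    by (simp add: power2_eq_square sum_product sum_distrib_left mult_ac)
  also have "\<dots> \<le> e * ((\<Sum>i<n. \<bar>x $ i\<bar>\<^sup>2) * (\<Sum>i<n. 1\<^sup>2))"
  proof (cases "n = 0")
    case False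
    then have "0 \<le> e" using e[of 0 0] by linarith
    then show ?thesis by (intro mult_left_mono Cauchy_Schwarz_ineq_sum)
  qed simp
  finally show ?thesis using x by (simp add: scalar_prod_self_sum mult_ac)
qed

lemma eig_abs_perturbation:
  fixes A B :: "real mat"
  assumes A: "A \<in> carrier_mat n n" "A\<^sup>T = A" and B: "B \<in> carrier_mat n n" "B\<^sup>T = B" and j: "1 \<le> j" "j \<le> n"
    and e: "\<And>i j. i < n \<Longrightarrow> j < n \<Longrightarrow> \<bar>A $$ (i,j) - B $$ (i,j)\<bar> \<le> e"
  shows "\<bar>eig A j - eig B j\<bar> \<le> e * real n"
proof -
  note q = quad_form_entry_bound[OF A(1) B(1) _ e]
  have "eig B j - e * real n \<le> eig A j"
  proof (rule eig_perturbation[OF A B j])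
    fix x :: "real vec" assume "x \<in> carrier_vec n"
    from q[OF this] show "x \<bullet> (B *\<^sub>v x) - e * real n * (x \<bullet> x) \<le> x \<bullet> (A *\<^sub>v x)" by linarith
  qed
  moreover have "eig A j - e * real n \<le> eig B j"
  proof (rule eig_perturbation[OF B A j])
    fix x :: "real vec" assume "x \<in> carrier_vec n"
    from q[OF this] show "x \<bullet> (A *\<^sub>v x) - e * real n * (x \<bullet> x) \<le> x \<bullet> (B *\<^sub>v x)" by linarith
  qed
  ultimately show ?thesis by linarith
qed

text \<open>Rounding the entries to a grid gives a symmetric matrix with countably many values, and
  eigenvalues are Lipschitz in the entries.\<close>

lemma eig_measurable:
  fixes D :: "'w \<Rightarrow> real mat"
  assumes D: "\<And>\<omega>. \<omega> \<in> space M \<Longrightarrow> D \<omega> \<in> carrier_mat n n" "\<And>\<omega>. \<omega> \<in> space M \<Longrightarrow> (D \<omega>)\<^sup>T = D \<omega>"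
    and m: "\<And>i j. i < n \<Longrightarrow> j < n \<Longrightarrow> (\<lambda>\<omega>. D \<omega> $$ (i,j)) \<in> borel_measurable M"
    and j: "1 \<le> j" "j \<le> n"
  shows "(\<lambda>\<omega>. eig (D \<omega>) j) \<in> borel_measurable M"
proof -
  \<comment> \<open>The rounded entries are coded as a list of integers, row by row. Lists of
    integers form a countable type, so every function of the list, in particular \<open>eig\<close>
    of the decoded matrix, is measurable for the discrete \<sigma>-algebra.\<close>
  define h where "h k \<omega> = map (\<lambda>l. \<lfloor>real (Suc k) * D \<omega> $$ (l div n, l mod n)\<rfloor>) [0..<n * n]" for k \<omega>
  define R where "R k l = mat n n (\<lambda>(i,j). real_of_int (l ! (i * n + j)) / real (Suc k))" for k and l :: "int list"
  have idx: "l div n < n" "l mod n < n" if "l < n * n" for l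
    using that by (cases "n = 0"; simp add: less_mult_imp_div_less)+
  have hm: "h k \<in> measurable M (count_space UNIV)" for k
  proof (subst measurable_count_space_eq_countable)
    show "h k \<in> space M \<rightarrow> UNIV \<and> (\<forall>a\<in>UNIV. h k -` {a} \<inter> space M \<in> sets M)"
    proof safe
      fix a :: "int list"
      show "h k -` {a} \<inter> space M \<in> sets M"
      proof (cases "length a = n * n")
        case True
        have "h k -` {a} \<inter> space M
            = {\<omega> \<in> space M. \<forall>l\<in>{..<n * n}. \<lfloor>real (Suc k) * D \<omega> $$ (l div n, l mod n)\<rfloor> = a ! l}"
          using True by (auto simp: h_def list_eq_iff_nth_eq)
        also have "\<dots> \<in> sets M"
        proof -
          have [measurable]: "(\<lambda>\<omega>. D \<omega> $$ (l div n, l mod n)) \<in> borel_measurable M" if "l \<in> {..<n * n}" for l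
            using that idx by (intro m) auto
          show ?thesis by measurable
        qed
        finally show ?thesis .
      next
        case False
        then have "h k -` {a} = {}" by (auto simp: h_def)
        then show ?thesis by simp
      qed
    qed simp
  qed simp
  have Rh: "R k (h k \<omega>) $$ (i,i') = real_of_int \<lfloor>real (Suc k) * D \<omega> $$ (i,i')\<rfloor> / real (Suc k)" if "i < n" "i' < n" for k \<omega> i i'
  proof -
    have "i * n + i' < n * n"
    proof -
      have "i * n + i' < (i + 1) * n" using that by simp
      also have "\<dots> \<le> n * n" using that by (intro mult_right_mono) auto
      finally show ?thesis .
    qed
    moreover have "(i * n + i') div n = i" "(i * n + i') mod n = i'" using that by auto
    ultimately show ?thesis using that unfolding R_def h_def by simp
  qed
  have "(\<lambda>\<omega>. eig (R k (h k \<omega>)) j) \<in> borel_measurable M" for k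
    by (rule measurable_compose[OF hm]) simp
  moreover have "(\<lambda>k. eig (R k (h k \<omega>)) j) \<longlonglongrightarrow> eig (D \<omega>) j" if \<omega>: "\<omega> \<in> space M" for \<omega>
  proof -
    have Rc: "R k l \<in> carrier_mat n n" for k l unfolding R_def by simp
    have RT: "(R k (h k \<omega>))\<^sup>T = R k (h k \<omega>)" for k
    proof (rule eq_matI)
      fix i i' assume "i < dim_row (R k (h k \<omega>))" "i' < dim_col (R k (h k \<omega>))"
      then have ii: "i < n" "i' < n" using Rc[of k "h k \<omega>"] by auto
      moreover have "D \<omega> $$ (i,i') = D \<omega> $$ (i',i)" using D[OF \<omega>] ii by (metis carrier_matD index_transpose_mat(1))
      ultimately show "(R k (h k \<omega>))\<^sup>T $$ (i,i') = R k (h k \<omega>) $$ (i,i')"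
        using Rc[of k "h k \<omega>"] by (simp add: Rh)
    qed (use Rc in \<open>auto simp: R_def\<close>)
    have bnd: "\<bar>eig (R k (h k \<omega>)) j - eig (D \<omega>) j\<bar> \<le> 1 / real (Suc k) * real n" for k
    proof (rule eig_abs_perturbation[OF Rc RT D[OF \<omega>] j])
      fix i i' assume ii: "i < n" "i' < n"
      define z where "z = real (Suc k) * D \<omega> $$ (i,i')"
      have "R k (h k \<omega>) $$ (i,i') - D \<omega> $$ (i,i') = (real_of_int \<lfloor>z\<rfloor> - z) / real (Suc k)"
        unfolding Rh[OF ii] z_def by (simp add: field_simps)
      also have "\<bar>\<dots>\<bar> \<le> 1 / real (Suc k)"
        unfolding abs_divide by (intro frac_le) (auto, linarith)
      finally show "\<bar>R k (h k \<omega>) $$ (i,i') - D \<omega> $$ (i,i')\<bar> \<le> 1 / real (Suc k)" .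
    qed
    have null: "(\<lambda>k. 1 / real (Suc k) * real n) \<longlonglongrightarrow> 0"
      using tendsto_mult_right[OF LIMSEQ_inverse_real_of_nat, of "real n"] by (simp add: inverse_eq_divide)
    have "\<forall>k. norm (eig (R k (h k \<omega>)) j - eig (D \<omega>) j) \<le> 1 / real (Suc k) * real n"
      using bnd by (simp only: real_norm_def) blast
    then have "(\<lambda>k. eig (R k (h k \<omega>)) j - eig (D \<omega>) j) \<longlonglongrightarrow> 0"
      by (rule Lim_null_comparison[OF always_eventually null])
    then show ?thesis by (rule LIM_zero_cancel)
  qed
  ultimately show ?thesis by (rule borel_measurable_LIMSEQ_real[rotated])
qed

text \<open>The event is a finite union over the possible sets of maximizers, each described by
  finitely many comparisons of measurable gaps.\<close>

lemma dim_estimate_measurable: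
  fixes D :: "'w \<Rightarrow> real mat"
  assumes D: "\<And>\<omega>. \<omega> \<in> space M \<Longrightarrow> D \<omega> \<in> carrier_mat n n" "\<And>\<omega>. \<omega> \<in> space M \<Longrightarrow> (D \<omega>)\<^sup>T = D \<omega>"
    and m: "\<And>i j. i < n \<Longrightarrow> j < n \<Longrightarrow> (\<lambda>\<omega>. D \<omega> $$ (i,j)) \<in> borel_measurable M"
  shows "{\<omega> \<in> space M. dim_estimate n (D \<omega>) = r} \<in> sets M"
proof -
  define A where "A \<omega> = {j \<in> {1..<n}. \<forall>i\<in>{1..<n}. eig (D \<omega>) i - eig (D \<omega>) (i + 1) \<le> eig (D \<omega>) j - eig (D \<omega>) (j + 1)}" for \<omega>
  have [measurable]: "(\<lambda>\<omega>. eig (D \<omega>) i) \<in> borel_measurable M" if "i \<in> {1..n}" for i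
    using that by (intro eig_measurable[OF D m]) auto
  have g[measurable]: "(\<lambda>\<omega>. eig (D \<omega>) i - eig (D \<omega>) (i + 1)) \<in> borel_measurable M" if "i \<in> {1..<n}" for i
    using that by (intro borel_measurable_diff) auto
  have "{\<omega> \<in> space M. dim_estimate n (D \<omega>) = r}
      = (\<Union>S \<in> {S. S \<subseteq> {1..<n} \<and> (SOME j. j \<in> S) = r}. {\<omega> \<in> space M. A \<omega> = S})"
  proof -
    have "dim_estimate n (D \<omega>) = (SOME j. j \<in> A \<omega>)" "A \<omega> \<subseteq> {1..<n}" for \<omega>
      unfolding A_def dim_estimate_eq_Some by auto
    then show ?thesis by auto
  qed
  also have "\<dots> \<in> sets M"
  proof (intro sets.finite_UN)
    show "finite {S. S \<subseteq> {1..<n} \<and> (SOME j. j \<in> S) = r}"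
      by (rule finite_subset[of _ "Pow {1..<n}"]) auto
    fix S assume "S \<in> {S. S \<subseteq> {1..<n} \<and> (SOME j. j \<in> S) = r}"
    then have "{\<omega> \<in> space M. A \<omega> = S} = {\<omega> \<in> space M. \<forall>j\<in>{1..<n}.
        (\<forall>i\<in>{1..<n}. eig (D \<omega>) i - eig (D \<omega>) (i + 1) \<le> eig (D \<omega>) j - eig (D \<omega>) (j + 1)) \<longleftrightarrow> j \<in> S}"
      unfolding A_def by auto
    also have "\<dots> \<in> sets M" using g by measurable
    finally show "{\<omega> \<in> space M. A \<omega> = S} \<in> sets M" .
  qed
  finally show ?thesis .
qed

text \<open>\<open>lam_vrest\<close> bounds the form of R = S - P P' S P P' only from above, but
  perturbation needs both sides. Split x = z + p with p = P P' x. Then x' R x = z' S z + 2 z' S p,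
  and the reflected vector z - p, of the same norm, gives z' S z - 2 z' S p. As z' S z >= 0, minus
  the first value is at most the second, so the upper bound at the reflected vector is a lower bound
  at x.\<close>

lemma rest_quad_form_abs:
  fixes P S :: "real mat"
  assumes P: "P \<in> carrier_mat n r" "P\<^sup>T * P = 1\<^sub>m r" and n: "0 < n"
    and S: "S \<in> carrier_mat n n" "S\<^sup>T = S"
    and psd: "\<And>v. v \<in> carrier_vec n \<Longrightarrow> 0 \<le> v \<bullet> (S *\<^sub>v v)" and x: "x \<in> carrier_vec n"
  shows "\<bar>x \<bullet> (S *\<^sub>v x) - (P\<^sup>T *\<^sub>v x) \<bullet> ((P\<^sup>T * S * P) *\<^sub>v (P\<^sup>T *\<^sub>v x))\<bar> \<le> lam_vrest P S * (x \<bullet> x)"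
proof -
  note cs = mult_carrier_mat[of P n r "P\<^sup>T" n] mult_carrier_mat[of _ n n _ n] mult_carrier_mat[of _ n n P r] mult_carrier_mat[of _ n r "P\<^sup>T" n]
  define X where "X = P\<^sup>T * S * P"
  have X: "X \<in> carrier_mat r r" unfolding X_def using P S
    by (metis mult_carrier_mat transpose_carrier_mat)
  define Q where "Q = P * X * P\<^sup>T"
  have PTS: "P\<^sup>T * S \<in> carrier_mat r n" using P(1) S by (metis mult_carrier_mat transpose_carrier_mat)
  have PPT: "P * P\<^sup>T \<in> carrier_mat n n" using P(1) by (metis mult_carrier_mat transpose_carrier_mat)
  have Q_alt: "P * P\<^sup>T * S * P * P\<^sup>T = Q"
  proof -
    have "P * P\<^sup>T * S = P * (P\<^sup>T * S)" using P(1) S by (intro assoc_mult_mat[of _ n r _ n _ n]) auto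
    moreover have "P * (P\<^sup>T * S) * P = P * (P\<^sup>T * S * P)" using P(1) PTS by (intro assoc_mult_mat[of _ n r _ n _ r]) auto
    ultimately show ?thesis unfolding Q_def X_def by simp
  qed
  have XT: "X\<^sup>T = X"
  proof -
    have "X\<^sup>T = P\<^sup>T * (P\<^sup>T * S)\<^sup>T" unfolding X_def using P(1) PTS by (subst transpose_mult[of _ r n _ r]) auto
    also have "(P\<^sup>T * S)\<^sup>T = S * P" using P(1) S by (subst transpose_mult[of _ r n _ n]) auto
    also have "P\<^sup>T * (S * P) = X" unfolding X_def using P(1) S by (intro assoc_mult_mat[symmetric, of _ r n _ n _ r]) auto
    finally show ?thesis .
  qed
  have PX: "P * X \<in> carrier_mat n r" using P(1) X by (metis mult_carrier_mat)
  have Q: "Q \<in> carrier_mat n n" unfolding Q_def using PX P(1) by (metis mult_carrier_mat transpose_carrier_mat)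
  have QT: "Q\<^sup>T = Q"
  proof -
    have "Q\<^sup>T = P * (P * X)\<^sup>T" unfolding Q_def using PX P(1) by (subst transpose_mult[of _ n r _ n]) auto
    also have "(P * X)\<^sup>T = X * P\<^sup>T" using P(1) X XT by (subst transpose_mult[of _ n r _ r]) auto
    also have "P * (X * P\<^sup>T) = Q" unfolding Q_def using P(1) X by (intro assoc_mult_mat[symmetric, of _ n r _ r _ n]) auto
    finally show ?thesis .
  qed
  define R where "R = S - Q"
  have R: "R \<in> carrier_mat n n" "R\<^sup>T = R" unfolding R_def using S Q QT by (auto simp: transpose_minus[of _ n n])
  have lam: "lam_vrest P S = lam_max R" unfolding lam_vrest_def R_def Q_alt ..
  have Rform: "w \<bullet> (R *\<^sub>v w) = w \<bullet> (S *\<^sub>v w) - (P\<^sup>T *\<^sub>v w) \<bullet> (X *\<^sub>v (P\<^sup>T *\<^sub>v w))" if w: "w \<in> carrier_vec n" for w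
    unfolding R_def using w S Q quad_form_conj[OF P(1) X w, folded Q_def]
    by (simp add: minus_mult_distrib_mat_vec[of _ n n] scalar_prod_minus_distrib[of _ n])
  have Xform: "y \<bullet> (X *\<^sub>v y) = (P *\<^sub>v y) \<bullet> (S *\<^sub>v (P *\<^sub>v y))" if y: "y \<in> carrier_vec r" for y
    using quad_form_conj[of "P\<^sup>T" r n S y] P(1) S y unfolding X_def by simp
  define y where "y = P\<^sup>T *\<^sub>v x"
  have y: "y \<in> carrier_vec r" unfolding y_def using P x by simp
  define p where "p = P *\<^sub>v y"
  have p: "p \<in> carrier_vec n" unfolding p_def using P y by simp
  define z where "z = x - p"
  have z: "z \<in> carrier_vec n" unfolding z_def using x p by simp
  have PTp: "P\<^sup>T *\<^sub>v p = y" unfolding p_def using P y assoc_mult_mat_vec[of "P\<^sup>T" r n P r y] by simp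
  have PTz: "P\<^sup>T *\<^sub>v z = 0\<^sub>v r"
    unfolding z_def using P x p y PTp y_def by (simp add: mult_minus_distrib_mat_vec[of _ r n])
  define x' where "x' = z - p"
  have x': "x' \<in> carrier_vec n" unfolding x'_def using z p by simp
  have PTx': "P\<^sup>T *\<^sub>v x' = - y"
    unfolding x'_def using P z p y PTp PTz by (simp add: mult_minus_distrib_mat_vec[of _ r n] minus_zero_vec)
  have xzp: "x = z + p" unfolding z_def using x p by auto
  have zp: "z \<bullet> p = 0"
  proof -
    have "z \<bullet> p = (P\<^sup>T *\<^sub>v z) \<bullet> y" unfolding p_def using transpose_vec_mult_scalar[OF P(1) y z] by simp
    then show ?thesis unfolding PTz using y by simp
  qed
  have pz: "p \<bullet> z = 0" using zp comm_scalar_prod[OF p z] by simp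
  have nrm: "x' \<bullet> x' = x \<bullet> x"
    unfolding x'_def xzp using z p zp pz
    by (simp add: minus_scalar_prod_distrib[of _ n] scalar_prod_minus_distrib[of _ n]
        add_scalar_prod_distrib[of _ n] scalar_prod_add_distrib[of _ n])
  have sym: "p \<bullet> (S *\<^sub>v z) = z \<bullet> (S *\<^sub>v p)"
    using transpose_vec_mult_scalar[OF S(1) z p] S p z comm_scalar_prod[of "S *\<^sub>v p" n z] by simp
  have Sx: "x \<bullet> (S *\<^sub>v x) = z \<bullet> (S *\<^sub>v z) + 2 * (z \<bullet> (S *\<^sub>v p)) + p \<bullet> (S *\<^sub>v p)"
    unfolding xzp using z p S sym
    by (simp add: mult_add_distrib_mat_vec[of _ n n] add_scalar_prod_distrib[of _ n] scalar_prod_add_distrib[of _ n])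
  have Sx': "x' \<bullet> (S *\<^sub>v x') = z \<bullet> (S *\<^sub>v z) - 2 * (z \<bullet> (S *\<^sub>v p)) + p \<bullet> (S *\<^sub>v p)"
    unfolding x'_def using z p S sym
    by (simp add: mult_minus_distrib_mat_vec[of _ n n] minus_scalar_prod_distrib[of _ n] scalar_prod_minus_distrib[of _ n])
  have Rx: "x \<bullet> (R *\<^sub>v x) = z \<bullet> (S *\<^sub>v z) + 2 * (z \<bullet> (S *\<^sub>v p))"
    unfolding Rform[OF x] y_def[symmetric] Xform[OF y] p_def[symmetric] Sx by simp
  have "(- y) \<bullet> (X *\<^sub>v (- y)) = y \<bullet> (X *\<^sub>v y)"
  proof -
    have my: "- y = (-1) \<cdot>\<^sub>v y" by (rule eq_vecI) auto
    show ?thesis unfolding my using X y by (simp add: mult_mat_vec[of _ r r])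
  qed
  then have Rx': "x' \<bullet> (R *\<^sub>v x') = z \<bullet> (S *\<^sub>v z) - 2 * (z \<bullet> (S *\<^sub>v p))"
    unfolding Rform[OF x'] PTx' Sx' by (simp add: Xform[OF y] p_def)
  have 1: "x \<bullet> (R *\<^sub>v x) \<le> lam_max R * (x \<bullet> x)" by (rule rayleigh_bounds(1)[OF R n x])
  have 2: "x' \<bullet> (R *\<^sub>v x') \<le> lam_max R * (x \<bullet> x)" using rayleigh_bounds(1)[OF R n x'] nrm by simp
  have 3: "- (x \<bullet> (R *\<^sub>v x)) \<le> lam_max R * (x \<bullet> x)" using 2 psd[OF z] unfolding Rx Rx' by linarith
  show "\<bar>x \<bullet> (S *\<^sub>v x) - (P\<^sup>T *\<^sub>v x) \<bullet> ((P\<^sup>T * S * P) *\<^sub>v (P\<^sup>T *\<^sub>v x))\<bar> \<le> lam_vrest P S * (x \<bullet> x)"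
    using 1 3 unfolding lam Rform[OF x] X_def by linarith
qed


text \<open>With \<epsilon> = \<delta> + \<open>lam_vrest P S\<close> and \<mu> =
  \<open>lam_min \<Lambda> + lam_vP P S\<close>, a lower bound for the eigenvalues of X = \<Lambda>
  + P' S P, the r-th gap of D is at least \<mu> - 2 \<epsilon>, while an earlier gap exceeds that of
  X by at most 2 \<epsilon>. These two losses explain the factor 4 in the gap condition; strictness
  comes from the strict bound on \<epsilon>.\<close>

lemma dim_estimate_correct:
  fixes P \<Lambda> S D :: "real mat"
  assumes P: "basis_matrix n r P" and r: "1 \<le> r"
    and \<Lambda>: "\<Lambda> \<in> carrier_mat r r" "\<Lambda>\<^sup>T = \<Lambda>" and lm: "0 < lam_min \<Lambda>"
    and S: "S \<in> carrier_mat n n" "S\<^sup>T = S"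
    and psd: "\<And>v. v \<in> carrier_vec n \<Longrightarrow> 0 \<le> v \<bullet> (S *\<^sub>v v)"
    and D: "D \<in> carrier_mat n n" "D\<^sup>T = D" and Dpsd: "\<And>v. v \<in> carrier_vec n \<Longrightarrow> 0 \<le> v \<bullet> (D *\<^sub>v v)"
    and dev: "\<And>x. x \<in> carrier_vec n \<Longrightarrow> \<bar>x \<bullet> (D *\<^sub>v x)
      - ((P\<^sup>T *\<^sub>v x) \<bullet> (\<Lambda> *\<^sub>v (P\<^sup>T *\<^sub>v x)) + x \<bullet> (S *\<^sub>v x))\<bar> \<le> \<delta> * (x \<bullet> x)"
    and \<delta>: "\<delta> + lam_vrest P S < d * lam_min \<Lambda>"
    and gap: "max_gap r (\<Lambda> + P\<^sup>T * S * P) \<le> (1 - 4 * d) * lam_min \<Lambda> + lam_vP P S"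
  shows "dim_estimate n D = r"
proof -
  have rn: "r < n" and Pc: "P \<in> carrier_mat n r" "P\<^sup>T * P = 1\<^sub>m r" using P unfolding basis_matrix_def by auto
  have n: "0 < n" and r0: "0 < r" using rn r by auto
  define Y where "Y = P\<^sup>T * S * P"
  have PTS: "P\<^sup>T * S \<in> carrier_mat r n" using Pc(1) S by (metis mult_carrier_mat transpose_carrier_mat)
  have Y: "Y \<in> carrier_mat r r" unfolding Y_def using Pc(1) PTS by (metis mult_carrier_mat)
  have YT: "Y\<^sup>T = Y"
  proof -
    have "Y\<^sup>T = P\<^sup>T * (P\<^sup>T * S)\<^sup>T" unfolding Y_def using Pc(1) PTS by (subst transpose_mult[of _ r n _ r]) auto
    also have "(P\<^sup>T * S)\<^sup>T = S * P" using Pc(1) S by (subst transpose_mult[of _ r n _ n]) auto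
    also have "P\<^sup>T * (S * P) = Y" unfolding Y_def using Pc(1) S by (intro assoc_mult_mat[symmetric, of _ r n _ n _ r]) auto
    finally show ?thesis .
  qed
  define X where "X = \<Lambda> + Y"
  have X: "X \<in> carrier_mat r r" "X\<^sup>T = X" unfolding X_def using \<Lambda> Y YT by (auto simp: transpose_add[of _ r r])
  define \<epsilon> where "\<epsilon> = \<delta> + lam_vrest P S"
  define \<mu> where "\<mu> = lam_min \<Lambda> + lam_vP P S"
  have Xform: "y \<bullet> (X *\<^sub>v y) = y \<bullet> (\<Lambda> *\<^sub>v y) + y \<bullet> (Y *\<^sub>v y)" if "y \<in> carrier_vec r" for y
    unfolding X_def using that \<Lambda> Y by (simp add: add_mult_distrib_mat_vec[of _ r r] scalar_prod_add_distrib[of _ r])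
  have close: "\<bar>x \<bullet> (D *\<^sub>v x) - (P\<^sup>T *\<^sub>v x) \<bullet> (X *\<^sub>v (P\<^sup>T *\<^sub>v x))\<bar> \<le> \<epsilon> * (x \<bullet> x)" if x: "x \<in> carrier_vec n" for x
  proof -
    have y: "P\<^sup>T *\<^sub>v x \<in> carrier_vec r" using Pc x by simp
    show ?thesis unfolding Xform[OF y] \<epsilon>_def distrib_right
      using dev[OF x] rest_quad_form_abs[OF Pc n S psd x] unfolding Y_def by linarith
  qed
  have \<epsilon>0: "0 \<le> \<epsilon>"
  proof -
    have "\<bar>unit_vec n 0 \<bullet> (D *\<^sub>v unit_vec n 0) - (P\<^sup>T *\<^sub>v unit_vec n 0) \<bullet> (X *\<^sub>v (P\<^sup>T *\<^sub>v unit_vec n 0))\<bar> \<le> \<epsilon> * (unit_vec n 0 \<bullet> unit_vec n 0)"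
      by (rule close) simp
    then have "0 \<le> \<epsilon> * (unit_vec n 0 \<bullet> unit_vec n 0 :: real)" by (rule order_trans[OF abs_ge_zero])
    then show ?thesis using n by simp
  qed
  have Yge: "lam_vP P S * (y \<bullet> y) \<le> y \<bullet> (Y *\<^sub>v y)" if "y \<in> carrier_vec r" for y
    unfolding lam_vP_def Y_def[symmetric] by (rule rayleigh_bounds(2)[OF Y YT r0 that])
  have vP0: "0 \<le> lam_vP P S"
  proof -
    obtain y where y: "y \<in> carrier_vec r" "y \<bullet> y = 1" "y \<bullet> (Y *\<^sub>v y) = eig Y r"
      using eig_vector[OF Y YT r order_refl] by auto
    have "y \<bullet> (Y *\<^sub>v y) = (P *\<^sub>v y) \<bullet> (S *\<^sub>v (P *\<^sub>v y))"
      using quad_form_conj[of "P\<^sup>T" r n S y] Pc(1) S y unfolding Y_def by simp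
    then have "0 \<le> eig Y r" using psd[of "P *\<^sub>v y"] Pc y by simp
    then show ?thesis unfolding lam_vP_def Y_def[symmetric] lam_max_eig(2)[OF Y YT r0] .
  qed
  have \<mu>0: "0 < \<mu>" unfolding \<mu>_def using lm vP0 by simp
  have eigX: "\<mu> \<le> eig X j" if j: "1 \<le> j" "j \<le> r" for j
  proof -
    obtain y where y: "y \<in> carrier_vec r" "y \<bullet> y = 1" "y \<bullet> (X *\<^sub>v y) = eig X j"
      using eig_vector[OF X j] by auto
    have "lam_min \<Lambda> * (y \<bullet> y) \<le> y \<bullet> (\<Lambda> *\<^sub>v y)" by (rule rayleigh_bounds(2)[OF \<Lambda> r0 y(1)])
    then show ?thesis using Yge[OF y(1)] y unfolding \<mu>_def Xform[OF y(1)] by simp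
  qed
  have lo: "eig X j - \<epsilon> \<le> eig D j" if j: "1 \<le> j" "j \<le> r" for j
  proof (rule eig_near_low_rank_lower[OF D X Pc _ j])
    fix x :: "real vec" assume "x \<in> carrier_vec n"
    from close[OF this] show "(P\<^sup>T *\<^sub>v x) \<bullet> (X *\<^sub>v (P\<^sup>T *\<^sub>v x)) - \<epsilon> * (x \<bullet> x) \<le> x \<bullet> (D *\<^sub>v x)" by linarith
  qed (use rn in simp)
  have close': "x \<bullet> (D *\<^sub>v x) \<le> (P\<^sup>T *\<^sub>v x) \<bullet> (X *\<^sub>v (P\<^sup>T *\<^sub>v x)) + \<epsilon> * (x \<bullet> x)" if "x \<in> carrier_vec n" for x
    using close[OF that] by linarith
  have hi: "eig D j \<le> eig X j + \<epsilon>" if j: "1 \<le> j" "j \<le> r" for j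
    by (rule eig_near_low_rank_upper[OF D X Pc _ j _ close']) (use rn eigX[OF j] \<mu>0 in auto)
  have tail: "eig D j \<le> \<epsilon>" if j: "r < j" "j \<le> n" for j
    by (rule eig_near_low_rank_tail[OF D X(1) Pc(1) j close'])
  have nonneg: "0 \<le> eig D j" if j: "1 \<le> j" "j \<le> n" for j
  proof -
    obtain z where "z \<in> carrier_vec n" "z \<bullet> (D *\<^sub>v z) = eig D j" using eig_vector[OF D j] by auto
    then show ?thesis using Dpsd[of z] by simp
  qed
  have d: "\<epsilon> < d * lam_min \<Lambda>" using \<delta> unfolding \<epsilon>_def .
  have fin: "finite (insert 0 ((\<lambda>j. eig X j - eig X (j + 1)) ` {1..<r}))" by simp
  have g0: "0 \<le> max_gap r X" unfolding max_gap_def by (rule Max_ge[OF fin]) simp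
  have gj: "eig X j - eig X (j + 1) \<le> max_gap r X" if "j \<in> {1..<r}" for j
    unfolding max_gap_def using that by (intro Max_ge[OF fin]) auto
  have gap': "max_gap r X \<le> \<mu> - 4 * (d * lam_min \<Lambda>)"
    using gap unfolding X_def Y_def \<mu>_def by (simp add: algebra_simps)
  have top: "\<mu> - 2 * \<epsilon> \<le> eig D r - eig D (r + 1)"
    using lo[of r] eigX[of r] tail[of "r + 1"] r rn by simp
  show ?thesis
  proof (rule dim_estimate_unique)
    show "r \<in> {1..<n}" using r rn by simp
    fix j assume j: "j \<in> {1..<n}" "j \<noteq> r"
    show "eig D j - eig D (j + 1) < eig D r - eig D (r + 1)"
    proof (cases "j < r")
      case True
      have "eig D j - eig D (j + 1) \<le> eig X j - eig X (j + 1) + 2 * \<epsilon>"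
        using hi[of j] lo[of "j + 1"] j True by simp
      then show ?thesis using gj[of j] j True gap' top d by simp
    next
      case False
      \<comment> \<open>Beyond r the eigenvalues of D lie between 0 and \<epsilon>. Since
        \<open>max_gap\<close> is nonnegative, the gap condition yields \<mu> > 4 \<epsilon>, so
        \<mu> - 2 \<epsilon> exceeds \<epsilon>.\<close>
      then have "eig D j - eig D (j + 1) \<le> \<epsilon>" using tail[of j] nonneg[of "j + 1"] j by simp
      then show ?thesis using top g0 gap' d \<epsilon>0 by linarith
    qed
  qed
qed

section \<open>The signal model\<close>

lemma scalar_prod_sum: "y \<in> carrier_vec n \<Longrightarrow> x \<bullet> y = (\<Sum>i<n. x $ i * y $ i)" for x y :: "real vec"
  by (simp add: scalar_prod_def atLeast0LessThan)

lemma scalar_prod_Cauchy_Schwarz: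
  fixes x y :: "real vec"
  assumes "x \<in> carrier_vec n" "y \<in> carrier_vec n"
  shows "(x \<bullet> y)\<^sup>2 \<le> (x \<bullet> x) * (y \<bullet> y)"
  using Cauchy_Schwarz_ineq_sum[of "\<lambda>i. x $ i" "\<lambda>i. y $ i" "{..<n}"] assms
  by (simp add: scalar_prod_self_sum scalar_prod_sum)

lemma vec_norm2_square: "(vec_norm2 x)\<^sup>2 = x \<bullet> x"
  unfolding vec_norm2_def using scalar_prod_self_nonneg[of x] by simp

lemma vec_norm2_nonneg [simp]: "0 \<le> vec_norm2 x"
  unfolding vec_norm2_def using scalar_prod_self_nonneg[of x] by simp

lemma scalar_prod_le_norms:
  assumes "x \<in> carrier_vec n" "y \<in> carrier_vec n"
  shows "\<bar>x \<bullet> y\<bar> \<le> vec_norm2 x * vec_norm2 y"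
  using scalar_prod_Cauchy_Schwarz[OF assms]
  by (intro abs_le_square_iff[THEN iffD2, of _ "vec_norm2 x * vec_norm2 y", simplified abs_of_nonneg[OF mult_nonneg_nonneg[OF vec_norm2_nonneg vec_norm2_nonneg]]])
    (simp add: power_mult_distrib vec_norm2_square)

text \<open>\<open>mat_norm2\<close> is a supremum of reals, from which nothing follows before the
  set is known to be bounded; the Frobenius norm is a bound.\<close>

lemma mat_norm2_bdd:
  assumes A: "A \<in> carrier_mat k l"
  shows "bdd_above ((\<lambda>x. vec_norm2 (A *\<^sub>v x)) ` {x \<in> carrier_vec (dim_col A). vec_norm2 x \<le> 1})"
proof (rule bdd_aboveI2)
  fix x assume "x \<in> {x \<in> carrier_vec (dim_col A). vec_norm2 x \<le> 1}"
  then have x: "x \<in> carrier_vec l" "x \<bullet> x \<le> 1" using A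
    by (auto simp: vec_norm2_square[symmetric] intro: power_le_one)
  have "(A *\<^sub>v x) \<bullet> (A *\<^sub>v x) = (\<Sum>i<k. (row A i \<bullet> x)\<^sup>2)"
    using A x by (subst scalar_prod_self_sum[of _ k]) auto
  also have "\<dots> \<le> (\<Sum>i<k. (row A i \<bullet> row A i) * 1)"
  proof (rule sum_mono)
    fix i assume "i \<in> {..<k}"
    then have "(row A i \<bullet> x)\<^sup>2 \<le> (row A i \<bullet> row A i) * (x \<bullet> x)"
      using A x by (intro scalar_prod_Cauchy_Schwarz[of _ l]) auto
    also have "\<dots> \<le> (row A i \<bullet> row A i) * 1" using x by (intro mult_left_mono scalar_prod_self_nonneg)
    finally show "(row A i \<bullet> x)\<^sup>2 \<le> (row A i \<bullet> row A i) * 1" .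
  qed
  finally show "vec_norm2 (A *\<^sub>v x) \<le> sqrt (\<Sum>i<k. (row A i \<bullet> row A i) * 1)"
    unfolding vec_norm2_def by (rule real_sqrt_le_mono)
qed

lemma mat_norm2_nonneg:
  assumes A: "A \<in> carrier_mat k l"
  shows "0 \<le> mat_norm2 A"
proof -
  have "vec_norm2 (A *\<^sub>v 0\<^sub>v l) \<le> mat_norm2 A" unfolding mat_norm2_def
    using A by (intro cSUP_upper mat_norm2_bdd[OF A]) (auto simp: vec_norm2_def)
  then show ?thesis using vec_norm2_nonneg order_trans by blast
qed

lemma mat_norm2_bound:
  assumes A: "A \<in> carrier_mat k l" and x: "x \<in> carrier_vec l"
  shows "vec_norm2 (A *\<^sub>v x) \<le> mat_norm2 A * vec_norm2 x"
proof (cases "vec_norm2 x = 0")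
  case True
  then have "x \<bullet> x = 0" using vec_norm2_square[of x] by simp
  then have "x = 0\<^sub>v l" using scalar_prod_self_pos[OF x] by auto
  then have "A *\<^sub>v x = 0\<^sub>v k" using A by (intro eq_vecI) auto
  then show ?thesis by (simp add: True) (simp add: vec_norm2_def)
next
  case False
  define c where "c = vec_norm2 x"
  have c: "0 < c" unfolding c_def using False by (simp add: less_le)
  have nrm: "vec_norm2 ((1 / c) \<cdot>\<^sub>v y) = vec_norm2 y / c" for y
    unfolding vec_norm2_def using c by (simp add: real_sqrt_divide real_sqrt_mult power2_eq_square[symmetric])
  have "vec_norm2 (A *\<^sub>v ((1 / c) \<cdot>\<^sub>v x)) \<le> mat_norm2 A" unfolding mat_norm2_def
    using A x c by (intro cSUP_upper mat_norm2_bdd[OF A]) (auto simp: nrm c_def[symmetric])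
  then show ?thesis using c unfolding mult_mat_vec[OF A x] nrm c_def[symmetric] by (simp add: field_simps)
qed

lemma mat_norm2_square_bound:
  assumes A: "A \<in> carrier_mat k l" and x: "x \<in> carrier_vec l" and q: "mat_norm2 A \<le> q"
  shows "(A *\<^sub>v x) \<bullet> (A *\<^sub>v x) \<le> q\<^sup>2 * (x \<bullet> x)"
proof -
  have "vec_norm2 (A *\<^sub>v x) \<le> q * vec_norm2 x"
    using mat_norm2_bound[OF A x] mult_right_mono[OF q vec_norm2_nonneg[of x]] by linarith
  then have "(vec_norm2 (A *\<^sub>v x))\<^sup>2 \<le> (q * vec_norm2 x)\<^sup>2" by (intro power_mono) auto
  then show ?thesis by (simp add: power_mult_distrib vec_norm2_square)
qed

text \<open>With z = A' y, Cauchy-Schwarz gives |z|^2 = y . A z <= |y| |A z|, and |A z| is at most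
  |q| |z|. Operator norm bounds are kept in this squared form for all vectors, so that they pass to
  transposes directly.\<close>

lemma transpose_norm_bound:
  fixes A :: "real mat"
  assumes A: "A \<in> carrier_mat k l" and le: "\<And>x. x \<in> carrier_vec l \<Longrightarrow> (A *\<^sub>v x) \<bullet> (A *\<^sub>v x) \<le> q\<^sup>2 * (x \<bullet> x)"
    and y: "y \<in> carrier_vec k"
  shows "(A\<^sup>T *\<^sub>v y) \<bullet> (A\<^sup>T *\<^sub>v y) \<le> q\<^sup>2 * (y \<bullet> y)"
proof -
  define z where "z = A\<^sup>T *\<^sub>v y"
  have z: "z \<in> carrier_vec l" unfolding z_def using A y by simp
  have Az: "A *\<^sub>v z \<in> carrier_vec k" using A z by simp
  have "z \<bullet> z = y \<bullet> (A *\<^sub>v z)"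
    unfolding z_def using transpose_vec_mult_scalar[OF A z[unfolded z_def] y] by simp
  then have "(z \<bullet> z)\<^sup>2 \<le> (y \<bullet> y) * ((A *\<^sub>v z) \<bullet> (A *\<^sub>v z))"
    using scalar_prod_Cauchy_Schwarz[OF y Az] by simp
  also have "\<dots> \<le> (y \<bullet> y) * (q\<^sup>2 * (z \<bullet> z))"
    by (intro mult_left_mono le[OF z] scalar_prod_self_nonneg)
  finally have "(z \<bullet> z) * (z \<bullet> z) \<le> (q\<^sup>2 * (y \<bullet> y)) * (z \<bullet> z)" by (simp add: power2_eq_square mult_ac)
  then show ?thesis using scalar_prod_self_nonneg[of z] scalar_prod_self_nonneg[of y]
    unfolding z_def[symmetric] by (cases "z \<bullet> z = 0") auto
qed

lemma transpose_mult_vec_scalar: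
  fixes A :: "real mat"
  assumes "A \<in> carrier_mat k l" "x \<in> carrier_vec k" "y \<in> carrier_vec l"
  shows "x \<bullet> (A *\<^sub>v y) = (A\<^sup>T *\<^sub>v x) \<bullet> y"
  using transpose_vec_mult_scalar[OF assms(1,3,2)] by simp

lemma integrable_mult_of_squares:
  fixes f g :: "'w \<Rightarrow> real"
  assumes "f \<in> borel_measurable M" "g \<in> borel_measurable M"
    and "integrable M (\<lambda>\<omega>. (f \<omega>)\<^sup>2)" "integrable M (\<lambda>\<omega>. (g \<omega>)\<^sup>2)"
  shows "integrable M (\<lambda>\<omega>. f \<omega> * g \<omega>)"
proof (rule Bochner_Integration.integrable_bound[OF Bochner_Integration.integrable_add[OF assms(3,4)]])
  show "(\<lambda>\<omega>. f \<omega> * g \<omega>) \<in> borel_measurable M" using assms by measurable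
  have "\<bar>x * y\<bar> \<le> x\<^sup>2 + y\<^sup>2" for x y :: real
    using sum_squares_bound[of "\<bar>x\<bar>" "\<bar>y\<bar>"] by (simp add: abs_mult mult.assoc)
      (smt (verit) mult_nonneg_nonneg abs_ge_zero zero_le_power2)
  then show "AE \<omega> in M. norm (f \<omega> * g \<omega>) \<le> norm ((f \<omega>)\<^sup>2 + (g \<omega>)\<^sup>2)" by auto
qed

text \<open>Carrier facts about \<open>a t\<close> and \<open>v t\<close> hold only on the sample
  space, so independence has to be transferred between functions that agree there.\<close>

lemma (in prob_space) indep_vars_cong_space:
  assumes ind: "indep_vars N X I" and eq: "\<And>i \<omega>. i \<in> I \<Longrightarrow> \<omega> \<in> space M \<Longrightarrow> X i \<omega> = Y i \<omega>"
  shows "indep_vars N Y I"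
  unfolding indep_vars_def2
proof
  show "\<forall>i\<in>I. random_variable (N i) (Y i)"
    using ind eq measurable_cong[of M _ _ "N _"] unfolding indep_vars_def2 by (metis (mono_tags, lifting) measurable_cong)
  have "{X i -` A \<inter> space M |A. A \<in> sets (N i)} = {Y i -` A \<inter> space M |A. A \<in> sets (N i)}" if "i \<in> I" for i
  proof -
    have "X i -` A \<inter> space M = Y i -` A \<inter> space M" for A using eq[OF that] by auto
    then show ?thesis by simp
  qed
  then show "indep_sets (\<lambda>i. {Y i -` A \<inter> space M |A. A \<in> sets (N i)}) I"
    using ind unfolding indep_vars_def2 by (simp cong: indep_sets_cong)
qed

locale signal_model = prob_space M for M :: "'w measure" +
  fixes n r \<alpha> :: nat and P :: "real mat" and a v :: "nat \<Rightarrow> 'w \<Rightarrow> real vec" and \<Lambda> S :: "real mat"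
  assumes basic: "basic_model M n r \<alpha> P a v \<Lambda> S"
begin

abbreviation "I \<equiv> {1..\<alpha>}"

lemma dims: "1 \<le> r" "1 \<le> \<alpha>" "r < n" "2 \<le> n" "P \<in> carrier_mat n r" "P\<^sup>T * P = 1\<^sub>m r"
  using basic unfolding basic_model_def basis_matrix_def by auto

lemma a_carrier: "t \<in> I \<Longrightarrow> \<omega> \<in> space M \<Longrightarrow> a t \<omega> \<in> carrier_vec r"
  and v_carrier: "t \<in> I \<Longrightarrow> \<omega> \<in> space M \<Longrightarrow> v t \<omega> \<in> carrier_vec n"
  and a_measurable: "t \<in> I \<Longrightarrow> i < r \<Longrightarrow> (\<lambda>\<omega>. a t \<omega> $ i) \<in> borel_measurable M"
  and v_measurable: "t \<in> I \<Longrightarrow> i < n \<Longrightarrow> (\<lambda>\<omega>. v t \<omega> $ i) \<in> borel_measurable M"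
  using basic unfolding basic_model_def random_vec_def by auto

lemma a_sq: "t \<in> I \<Longrightarrow> i < r \<Longrightarrow> integrable M (\<lambda>\<omega>. (a t \<omega> $ i)\<^sup>2)"
  and v_sq: "t \<in> I \<Longrightarrow> i < n \<Longrightarrow> integrable M (\<lambda>\<omega>. (v t \<omega> $ i)\<^sup>2)"
  using basic unfolding basic_model_def square_integrable_vec_def by auto

lemma Lambda_eq: "t \<in> I \<Longrightarrow> \<Lambda> = cross_moment M r r (a t) (a t)"
  and S_eq: "t \<in> I \<Longrightarrow> S = cross_moment M n n (v t) (v t)"
  and cross_zero: "t \<in> I \<Longrightarrow> cross_moment M n n (signal P a t) (v t) = 0\<^sub>m n n"
  using basic unfolding basic_model_def by auto

lemma one_in_I: "1 \<in> I" using dims by simp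

lemma Lambda_carrier [simp]: "\<Lambda> \<in> carrier_mat r r"
  unfolding Lambda_eq[OF one_in_I] cross_moment_def by simp

lemma S_carrier [simp]: "S \<in> carrier_mat n n"
  unfolding S_eq[OF one_in_I] cross_moment_def by simp

lemma Lambda_index:
  assumes t: "t \<in> I" and ij: "i < r" "j < r"
  shows "\<Lambda> $$ (i,j) = expectation (\<lambda>\<omega>. a t \<omega> $ i * a t \<omega> $ j)"
proof -
  have "\<Lambda> $$ (i,j) = expectation (\<lambda>\<omega>. outer (a t \<omega>) (a t \<omega>) $$ (i,j))"
    by (subst Lambda_eq[OF t]) (use ij in \<open>simp add: cross_moment_def\<close>)
  also have "\<dots> = expectation (\<lambda>\<omega>. a t \<omega> $ i * a t \<omega> $ j)"
    using ij by (intro Bochner_Integration.integral_cong) (auto simp: outer_def carrier_vecD[OF a_carrier[OF t]])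
  finally show ?thesis .
qed

lemma S_index:
  assumes t: "t \<in> I" and ij: "i < n" "j < n"
  shows "S $$ (i,j) = expectation (\<lambda>\<omega>. v t \<omega> $ i * v t \<omega> $ j)"
proof -
  have "S $$ (i,j) = expectation (\<lambda>\<omega>. outer (v t \<omega>) (v t \<omega>) $$ (i,j))"
    by (subst S_eq[OF t]) (use ij in \<open>simp add: cross_moment_def\<close>)
  also have "\<dots> = expectation (\<lambda>\<omega>. v t \<omega> $ i * v t \<omega> $ j)"
    using ij by (intro Bochner_Integration.integral_cong) (auto simp: outer_def carrier_vecD[OF v_carrier[OF t]])
  finally show ?thesis .
qed

lemma cross_index:
  assumes t: "t \<in> I" and ij: "i < n" "j < n"
  shows "expectation (\<lambda>\<omega>. (P *\<^sub>v a t \<omega>) $ i * v t \<omega> $ j) = 0"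
proof -
  have "0 = cross_moment M n n (signal P a t) (v t) $$ (i,j)" unfolding cross_zero[OF t] using ij by simp
  also have "\<dots> = expectation (\<lambda>\<omega>. outer (signal P a t \<omega>) (v t \<omega>) $$ (i,j))"
    using ij by (simp add: cross_moment_def)
  also have "\<dots> = expectation (\<lambda>\<omega>. (P *\<^sub>v a t \<omega>) $ i * v t \<omega> $ j)"
    using ij dims
    by (intro Bochner_Integration.integral_cong) (auto simp: outer_def signal_def carrier_vecD[OF v_carrier[OF t]])
  finally show ?thesis by simp
qed

lemma Lambda_sym: "\<Lambda>\<^sup>T = \<Lambda>"
proof (rule eq_matI)
  fix i j assume "i < dim_row \<Lambda>" "j < dim_col \<Lambda>"
  then have ij: "i < r" "j < r" using Lambda_carrier by auto
  then show "\<Lambda>\<^sup>T $$ (i,j) = \<Lambda> $$ (i,j)"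
    using Lambda_index[OF one_in_I ij] Lambda_index[OF one_in_I ij(2,1)] carrier_matD[OF Lambda_carrier]
    by (simp add: mult.commute)
qed (use carrier_matD[OF Lambda_carrier] in auto)

lemma S_sym: "S\<^sup>T = S"
proof (rule eq_matI)
  fix i j assume "i < dim_row S" "j < dim_col S"
  then have ij: "i < n" "j < n" using S_carrier by auto
  then show "S\<^sup>T $$ (i,j) = S $$ (i,j)"
    using S_index[OF one_in_I ij] S_index[OF one_in_I ij(2,1)] carrier_matD[OF S_carrier]
    by (simp add: mult.commute)
qed (use carrier_matD[OF S_carrier] in auto)

text \<open>The scalar x . y_t and each of its parts has this form, with the coefficient of
  \<open>a t\<close> obtained from x through the transpose of P, of M_t P or of their sum. One set
  of moment and independence facts thus serves all blocks.\<close>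

definition lin_form :: "real vec \<Rightarrow> real vec \<Rightarrow> nat \<Rightarrow> 'w \<Rightarrow> real" where
  "lin_form y x t \<omega> = y \<bullet> a t \<omega> + x \<bullet> v t \<omega>"

lemma la_measurable [measurable]: "t \<in> I \<Longrightarrow> y \<in> carrier_vec r \<Longrightarrow> (\<lambda>\<omega>. y \<bullet> a t \<omega>) \<in> borel_measurable M"
proof -
  assume t: "t \<in> I" and y: "y \<in> carrier_vec r"
  have "(\<lambda>\<omega>. \<Sum>i<r. y $ i * a t \<omega> $ i) \<in> borel_measurable M"
    using a_measurable[OF t] by (intro borel_measurable_sum borel_measurable_times) auto
  then show ?thesis
    by (rule measurable_cong[THEN iffD1, rotated]) (auto simp: scalar_prod_sum[OF a_carrier[OF t]])
qed

lemma lv_measurable [measurable]: "t \<in> I \<Longrightarrow> x \<in> carrier_vec n \<Longrightarrow> (\<lambda>\<omega>. x \<bullet> v t \<omega>) \<in> borel_measurable M"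
proof -
  assume t: "t \<in> I" and x: "x \<in> carrier_vec n"
  have "(\<lambda>\<omega>. \<Sum>i<n. x $ i * v t \<omega> $ i) \<in> borel_measurable M"
    using v_measurable[OF t] by (intro borel_measurable_sum borel_measurable_times) auto
  then show ?thesis
    by (rule measurable_cong[THEN iffD1, rotated]) (auto simp: scalar_prod_sum[OF v_carrier[OF t]])
qed

lemma bilinear_expectation:
  fixes X Y :: "'w \<Rightarrow> real vec"
  assumes X: "\<And>\<omega>. \<omega> \<in> space M \<Longrightarrow> X \<omega> \<in> carrier_vec k" and Y: "\<And>\<omega>. \<omega> \<in> space M \<Longrightarrow> Y \<omega> \<in> carrier_vec l"
    and int: "\<And>i j. i < k \<Longrightarrow> j < l \<Longrightarrow> integrable M (\<lambda>\<omega>. X \<omega> $ i * Y \<omega> $ j)"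
  shows "integrable M (\<lambda>\<omega>. (x \<bullet> X \<omega>) * (y \<bullet> Y \<omega>))"
    "expectation (\<lambda>\<omega>. (x \<bullet> X \<omega>) * (y \<bullet> Y \<omega>))
      = (\<Sum>i<k. \<Sum>j<l. x $ i * y $ j * expectation (\<lambda>\<omega>. X \<omega> $ i * Y \<omega> $ j))"
proof -
  have eq: "(x \<bullet> X \<omega>) * (y \<bullet> Y \<omega>) = (\<Sum>i<k. \<Sum>j<l. x $ i * y $ j * (X \<omega> $ i * Y \<omega> $ j))" if "\<omega> \<in> space M" for \<omega>
    using X[OF that] Y[OF that] by (simp add: scalar_prod_sum sum_product mult_ac)
  have i1: "integrable M (\<lambda>\<omega>. x $ i * y $ j * (X \<omega> $ i * Y \<omega> $ j))" if "i < k" "j < l" for i j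
    by (intro integrable_mult_right int that)
  have i2: "integrable M (\<lambda>\<omega>. \<Sum>j<l. x $ i * y $ j * (X \<omega> $ i * Y \<omega> $ j))" if "i < k" for i
    using i1[OF that] by (intro Bochner_Integration.integrable_sum) auto
  have i3: "integrable M (\<lambda>\<omega>. \<Sum>i<k. \<Sum>j<l. x $ i * y $ j * (X \<omega> $ i * Y \<omega> $ j))"
    by (rule Bochner_Integration.integrable_sum) (use i2 in auto)
  show "integrable M (\<lambda>\<omega>. (x \<bullet> X \<omega>) * (y \<bullet> Y \<omega>))"
    by (rule Bochner_Integration.integrable_cong[OF refl eq, THEN iffD2, OF _ i3])
  have "expectation (\<lambda>\<omega>. (x \<bullet> X \<omega>) * (y \<bullet> Y \<omega>)) = expectation (\<lambda>\<omega>. \<Sum>i<k. \<Sum>j<l. x $ i * y $ j * (X \<omega> $ i * Y \<omega> $ j))"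
    by (rule Bochner_Integration.integral_cong[OF refl eq])
  also have "\<dots> = (\<Sum>i<k. expectation (\<lambda>\<omega>. \<Sum>j<l. x $ i * y $ j * (X \<omega> $ i * Y \<omega> $ j)))"
    using i2 by (intro Bochner_Integration.integral_sum) auto
  also have "\<dots> = (\<Sum>i<k. \<Sum>j<l. expectation (\<lambda>\<omega>. x $ i * y $ j * (X \<omega> $ i * Y \<omega> $ j)))"
    by (intro sum.cong refl Bochner_Integration.integral_sum i1) auto
  finally show "expectation (\<lambda>\<omega>. (x \<bullet> X \<omega>) * (y \<bullet> Y \<omega>))
      = (\<Sum>i<k. \<Sum>j<l. x $ i * y $ j * expectation (\<lambda>\<omega>. X \<omega> $ i * Y \<omega> $ j))" by simp
qed

lemma bilinear_form_sum:
  fixes A :: "real mat"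
  assumes "A \<in> carrier_mat k l" "x \<in> carrier_vec k" "y \<in> carrier_vec l"
  shows "x \<bullet> (A *\<^sub>v y) = (\<Sum>i<k. \<Sum>j<l. x $ i * y $ j * A $$ (i,j))"
  using assms by (simp add: scalar_prod_def atLeast0LessThan sum_distrib_left mult_ac)

lemma aa_moment:
  assumes t: "t \<in> I" and y: "y \<in> carrier_vec r" "y' \<in> carrier_vec r"
  shows "integrable M (\<lambda>\<omega>. (y \<bullet> a t \<omega>) * (y' \<bullet> a t \<omega>))"
    "expectation (\<lambda>\<omega>. (y \<bullet> a t \<omega>) * (y' \<bullet> a t \<omega>)) = y \<bullet> (\<Lambda> *\<^sub>v y')"
proof -
  have i: "integrable M (\<lambda>\<omega>. a t \<omega> $ i * a t \<omega> $ j)" if "i < r" "j < r" for i j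
    by (intro integrable_mult_of_squares a_measurable a_sq t that)
  note b = bilinear_expectation[of "a t" r "a t" r, OF a_carrier[OF t] a_carrier[OF t] i]
  show "integrable M (\<lambda>\<omega>. (y \<bullet> a t \<omega>) * (y' \<bullet> a t \<omega>))" by (rule b(1))
  show "expectation (\<lambda>\<omega>. (y \<bullet> a t \<omega>) * (y' \<bullet> a t \<omega>)) = y \<bullet> (\<Lambda> *\<^sub>v y')"
    unfolding bilinear_form_sum[OF Lambda_carrier y] by (subst b(2)) (auto simp: Lambda_index[OF t] intro!: sum.cong)
qed

lemma vv_moment:
  assumes t: "t \<in> I" and x: "x \<in> carrier_vec n" "x' \<in> carrier_vec n"
  shows "integrable M (\<lambda>\<omega>. (x \<bullet> v t \<omega>) * (x' \<bullet> v t \<omega>))"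
    "expectation (\<lambda>\<omega>. (x \<bullet> v t \<omega>) * (x' \<bullet> v t \<omega>)) = x \<bullet> (S *\<^sub>v x')"
proof -
  have i: "integrable M (\<lambda>\<omega>. v t \<omega> $ i * v t \<omega> $ j)" if "i < n" "j < n" for i j
    by (intro integrable_mult_of_squares v_measurable v_sq t that)
  note b = bilinear_expectation[of "v t" n "v t" n, OF v_carrier[OF t] v_carrier[OF t] i]
  show "integrable M (\<lambda>\<omega>. (x \<bullet> v t \<omega>) * (x' \<bullet> v t \<omega>))" by (rule b(1))
  show "expectation (\<lambda>\<omega>. (x \<bullet> v t \<omega>) * (x' \<bullet> v t \<omega>)) = x \<bullet> (S *\<^sub>v x')"
    unfolding bilinear_form_sum[OF S_carrier x] by (subst b(2)) (auto simp: S_index[OF t] intro!: sum.cong)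
qed

text \<open>\<open>P\<close> is an isometry, so \<open>E[\<ell> v'] = 0\<close> already gives \<open>E[a v'] = 0\<close>.\<close>

lemma av_moment:
  assumes t: "t \<in> I" and y: "y \<in> carrier_vec r" and x: "x \<in> carrier_vec n"
  shows "integrable M (\<lambda>\<omega>. (y \<bullet> a t \<omega>) * (x \<bullet> v t \<omega>))"
    "expectation (\<lambda>\<omega>. (y \<bullet> a t \<omega>) * (x \<bullet> v t \<omega>)) = 0"
proof -
  have Pa: "P *\<^sub>v a t \<omega> \<in> carrier_vec n" if "\<omega> \<in> space M" for \<omega> using dims a_carrier[OF t that] by simp
  have yPa: "y \<bullet> a t \<omega> = (P *\<^sub>v y) \<bullet> (P *\<^sub>v a t \<omega>)" if "\<omega> \<in> space M" for \<omega>
    using isometry_scalar_prod[OF dims(5,6) y a_carrier[OF t that]] by simp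
  have Pi: "(P *\<^sub>v a t \<omega>) $ i = row P i \<bullet> a t \<omega>" if "i < n" for i \<omega> using dims that by simp
  have rc: "row P i \<in> carrier_vec r" if "i < n" for i using dims that by auto
  have i: "integrable M (\<lambda>\<omega>. (P *\<^sub>v a t \<omega>) $ i * v t \<omega> $ j)" if "i < n" "j < n" for i j
    unfolding Pi[OF that(1)] using aa_moment(1)[OF t rc[OF that(1)] rc[OF that(1)]]
    by (intro integrable_mult_of_squares la_measurable v_measurable v_sq t that rc) (simp add: power2_eq_square)
  note b = bilinear_expectation[of "\<lambda>\<omega>. P *\<^sub>v a t \<omega>" n "v t" n "P *\<^sub>v y" x, OF Pa v_carrier[OF t] i]
  show "integrable M (\<lambda>\<omega>. (y \<bullet> a t \<omega>) * (x \<bullet> v t \<omega>))"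
    by (rule Bochner_Integration.integrable_cong[OF refl, THEN iffD2, OF _ b(1)]) (simp_all add: yPa)
  have "expectation (\<lambda>\<omega>. (y \<bullet> a t \<omega>) * (x \<bullet> v t \<omega>)) = expectation (\<lambda>\<omega>. ((P *\<^sub>v y) \<bullet> (P *\<^sub>v a t \<omega>)) * (x \<bullet> v t \<omega>))"
    by (rule Bochner_Integration.integral_cong) (simp_all add: yPa)
  also have "\<dots> = 0" by (subst b(2)) (simp_all add: cross_index[OF t])
  finally show "expectation (\<lambda>\<omega>. (y \<bullet> a t \<omega>) * (x \<bullet> v t \<omega>)) = 0" .
qed

lemma lin_form_measurable [measurable]:
  "t \<in> I \<Longrightarrow> y \<in> carrier_vec r \<Longrightarrow> x \<in> carrier_vec n \<Longrightarrow> lin_form y x t \<in> borel_measurable M"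
  unfolding lin_form_def[abs_def] by (intro borel_measurable_add la_measurable lv_measurable)

lemma lin_form_moment:
  assumes t: "t \<in> I" and y: "y \<in> carrier_vec r" "y' \<in> carrier_vec r" and x: "x \<in> carrier_vec n" "x' \<in> carrier_vec n"
  shows "integrable M (\<lambda>\<omega>. lin_form y x t \<omega> * lin_form y' x' t \<omega>)"
    "expectation (\<lambda>\<omega>. lin_form y x t \<omega> * lin_form y' x' t \<omega>) = y \<bullet> (\<Lambda> *\<^sub>v y') + x \<bullet> (S *\<^sub>v x')"
proof -
  have eq: "lin_form y x t \<omega> * lin_form y' x' t \<omega> = (y \<bullet> a t \<omega>) * (y' \<bullet> a t \<omega>) + (y \<bullet> a t \<omega>) * (x' \<bullet> v t \<omega>)
      + ((y' \<bullet> a t \<omega>) * (x \<bullet> v t \<omega>) + (x \<bullet> v t \<omega>) * (x' \<bullet> v t \<omega>))" for \<omega>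
    unfolding lin_form_def by (simp add: algebra_simps)
  note i = aa_moment(1)[OF t y] av_moment(1)[OF t y(1) x(2)] av_moment(1)[OF t y(2) x(1)] vv_moment(1)[OF t x]
  show "integrable M (\<lambda>\<omega>. lin_form y x t \<omega> * lin_form y' x' t \<omega>)"
    unfolding eq by (intro Bochner_Integration.integrable_add i)
  show "expectation (\<lambda>\<omega>. lin_form y x t \<omega> * lin_form y' x' t \<omega>) = y \<bullet> (\<Lambda> *\<^sub>v y') + x \<bullet> (S *\<^sub>v x')"
    unfolding eq using i aa_moment(2)[OF t y] av_moment(2)[OF t y(1) x(2)] av_moment(2)[OF t y(2) x(1)] vv_moment(2)[OF t x]
    by simp
qed

lemma lin_form_square_moment:
  assumes "t \<in> I" "y \<in> carrier_vec r" "x \<in> carrier_vec n"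
  shows "integrable M (\<lambda>\<omega>. (lin_form y x t \<omega>)\<^sup>2)"
    "expectation (\<lambda>\<omega>. (lin_form y x t \<omega>)\<^sup>2) = y \<bullet> (\<Lambda> *\<^sub>v y) + x \<bullet> (S *\<^sub>v x)"
  using lin_form_moment[OF assms(1,2,2,3,3)] by (simp_all add: power2_eq_square)

lemma Lambda_psd: "y \<in> carrier_vec r \<Longrightarrow> 0 \<le> y \<bullet> (\<Lambda> *\<^sub>v y)"
  using aa_moment(2)[OF one_in_I, of y y] by (metis integral_nonneg_AE AE_I2 zero_le_square)

lemma S_psd: "x \<in> carrier_vec n \<Longrightarrow> 0 \<le> x \<bullet> (S *\<^sub>v x)"
  using vv_moment(2)[OF one_in_I, of x x] by (metis integral_nonneg_AE AE_I2 zero_le_square)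

lemma indep: "indep_vars (\<lambda>_. PiM {..<r} (\<lambda>_. borel) \<Otimes>\<^sub>M PiM {..<n} (\<lambda>_. borel))
    (\<lambda>t \<omega>. (coords r (a t \<omega>), coords n (v t \<omega>))) I"
  using basic unfolding basic_model_def indep_pairs_def by simp

text \<open>The coefficient of \<open>a t\<close> may vary with t, as the matrices M_t do.
  Independence passes through the coordinate tuples, on which the form is a measurable
  function.\<close>

lemma lin_form_indep:
  assumes y: "\<And>t. t \<in> I \<Longrightarrow> y t \<in> carrier_vec r" and x: "x \<in> carrier_vec n"
  shows "indep_vars (\<lambda>_. borel) (\<lambda>t. lin_form (y t) x t) I"
proof -
  let ?N = "PiM {..<r} (\<lambda>_. borel) \<Otimes>\<^sub>M PiM {..<n} (\<lambda>_. borel :: real measure)"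
  define F where "F t p = (\<Sum>i<r. y t $ i * fst p i) + (\<Sum>i<n. x $ i * snd p i)" for t and p :: "(nat \<Rightarrow> real) \<times> (nat \<Rightarrow> real)"
  have f: "(\<lambda>p. fst p i) \<in> borel_measurable ?N" if "i < r" for i
    by (rule measurable_compose[OF measurable_fst measurable_component_singleton]) (use that in simp)
  have g: "(\<lambda>p. snd p i) \<in> borel_measurable ?N" if "i < n" for i
    by (rule measurable_compose[OF measurable_snd measurable_component_singleton]) (use that in simp)
  have "indep_vars (\<lambda>_. borel) (\<lambda>t \<omega>. F t (coords r (a t \<omega>), coords n (v t \<omega>))) I"
    by (rule indep_vars_compose2[OF indep])
      (auto simp: F_def[abs_def] intro!: borel_measurable_add borel_measurable_sum borel_measurable_times f g)
  then show ?thesis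
  proof (rule indep_vars_cong_space)
    show "F t (coords r (a t \<omega>), coords n (v t \<omega>)) = lin_form (y t) x t \<omega>" if "t \<in> I" "\<omega> \<in> space M" for t \<omega>
      unfolding F_def lin_form_def coords_def using a_carrier[OF that] v_carrier[OF that] by (simp add: scalar_prod_sum)
  qed
qed

text \<open>The moment method needs surely bounded vectors, so a vector of norm above \<open>\<surd>B\<close>, which has
  probability zero, is replaced by \<open>0\<close>.\<close>

lemma covariance_deviation_pos:
  assumes A: "\<And>t. t \<in> I \<Longrightarrow> A t \<in> carrier_mat n r"
    and bnd: "\<And>t. t \<in> I \<Longrightarrow> AE \<omega> in M. (A t *\<^sub>v a t \<omega> + c \<cdot>\<^sub>v v t \<omega>) \<bullet> (A t *\<^sub>v a t \<omega> + c \<cdot>\<^sub>v v t \<omega>) \<le> B"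
    and sec: "\<And>t x. t \<in> I \<Longrightarrow> x \<in> carrier_vec n \<Longrightarrow>
      ((A t)\<^sup>T *\<^sub>v x) \<bullet> (\<Lambda> *\<^sub>v ((A t)\<^sup>T *\<^sub>v x)) + c\<^sup>2 * (x \<bullet> (S *\<^sub>v x)) \<le> L * (x \<bullet> x)"
    and L: "0 < L" "L \<le> B"
  obtains E where "E \<in> events" "prob E \<le> 1 / real n ^ 10"
    "\<And>\<omega> x. \<omega> \<in> space M - E \<Longrightarrow> x \<in> carrier_vec n \<Longrightarrow>
      \<bar>\<Sum>t\<in>I. (lin_form ((A t)\<^sup>T *\<^sub>v x) (c \<cdot>\<^sub>v x) t \<omega>)\<^sup>2
        - (((A t)\<^sup>T *\<^sub>v x) \<bullet> (\<Lambda> *\<^sub>v ((A t)\<^sup>T *\<^sub>v x)) + c\<^sup>2 * (x \<bullet> (S *\<^sub>v x)))\<bar>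
      \<le> real \<alpha> * (12 * exp 6 * (B * (ln (real n) / real \<alpha>) + sqrt (B * L * (ln (real n) / real \<alpha>)))) * (x \<bullet> x)"
proof -
  let ?N = "PiM {..<r} (\<lambda>_. borel) \<Otimes>\<^sub>M PiM {..<n} (\<lambda>_. borel :: real measure)"
  define \<zeta> where "\<zeta> t p k = (\<Sum>j<r. A t $$ (k,j) * fst p j) + c * snd p k" for t and p :: "(nat \<Rightarrow> real) \<times> (nat \<Rightarrow> real)" and k
  define \<phi> where "\<phi> t p = (\<lambda>i\<in>{..<n}. if (\<Sum>k<n. (\<zeta> t p k)\<^sup>2) \<le> B then \<zeta> t p i else 0)" for t p
  define X where "X t \<omega> = \<phi> t (coords r (a t \<omega>), coords n (v t \<omega>))" for t \<omega>
  define Z where "Z t \<omega> = A t *\<^sub>v a t \<omega> + c \<cdot>\<^sub>v v t \<omega>" for t \<omega>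
  have f: "(\<lambda>p. fst p i) \<in> borel_measurable ?N" if "i < r" for i
    by (rule measurable_compose[OF measurable_fst measurable_component_singleton]) (use that in simp)
  have g: "(\<lambda>p. snd p i) \<in> borel_measurable ?N" if "i < n" for i
    by (rule measurable_compose[OF measurable_snd measurable_component_singleton]) (use that in simp)
  have \<zeta>m: "(\<lambda>p. \<zeta> t p k) \<in> borel_measurable ?N" if "k < n" for t k
    unfolding \<zeta>_def using that by (intro borel_measurable_add borel_measurable_sum borel_measurable_times f g) auto
  have \<zeta>s: "(\<lambda>p. \<Sum>k<n. (\<zeta> t p k)\<^sup>2) \<in> borel_measurable ?N" for t
    using \<zeta>m by (intro borel_measurable_sum borel_measurable_power) auto
  have \<phi>m: "\<phi> t \<in> measurable ?N (PiM {..<n} (\<lambda>_. borel))" for t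
    unfolding \<phi>_def
  proof (rule measurable_restrict)
    fix i assume "i \<in> {..<n}"
    then have [measurable]: "(\<lambda>p. \<zeta> t p i) \<in> borel_measurable ?N" using \<zeta>m by simp
    have [measurable]: "(\<lambda>p. \<Sum>k<n. (\<zeta> t p k)\<^sup>2) \<in> borel_measurable ?N" by (rule \<zeta>s)
    show "(\<lambda>p. if (\<Sum>k<n. (\<zeta> t p k)\<^sup>2) \<le> B then \<zeta> t p i else 0) \<in> borel_measurable ?N" by measurable
  qed
  have Zc: "Z t \<omega> \<in> carrier_vec n" if "t \<in> I" "\<omega> \<in> space M" for t \<omega>
    unfolding Z_def using A[OF that(1)] a_carrier[OF that] v_carrier[OF that] by simp
  have \<zeta>Z: "\<zeta> t (coords r (a t \<omega>), coords n (v t \<omega>)) k = Z t \<omega> $ k" if "t \<in> I" "\<omega> \<in> space M" "k < n" for t \<omega> k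
    using A[OF that(1)] a_carrier[OF that(1,2)] v_carrier[OF that(1,2)] that(3)
    by (simp add: \<zeta>_def Z_def coords_def scalar_prod_sum)
  have XZ: "X t \<omega> i = (if Z t \<omega> \<bullet> Z t \<omega> \<le> B then Z t \<omega> $ i else 0)" if "t \<in> I" "\<omega> \<in> space M" "i < n" for t \<omega> i
    using that \<zeta>Z[OF that(1,2)] unfolding X_def \<phi>_def scalar_prod_self_sum[OF Zc[OF that(1,2)]] by simp
  have ZL: "x \<bullet> Z t \<omega> = lin_form ((A t)\<^sup>T *\<^sub>v x) (c \<cdot>\<^sub>v x) t \<omega>" if "t \<in> I" "\<omega> \<in> space M" "x \<in> carrier_vec n" for t \<omega> x
    unfolding Z_def lin_form_def using A[OF that(1)] a_carrier[OF that(1,2)] v_carrier[OF that(1,2)] that(3)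
    by (simp add: scalar_prod_add_distrib[of _ n] transpose_mult_vec_scalar[of _ n r])
  have AE_XZ: "AE \<omega> in M. \<forall>t\<in>I. Z t \<omega> \<bullet> Z t \<omega> \<le> B"
    using bnd unfolding Z_def by (intro AE_finite_allI) auto
  have form: "(\<Sum>i<n. x $ i * X t \<omega> i) = lin_form ((A t)\<^sup>T *\<^sub>v x) (c \<cdot>\<^sub>v x) t \<omega>"
    if "t \<in> I" "\<omega> \<in> space M" "x \<in> carrier_vec n" "Z t \<omega> \<bullet> Z t \<omega> \<le> B" for t \<omega> x
    unfolding ZL[OF that(1,2,3), symmetric] scalar_prod_sum[OF Zc[OF that(1,2)]]
    using that by (intro sum.cong) (auto simp: XZ)
  have Ex: "expectation (\<lambda>\<omega>. (\<Sum>i<n. x $ i * X t \<omega> i)\<^sup>2)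
      = ((A t)\<^sup>T *\<^sub>v x) \<bullet> (\<Lambda> *\<^sub>v ((A t)\<^sup>T *\<^sub>v x)) + c\<^sup>2 * (x \<bullet> (S *\<^sub>v x))" if t: "t \<in> I" and x: "x \<in> carrier_vec n" for t x
  proof -
    have y: "(A t)\<^sup>T *\<^sub>v x \<in> carrier_vec r" and cx: "c \<cdot>\<^sub>v x \<in> carrier_vec n" using A[OF t] x by auto
    have Xm: "(\<lambda>\<omega>. X t \<omega> i) \<in> borel_measurable M" if "i < n" for i
    proof -
      have rv: "(\<lambda>\<omega>. (coords r (a t \<omega>), coords n (v t \<omega>))) \<in> measurable M ?N"
        using indep t unfolding indep_vars_def by auto
      have "X t \<in> measurable M (PiM {..<n} (\<lambda>_. borel))" unfolding X_def
        by (rule measurable_compose[OF rv \<phi>m])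
      from measurable_compose[OF this measurable_component_singleton[of i]] that show ?thesis by simp
    qed
    have "expectation (\<lambda>\<omega>. (\<Sum>i<n. x $ i * X t \<omega> i)\<^sup>2) = expectation (\<lambda>\<omega>. (lin_form ((A t)\<^sup>T *\<^sub>v x) (c \<cdot>\<^sub>v x) t \<omega>)\<^sup>2)"
    proof (rule integral_cong_AE)
      show "(\<lambda>\<omega>. (\<Sum>i<n. x $ i * X t \<omega> i)\<^sup>2) \<in> borel_measurable M"
        using Xm by (intro borel_measurable_power borel_measurable_sum borel_measurable_times) auto
      show "(\<lambda>\<omega>. (lin_form ((A t)\<^sup>T *\<^sub>v x) (c \<cdot>\<^sub>v x) t \<omega>)\<^sup>2) \<in> borel_measurable M"
        by (intro borel_measurable_power lin_form_measurable t y cx)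
      show "AE \<omega> in M. (\<Sum>i<n. x $ i * X t \<omega> i)\<^sup>2 = (lin_form ((A t)\<^sup>T *\<^sub>v x) (c \<cdot>\<^sub>v x) t \<omega>)\<^sup>2"
        using AE_XZ AE_space by eventually_elim (use form[OF t _ x] t in auto)
    qed
    also have "\<dots> = ((A t)\<^sup>T *\<^sub>v x) \<bullet> (\<Lambda> *\<^sub>v ((A t)\<^sup>T *\<^sub>v x)) + (c \<cdot>\<^sub>v x) \<bullet> (S *\<^sub>v (c \<cdot>\<^sub>v x))"
      by (rule lin_form_square_moment(2)[OF t y cx])
    also have "(c \<cdot>\<^sub>v x) \<bullet> (S *\<^sub>v (c \<cdot>\<^sub>v x)) = c\<^sup>2 * (x \<bullet> (S *\<^sub>v x))"
      using x S_carrier mult_mat_vec_carrier[OF S_carrier x] by (simp add: mult_mat_vec[OF S_carrier x] power2_eq_square)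
    finally show ?thesis .
  qed
  interpret Y: bounded_indep_vectors M n I X B L
  proof unfold_locales
    show "indep_vars (\<lambda>_. PiM {..<n} (\<lambda>_. borel)) X I"
      unfolding X_def[abs_def] by (rule indep_vars_compose2[OF indep \<phi>m])
    show "(\<Sum>i<n. (X t \<omega> i)\<^sup>2) \<le> B" for t \<omega>
      unfolding X_def \<phi>_def using L by (cases "(\<Sum>k<n. (\<zeta> t (coords r (a t \<omega>), coords n (v t \<omega>)) k)\<^sup>2) \<le> B") auto
    fix t and u :: "nat \<Rightarrow> real" assume t: "t \<in> I"
    have "expectation (\<lambda>\<omega>. (\<Sum>i<n. u i * X t \<omega> i)\<^sup>2) = expectation (\<lambda>\<omega>. (\<Sum>i<n. vec n u $ i * X t \<omega> i)\<^sup>2)" by simp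
    also have "\<dots> \<le> L * (vec n u \<bullet> vec n u)" unfolding Ex[OF t vec_carrier] by (rule sec[OF t vec_carrier])
    finally show "expectation (\<lambda>\<omega>. (\<Sum>i<n. u i * X t \<omega> i)\<^sup>2) \<le> L * (\<Sum>i<n. (u i)\<^sup>2)"
      by (simp add: scalar_prod_self_sum[of _ n])
  qed (use L in auto)
  \<comment> \<open>With p >= log n and level exp 6 the failure probability is at most n / exp(12
    log n) = n^(-11). Conversely p <= 3 log n because log n >= 1/2, so p costs only a constant
    against log n in the rate.\<close>
  define p where "p = nat \<lceil>ln (real n)\<rceil>"
  have ln: "1 / 2 \<le> ln (real n)"
  proof -
    have "exp (1 / 2 :: real) \<le> 2" using exp_bound_half[of "1 / 2 :: real"] by simp
    then have "exp (1 / 2 :: real) \<le> real n" using dims by simp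
    then show ?thesis by (subst ln_ge_iff) (use dims in auto)
  qed
  have p: "0 < p" "ln (real n) \<le> real p" "real p \<le> 3 * ln (real n)"
    unfolding p_def using ln by (auto, linarith+)
  define K where "K = 16 * (real p)\<^sup>2 * B\<^sup>2 + 32 * real p * real (card I) * B * L"
  obtain E0 where E0: "E0 \<in> events" "prob E0 \<le> real n / exp 6 ^ (2 * p)"
    "\<And>\<omega> x. \<omega> \<in> space M - E0 \<Longrightarrow> x \<in> carrier_vec n \<Longrightarrow>
       \<bar>x \<bullet> (Y.TX I \<omega> *\<^sub>v x)\<bar> \<le> exp 6 * sqrt K * (x \<bullet> x)"
    using Y.deviation_event[OF p(1), of "exp 6"] unfolding K_def by auto
  have pE0: "prob E0 \<le> 1 / real n ^ 10"
  proof -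
    have "exp (12 * ln (real n)) \<le> exp 6 ^ (2 * p)"
      unfolding exp_of_nat_mult[symmetric] using p(2) by simp
    moreover have "exp (12 * ln (real n)) = real n ^ 12"
      using dims exp_of_nat_mult[of 12 "ln (real n)"] by simp
    ultimately have "real n / exp 6 ^ (2 * p) \<le> real n / real n ^ 12"
      using dims by (intro divide_left_mono) auto
    also have "\<dots> = 1 / real n ^ 11" using dims by (simp add: power_eq_if)
    also have "\<dots> \<le> 1 / real n ^ 10" using dims by (intro divide_left_mono power_increasing) auto
    finally show ?thesis using E0(2) by simp
  qed
  obtain N where N: "{\<omega> \<in> space M. \<not> (\<forall>t\<in>I. Z t \<omega> \<bullet> Z t \<omega> \<le> B)} \<subseteq> N" "N \<in> events" "prob N = 0"
  proof -
    obtain N where "{\<omega> \<in> space M. \<not> (\<forall>t\<in>I. Z t \<omega> \<bullet> Z t \<omega> \<le> B)} \<subseteq> N" "emeasure M N = 0" "N \<in> sets M"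
      by (rule AE_E[OF AE_XZ])
    then show thesis by (intro that[of N]) (simp_all add: measure_def)
  qed
  define l where "l = ln (real n) / real \<alpha>"
  have \<alpha>: "0 < real \<alpha>" using dims by simp
  have l: "0 \<le> l" "ln (real n) = real \<alpha> * l" unfolding l_def using \<alpha> ln by auto
  have B: "0 < B" using L by simp
  \<comment> \<open>Subadditivity of the square root separates the two regimes; p <= 3 log n turns 4
    p B into 12 B log n, and 32 p into 96 log n, which is below 12^2 log n.\<close>
  have sK: "sqrt K \<le> 12 * (real \<alpha> * (B * l + sqrt (B * L * l)))"
  proof -
    have "sqrt K \<le> sqrt ((4 * real p * B)\<^sup>2) + sqrt (32 * real p * real \<alpha> * B * L)"
      unfolding K_def using B L by (intro order_trans[OF _ sqrt_add_le_add_sqrt]) (auto simp: power_mult_distrib)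
    also have "sqrt ((4 * real p * B)\<^sup>2) = 4 * real p * B" using B by simp
    also have "4 * real p * B \<le> 12 * (real \<alpha> * (B * l))"
      using p(3) B unfolding l(2) by (simp add: mult_ac)
    also have "sqrt (32 * real p * real \<alpha> * B * L) \<le> sqrt ((12 * real \<alpha>)\<^sup>2 * (B * L * l))"
    proof (rule real_sqrt_le_mono)
      have "32 * real p * real \<alpha> * B * L \<le> 32 * (3 * (real \<alpha> * l)) * real \<alpha> * B * L"
        using p(3) B L \<alpha> unfolding l(2) by (intro mult_right_mono mult_left_mono) auto
      also have "\<dots> \<le> (12 * real \<alpha>)\<^sup>2 * (B * L * l)"
        using B L \<alpha> l by (simp add: power2_eq_square mult_ac)
      finally show "32 * real p * real \<alpha> * B * L \<le> (12 * real \<alpha>)\<^sup>2 * (B * L * l)" .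
    qed
    also have "sqrt ((12 * real \<alpha>)\<^sup>2 * (B * L * l)) = 12 * real \<alpha> * sqrt (B * L * l)"
      using \<alpha> by (simp add: real_sqrt_mult)
    finally show ?thesis by (simp add: algebra_simps)
  qed
  show thesis
  proof (rule that[of "E0 \<union> N"])
    show "E0 \<union> N \<in> events" using E0 N by simp
    show "prob (E0 \<union> N) \<le> 1 / real n ^ 10" using measure_Un_le[OF E0(1) N(2)] N(3) pE0 by simp
    fix \<omega> and x :: "real vec" assume \<omega>: "\<omega> \<in> space M - (E0 \<union> N)" and x: "x \<in> carrier_vec n"
    have "x \<bullet> (Y.TX I \<omega> *\<^sub>v x) = (\<Sum>t\<in>I. (lin_form ((A t)\<^sup>T *\<^sub>v x) (c \<cdot>\<^sub>v x) t \<omega>)\<^sup>2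
        - (((A t)\<^sup>T *\<^sub>v x) \<bullet> (\<Lambda> *\<^sub>v ((A t)\<^sup>T *\<^sub>v x)) + c\<^sup>2 * (x \<bullet> (S *\<^sub>v x))))"
    proof -
      have "Z t \<omega> \<bullet> Z t \<omega> \<le> B" if "t \<in> I" for t using \<omega> N(1) that by blast
      then show ?thesis
        unfolding Y.T_quad_form[OF x] using \<omega> by (intro sum.cong refl) (simp add: Ex[OF _ x] form[OF _ _ x])
    qed
    then have "\<bar>\<Sum>t\<in>I. (lin_form ((A t)\<^sup>T *\<^sub>v x) (c \<cdot>\<^sub>v x) t \<omega>)\<^sup>2
        - (((A t)\<^sup>T *\<^sub>v x) \<bullet> (\<Lambda> *\<^sub>v ((A t)\<^sup>T *\<^sub>v x)) + c\<^sup>2 * (x \<bullet> (S *\<^sub>v x)))\<bar> \<le> exp 6 * sqrt K * (x \<bullet> x)"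
      using E0(3)[of \<omega> x] \<omega> x by auto
    also have "\<dots> \<le> exp 6 * (12 * (real \<alpha> * (B * l + sqrt (B * L * l)))) * (x \<bullet> x)"
      using sK by (intro mult_right_mono mult_left_mono scalar_prod_self_nonneg) auto
    finally show "\<bar>\<Sum>t\<in>I. (lin_form ((A t)\<^sup>T *\<^sub>v x) (c \<cdot>\<^sub>v x) t \<omega>)\<^sup>2
        - (((A t)\<^sup>T *\<^sub>v x) \<bullet> (\<Lambda> *\<^sub>v ((A t)\<^sup>T *\<^sub>v x)) + c\<^sup>2 * (x \<bullet> (S *\<^sub>v x)))\<bar>
      \<le> real \<alpha> * (12 * exp 6 * (B * (ln (real n) / real \<alpha>) + sqrt (B * L * (ln (real n) / real \<alpha>)))) * (x \<bullet> x)"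
      unfolding l_def by (simp only: mult_ac)
  qed
qed

end

text \<open>When \<open>p\<^sub>i > 1\<close> the deviation bounds with their linear term \<open>p\<^sub>i\<^sup>2\<close> are too weak; then the
  Cauchy--Schwarz inequality is used instead. The smallness hypotheses come from the gap condition,
  which forces \<open>\<Delta> \<le> (1 + \<lambda>\<^sub>v\<^sup>+/\<lambda>\<^sup>-) / 4\<close>.\<close>

lemma total_deviation_bound:
  fixes l f V g q \<eta> h p1 p2 m A A0 :: real
  assumes l: "0 < l" and f: "1 \<le> f" and V: "0 \<le> V" and q: "0 \<le> q" "q \<le> 1" and h: "0 \<le> h" and \<eta>: "1 \<le> \<eta>"
    and p: "0 \<le> p1" "p1 \<le> p2" and A: "1 \<le> A" "1 \<le> A0" and g: "0 \<le> g"
    and m: "0 \<le> m" "m\<^sup>2 = l * f * V" "m \<le> l * g" and Vg: "V \<le> l * g" "V \<le> l * g\<^sup>2"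
    and small: "\<eta> * f * h \<le> (1 + V / l) / 4" "q * f * p1 \<le> (1 + V / l) / 4" "g * p2 \<le> (1 + V / l) / 4"
    and E: "0 \<le> Ess" "Ess \<le> l * f" "\<bar>Esw\<bar> \<le> q * (l * f)" "0 \<le> Eww" "Eww \<le> q\<^sup>2 * (l * f)" "0 \<le> Evv" "Evv \<le> V"
    and e0: "\<bar>mss - Ess\<bar> \<le> A0 * \<eta> * (l * f) * h"
    and e1: "\<bar>msw - Esw\<bar> \<le> A * (q * (l * f)) * (p1\<^sup>2 + p1)"
    and e2: "\<bar>mww - Eww\<bar> \<le> A * (q\<^sup>2 * (l * f)) * (p1\<^sup>2 + p1)"
    and e3: "\<bar>muv\<bar> \<le> A * m * (p2\<^sup>2 + p2)"
    and e4: "\<bar>mvv - Evv\<bar> \<le> A * V * (p2\<^sup>2 + p2)"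
    and nn: "0 \<le> mss" "0 \<le> mww" "0 \<le> mvv"
    and cs: "msw\<^sup>2 \<le> mss * mww" "muv\<^sup>2 \<le> (2 * mss + 2 * mww) * mvv"
  shows "\<bar>mss - Ess\<bar> + 2 * \<bar>msw - Esw\<bar> + \<bar>mww - Eww\<bar> + 2 * \<bar>muv\<bar> + \<bar>mvv - Evv\<bar>
    \<le> (14 + 6 * A0 + 16 * A) * l * (\<eta> * f * h + max (q * f * p1) (g * p2))"
proof -
  define mx where "mx = max (q * f * p1) (g * p2)"
  define Q where "Q = q * (l * f)"
  have Q0: "0 \<le> Q" unfolding Q_def using q l f by simp
  have p2: "0 \<le> p2" using p by simp
  have Qp: "Q * p1 \<le> l * mx" unfolding Q_def mx_def using l by (simp add: mult.left_commute mult.assoc max.coboundedI1)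
  have gp: "l * g * p2 \<le> l * mx" unfolding mx_def using l by (simp add: mult.assoc max.coboundedI2)
  have lf0: "0 \<le> l * f" using l f by simp
  have lqQ: "q\<^sup>2 * (l * f) \<le> Q" unfolding Q_def using q lf0 mult_right_mono[of "q * q" "q * 1" "l * f"] mult_left_mono[of q 1 q]
    by (simp add: power2_eq_square)
  have sq_self: "y\<^sup>2 \<le> y" if "0 \<le> y" "y \<le> 1" for y :: real
    using that mult_left_mono[of y 1 y] by (simp add: power2_eq_square)
  have le_sq: "y \<le> y\<^sup>2" "1 \<le> y\<^sup>2" if "1 \<le> y" for y :: real
    using that mult_left_mono[of 1 y y] by (auto simp: power2_eq_square intro: order_trans)
  \<comment> \<open>If V >= l and p2 > 1, then g p2 >= V / l, while the smallness hypothesis gives g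
    p2 <= (1 + V/l)/4 <= V/(2 l). So a large rate is possible only for V < l, and then the
    right-hand sides of all three smallness hypotheses are below 1/2.\<close>
  have big: "V / l < 1" if "1 < p2"
  proof (rule ccontr)
    assume "\<not> V / l < 1"
    then have x: "1 \<le> V / l" by simp
    have "V / l \<le> g * 1" using Vg(1) l by (simp add: field_simps)
    also have "g * 1 \<le> g * p2" using that g by (intro mult_left_mono) auto
    finally have "V / l \<le> g * p2" by simp
    then show False using small(3) x by simp
  qed
  have qp: "q * p1 \<le> 1 / 2" if "V / l < 1"
  proof -
    have "q * p1 * 1 \<le> q * p1 * f" using q p f by (intro mult_left_mono) auto
    then show ?thesis using small(2) that by (simp add: mult_ac)
  qed
  have hb: "A0 * \<eta> * (l * f) * h \<le> A0 * (l * f)" if "V / l < 1"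
  proof -
    have "\<eta> * h * 1 \<le> \<eta> * h * f" using \<eta> h f by (intro mult_left_mono) auto
    then have "\<eta> * h \<le> 1" using small(1) that by (simp add: mult_ac)
    then have "A0 * (l * f) * (\<eta> * h) \<le> A0 * (l * f) * 1" using A lf0 by (intro mult_left_mono) auto
    then show ?thesis by (simp add: mult_ac)
  qed
  have T2: "A * (q\<^sup>2 * (l * f)) * (p1\<^sup>2 + p1) \<le> 2 * A * (Q * p1)"
  proof (cases "p1 \<le> 1")
    case True
    have "A * (q\<^sup>2 * (l * f)) * (p1\<^sup>2 + p1) \<le> A * Q * (p1 + p1)"
      using sq_self[OF p(1) True] lqQ Q0 A p lf0 by (intro mult_mono) auto
    then show ?thesis by (simp add: algebra_simps)
  next
    case False
    then have x: "V / l < 1" using big p by linarith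
    \<comment> \<open>This block carries q twice, so q p1 <= 1/2 lowers the quadratic Bernstein term
      to order q p1.\<close>
    have "q\<^sup>2 * (l * f) * (p1\<^sup>2 + p1) = Q * p1 * (q * p1) + (q\<^sup>2 * (l * f)) * p1"
      unfolding Q_def by (simp add: power2_eq_square algebra_simps)
    also have "\<dots> \<le> Q * p1 * 1 + Q * p1"
      using qp[OF x] Q0 p lqQ by (intro add_mono mult_left_mono mult_right_mono) auto
    finally have "A * (q\<^sup>2 * (l * f) * (p1\<^sup>2 + p1)) \<le> A * (2 * (Q * p1))" using A by (intro mult_left_mono) auto
    then show ?thesis by (simp add: mult_ac)
  qed
  have T1: "\<bar>msw - Esw\<bar> \<le> (2 + A0 + 2 * A) * (Q * p1)"
  proof (cases "p1 \<le> 1")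
    case True
    have "A * Q * (p1\<^sup>2 + p1) \<le> A * Q * (p1 + p1)"
      using sq_self[OF p(1) True] A Q0 by (intro mult_left_mono) auto
    also have "\<dots> = 2 * A * (Q * p1)" by simp
    also have "\<dots> \<le> (2 + A0 + 2 * A) * (Q * p1)" using A Q0 p by (intro mult_right_mono) auto
    finally show ?thesis using e1 unfolding Q_def by simp
  next
    case False
    then have x: "V / l < 1" and p1: "1 \<le> p1" using big p by auto
    \<comment> \<open>The cross block carries only one q, so p1^2 cannot be lowered as in the
      previous bound. The Cauchy-Schwarz estimate by the square root of mss mww is of order Q p1,
      since the square root halves the exponent of p1; the mean, at most Q, is below Q p1 as
      well.\<close>
    have ss: "mss \<le> (1 + A0) * (l * f)" using e0 hb[OF x] E(2) by (simp add: distrib_right)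
    have ww: "mww \<le> (1 + 2 * A) * (q\<^sup>2 * (l * f) * p1\<^sup>2)"
    proof -
      have qq: "0 \<le> q\<^sup>2 * (l * f)" using lf0 by simp
      have "mww \<le> q\<^sup>2 * (l * f) * 1 + A * (q\<^sup>2 * (l * f)) * (p1\<^sup>2 + p1)" using e2 E(5) by simp
      also have "\<dots> \<le> q\<^sup>2 * (l * f) * p1\<^sup>2 + A * (q\<^sup>2 * (l * f)) * (p1\<^sup>2 + p1\<^sup>2)"
        using le_sq[OF p1] qq A by (intro add_mono mult_left_mono) auto
      finally show ?thesis by (simp add: algebra_simps)
    qed
    have "msw\<^sup>2 \<le> ((1 + A0) * (l * f)) * ((1 + 2 * A) * (q\<^sup>2 * (l * f) * p1\<^sup>2))"
      using cs(1) mult_mono[OF ss ww] nn A lf0 by simp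
    also have "\<dots> = ((1 + A0) * (1 + 2 * A)) * (Q * p1)\<^sup>2" unfolding Q_def by (simp add: power2_eq_square algebra_simps)
    also have "\<dots> \<le> (1 + A0 + 2 * A)\<^sup>2 * (Q * p1)\<^sup>2"
    proof (rule mult_right_mono)
      show "(1 + A0) * (1 + 2 * A) \<le> (1 + A0 + 2 * A)\<^sup>2"
        using A by (auto simp: power2_eq_square algebra_simps)
    qed simp
    finally have "msw\<^sup>2 \<le> ((1 + A0 + 2 * A) * (Q * p1))\<^sup>2" by (simp add: power_mult_distrib)
    then have "\<bar>msw\<bar> \<le> (1 + A0 + 2 * A) * (Q * p1)"
      using A Q0 p by (simp add: abs_le_square_iff[symmetric])
    moreover have "\<bar>Esw\<bar> \<le> Q * p1" using E(3) mult_left_mono[OF p1 Q0] unfolding Q_def by simp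
    ultimately show ?thesis by (simp add: algebra_simps)
  qed
  have T3: "\<bar>muv\<bar> \<le> (5 + 2 * A0 + 4 * A) * (m * p2)"
  proof (cases "p2 \<le> 1")
    case True
    have "A * m * (p2\<^sup>2 + p2) \<le> A * m * (p2 + p2)"
      using sq_self[OF p2 True] A m by (intro mult_left_mono) auto
    also have "\<dots> = 2 * A * (m * p2)" by simp
    also have "\<dots> \<le> (5 + 2 * A0 + 4 * A) * (m * p2)" using A m p2 by (intro mult_right_mono) auto
    finally show ?thesis using e3 by simp
  next
    case False
    then have x: "V / l < 1" and p21: "1 \<le> p2" using big by auto
    \<comment> \<open>The same device for the block of ell + w with v: the first Cauchy-Schwarz
      factor is of order l f, the second of order V p2^2, and m^2 = l f V.\<close>
    have ss: "mss \<le> (1 + A0) * (l * f)" using e0 hb[OF x] E(2) by (simp add: distrib_right)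
    have "A * (Q * p1) \<le> A * (l * f / 2)"
      using qp[OF x] A lf0 mult_left_mono[OF qp[OF x] lf0] unfolding Q_def by (intro mult_left_mono) (auto simp: mult_ac)
    then have ww: "mww \<le> (1 + A) * (l * f)"
      using e2 E(5) T2 lqQ mult_right_mono[of "q\<^sup>2" 1 "l * f"] q lf0 power_le_one[of q 2]
      by (simp add: distrib_right)
    have uu: "2 * mss + 2 * mww \<le> (2 * (2 + A0 + A)) * (l * f)" using ss ww by (simp add: algebra_simps)
    have vv: "mvv \<le> (1 + 2 * A) * (V * p2\<^sup>2)"
    proof -
      have "mvv \<le> V * 1 + A * V * (p2\<^sup>2 + p2)" using e4 E(7) by simp
      also have "\<dots> \<le> V * p2\<^sup>2 + A * V * (p2\<^sup>2 + p2\<^sup>2)"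
        using le_sq[OF p21] V A by (intro add_mono mult_left_mono) auto
      finally show ?thesis by (simp add: algebra_simps)
    qed
    have "muv\<^sup>2 \<le> ((2 * (2 + A0 + A)) * (l * f)) * ((1 + 2 * A) * (V * p2\<^sup>2))"
      using cs(2) mult_mono[OF uu vv] nn A lf0 by simp
    also have "\<dots> = ((2 * (2 + A0 + A)) * (1 + 2 * A)) * (m\<^sup>2 * p2\<^sup>2)" unfolding m(2) by (simp add: mult_ac)
    also have "\<dots> \<le> (5 + 2 * A0 + 4 * A)\<^sup>2 * (m\<^sup>2 * p2\<^sup>2)"
    proof (rule mult_right_mono)
      show "(2 * (2 + A0 + A)) * (1 + 2 * A) \<le> (5 + 2 * A0 + 4 * A)\<^sup>2"
        using A by (auto simp: power2_eq_square algebra_simps)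
    qed simp
    finally have "muv\<^sup>2 \<le> ((5 + 2 * A0 + 4 * A) * (m * p2))\<^sup>2" by (simp add: power_mult_distrib)
    then show ?thesis using A m p2 by (simp add: abs_le_square_iff[symmetric])
  qed
  have T4: "A * V * (p2\<^sup>2 + p2) \<le> 2 * A * (l * mx)"
  proof (cases "p2 \<le> 1")
    case True
    have "A * V * (p2\<^sup>2 + p2) \<le> A * (l * g) * (p2 + p2)"
      using sq_self[OF p2 True] Vg V A p2 by (intro mult_mono) auto
    also have "\<dots> = 2 * A * (l * g * p2)" by simp
    also have "\<dots> \<le> 2 * A * (l * mx)" using gp A by (intro mult_left_mono) auto
    finally show ?thesis .
  next
    case False
    then have x: "V / l < 1" using big by auto
    have gp1: "g * p2 \<le> 1" using small(3) x by simp
    \<comment> \<open>Two bounds on V are combined: l g^2 for the quadratic term, where one factor g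
      p2 <= 1 is then removed, and l g for the linear one.\<close>
    have "V * (p2\<^sup>2 + p2) \<le> l * g\<^sup>2 * p2\<^sup>2 + l * g * p2"
      unfolding distrib_left using Vg p2 by (intro add_mono mult_right_mono) auto
    also have "l * g\<^sup>2 * p2\<^sup>2 = l * g * p2 * (g * p2)" by (simp add: power2_eq_square)
    also have "\<dots> \<le> l * g * p2 * 1" using gp1 l g p2 by (intro mult_left_mono) auto
    finally have "V * (p2\<^sup>2 + p2) \<le> 2 * (l * mx)" using gp by (simp add: mult_ac)
    then have "A * (V * (p2\<^sup>2 + p2)) \<le> A * (2 * (l * mx))" using A by (intro mult_left_mono) auto
    then show ?thesis by (simp add: mult_ac)
  qed
  have mp: "m * p2 \<le> l * mx" using mult_right_mono[OF m(3) p2] gp by simp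
  have lmx: "0 \<le> l * mx" using mp m p2 by (meson mult_nonneg_nonneg order_trans)
  have "\<bar>msw - Esw\<bar> \<le> (2 + A0 + 2 * A) * (l * mx)"
    by (rule order_trans[OF T1 mult_left_mono[OF Qp]]) (use A in simp)
  moreover have "\<bar>mww - Eww\<bar> \<le> 2 * A * (l * mx)"
    by (rule order_trans[OF e2 order_trans[OF T2 mult_left_mono[OF Qp]]]) (use A in simp)
  moreover have "\<bar>muv\<bar> \<le> (5 + 2 * A0 + 4 * A) * (l * mx)"
    by (rule order_trans[OF T3 mult_left_mono[OF mp]]) (use A in simp)
  moreover have "\<bar>mvv - Evv\<bar> \<le> 2 * A * (l * mx)" by (rule order_trans[OF e4 T4])
  \<comment> \<open>2 (2 + A0 + 2 A) + 2 A + 2 (5 + 2 A0 + 4 A) + 2 A = 14 + 6 A0 + 16 A; the first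
    block stays apart because its rate is h.\<close>
  ultimately have "\<bar>mss - Ess\<bar> + 2 * \<bar>msw - Esw\<bar> + \<bar>mww - Eww\<bar> + 2 * \<bar>muv\<bar> + \<bar>mvv - Evv\<bar>
      \<le> A0 * \<eta> * (l * f) * h + (14 + 6 * A0 + 16 * A) * (l * mx)"
    using e0 by (simp add: algebra_simps)
  also have "A0 * \<eta> * (l * f) * h \<le> (14 + 6 * A0 + 16 * A) * (l * (\<eta> * f * h))"
  proof -
    have "A0 * (l * (\<eta> * f * h)) \<le> (14 + 6 * A0 + 16 * A) * (l * (\<eta> * f * h))"
      using A l \<eta> f h by (intro mult_right_mono) auto
    then show ?thesis by (simp add: mult_ac)
  qed
  finally show ?thesis unfolding mx_def by (simp add: algebra_simps)
qed

section \<open>Covariance and cross-covariance deviations at a given scale\<close>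

context signal_model
begin

lemma lin_form_family:
  assumes "A \<in> carrier_mat n r" "t \<in> I" "\<omega> \<in> space M" "x \<in> carrier_vec n"
  shows "x \<bullet> (A *\<^sub>v a t \<omega> + c \<cdot>\<^sub>v v t \<omega>) = lin_form (A\<^sup>T *\<^sub>v x) (c \<cdot>\<^sub>v x) t \<omega>"
  unfolding lin_form_def using assms(1,4) a_carrier[OF assms(2,3)] v_carrier[OF assms(2,3)]
  by (simp add: scalar_prod_add_distrib[of _ n] transpose_mult_vec_scalar[of _ n r])

text \<open>The covariance of x . (A a_t + c v_t) and x . (A' a_t + c' v_t), by
  \<open>cov_moment\<close>; the scalars c and c' switch the noise on or off.\<close>

definition cov :: "real mat \<Rightarrow> real \<Rightarrow> real mat \<Rightarrow> real \<Rightarrow> real vec \<Rightarrow> real" where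
  "cov A c A' c' x = (A\<^sup>T *\<^sub>v x) \<bullet> (\<Lambda> *\<^sub>v (A'\<^sup>T *\<^sub>v x)) + c * c' * (x \<bullet> (S *\<^sub>v x))"

lemma cov_moment:
  assumes A: "A \<in> carrier_mat n r" "A' \<in> carrier_mat n r" and t: "t \<in> I" and x: "x \<in> carrier_vec n"
  shows "integrable M (\<lambda>\<omega>. lin_form (A\<^sup>T *\<^sub>v x) (c \<cdot>\<^sub>v x) t \<omega> * lin_form (A'\<^sup>T *\<^sub>v x) (c' \<cdot>\<^sub>v x) t \<omega>)"
    "expectation (\<lambda>\<omega>. lin_form (A\<^sup>T *\<^sub>v x) (c \<cdot>\<^sub>v x) t \<omega> * lin_form (A'\<^sup>T *\<^sub>v x) (c' \<cdot>\<^sub>v x) t \<omega>) = cov A c A' c' x"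
proof -
  have y: "A\<^sup>T *\<^sub>v x \<in> carrier_vec r" "A'\<^sup>T *\<^sub>v x \<in> carrier_vec r" "c \<cdot>\<^sub>v x \<in> carrier_vec n" "c' \<cdot>\<^sub>v x \<in> carrier_vec n"
    using A x by auto
  have "(c \<cdot>\<^sub>v x) \<bullet> (S *\<^sub>v (c' \<cdot>\<^sub>v x)) = c * c' * (x \<bullet> (S *\<^sub>v x))"
    using x S_carrier mult_mat_vec_carrier[OF S_carrier x] by (simp add: mult_mat_vec[OF S_carrier x])
  then show "expectation (\<lambda>\<omega>. lin_form (A\<^sup>T *\<^sub>v x) (c \<cdot>\<^sub>v x) t \<omega> * lin_form (A'\<^sup>T *\<^sub>v x) (c' \<cdot>\<^sub>v x) t \<omega>) = cov A c A' c' x"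
    unfolding lin_form_moment(2)[OF t y] cov_def by simp
  show "integrable M (\<lambda>\<omega>. lin_form (A\<^sup>T *\<^sub>v x) (c \<cdot>\<^sub>v x) t \<omega> * lin_form (A'\<^sup>T *\<^sub>v x) (c' \<cdot>\<^sub>v x) t \<omega>)"
    by (rule lin_form_moment(1)[OF t y])
qed

lemma cov_self_nonneg: "A \<in> carrier_mat n r \<Longrightarrow> x \<in> carrier_vec n \<Longrightarrow> 0 \<le> cov A c A c x"
  unfolding cov_def using Lambda_psd[of "A\<^sup>T *\<^sub>v x"] S_psd[of x] by simp

text \<open>The moment method needs a positive second-moment bound. At scale 0, which occurs for q =
  0 or vanishing noise covariance, the vectors are almost surely 0 instead, and so is the
  deviation.\<close>

lemma null_family:
  assumes A: "\<And>t. t \<in> I \<Longrightarrow> A t \<in> carrier_mat n r"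
    and bnd: "\<And>t. t \<in> I \<Longrightarrow> AE \<omega> in M. (A t *\<^sub>v a t \<omega> + c \<cdot>\<^sub>v v t \<omega>) \<bullet> (A t *\<^sub>v a t \<omega> + c \<cdot>\<^sub>v v t \<omega>) \<le> 0"
  obtains N where "N \<in> events" "prob N = 0"
    "\<And>\<omega> t x. \<omega> \<in> space M - N \<Longrightarrow> t \<in> I \<Longrightarrow> x \<in> carrier_vec n \<Longrightarrow> lin_form ((A t)\<^sup>T *\<^sub>v x) (c \<cdot>\<^sub>v x) t \<omega> = 0"
proof -
  let ?Z = "\<lambda>t \<omega>. A t *\<^sub>v a t \<omega> + c \<cdot>\<^sub>v v t \<omega>"
  have "AE \<omega> in M. \<forall>t\<in>I. ?Z t \<omega> \<bullet> ?Z t \<omega> \<le> 0" using bnd by (intro AE_finite_allI) auto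
  then obtain N where N: "{\<omega> \<in> space M. \<not> (\<forall>t\<in>I. ?Z t \<omega> \<bullet> ?Z t \<omega> \<le> 0)} \<subseteq> N" "emeasure M N = 0" "N \<in> sets M"
    by (rule AE_E)
  show thesis
  proof (rule that[of N])
    fix \<omega> t and x :: "real vec" assume \<omega>: "\<omega> \<in> space M - N" and t: "t \<in> I" and x: "x \<in> carrier_vec n"
    have Zc: "?Z t \<omega> \<in> carrier_vec n" using A[OF t] a_carrier[OF t] v_carrier[OF t] \<omega> by simp
    have "?Z t \<omega> \<bullet> ?Z t \<omega> \<le> 0" using N(1) \<omega> t by blast
    then have "?Z t \<omega> = 0\<^sub>v n" using scalar_prod_self_pos[OF Zc] by force
    then show "lin_form ((A t)\<^sup>T *\<^sub>v x) (c \<cdot>\<^sub>v x) t \<omega> = 0"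
      using lin_form_family[OF A[OF t] t _ x, of \<omega> c] \<omega> x by simp
  qed (use N in \<open>auto simp: measure_def\<close>)
qed

definition \<kappa>1 :: real where "\<kappa>1 = 12 * exp 6"

definition lr :: real where "lr = ln (real n) / real \<alpha>"

lemma lr_nonneg: "0 \<le> lr"
  unfolding lr_def using dims by simp

text \<open>Normal form: second moment at most \<rho>^2, squared norm at most \<beta> \<rho>^2. The
  bound is homogeneous in \<rho>, so \<rho> = 0 is included and only the ratio \<beta> enters the
  rate.\<close>

lemma covariance_deviation:
  assumes A: "\<And>t. t \<in> I \<Longrightarrow> A t \<in> carrier_mat n r" and \<beta>: "1 \<le> \<beta>" and \<rho>: "0 \<le> \<rho>"
    and bnd: "\<And>t. t \<in> I \<Longrightarrow> AE \<omega> in M. (A t *\<^sub>v a t \<omega> + c \<cdot>\<^sub>v v t \<omega>) \<bullet> (A t *\<^sub>v a t \<omega> + c \<cdot>\<^sub>v v t \<omega>) \<le> \<beta> * \<rho>\<^sup>2"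
    and sec: "\<And>t x. t \<in> I \<Longrightarrow> x \<in> carrier_vec n \<Longrightarrow> cov (A t) c (A t) c x \<le> \<rho>\<^sup>2 * (x \<bullet> x)"
  obtains E where "E \<in> events" "prob E \<le> 1 / real n ^ 10"
    "\<And>\<omega> x. \<omega> \<in> space M - E \<Longrightarrow> x \<in> carrier_vec n \<Longrightarrow>
      \<bar>\<Sum>t\<in>I. (lin_form ((A t)\<^sup>T *\<^sub>v x) (c \<cdot>\<^sub>v x) t \<omega>)\<^sup>2 - cov (A t) c (A t) c x\<bar>
      \<le> real \<alpha> * (\<kappa>1 * \<rho>\<^sup>2 * (\<beta> * lr + sqrt (\<beta> * lr))) * (x \<bullet> x)"
proof (cases "\<rho> = 0")
  case True
  obtain N where N: "N \<in> events" "prob N = 0"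
    "\<And>\<omega> t x. \<omega> \<in> space M - N \<Longrightarrow> t \<in> I \<Longrightarrow> x \<in> carrier_vec n \<Longrightarrow> lin_form ((A t)\<^sup>T *\<^sub>v x) (c \<cdot>\<^sub>v x) t \<omega> = 0"
    using null_family[of A c, OF A] bnd True by auto
  have z: "cov (A t) c (A t) c x = 0" if "t \<in> I" "x \<in> carrier_vec n" for t x
    using sec[OF that] cov_self_nonneg[OF A[OF that(1)] that(2), of c] True by simp
  show thesis by (rule that[of N]) (use N z True in auto)
next
  case False
  then have \<rho>0: "0 < \<rho>\<^sup>2" by simp
  have "\<rho>\<^sup>2 \<le> \<beta> * \<rho>\<^sup>2" using \<beta> mult_right_mono[of 1 \<beta> "\<rho>\<^sup>2"] by simp
  note dev = covariance_deviation_pos[of A c "\<beta> * \<rho>\<^sup>2" "\<rho>\<^sup>2", OF A bnd _ \<rho>0 this]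
  have sec': "((A t)\<^sup>T *\<^sub>v x) \<bullet> (\<Lambda> *\<^sub>v ((A t)\<^sup>T *\<^sub>v x)) + c\<^sup>2 * (x \<bullet> (S *\<^sub>v x)) \<le> \<rho>\<^sup>2 * (x \<bullet> x)"
    if "t \<in> I" "x \<in> carrier_vec n" for t x
    using sec[OF that] unfolding cov_def by (simp add: power2_eq_square)
  obtain E where E: "E \<in> events" "prob E \<le> 1 / real n ^ 10"
    "\<And>\<omega> x. \<omega> \<in> space M - E \<Longrightarrow> x \<in> carrier_vec n \<Longrightarrow>
      \<bar>\<Sum>t\<in>I. (lin_form ((A t)\<^sup>T *\<^sub>v x) (c \<cdot>\<^sub>v x) t \<omega>)\<^sup>2
        - (((A t)\<^sup>T *\<^sub>v x) \<bullet> (\<Lambda> *\<^sub>v ((A t)\<^sup>T *\<^sub>v x)) + c\<^sup>2 * (x \<bullet> (S *\<^sub>v x)))\<bar>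
      \<le> real \<alpha> * (12 * exp 6 * (\<beta> * \<rho>\<^sup>2 * (ln (real n) / real \<alpha>) + sqrt (\<beta> * \<rho>\<^sup>2 * \<rho>\<^sup>2 * (ln (real n) / real \<alpha>)))) * (x \<bullet> x)"
    using dev[OF _ _ sec'] by blast
  have "sqrt (\<beta> * \<rho>\<^sup>2 * \<rho>\<^sup>2 * lr) = \<rho>\<^sup>2 * sqrt (\<beta> * lr)"
  proof -
    have "\<beta> * \<rho>\<^sup>2 * \<rho>\<^sup>2 * lr = (\<rho>\<^sup>2)\<^sup>2 * (\<beta> * lr)" by (simp only: power2_eq_square mult_ac)
    then have "sqrt (\<beta> * \<rho>\<^sup>2 * \<rho>\<^sup>2 * lr) = sqrt ((\<rho>\<^sup>2)\<^sup>2) * sqrt (\<beta> * lr)" by (simp only: real_sqrt_mult)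
    also have "sqrt ((\<rho>\<^sup>2)\<^sup>2) = \<rho>\<^sup>2" by (rule real_sqrt_unique) auto
    finally show ?thesis .
  qed
  then have rhs: "12 * exp 6 * (\<beta> * \<rho>\<^sup>2 * lr + sqrt (\<beta> * \<rho>\<^sup>2 * \<rho>\<^sup>2 * lr)) = \<kappa>1 * \<rho>\<^sup>2 * (\<beta> * lr + sqrt (\<beta> * lr))"
    unfolding \<kappa>1_def by (simp add: algebra_simps)
  show thesis
  proof (rule that[OF E(1,2)])
    fix \<omega> and x :: "real vec" assume "\<omega> \<in> space M - E" "x \<in> carrier_vec n"
    from E(3)[OF this] show "\<bar>\<Sum>t\<in>I. (lin_form ((A t)\<^sup>T *\<^sub>v x) (c \<cdot>\<^sub>v x) t \<omega>)\<^sup>2 - cov (A t) c (A t) c x\<bar>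
      \<le> real \<alpha> * (\<kappa>1 * \<rho>\<^sup>2 * (\<beta> * lr + sqrt (\<beta> * lr))) * (x \<bullet> x)"
      unfolding rhs[unfolded lr_def] by (simp add: cov_def power2_eq_square lr_def)
  qed
qed

text \<open>Before polarization the two vectors are multiplied by each other's scale, giving \<rho>'
  Z and \<rho> Z'. Both then have scale \<rho> \<rho>', their sum and difference have scale at most
  2 \<rho> \<rho>', and dividing by 4 \<rho> \<rho>' leaves the product of the scales. Unscaled
  polarization would give \<rho>^2 + \<rho>'^2 and lose the factor q of the cross block.\<close>

lemma product_deviation:
  assumes A: "\<And>t. t \<in> I \<Longrightarrow> A t \<in> carrier_mat n r" "\<And>t. t \<in> I \<Longrightarrow> A' t \<in> carrier_mat n r"
    and \<beta>: "1 \<le> \<beta>" and \<rho>: "0 \<le> \<rho>" "0 \<le> \<rho>'"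
    and bnd: "\<And>t. t \<in> I \<Longrightarrow> AE \<omega> in M. (A t *\<^sub>v a t \<omega> + c \<cdot>\<^sub>v v t \<omega>) \<bullet> (A t *\<^sub>v a t \<omega> + c \<cdot>\<^sub>v v t \<omega>) \<le> \<beta> * \<rho>\<^sup>2"
      "\<And>t. t \<in> I \<Longrightarrow> AE \<omega> in M. (A' t *\<^sub>v a t \<omega> + c' \<cdot>\<^sub>v v t \<omega>) \<bullet> (A' t *\<^sub>v a t \<omega> + c' \<cdot>\<^sub>v v t \<omega>) \<le> \<beta> * \<rho>'\<^sup>2"
    and sec: "\<And>t x. t \<in> I \<Longrightarrow> x \<in> carrier_vec n \<Longrightarrow> cov (A t) c (A t) c x \<le> \<rho>\<^sup>2 * (x \<bullet> x)"
      "\<And>t x. t \<in> I \<Longrightarrow> x \<in> carrier_vec n \<Longrightarrow> cov (A' t) c' (A' t) c' x \<le> \<rho>'\<^sup>2 * (x \<bullet> x)"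
  obtains E where "E \<in> events" "prob E \<le> 2 / real n ^ 10"
    "\<And>\<omega> x. \<omega> \<in> space M - E \<Longrightarrow> x \<in> carrier_vec n \<Longrightarrow>
      \<bar>\<Sum>t\<in>I. lin_form ((A t)\<^sup>T *\<^sub>v x) (c \<cdot>\<^sub>v x) t \<omega> * lin_form ((A' t)\<^sup>T *\<^sub>v x) (c' \<cdot>\<^sub>v x) t \<omega> - cov (A t) c (A' t) c' x\<bar>
      \<le> real \<alpha> * (2 * \<kappa>1 * (\<rho> * \<rho>') * (\<beta> * lr + sqrt (\<beta> * lr))) * (x \<bullet> x)"
proof (cases "\<rho> = 0 \<or> \<rho>' = 0")
  case True
  obtain N where N: "N \<in> events" "prob N = 0"
    "\<And>\<omega> t x. \<omega> \<in> space M - N \<Longrightarrow> t \<in> I \<Longrightarrow> x \<in> carrier_vec n \<Longrightarrow>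
      lin_form ((A t)\<^sup>T *\<^sub>v x) (c \<cdot>\<^sub>v x) t \<omega> * lin_form ((A' t)\<^sup>T *\<^sub>v x) (c' \<cdot>\<^sub>v x) t \<omega> = 0"
  proof (cases "\<rho> = 0")
    case True
    then have b: "AE \<omega> in M. (A t *\<^sub>v a t \<omega> + c \<cdot>\<^sub>v v t \<omega>) \<bullet> (A t *\<^sub>v a t \<omega> + c \<cdot>\<^sub>v v t \<omega>) \<le> 0" if "t \<in> I" for t
      using bnd(1)[OF that] by simp
    obtain N where "N \<in> events" "prob N = 0"
      "\<And>\<omega> t x. \<omega> \<in> space M - N \<Longrightarrow> t \<in> I \<Longrightarrow> x \<in> carrier_vec n \<Longrightarrow> lin_form ((A t)\<^sup>T *\<^sub>v x) (c \<cdot>\<^sub>v x) t \<omega> = 0"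
      using null_family[of A c, OF A(1)] b by auto
    then show thesis by (intro that[of N]) simp_all
  next
    case False
    then have b: "AE \<omega> in M. (A' t *\<^sub>v a t \<omega> + c' \<cdot>\<^sub>v v t \<omega>) \<bullet> (A' t *\<^sub>v a t \<omega> + c' \<cdot>\<^sub>v v t \<omega>) \<le> 0" if "t \<in> I" for t
      using bnd(2)[OF that] \<open>\<rho> = 0 \<or> \<rho>' = 0\<close> by simp
    obtain N where "N \<in> events" "prob N = 0"
      "\<And>\<omega> t x. \<omega> \<in> space M - N \<Longrightarrow> t \<in> I \<Longrightarrow> x \<in> carrier_vec n \<Longrightarrow> lin_form ((A' t)\<^sup>T *\<^sub>v x) (c' \<cdot>\<^sub>v x) t \<omega> = 0"
      using null_family[of A' c', OF A(2)] b by auto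
    then show thesis by (intro that[of N]) simp_all
  qed
  \<comment> \<open>If one factor vanishes almost surely, the covariance is the mean of a product
    that is almost surely 0.\<close>
  have z: "cov (A t) c (A' t) c' x = 0" if t: "t \<in> I" and x: "x \<in> carrier_vec n" for t x
  proof -
    have "AE \<omega> in M. \<omega> \<notin> N" using N(1,2) by (auto intro!: AE_not_in simp: null_sets_def emeasure_eq_measure)
    then have "AE \<omega> in M. lin_form ((A t)\<^sup>T *\<^sub>v x) (c \<cdot>\<^sub>v x) t \<omega> * lin_form ((A' t)\<^sup>T *\<^sub>v x) (c' \<cdot>\<^sub>v x) t \<omega> = 0"
      using AE_space by eventually_elim (use N(3)[OF _ t x] in auto)
    then have "expectation (\<lambda>\<omega>. lin_form ((A t)\<^sup>T *\<^sub>v x) (c \<cdot>\<^sub>v x) t \<omega> * lin_form ((A' t)\<^sup>T *\<^sub>v x) (c' \<cdot>\<^sub>v x) t \<omega>) = 0"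
      by (rule integral_eq_zero_AE)
    then show ?thesis unfolding cov_moment(2)[OF A(1)[OF t] A(2)[OF t] t x] .
  qed
  show thesis
  proof (rule that[OF N(1)])
    show "prob N \<le> 2 / real n ^ 10" using N(2) by simp
    fix \<omega> and x :: "real vec" assume \<omega>: "\<omega> \<in> space M - N" and x: "x \<in> carrier_vec n"
    have "(\<Sum>t\<in>I. lin_form ((A t)\<^sup>T *\<^sub>v x) (c \<cdot>\<^sub>v x) t \<omega> * lin_form ((A' t)\<^sup>T *\<^sub>v x) (c' \<cdot>\<^sub>v x) t \<omega> - cov (A t) c (A' t) c' x) = 0"
      using N(3)[OF \<omega> _ x] z[OF _ x] by (intro sum.neutral) simp
    then show "\<bar>\<Sum>t\<in>I. lin_form ((A t)\<^sup>T *\<^sub>v x) (c \<cdot>\<^sub>v x) t \<omega> * lin_form ((A' t)\<^sup>T *\<^sub>v x) (c' \<cdot>\<^sub>v x) t \<omega> - cov (A t) c (A' t) c' x\<bar>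
      \<le> real \<alpha> * (2 * \<kappa>1 * (\<rho> * \<rho>') * (\<beta> * lr + sqrt (\<beta> * lr))) * (x \<bullet> x)" using True by auto
  qed
next
  case False
  then have pos: "0 < \<rho>" "0 < \<rho>'" using \<rho> by auto
  define As where "As s t = mat n r (\<lambda>(i,j). \<rho>' * A t $$ (i,j) + s * \<rho> * A' t $$ (i,j))" for s :: real and t
  define cs where "cs s = \<rho>' * c + s * \<rho> * c'" for s :: real
  let ?f = "\<lambda>t x \<omega>. lin_form ((A t)\<^sup>T *\<^sub>v x) (c \<cdot>\<^sub>v x) t \<omega>" and ?f' = "\<lambda>t x \<omega>. lin_form ((A' t)\<^sup>T *\<^sub>v x) (c' \<cdot>\<^sub>v x) t \<omega>"
  have Asc: "As s t \<in> carrier_mat n r" for s t unfolding As_def by simp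
  have Zs: "As s t *\<^sub>v a t \<omega> + cs s \<cdot>\<^sub>v v t \<omega>
      = \<rho>' \<cdot>\<^sub>v (A t *\<^sub>v a t \<omega> + c \<cdot>\<^sub>v v t \<omega>) + (s * \<rho>) \<cdot>\<^sub>v (A' t *\<^sub>v a t \<omega> + c' \<cdot>\<^sub>v v t \<omega>)"
    if t: "t \<in> I" and \<omega>: "\<omega> \<in> space M" for s t \<omega>
  proof (rule eq_vecI)
    fix i assume "i < dim_vec (\<rho>' \<cdot>\<^sub>v (A t *\<^sub>v a t \<omega> + c \<cdot>\<^sub>v v t \<omega>) + (s * \<rho>) \<cdot>\<^sub>v (A' t *\<^sub>v a t \<omega> + c' \<cdot>\<^sub>v v t \<omega>))"
    then have i: "i < n" using v_carrier[OF t \<omega>] by simp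
    have "(As s t *\<^sub>v a t \<omega>) $ i = \<rho>' * (A t *\<^sub>v a t \<omega>) $ i + (s * \<rho>) * (A' t *\<^sub>v a t \<omega>) $ i"
      using i A[OF t] a_carrier[OF t \<omega>]
      by (simp add: As_def scalar_prod_sum[of _ r] sum.distrib sum_distrib_left algebra_simps)
    then show "(As s t *\<^sub>v a t \<omega> + cs s \<cdot>\<^sub>v v t \<omega>) $ i
        = (\<rho>' \<cdot>\<^sub>v (A t *\<^sub>v a t \<omega> + c \<cdot>\<^sub>v v t \<omega>) + (s * \<rho>) \<cdot>\<^sub>v (A' t *\<^sub>v a t \<omega> + c' \<cdot>\<^sub>v v t \<omega>)) $ i"
      using i v_carrier[OF t \<omega>] A[OF t] by (simp add: cs_def algebra_simps)
  qed (use v_carrier[OF t \<omega>] Asc in auto)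
  have Zc: "A t *\<^sub>v a t \<omega> + c \<cdot>\<^sub>v v t \<omega> \<in> carrier_vec n" "A' t *\<^sub>v a t \<omega> + c' \<cdot>\<^sub>v v t \<omega> \<in> carrier_vec n"
    if "t \<in> I" "\<omega> \<in> space M" for t \<omega>
    using A(1)[OF that(1)] A(2)[OF that(1)] v_carrier[OF that] a_carrier[OF that] by auto
  have fs: "lin_form ((As s t)\<^sup>T *\<^sub>v x) (cs s \<cdot>\<^sub>v x) t \<omega> = \<rho>' * ?f t x \<omega> + s * \<rho> * ?f' t x \<omega>"
    if t: "t \<in> I" and \<omega>: "\<omega> \<in> space M" and x: "x \<in> carrier_vec n" for s t \<omega> x
    unfolding lin_form_family[OF Asc t \<omega> x, symmetric] lin_form_family[OF A(1)[OF t] t \<omega> x, symmetric]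
      lin_form_family[OF A(2)[OF t] t \<omega> x, symmetric] Zs[OF t \<omega>]
    using x Zc[OF t \<omega>] by (simp add: scalar_prod_add_distrib[of _ n])
  have covs: "cov (As s t) (cs s) (As s t) (cs s) x
      = \<rho>'\<^sup>2 * cov (A t) c (A t) c x + 2 * (s * \<rho> * \<rho>') * cov (A t) c (A' t) c' x + (s * \<rho>)\<^sup>2 * cov (A' t) c' (A' t) c' x"
    if t: "t \<in> I" and x: "x \<in> carrier_vec n" for s t x
  proof -
    note i = cov_moment(1)[OF A(1)[OF t] A(1)[OF t] t x] cov_moment(1)[OF A(1)[OF t] A(2)[OF t] t x]
      cov_moment(1)[OF A(2)[OF t] A(2)[OF t] t x]
    have "cov (As s t) (cs s) (As s t) (cs s) x
        = expectation (\<lambda>\<omega>. \<rho>'\<^sup>2 * (?f t x \<omega> * ?f t x \<omega>) + 2 * (s * \<rho> * \<rho>') * (?f t x \<omega> * ?f' t x \<omega>) + (s * \<rho>)\<^sup>2 * (?f' t x \<omega> * ?f' t x \<omega>))"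
      unfolding cov_moment(2)[OF Asc Asc t x, symmetric]
      by (rule Bochner_Integration.integral_cong) (auto simp: fs[OF t _ x] power2_eq_square algebra_simps)
    also have "\<dots> = \<rho>'\<^sup>2 * cov (A t) c (A t) c x + 2 * (s * \<rho> * \<rho>') * cov (A t) c (A' t) c' x + (s * \<rho>)\<^sup>2 * cov (A' t) c' (A' t) c' x"
      using i cov_moment(2)[OF A(1)[OF t] A(1)[OF t] t x] cov_moment(2)[OF A(1)[OF t] A(2)[OF t] t x]
        cov_moment(2)[OF A(2)[OF t] A(2)[OF t] t x] by simp
    finally show ?thesis .
  qed
  have secs: "cov (As s t) (cs s) (As s t) (cs s) x \<le> (2 * \<rho> * \<rho>')\<^sup>2 * (x \<bullet> x)"
    if s: "s\<^sup>2 = 1" and t: "t \<in> I" and x: "x \<in> carrier_vec n" for s t x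
  proof -
    have "cov (As s t) (cs s) (As s t) (cs s) x + cov (As (-s) t) (cs (-s)) (As (-s) t) (cs (-s)) x
        = 2 * \<rho>'\<^sup>2 * cov (A t) c (A t) c x + 2 * \<rho>\<^sup>2 * cov (A' t) c' (A' t) c' x"
      unfolding covs[OF t x] using s by (simp add: power_mult_distrib)
    also have "\<dots> \<le> 2 * \<rho>'\<^sup>2 * (\<rho>\<^sup>2 * (x \<bullet> x)) + 2 * \<rho>\<^sup>2 * (\<rho>'\<^sup>2 * (x \<bullet> x))"
      by (intro add_mono mult_left_mono sec t x) auto
    finally show ?thesis using cov_self_nonneg[OF Asc x, of "-s" t "cs (-s)"]
      by (simp add: power_mult_distrib algebra_simps)
  qed
  have bnds: "AE \<omega> in M. (As s t *\<^sub>v a t \<omega> + cs s \<cdot>\<^sub>v v t \<omega>) \<bullet> (As s t *\<^sub>v a t \<omega> + cs s \<cdot>\<^sub>v v t \<omega>) \<le> \<beta> * (2 * \<rho> * \<rho>')\<^sup>2"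
    if s: "s\<^sup>2 = 1" and t: "t \<in> I" for s t
    using bnd(1)[OF t] bnd(2)[OF t] AE_space
  proof eventually_elim
    fix \<omega> assume b: "(A t *\<^sub>v a t \<omega> + c \<cdot>\<^sub>v v t \<omega>) \<bullet> (A t *\<^sub>v a t \<omega> + c \<cdot>\<^sub>v v t \<omega>) \<le> \<beta> * \<rho>\<^sup>2"
      "(A' t *\<^sub>v a t \<omega> + c' \<cdot>\<^sub>v v t \<omega>) \<bullet> (A' t *\<^sub>v a t \<omega> + c' \<cdot>\<^sub>v v t \<omega>) \<le> \<beta> * \<rho>'\<^sup>2" and \<omega>: "\<omega> \<in> space M"
    define z z' where "z = A t *\<^sub>v a t \<omega> + c \<cdot>\<^sub>v v t \<omega>" and "z' = A' t *\<^sub>v a t \<omega> + c' \<cdot>\<^sub>v v t \<omega>"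
    have z: "z \<in> carrier_vec n" "z' \<in> carrier_vec n" unfolding z_def z'_def using Zc[OF t \<omega>] by auto
    have "(\<rho>' \<cdot>\<^sub>v z + (s * \<rho>) \<cdot>\<^sub>v z') \<bullet> (\<rho>' \<cdot>\<^sub>v z + (s * \<rho>) \<cdot>\<^sub>v z') = (\<Sum>i<n. (\<rho>' * z $ i + s * \<rho> * z' $ i)\<^sup>2)"
      using z by (subst scalar_prod_self_sum[of _ n]) auto
    also have "\<dots> \<le> (\<Sum>i<n. 2 * \<rho>'\<^sup>2 * (z $ i)\<^sup>2 + 2 * \<rho>\<^sup>2 * (z' $ i)\<^sup>2)"
    proof (rule sum_mono)
      fix i
      have "(u + w)\<^sup>2 \<le> 2 * u\<^sup>2 + 2 * w\<^sup>2" for u w :: real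
        using zero_le_power2[of "u - w"] by (simp add: power2_eq_square algebra_simps)
      from this[of "\<rho>' * z $ i" "s * \<rho> * z' $ i"]
      show "(\<rho>' * z $ i + s * \<rho> * z' $ i)\<^sup>2 \<le> 2 * \<rho>'\<^sup>2 * (z $ i)\<^sup>2 + 2 * \<rho>\<^sup>2 * (z' $ i)\<^sup>2"
        using s by (simp add: power_mult_distrib)
    qed
    also have "\<dots> = 2 * \<rho>'\<^sup>2 * (z \<bullet> z) + 2 * \<rho>\<^sup>2 * (z' \<bullet> z')"
      using z by (simp add: scalar_prod_self_sum[of _ n] sum.distrib sum_distrib_left)
    also have "\<dots> \<le> 2 * \<rho>'\<^sup>2 * (\<beta> * \<rho>\<^sup>2) + 2 * \<rho>\<^sup>2 * (\<beta> * \<rho>'\<^sup>2)"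
      using b unfolding z_def z'_def by (intro add_mono mult_left_mono) auto
    also have "\<dots> = \<beta> * (2 * \<rho> * \<rho>')\<^sup>2" by (simp add: power_mult_distrib)
    finally show "(As s t *\<^sub>v a t \<omega> + cs s \<cdot>\<^sub>v v t \<omega>) \<bullet> (As s t *\<^sub>v a t \<omega> + cs s \<cdot>\<^sub>v v t \<omega>) \<le> \<beta> * (2 * \<rho> * \<rho>')\<^sup>2"
      unfolding Zs[OF t \<omega>] z_def z'_def .
  qed
  have r0: "0 \<le> 2 * \<rho> * \<rho>'" using \<rho> by simp
  define w where "w = \<kappa>1 * (2 * \<rho> * \<rho>')\<^sup>2 * (\<beta> * lr + sqrt (\<beta> * lr))"
  obtain E1 where E1: "E1 \<in> events" "prob E1 \<le> 1 / real n ^ 10"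
    "\<And>\<omega> x. \<omega> \<in> space M - E1 \<Longrightarrow> x \<in> carrier_vec n \<Longrightarrow>
      \<bar>\<Sum>t\<in>I. (lin_form ((As 1 t)\<^sup>T *\<^sub>v x) (cs 1 \<cdot>\<^sub>v x) t \<omega>)\<^sup>2 - cov (As 1 t) (cs 1) (As 1 t) (cs 1) x\<bar> \<le> real \<alpha> * w * (x \<bullet> x)"
    using covariance_deviation[of "As 1" \<beta> "2 * \<rho> * \<rho>'" "cs 1", OF Asc \<beta> r0 bnds secs] unfolding w_def by auto
  obtain E2 where E2: "E2 \<in> events" "prob E2 \<le> 1 / real n ^ 10"
    "\<And>\<omega> x. \<omega> \<in> space M - E2 \<Longrightarrow> x \<in> carrier_vec n \<Longrightarrow>
      \<bar>\<Sum>t\<in>I. (lin_form ((As (-1) t)\<^sup>T *\<^sub>v x) (cs (-1) \<cdot>\<^sub>v x) t \<omega>)\<^sup>2 - cov (As (-1) t) (cs (-1)) (As (-1) t) (cs (-1)) x\<bar> \<le> real \<alpha> * w * (x \<bullet> x)"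
    using covariance_deviation[of "As (-1)" \<beta> "2 * \<rho> * \<rho>'" "cs (-1)", OF Asc \<beta> r0 bnds secs] unfolding w_def by auto
  show thesis
  proof (rule that[of "E1 \<union> E2"])
    show "E1 \<union> E2 \<in> events" using E1 E2 by simp
    show "prob (E1 \<union> E2) \<le> 2 / real n ^ 10" using measure_Un_le[OF E1(1) E2(1)] E1(2) E2(2) by simp
    fix \<omega> and x :: "real vec" assume \<omega>: "\<omega> \<in> space M - (E1 \<union> E2)" and x: "x \<in> carrier_vec n"
    define Dp where "Dp = (\<Sum>t\<in>I. ?f t x \<omega> * ?f' t x \<omega> - cov (A t) c (A' t) c' x)"
    have "(\<Sum>t\<in>I. (lin_form ((As 1 t)\<^sup>T *\<^sub>v x) (cs 1 \<cdot>\<^sub>v x) t \<omega>)\<^sup>2 - cov (As 1 t) (cs 1) (As 1 t) (cs 1) x)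
      - (\<Sum>t\<in>I. (lin_form ((As (-1) t)\<^sup>T *\<^sub>v x) (cs (-1) \<cdot>\<^sub>v x) t \<omega>)\<^sup>2 - cov (As (-1) t) (cs (-1)) (As (-1) t) (cs (-1)) x)
      = (\<Sum>t\<in>I. 4 * \<rho> * \<rho>' * (?f t x \<omega> * ?f' t x \<omega> - cov (A t) c (A' t) c' x))"
      unfolding sum_subtractf[symmetric] using \<omega>
      by (intro sum.cong refl) (simp add: fs[OF _ _ x] covs[OF _ x] power2_eq_square algebra_simps)
    also have "\<dots> = 4 * \<rho> * \<rho>' * Dp" unfolding Dp_def by (simp add: sum_distrib_left)
    finally have "\<bar>4 * \<rho> * \<rho>' * Dp\<bar> \<le> 2 * (real \<alpha> * w * (x \<bullet> x))"
      using E1(3)[of \<omega> x] E2(3)[of \<omega> x] \<omega> x by force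
    then have "4 * \<rho> * \<rho>' * \<bar>Dp\<bar> \<le> 4 * \<rho> * \<rho>' * (real \<alpha> * (2 * \<kappa>1 * (\<rho> * \<rho>') * (\<beta> * lr + sqrt (\<beta> * lr))) * (x \<bullet> x))"
      using pos unfolding w_def by (simp add: abs_mult power2_eq_square mult_ac)
    then show "\<bar>\<Sum>t\<in>I. ?f t x \<omega> * ?f' t x \<omega> - cov (A t) c (A' t) c' x\<bar>
      \<le> real \<alpha> * (2 * \<kappa>1 * (\<rho> * \<rho>') * (\<beta> * lr + sqrt (\<beta> * lr))) * (x \<bullet> x)"
      using pos unfolding Dp_def by (subst (asm) mult_le_cancel_left_pos) auto
  qed
qed

end

section \<open>Data-dependent noise\<close>

lemma abs_powr_even: "\<bar>y\<bar> powr (2 * real k) = y ^ (2 * k)" if "1 \<le> k" for y :: real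
proof (cases "y = 0")
  case True
  then show ?thesis using that by simp
next
  case False
  then have "\<bar>y\<bar> powr real (2 * k) = \<bar>y\<bar> ^ (2 * k)" by (intro powr_realpow) simp
  then show ?thesis by (simp add: power_even_abs)
qed

text \<open>The supremum is evaluated at p = 2 k. Its infinite branch makes a finite norm imply
  integrability; raising (E Y^(2k))^(1/(2k)) <= sqrt(2k) K to the power 2k gives the moment
  bound.\<close>

lemma subgauss_norm_even_moment:
  assumes le: "subgauss_norm M Y \<le> ereal K" and K: "0 \<le> K" and k: "1 \<le> k"
  shows "integrable M (\<lambda>\<omega>. Y \<omega> ^ (2 * k))"
    "integral\<^sup>L M (\<lambda>\<omega>. Y \<omega> ^ (2 * k)) \<le> (2 * real k) ^ k * (K\<^sup>2) ^ k"
proof -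
  define p where "p = 2 * real k"
  have p: "1 \<le> p" unfolding p_def using k by simp
  define m where "m = integral\<^sup>L M (\<lambda>\<omega>. \<bar>Y \<omega>\<bar> powr p)"
  have pw: "(\<lambda>\<omega>. \<bar>Y \<omega>\<bar> powr p) = (\<lambda>\<omega>. Y \<omega> ^ (2 * k))"
    unfolding p_def using abs_powr_even[OF k] by simp
  have "(if integrable M (\<lambda>\<omega>. \<bar>Y \<omega>\<bar> powr p)
        then ereal (p powr (- 1 / 2) * (integral\<^sup>L M (\<lambda>\<omega>. \<bar>Y \<omega>\<bar> powr p)) powr (1 / p))
        else \<infinity>) \<le> subgauss_norm M Y"
    unfolding subgauss_norm_def by (rule SUP_upper) (use p in simp)
  also note le
  finally have *: "(if integrable M (\<lambda>\<omega>. \<bar>Y \<omega>\<bar> powr p)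
        then ereal (p powr (- 1 / 2) * m powr (1 / p)) else \<infinity>) \<le> ereal K" unfolding m_def .
  then have int: "integrable M (\<lambda>\<omega>. \<bar>Y \<omega>\<bar> powr p)" and le: "p powr (- 1 / 2) * m powr (1 / p) \<le> K"
    by (auto split: if_splits)
  show "integrable M (\<lambda>\<omega>. Y \<omega> ^ (2 * k))" using int unfolding pw .
  have m_eq: "m = integral\<^sup>L M (\<lambda>\<omega>. Y \<omega> ^ (2 * k))" unfolding m_def pw ..
  have m0: "0 \<le> m" unfolding m_def by (rule integral_nonneg_AE) auto
  have "m powr (1 / p) = (p powr (1 / 2) * p powr (- 1 / 2)) * m powr (1 / p)"
    using p by (simp add: powr_add[symmetric])
  also have "\<dots> \<le> p powr (1 / 2) * K" using mult_left_mono[OF le, of "p powr (1 / 2)"] by (simp add: mult_ac)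
  also have "p powr (1 / 2) = sqrt p" using p by (simp add: powr_half_sqrt)
  finally have root: "m powr (1 / p) \<le> sqrt p * K" .
  have "m = (m powr (1 / p)) ^ (2 * k)"
  proof (cases "m = 0")
    case True
    then show ?thesis using k by simp
  next
    case False
    then have "(m powr (1 / p)) ^ (2 * k) = (m powr (1 / p)) powr real (2 * k)"
      using m0 by (intro powr_realpow[symmetric]) simp
    also have "\<dots> = m powr 1" unfolding powr_powr p_def using k by simp
    finally show ?thesis using m0 False by simp
  qed
  also have "\<dots> \<le> (sqrt p * K) ^ (2 * k)" using root by (intro power_mono) auto
  also have "\<dots> = p ^ k * (K\<^sup>2) ^ k"
    using p by (simp add: power_mult_distrib power_mult)
  finally show "integral\<^sup>L M (\<lambda>\<omega>. Y \<omega> ^ (2 * k)) \<le> (2 * real k) ^ k * (K\<^sup>2) ^ k"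
    unfolding m_eq unfolding p_def .
qed

text \<open>Scaling to a unit vector; u = 0, which the supremum over unit vectors does not reach, is
  treated separately.\<close>

lemma subgauss_norm_vec_even_moment:
  assumes le: "subgauss_norm_vec M d X \<le> ereal K" and K: "0 \<le> K" and k: "1 \<le> k"
    and X: "\<And>\<omega>. \<omega> \<in> space M \<Longrightarrow> X \<omega> \<in> carrier_vec d" and u: "u \<in> carrier_vec d"
  shows "integrable M (\<lambda>\<omega>. (u \<bullet> X \<omega>) ^ (2 * k))"
    "integral\<^sup>L M (\<lambda>\<omega>. (u \<bullet> X \<omega>) ^ (2 * k)) \<le> (2 * real k) ^ k * (K\<^sup>2) ^ k * (u \<bullet> u) ^ k"
proof -
  have "integrable M (\<lambda>\<omega>. (u \<bullet> X \<omega>) ^ (2 * k)) \<and>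
    integral\<^sup>L M (\<lambda>\<omega>. (u \<bullet> X \<omega>) ^ (2 * k)) \<le> (2 * real k) ^ k * (K\<^sup>2) ^ k * (u \<bullet> u) ^ k"
  proof (cases "u = 0\<^sub>v d")
    case True
    have z: "(u \<bullet> X \<omega>) ^ (2 * k) = 0" if "\<omega> \<in> space M" for \<omega>
      using X[OF that] k True by simp
    have "integrable M (\<lambda>\<omega>. (u \<bullet> X \<omega>) ^ (2 * k)) = integrable M (\<lambda>\<omega>. 0 :: real)"
      by (rule Bochner_Integration.integrable_cong[OF refl z])
    moreover have "integral\<^sup>L M (\<lambda>\<omega>. (u \<bullet> X \<omega>) ^ (2 * k)) = integral\<^sup>L M (\<lambda>\<omega>. 0 :: real)"
      by (rule Bochner_Integration.integral_cong[OF refl z])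
    ultimately show ?thesis using scalar_prod_self_nonneg[of u] by simp
  next
    case False
    define s where "s = vec_norm2 u"
    have s2: "s\<^sup>2 = u \<bullet> u" unfolding s_def by (rule vec_norm2_square)
    have s: "0 < s" unfolding s_def vec_norm2_def using scalar_prod_self_pos[OF u False] by simp
    define w where "w = (1 / s) \<cdot>\<^sub>v u"
    have w: "w \<in> carrier_vec d" unfolding w_def using u by simp
    have "w \<bullet> w = 1" unfolding w_def using u s by (simp add: s2[symmetric] power2_eq_square)
    then have "subgauss_norm M (\<lambda>\<omega>. w \<bullet> X \<omega>) \<le> subgauss_norm_vec M d X"
      unfolding subgauss_norm_vec_def using w by (intro SUP_upper) (simp add: vec_norm2_def)
    also note le
    finally have le': "subgauss_norm M (\<lambda>\<omega>. w \<bullet> X \<omega>) \<le> ereal K" .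
    note mom = subgauss_norm_even_moment[OF le' K k]
    have eq: "(u \<bullet> X \<omega>) ^ (2 * k) = (u \<bullet> u) ^ k * (w \<bullet> X \<omega>) ^ (2 * k)" if "\<omega> \<in> space M" for \<omega>
    proof -
      have "u \<bullet> X \<omega> = s * (w \<bullet> X \<omega>)" unfolding w_def using u X[OF that] s by simp
      then show ?thesis unfolding s2[symmetric] by (simp add: power_mult_distrib power_mult)
    qed
    have "integrable M (\<lambda>\<omega>. (u \<bullet> X \<omega>) ^ (2 * k)) = integrable M (\<lambda>\<omega>. (u \<bullet> u) ^ k * (w \<bullet> X \<omega>) ^ (2 * k))"
      by (rule Bochner_Integration.integrable_cong[OF refl eq])
    moreover have "integral\<^sup>L M (\<lambda>\<omega>. (u \<bullet> X \<omega>) ^ (2 * k)) = (u \<bullet> u) ^ k * integral\<^sup>L M (\<lambda>\<omega>. (w \<bullet> X \<omega>) ^ (2 * k))"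
      unfolding integral_mult_right_zero[symmetric] by (rule Bochner_Integration.integral_cong[OF refl eq])
    moreover have "(u \<bullet> u) ^ k * integral\<^sup>L M (\<lambda>\<omega>. (w \<bullet> X \<omega>) ^ (2 * k)) \<le> (u \<bullet> u) ^ k * ((2 * real k) ^ k * (K\<^sup>2) ^ k)"
      using scalar_prod_self_nonneg[of u] by (intro mult_left_mono mom(2)) auto
    ultimately show ?thesis using mom(1) by (simp add: mult_ac)
  qed
  then show "integrable M (\<lambda>\<omega>. (u \<bullet> X \<omega>) ^ (2 * k))"
    "integral\<^sup>L M (\<lambda>\<omega>. (u \<bullet> X \<omega>) ^ (2 * k)) \<le> (2 * real k) ^ k * (K\<^sup>2) ^ k * (u \<bullet> u) ^ k" by auto
qed

lemma quad_form_unit_scale: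
  fixes B :: "real mat"
  assumes B: "B \<in> carrier_mat n n" and x: "x \<in> carrier_vec n"
    and unit: "\<And>x. x \<in> carrier_vec n \<Longrightarrow> x \<bullet> x = 1 \<Longrightarrow> \<bar>x \<bullet> (B *\<^sub>v x)\<bar> \<le> \<delta>"
  shows "\<bar>x \<bullet> (B *\<^sub>v x)\<bar> \<le> \<delta> * (x \<bullet> x)"
proof (cases "x = 0\<^sub>v n")
  case True
  have "B *\<^sub>v x \<in> carrier_vec n" using B x by simp
  then have "x \<bullet> (B *\<^sub>v x) = 0" unfolding True by simp
  then show ?thesis using True x by simp
next
  case False
  define s where "s = vec_norm2 x"
  have s2: "s\<^sup>2 = x \<bullet> x" unfolding s_def by (rule vec_norm2_square)
  have s: "0 < s" unfolding s_def vec_norm2_def using scalar_prod_self_pos[OF x False] by simp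
  define w where "w = (1 / s) \<cdot>\<^sub>v x"
  have w: "w \<in> carrier_vec n" unfolding w_def using x by simp
  have "w \<bullet> w = 1" unfolding w_def using x s by (simp add: s2[symmetric] power2_eq_square)
  from unit[OF w this] have "s\<^sup>2 * \<bar>w \<bullet> (B *\<^sub>v w)\<bar> \<le> s\<^sup>2 * \<delta>" by (intro mult_left_mono) auto
  moreover have "x \<bullet> (B *\<^sub>v x) = s\<^sup>2 * (w \<bullet> (B *\<^sub>v w))"
    unfolding w_def using B x s mult_mat_vec_carrier[OF B x] by (simp add: mult_mat_vec[OF B x] power2_eq_square)
  ultimately show ?thesis unfolding s2[symmetric] by (simp add: abs_mult mult.commute)
qed

locale dependent_model = signal_model +
  fixes Mt :: "nat \<Rightarrow> real mat" and q b :: real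
  assumes dep: "data_dependency n \<alpha> P Mt q b" and b1: "b < 1" and q1: "q < 1" and Lambda_pos: "0 < lam_min \<Lambda>"
begin

abbreviation "lamp \<equiv> lam_max \<Lambda>"
abbreviation "lamm \<equiv> lam_min \<Lambda>"
abbreviation "V \<equiv> lam_v S"

definition Nt :: "nat \<Rightarrow> real mat" where "Nt t = Mt t * P"

text \<open>The order of the factors matters: with N = M2 (M1 P) one has N' x = (M1 P)' (M2' x). So
  M1 P supplies q^2 for each t separately, and the average of |M2' x|^2 is the form of the averaged
  M2 M2', which brings in b. The signs of q and b follow because they bound norms.\<close>

lemma dependency_facts:
  shows "t \<in> I \<Longrightarrow> Mt t \<in> carrier_mat n n" and "0 \<le> q" and "0 \<le> b"
    and "t \<in> I \<Longrightarrow> y \<in> carrier_vec r \<Longrightarrow> (Nt t *\<^sub>v y) \<bullet> (Nt t *\<^sub>v y) \<le> q\<^sup>2 * (y \<bullet> y)"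
    and "t \<in> I \<Longrightarrow> x \<in> carrier_vec n \<Longrightarrow> ((Nt t)\<^sup>T *\<^sub>v x) \<bullet> ((Nt t)\<^sup>T *\<^sub>v x) \<le> q\<^sup>2 * (x \<bullet> x)"
    and "x \<in> carrier_vec n \<Longrightarrow> (\<Sum>t\<in>I. ((Nt t)\<^sup>T *\<^sub>v x) \<bullet> ((Nt t)\<^sup>T *\<^sub>v x)) \<le> real \<alpha> * (q\<^sup>2 * b) * (x \<bullet> x)"
proof -
  obtain m M1 M2 where D: "\<forall>t\<in>I. M1 t \<in> carrier_mat (m t) n \<and> M2 t \<in> carrier_mat n (m t) \<and> Mt t = M2 t * M1 t \<and>
      mat_norm2 (M1 t * P) \<le> q \<and> mat_norm2 (M2 t) \<le> 1"
    and nb: "mat_norm2 (avg_mat n \<alpha> (\<lambda>t. M2 t * (M2 t)\<^sup>T)) \<le> b"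
    using dep unfolding data_dependency_def by blast
  have M1: "M1 t \<in> carrier_mat (m t) n" and M2: "M2 t \<in> carrier_mat n (m t)" and Mt: "Mt t = M2 t * M1 t"
    and n1: "mat_norm2 (M1 t * P) \<le> q" and n2: "mat_norm2 (M2 t) \<le> 1" if "t \<in> I" for t
    using D that by blast+
  note P = dims(5)
  have M1P: "M1 t * P \<in> carrier_mat (m t) r" if "t \<in> I" for t using M1[OF that] P by simp
  show Mtc: "Mt t \<in> carrier_mat n n" if "t \<in> I" for t unfolding Mt[OF that] using M1[OF that] M2[OF that] by simp
  show q0: "0 \<le> q" using mat_norm2_nonneg[OF M1P[OF one_in_I]] n1[OF one_in_I] by simp
  let ?A = "avg_mat n \<alpha> (\<lambda>t. M2 t * (M2 t)\<^sup>T)"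
  have Ac: "?A \<in> carrier_mat n n" unfolding avg_mat_def by simp
  show b0: "0 \<le> b" using mat_norm2_nonneg[OF Ac] nb by simp
  have N_eq: "Nt t = M2 t * (M1 t * P)" if "t \<in> I" for t
    unfolding Nt_def Mt[OF that] using M1[OF that] M2[OF that] P by simp
  show Ny: "(Nt t *\<^sub>v y) \<bullet> (Nt t *\<^sub>v y) \<le> q\<^sup>2 * (y \<bullet> y)" if t: "t \<in> I" and y: "y \<in> carrier_vec r" for t y
  proof -
    have My: "(M1 t * P) *\<^sub>v y \<in> carrier_vec (m t)" using M1P[OF t] y by simp
    have "Nt t *\<^sub>v y = M2 t *\<^sub>v ((M1 t * P) *\<^sub>v y)" unfolding N_eq[OF t] using M2[OF t] M1P[OF t] y by simp
    then have "(Nt t *\<^sub>v y) \<bullet> (Nt t *\<^sub>v y) \<le> 1\<^sup>2 * (((M1 t * P) *\<^sub>v y) \<bullet> ((M1 t * P) *\<^sub>v y))"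
      using mat_norm2_square_bound[OF M2[OF t] My n2[OF t]] by simp
    also have "\<dots> \<le> q\<^sup>2 * (y \<bullet> y)" using mat_norm2_square_bound[OF M1P[OF t] y n1[OF t]] by simp
    finally show ?thesis .
  qed
  have Ntc: "Nt t \<in> carrier_mat n r" if "t \<in> I" for t unfolding Nt_def by (rule mult_carrier_mat[OF Mtc[OF that] P])
  show "((Nt t)\<^sup>T *\<^sub>v x) \<bullet> ((Nt t)\<^sup>T *\<^sub>v x) \<le> q\<^sup>2 * (x \<bullet> x)" if t: "t \<in> I" and x: "x \<in> carrier_vec n" for t x
    by (rule transpose_norm_bound[OF Ntc[OF t] Ny[OF t] x])
  have step: "((Nt t)\<^sup>T *\<^sub>v x) \<bullet> ((Nt t)\<^sup>T *\<^sub>v x) \<le> q\<^sup>2 * (((M2 t)\<^sup>T *\<^sub>v x) \<bullet> ((M2 t)\<^sup>T *\<^sub>v x))"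
    if t: "t \<in> I" and x: "x \<in> carrier_vec n" for t x
  proof -
    have "(Nt t)\<^sup>T *\<^sub>v x = (M1 t * P)\<^sup>T *\<^sub>v ((M2 t)\<^sup>T *\<^sub>v x)"
      unfolding N_eq[OF t] transpose_mult[OF M2[OF t] M1P[OF t]] using M2[OF t] M1P[OF t] x
      by (intro assoc_mult_mat_vec[of _ r "m t" _ n]) auto
    then show ?thesis
      using transpose_norm_bound[OF M1P[OF t] mat_norm2_square_bound[OF M1P[OF t] _ n1[OF t]], of "(M2 t)\<^sup>T *\<^sub>v x"] M2[OF t] x by simp
  qed
  show "(\<Sum>t\<in>I. ((Nt t)\<^sup>T *\<^sub>v x) \<bullet> ((Nt t)\<^sup>T *\<^sub>v x)) \<le> real \<alpha> * (q\<^sup>2 * b) * (x \<bullet> x)" if x: "x \<in> carrier_vec n" for x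
  proof -
    have form: "x \<bullet> (?A *\<^sub>v x) = 1 / real \<alpha> * (\<Sum>t\<in>I. ((M2 t)\<^sup>T *\<^sub>v x) \<bullet> ((M2 t)\<^sup>T *\<^sub>v x))"
    proof -
      have "x \<bullet> (?A *\<^sub>v x) = (\<Sum>i<n. \<Sum>j<n. x $ i * x $ j * (1 / real \<alpha> * (\<Sum>t\<in>I. (M2 t * (M2 t)\<^sup>T) $$ (i,j))))"
        unfolding bilinear_form_sum[OF Ac x x] by (simp add: avg_mat_def)
      also have "\<dots> = 1 / real \<alpha> * (\<Sum>i<n. \<Sum>j<n. \<Sum>t\<in>I. x $ i * x $ j * (M2 t * (M2 t)\<^sup>T) $$ (i,j))"
        by (simp add: sum_distrib_left mult_ac)
      also have "(\<Sum>i<n. \<Sum>j<n. \<Sum>t\<in>I. x $ i * x $ j * (M2 t * (M2 t)\<^sup>T) $$ (i,j))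
          = (\<Sum>t\<in>I. \<Sum>i<n. \<Sum>j<n. x $ i * x $ j * (M2 t * (M2 t)\<^sup>T) $$ (i,j))"
        by (subst (2) sum.swap, subst sum.swap) (rule refl)
      also have "\<dots> = (\<Sum>t\<in>I. ((M2 t)\<^sup>T *\<^sub>v x) \<bullet> ((M2 t)\<^sup>T *\<^sub>v x))"
      proof (intro sum.cong refl)
        fix t assume t: "t \<in> I"
        have c: "M2 t * (M2 t)\<^sup>T \<in> carrier_mat n n" using M2[OF t] by (metis mult_carrier_mat transpose_carrier_mat)
        have "x \<bullet> ((M2 t * (M2 t)\<^sup>T) *\<^sub>v x) = x \<bullet> (M2 t *\<^sub>v ((M2 t)\<^sup>T *\<^sub>v x))"
          using M2[OF t] x by (simp add: assoc_mult_mat_vec[of _ n "m t" _ n])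
        also have "\<dots> = ((M2 t)\<^sup>T *\<^sub>v x) \<bullet> ((M2 t)\<^sup>T *\<^sub>v x)"
          using M2[OF t] x by (intro transpose_mult_vec_scalar[of _ n "m t"]) auto
        finally show "(\<Sum>i<n. \<Sum>j<n. x $ i * x $ j * (M2 t * (M2 t)\<^sup>T) $$ (i,j)) = ((M2 t)\<^sup>T *\<^sub>v x) \<bullet> ((M2 t)\<^sup>T *\<^sub>v x)"
          unfolding bilinear_form_sum[OF c x x] .
      qed
      finally show ?thesis .
    qed
    have "x \<bullet> (?A *\<^sub>v x) \<le> vec_norm2 x * vec_norm2 (?A *\<^sub>v x)"
      using scalar_prod_le_norms[OF x, of "?A *\<^sub>v x"] Ac x by simp
    also have "\<dots> \<le> vec_norm2 x * (b * vec_norm2 x)"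
      using mat_norm2_bound[OF Ac x] mult_right_mono[OF nb vec_norm2_nonneg[of x]]
      by (intro mult_left_mono) auto
    also have "\<dots> = b * (x \<bullet> x)" unfolding vec_norm2_square[symmetric] by (simp add: power2_eq_square)
    finally have "(\<Sum>t\<in>I. ((M2 t)\<^sup>T *\<^sub>v x) \<bullet> ((M2 t)\<^sup>T *\<^sub>v x)) \<le> real \<alpha> * (b * (x \<bullet> x))"
      unfolding form using dims by (simp add: field_simps)
    then have "q\<^sup>2 * (\<Sum>t\<in>I. ((M2 t)\<^sup>T *\<^sub>v x) \<bullet> ((M2 t)\<^sup>T *\<^sub>v x)) \<le> q\<^sup>2 * (real \<alpha> * (b * (x \<bullet> x)))"
      by (intro mult_left_mono) auto
    moreover have "(\<Sum>t\<in>I. ((Nt t)\<^sup>T *\<^sub>v x) \<bullet> ((Nt t)\<^sup>T *\<^sub>v x)) \<le> q\<^sup>2 * (\<Sum>t\<in>I. ((M2 t)\<^sup>T *\<^sub>v x) \<bullet> ((M2 t)\<^sup>T *\<^sub>v x))"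
      unfolding sum_distrib_left by (intro sum_mono step x)
    ultimately show ?thesis by (simp add: mult_ac)
  qed
qed

lemmas Mt_carrier = dependency_facts(1) and q0 = dependency_facts(2) and b0 = dependency_facts(3)
  and Nt_norm = dependency_facts(4) and NtT_norm = dependency_facts(5) and NtT_sum = dependency_facts(6)

lemma Nt_carrier [simp]: "t \<in> I \<Longrightarrow> Nt t \<in> carrier_mat n r"
  unfolding Nt_def by (rule mult_carrier_mat[OF Mt_carrier dims(5)])

lemma lam_facts: "lamm \<le> lamp" "0 < lamp" "0 \<le> V"
proof -
  have r0: "0 < r" using dims by simp
  show "lamm \<le> lamp" unfolding lam_max_eig[OF Lambda_carrier Lambda_sym r0]
    by (rule eig_antimono[OF Lambda_carrier Lambda_sym]) (use dims in auto)
  then show "0 < lamp" using Lambda_pos by simp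
  show "0 \<le> V" unfolding lam_v_def by (rule mat_norm2_nonneg[OF S_carrier])
qed

lemma Lambda_bounds:
  assumes y: "y \<in> carrier_vec r"
  shows "y \<bullet> (\<Lambda> *\<^sub>v y) \<le> lamp * (y \<bullet> y)" "y' \<in> carrier_vec r \<Longrightarrow> \<bar>y \<bullet> (\<Lambda> *\<^sub>v y')\<bar> \<le> lamp * (vec_norm2 y * vec_norm2 y')"
proof -
  have r0: "0 < r" using dims by simp
  show up: "y \<bullet> (\<Lambda> *\<^sub>v y) \<le> lamp * (y \<bullet> y)" by (rule rayleigh_bounds(1)[OF Lambda_carrier Lambda_sym r0 y])
  assume y': "y' \<in> carrier_vec r"
  have "(\<Lambda> *\<^sub>v y') \<bullet> (\<Lambda> *\<^sub>v y') \<le> lamp\<^sup>2 * (y' \<bullet> y')"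
    by (rule psd_mult_vec_norm_le[OF Lambda_carrier Lambda_sym lam_facts(2) Lambda_psd rayleigh_bounds(1)[OF Lambda_carrier Lambda_sym r0] y'])
  then have "(vec_norm2 (\<Lambda> *\<^sub>v y'))\<^sup>2 \<le> (lamp * vec_norm2 y')\<^sup>2"
    by (simp add: vec_norm2_square power_mult_distrib)
  then have "vec_norm2 (\<Lambda> *\<^sub>v y') \<le> lamp * vec_norm2 y'"
    by (rule power2_le_imp_le) (rule mult_nonneg_nonneg[OF less_imp_le[OF lam_facts(2)] vec_norm2_nonneg])
  then have "vec_norm2 y * vec_norm2 (\<Lambda> *\<^sub>v y') \<le> vec_norm2 y * (lamp * vec_norm2 y')"
    by (rule mult_left_mono) (rule vec_norm2_nonneg)
  then show "\<bar>y \<bullet> (\<Lambda> *\<^sub>v y')\<bar> \<le> lamp * (vec_norm2 y * vec_norm2 y')"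
    using scalar_prod_le_norms[OF y mult_mat_vec_carrier[OF Lambda_carrier y']] by (simp only: mult.left_commute)
qed

lemma S_bound: "x \<in> carrier_vec n \<Longrightarrow> x \<bullet> (S *\<^sub>v x) \<le> V * (x \<bullet> x)"
proof -
  assume x: "x \<in> carrier_vec n"
  have "x \<bullet> (S *\<^sub>v x) \<le> vec_norm2 x * vec_norm2 (S *\<^sub>v x)"
    using scalar_prod_le_norms[OF x, of "S *\<^sub>v x"] S_carrier x by simp
  also have "\<dots> \<le> vec_norm2 x * (V * vec_norm2 x)"
    unfolding lam_v_def by (intro mult_left_mono mat_norm2_bound[OF S_carrier x]) auto
  finally show ?thesis unfolding vec_norm2_square[symmetric] by (simp add: power2_eq_square mult_ac)
qed

definition Ut :: "nat \<Rightarrow> real mat" where "Ut t = P + Nt t"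

lemma Ut_carrier [simp]: "t \<in> I \<Longrightarrow> Ut t \<in> carrier_mat n r"
  unfolding Ut_def using dims by simp

lemma UtT: "t \<in> I \<Longrightarrow> x \<in> carrier_vec n \<Longrightarrow> (Ut t)\<^sup>T *\<^sub>v x = P\<^sup>T *\<^sub>v x + (Nt t)\<^sup>T *\<^sub>v x"
  unfolding Ut_def using dims by (simp add: transpose_add[of P n r] add_mult_distrib_mat_vec[of _ r n])

lemma observation_form:
  assumes t: "t \<in> I" and \<omega>: "\<omega> \<in> space M" and x: "x \<in> carrier_vec n"
  shows "observation P Mt a v t \<omega> \<in> carrier_vec n"
    "x \<bullet> observation P Mt a v t \<omega> = lin_form ((Ut t)\<^sup>T *\<^sub>v x) (1 \<cdot>\<^sub>v x) t \<omega>"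
proof -
  note c = a_carrier[OF t \<omega>] v_carrier[OF t \<omega>] Mt_carrier[OF t] dims(5)
  have "observation P Mt a v t \<omega> = Ut t *\<^sub>v a t \<omega> + 1 \<cdot>\<^sub>v v t \<omega>"
    unfolding observation_def signal_def Ut_def Nt_def using c
    by (simp add: add_mult_distrib_mat_vec[of _ n r] assoc_mult_mat_vec[of _ n n _ r])
  then show "x \<bullet> observation P Mt a v t \<omega> = lin_form ((Ut t)\<^sup>T *\<^sub>v x) (1 \<cdot>\<^sub>v x) t \<omega>"
    using lin_form_family[OF Ut_carrier[OF t] t \<omega> x, of 1] by simp
  show "observation P Mt a v t \<omega> \<in> carrier_vec n"
    unfolding observation_def signal_def using c by simp
qed

abbreviation "Dw \<omega> \<equiv> sample_cov n \<alpha> (observation P Mt a v) \<omega>"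

lemma D_facts:
  assumes \<omega>: "\<omega> \<in> space M"
  shows "Dw \<omega> \<in> carrier_mat n n" "(Dw \<omega>)\<^sup>T = Dw \<omega>"
    "\<And>i j. i < n \<Longrightarrow> j < n \<Longrightarrow> Dw \<omega> $$ (i,j) = 1 / real \<alpha> * (\<Sum>t\<in>I. observation P Mt a v t \<omega> $ i * observation P Mt a v t \<omega> $ j)"
    "\<And>x. x \<in> carrier_vec n \<Longrightarrow> x \<bullet> (Dw \<omega> *\<^sub>v x) = 1 / real \<alpha> * (\<Sum>t\<in>I. (lin_form ((Ut t)\<^sup>T *\<^sub>v x) (1 \<cdot>\<^sub>v x) t \<omega>)\<^sup>2)"
proof -
  let ?y = "\<lambda>t. observation P Mt a v t \<omega>"
  have yc: "?y t \<in> carrier_vec n" if "t \<in> I" for t using observation_form(1)[OF that \<omega>, of "0\<^sub>v n"] by simp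
  show c: "Dw \<omega> \<in> carrier_mat n n" unfolding sample_cov_def avg_mat_def by simp
  show idx: "Dw \<omega> $$ (i,j) = 1 / real \<alpha> * (\<Sum>t\<in>I. ?y t $ i * ?y t $ j)" if "i < n" "j < n" for i j
  proof -
    have "outer (?y t) (?y t) $$ (i,j) = ?y t $ i * ?y t $ j" if "t \<in> I" for t
      using carrier_vecD[OF yc[OF that]] \<open>i < n\<close> \<open>j < n\<close> by (simp add: outer_def)
    then have "(\<Sum>t\<in>I. outer (?y t) (?y t) $$ (i,j)) = (\<Sum>t\<in>I. ?y t $ i * ?y t $ j)" by (rule sum.cong[OF refl])
    then show ?thesis unfolding sample_cov_def avg_mat_def using that by simp
  qed
  show "(Dw \<omega>)\<^sup>T = Dw \<omega>"
    by (rule eq_matI) (use c idx in \<open>auto simp: mult.commute\<close>)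
  fix x :: "real vec" assume x: "x \<in> carrier_vec n"
  have "x \<bullet> (Dw \<omega> *\<^sub>v x) = (\<Sum>i<n. \<Sum>j<n. x $ i * x $ j * (1 / real \<alpha> * (\<Sum>t\<in>I. ?y t $ i * ?y t $ j)))"
    unfolding bilinear_form_sum[OF c x x] by (intro sum.cong refl) (simp add: idx)
  also have "\<dots> = 1 / real \<alpha> * (\<Sum>i<n. \<Sum>j<n. \<Sum>t\<in>I. (x $ i * ?y t $ i) * (x $ j * ?y t $ j))"
    by (simp add: sum_distrib_left mult_ac)
  also have "(\<Sum>i<n. \<Sum>j<n. \<Sum>t\<in>I. (x $ i * ?y t $ i) * (x $ j * ?y t $ j))
      = (\<Sum>t\<in>I. \<Sum>i<n. \<Sum>j<n. (x $ i * ?y t $ i) * (x $ j * ?y t $ j))"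
    by (subst (2) sum.swap, subst sum.swap) (rule refl)
  also have "\<dots> = (\<Sum>t\<in>I. (x \<bullet> ?y t)\<^sup>2)"
    by (intro sum.cong refl) (simp add: scalar_prod_sum[OF yc] power2_eq_square sum_product)
  also have "\<dots> = (\<Sum>t\<in>I. (lin_form ((Ut t)\<^sup>T *\<^sub>v x) (1 \<cdot>\<^sub>v x) t \<omega>)\<^sup>2)"
    using observation_form(2)[OF _ \<omega> x] by simp
  finally show "x \<bullet> (Dw \<omega> *\<^sub>v x) = 1 / real \<alpha> * (\<Sum>t\<in>I. (lin_form ((Ut t)\<^sup>T *\<^sub>v x) (1 \<cdot>\<^sub>v x) t \<omega>)\<^sup>2)" .
qed

lemma recovery_measurable: "{\<omega> \<in> space M. dim_estimate n (Dw \<omega>) = r} \<in> events"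
proof (rule dim_estimate_measurable[OF D_facts(1,2)])
  fix i j assume ij: "i < n" "j < n"
  have ym: "(\<lambda>\<omega>. observation P Mt a v t \<omega> $ i) \<in> borel_measurable M" if "t \<in> I" "i < n" for t i
  proof -
    have "unit_vec n i \<bullet> observation P Mt a v t \<omega> = observation P Mt a v t \<omega> $ i" if "\<omega> \<in> space M" for \<omega>
      using observation_form(1)[OF \<open>t \<in> I\<close> that, of "0\<^sub>v n"] \<open>i < n\<close> by simp
    then have eq: "lin_form ((Ut t)\<^sup>T *\<^sub>v unit_vec n i) (1 \<cdot>\<^sub>v unit_vec n i) t \<omega> = observation P Mt a v t \<omega> $ i" if "\<omega> \<in> space M" for \<omega>
      using observation_form(2)[OF \<open>t \<in> I\<close> that, of "unit_vec n i"] that by simp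
    have "(\<lambda>\<omega>. lin_form ((Ut t)\<^sup>T *\<^sub>v unit_vec n i) (1 \<cdot>\<^sub>v unit_vec n i) t \<omega>) \<in> borel_measurable M"
      using that mult_mat_vec_carrier[OF transpose_carrier_mat[THEN iffD2, OF Ut_carrier[OF that(1)]], of "unit_vec n i"]
      by (intro lin_form_measurable) auto
    moreover have "(\<lambda>\<omega>. lin_form ((Ut t)\<^sup>T *\<^sub>v unit_vec n i) (1 \<cdot>\<^sub>v unit_vec n i) t \<omega>) \<in> borel_measurable M
      \<longleftrightarrow> (\<lambda>\<omega>. observation P Mt a v t \<omega> $ i) \<in> borel_measurable M"
      by (rule measurable_cong) (rule eq)
    ultimately show ?thesis by blast
  qed
  have "(\<lambda>\<omega>. 1 / real \<alpha> * (\<Sum>t\<in>I. observation P Mt a v t \<omega> $ i * observation P Mt a v t \<omega> $ j)) \<in> borel_measurable M"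
    using ym ij by (intro borel_measurable_times borel_measurable_sum borel_measurable_const) auto
  moreover have "(\<lambda>\<omega>. Dw \<omega> $$ (i,j)) \<in> borel_measurable M \<longleftrightarrow>
    (\<lambda>\<omega>. 1 / real \<alpha> * (\<Sum>t\<in>I. observation P Mt a v t \<omega> $ i * observation P Mt a v t \<omega> $ j)) \<in> borel_measurable M"
    by (rule measurable_cong) (rule D_facts(3)[OF _ ij])
  ultimately show "(\<lambda>\<omega>. Dw \<omega> $$ (i,j)) \<in> borel_measurable M" by blast
qed auto

lemma recovery_probability:
  assumes E: "E \<in> events" "prob E \<le> 10 / real n ^ 10"
    and good: "\<And>\<omega>. \<omega> \<in> space M - E \<Longrightarrow> dim_estimate n (Dw \<omega>) = r"
  shows "1 - 10 / real n ^ 10 \<le> prob {\<omega> \<in> space M. dim_estimate n (Dw \<omega>) = r}"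
proof -
  have "1 - 10 / real n ^ 10 \<le> prob (space M - E)" using E by (simp add: prob_compl)
  also have "\<dots> \<le> prob {\<omega> \<in> space M. dim_estimate n (Dw \<omega>) = r}"
    using good by (intro finite_measure_mono recovery_measurable) auto
  finally show ?thesis .
qed

end

section \<open>Bias of the sample covariance and the recovery criterion\<close>

lemma vec_add_norm_le:
  fixes x y :: "real vec"
  assumes "x \<in> carrier_vec n" "y \<in> carrier_vec n"
  shows "(x + y) \<bullet> (x + y) \<le> 2 * (x \<bullet> x) + 2 * (y \<bullet> y)"
proof -
  have "0 \<le> (x - y) \<bullet> (x - y)" by (rule scalar_prod_self_nonneg)
  then show ?thesis using assms comm_scalar_prod[OF assms]
    by (simp add: add_scalar_prod_distrib[of _ n] scalar_prod_add_distrib[of _ n]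
        minus_scalar_prod_distrib[of _ n] scalar_prod_minus_distrib[of _ n])
qed

context dependent_model
begin

lemma lam_vP_le: "lam_vP P S \<le> V"
proof -
  note P = dims(5)
  have r0: "0 < r" using dims by simp
  define Y where "Y = P\<^sup>T * S * P"
  have PTS: "P\<^sup>T * S \<in> carrier_mat r n" using P S_carrier by (metis mult_carrier_mat transpose_carrier_mat)
  have Y: "Y \<in> carrier_mat r r" unfolding Y_def using P PTS by (metis mult_carrier_mat)
  have YT: "Y\<^sup>T = Y"
  proof -
    have "Y\<^sup>T = P\<^sup>T * (P\<^sup>T * S)\<^sup>T" unfolding Y_def using P PTS by (subst transpose_mult[of _ r n _ r]) auto
    also have "(P\<^sup>T * S)\<^sup>T = S * P" using P S_carrier S_sym by (subst transpose_mult[of _ r n _ n]) auto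
    also have "P\<^sup>T * (S * P) = Y" unfolding Y_def using P S_carrier by (intro assoc_mult_mat[symmetric, of _ r n _ n _ r]) auto
    finally show ?thesis .
  qed
  obtain y where y: "y \<in> carrier_vec r" "y \<bullet> y = 1" "y \<bullet> (Y *\<^sub>v y) = eig Y r"
    using eig_vector[OF Y YT dims(1) order_refl] by auto
  have "y \<bullet> (Y *\<^sub>v y) = (P *\<^sub>v y) \<bullet> (S *\<^sub>v (P *\<^sub>v y))"
    using quad_form_conj[OF transpose_carrier_mat[THEN iffD2, OF P] S_carrier y(1)]
    unfolding transpose_transpose Y_def[symmetric] .
  also have "\<dots> \<le> V * ((P *\<^sub>v y) \<bullet> (P *\<^sub>v y))" using P y by (intro S_bound) simp
  also have "(P *\<^sub>v y) \<bullet> (P *\<^sub>v y) = 1" using isometry_scalar_prod[OF dims(5,6) y(1) y(1)] y(2) by simp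
  finally show ?thesis unfolding lam_vP_def Y_def[symmetric] lam_max_eig(2)[OF Y YT r0] y(3) by simp
qed

lemma lam_vrest_nonneg: "0 \<le> lam_vrest P S"
proof -
  have n0: "0 < n" using dims by simp
  have "0 \<le> lam_vrest P S * (unit_vec n 0 \<bullet> unit_vec n 0)"
    by (rule order_trans[OF abs_ge_zero rest_quad_form_abs[OF dims(5,6) n0 S_carrier S_sym S_psd unit_vec_carrier]])
  then show ?thesis using n0 by simp
qed

text \<open>The source of all smallness of the rates: the left side of the gap condition is
  nonnegative, and \<open>lam_vP P S\<close> is at most V.\<close>

lemma gap_bound:
  assumes "max_gap r (\<Lambda> + P\<^sup>T * S * P) \<le> (1 - 4 * d) * lamm + lam_vP P S"
  shows "4 * d * lamm \<le> lamm + V"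
proof -
  have "0 \<le> max_gap r (\<Lambda> + P\<^sup>T * S * P)" unfolding max_gap_def by (rule Max_ge) auto
  then show ?thesis using assms lam_vP_le by (simp add: algebra_simps)
qed

lemma form_norms:
  assumes t: "t \<in> I" and x: "x \<in> carrier_vec n" "x \<bullet> x = 1"
  shows "vec_norm2 (P\<^sup>T *\<^sub>v x) \<le> 1" "vec_norm2 ((Nt t)\<^sup>T *\<^sub>v x) \<le> q"
proof -
  have "(vec_norm2 (P\<^sup>T *\<^sub>v x))\<^sup>2 \<le> 1\<^sup>2"
    unfolding vec_norm2_square using transpose_isometry_contracts[OF dims(5,6) x(1)] x(2) by simp
  then show "vec_norm2 (P\<^sup>T *\<^sub>v x) \<le> 1" by (rule power2_le_imp_le) simp
  have "(vec_norm2 ((Nt t)\<^sup>T *\<^sub>v x))\<^sup>2 \<le> q\<^sup>2"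
    unfolding vec_norm2_square using NtT_norm[OF t x(1)] x(2) by simp
  then show "vec_norm2 ((Nt t)\<^sup>T *\<^sub>v x) \<le> q" by (rule power2_le_imp_le[OF _ q0])
qed

lemma cov_Ut:
  assumes t: "t \<in> I" and x: "x \<in> carrier_vec n"
  shows "cov (Ut t) 1 (Ut t) 1 x = cov P 0 P 0 x + 2 * cov P 0 (Nt t) 0 x + cov (Nt t) 0 (Nt t) 0 x + x \<bullet> (S *\<^sub>v x)"
proof -
  define y z where "y = P\<^sup>T *\<^sub>v x" and "z = (Nt t)\<^sup>T *\<^sub>v x"
  have y: "y \<in> carrier_vec r" "z \<in> carrier_vec r" unfolding y_def z_def using dims x Nt_carrier[OF t] by auto
  have "z \<bullet> (\<Lambda> *\<^sub>v y) = y \<bullet> (\<Lambda> *\<^sub>v z)"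
    using transpose_mult_vec_scalar[OF Lambda_carrier y(2,1)] Lambda_sym comm_scalar_prod[of "\<Lambda> *\<^sub>v z" r y] y Lambda_carrier
    by simp
  then show ?thesis unfolding cov_def UtT[OF t x] y_def[symmetric] z_def[symmetric]
    using y Lambda_carrier mult_mat_vec_carrier[OF Lambda_carrier y(1)] mult_mat_vec_carrier[OF Lambda_carrier y(2)]
    by (simp add: mult_add_distrib_mat_vec[of _ r r] add_scalar_prod_distrib[of _ r] scalar_prod_add_distrib[of _ r])
qed

text \<open>Without the main part there remain twice the covariance of ell with w and the covariance
  of w. Averaging |N_t' x| over t by Cauchy-Schwarz gives q sqrt b, where a bound for each t alone
  would give q. Since q, b < 1, the term q^2 b of the second part is also at most q sqrt b; hence
  the factor 3.\<close>

lemma bias_bound: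
  assumes x: "x \<in> carrier_vec n" "x \<bullet> x = 1"
  shows "\<bar>1 / real \<alpha> * (\<Sum>t\<in>I. cov (Ut t) 1 (Ut t) 1 x) - (cov P 0 P 0 x + x \<bullet> (S *\<^sub>v x))\<bar> \<le> 3 * sqrt b * q * lamp"
proof -
  have \<alpha>: "0 < real \<alpha>" using dims by simp
  let ?z = "\<lambda>t. (Nt t)\<^sup>T *\<^sub>v x"
  have z: "?z t \<in> carrier_vec r" if "t \<in> I" for t using Nt_carrier[OF that] x by simp
  have y: "P\<^sup>T *\<^sub>v x \<in> carrier_vec r" using dims x by simp
  have sq: "(\<Sum>t\<in>I. (vec_norm2 (?z t))\<^sup>2) \<le> real \<alpha> * (q\<^sup>2 * b)"
    using NtT_sum[OF x(1)] x(2) unfolding vec_norm2_square by simp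
  have "(\<Sum>t\<in>I. 1 * vec_norm2 (?z t))\<^sup>2 \<le> (\<Sum>t\<in>I. 1\<^sup>2) * (\<Sum>t\<in>I. (vec_norm2 (?z t))\<^sup>2)"
    by (rule Cauchy_Schwarz_ineq_sum)
  also have "\<dots> \<le> real \<alpha> * (real \<alpha> * (q\<^sup>2 * b))" using sq by (simp add: mult_left_mono)
  also have "\<dots> = (real \<alpha> * (q * sqrt b))\<^sup>2" using b0 by (simp add: power_mult_distrib power2_eq_square mult_ac)
  finally have sum1: "(\<Sum>t\<in>I. vec_norm2 (?z t)) \<le> real \<alpha> * (q * sqrt b)"
    unfolding mult_1 by (rule power2_le_imp_le) (use q0 b0 in simp)
  have c1: "\<bar>\<Sum>t\<in>I. cov P 0 (Nt t) 0 x\<bar> \<le> lamp * (real \<alpha> * (q * sqrt b))"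
  proof -
    have "\<bar>\<Sum>t\<in>I. cov P 0 (Nt t) 0 x\<bar> \<le> (\<Sum>t\<in>I. lamp * vec_norm2 (?z t))"
    proof (rule order_trans[OF sum_abs sum_mono])
      fix t assume t: "t \<in> I"
      have "\<bar>cov P 0 (Nt t) 0 x\<bar> \<le> lamp * (vec_norm2 (P\<^sup>T *\<^sub>v x) * vec_norm2 (?z t))"
        unfolding cov_def using Lambda_bounds(2)[OF y z[OF t]] by simp
      also have "\<dots> \<le> lamp * (1 * vec_norm2 (?z t))"
        using form_norms(1)[OF t x] lam_facts by (intro mult_left_mono mult_right_mono) auto
      finally show "\<bar>cov P 0 (Nt t) 0 x\<bar> \<le> lamp * vec_norm2 (?z t)" by simp
    qed
    also have "\<dots> = lamp * (\<Sum>t\<in>I. vec_norm2 (?z t))" by (simp add: sum_distrib_left)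
    also have "\<dots> \<le> lamp * (real \<alpha> * (q * sqrt b))" using sum1 lam_facts by (intro mult_left_mono) auto
    finally show ?thesis .
  qed
  have c2: "\<bar>\<Sum>t\<in>I. cov (Nt t) 0 (Nt t) 0 x\<bar> \<le> lamp * (real \<alpha> * (q * sqrt b))"
  proof -
    have "\<bar>\<Sum>t\<in>I. cov (Nt t) 0 (Nt t) 0 x\<bar> \<le> (\<Sum>t\<in>I. lamp * (vec_norm2 (?z t))\<^sup>2)"
    proof (rule order_trans[OF sum_abs sum_mono])
      fix t assume t: "t \<in> I"
      show "\<bar>cov (Nt t) 0 (Nt t) 0 x\<bar> \<le> lamp * (vec_norm2 (?z t))\<^sup>2"
        unfolding cov_def vec_norm2_square using Lambda_bounds(1)[OF z[OF t]] Lambda_psd[OF z[OF t]] by simp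
    qed
    also have "\<dots> = lamp * (\<Sum>t\<in>I. (vec_norm2 (?z t))\<^sup>2)" by (simp add: sum_distrib_left)
    also have "\<dots> \<le> lamp * (real \<alpha> * (q\<^sup>2 * b))" using sq lam_facts by (intro mult_left_mono) auto
    also have "\<dots> \<le> lamp * (real \<alpha> * (q * sqrt b))"
    proof -
      have "q * q \<le> q * 1" using q0 q1 by (intro mult_left_mono) auto
      moreover have "b \<le> sqrt b"
      proof -
        have "sqrt b * sqrt b \<le> sqrt b * 1" using b0 b1 by (intro mult_left_mono) auto
        then show ?thesis using b0 by simp
      qed
      ultimately have "q\<^sup>2 * b \<le> q * sqrt b" using q0 b0 by (intro mult_mono) (auto simp: power2_eq_square)
      then show ?thesis using lam_facts by (intro mult_left_mono) auto
    qed
    finally show ?thesis .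
  qed
  have "(\<Sum>t\<in>I. cov (Ut t) 1 (Ut t) 1 x) = real \<alpha> * (cov P 0 P 0 x + x \<bullet> (S *\<^sub>v x))
      + 2 * (\<Sum>t\<in>I. cov P 0 (Nt t) 0 x) + (\<Sum>t\<in>I. cov (Nt t) 0 (Nt t) 0 x)"
  proof -
    have "(\<Sum>t\<in>I. cov (Ut t) 1 (Ut t) 1 x) = (\<Sum>t\<in>I. (cov P 0 P 0 x + x \<bullet> (S *\<^sub>v x))
        + 2 * cov P 0 (Nt t) 0 x + cov (Nt t) 0 (Nt t) 0 x)"
      by (rule sum.cong[OF refl]) (simp add: cov_Ut[OF _ x(1)])
    then show ?thesis by (simp add: sum.distrib sum_distrib_left[symmetric] distrib_left)
  qed
  then have "1 / real \<alpha> * (\<Sum>t\<in>I. cov (Ut t) 1 (Ut t) 1 x) - (cov P 0 P 0 x + x \<bullet> (S *\<^sub>v x))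
      = (2 * (\<Sum>t\<in>I. cov P 0 (Nt t) 0 x) + (\<Sum>t\<in>I. cov (Nt t) 0 (Nt t) 0 x)) / real \<alpha>"
    using \<alpha> by (simp add: field_simps)
  also have "\<bar>\<dots>\<bar> \<le> (3 * (lamp * (real \<alpha> * (q * sqrt b)))) / real \<alpha>"
    unfolding abs_divide abs_of_pos[OF \<alpha>] by (rule divide_right_mono) (use c1 c2 \<alpha> in linarith)+
  also have "\<dots> = 3 * sqrt b * q * lamp" using \<alpha> by simp
  finally show ?thesis .
qed

text \<open>The deviation is asked for at unit vectors only; homogeneity extends it to all vectors,
  and the bias is added to \<delta> before \<open>dim_estimate_correct\<close> is applied.\<close>

lemma recovery:
  assumes \<omega>: "\<omega> \<in> space M"
    and dev: "\<And>x. x \<in> carrier_vec n \<Longrightarrow> x \<bullet> x = 1 \<Longrightarrow>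
      \<bar>\<Sum>t\<in>I. (lin_form ((Ut t)\<^sup>T *\<^sub>v x) (1 \<cdot>\<^sub>v x) t \<omega>)\<^sup>2 - cov (Ut t) 1 (Ut t) 1 x\<bar> \<le> real \<alpha> * \<delta>"
    and \<delta>: "\<delta> + 3 * sqrt b * q * lamp + lam_vrest P S < d * lamm"
    and gap: "max_gap r (\<Lambda> + P\<^sup>T * S * P) \<le> (1 - 4 * d) * lamm + lam_vP P S"
  shows "dim_estimate n (Dw \<omega>) = r"
proof -
  note P = dims(5)
  have \<alpha>: "0 < real \<alpha>" using dims by simp
  have bm: "basis_matrix n r P" using basic unfolding basic_model_def by simp
  define Q where "Q = P * \<Lambda> * P\<^sup>T"
  have Q: "Q \<in> carrier_mat n n" unfolding Q_def using P mult_carrier_mat[OF mult_carrier_mat[OF P Lambda_carrier], of "P\<^sup>T" n] by simp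
  define B where "B = Dw \<omega> - (Q + S)"
  have B: "B \<in> carrier_mat n n" unfolding B_def using minus_carrier_mat[of "Q + S" n n "Dw \<omega>"] Q S_carrier by simp
  have Bform: "x \<bullet> (B *\<^sub>v x) = x \<bullet> (Dw \<omega> *\<^sub>v x) - ((P\<^sup>T *\<^sub>v x) \<bullet> (\<Lambda> *\<^sub>v (P\<^sup>T *\<^sub>v x)) + x \<bullet> (S *\<^sub>v x))"
    if x: "x \<in> carrier_vec n" for x
    unfolding B_def using D_facts(1)[OF \<omega>] Q S_carrier x mult_mat_vec_carrier[OF Q x] mult_mat_vec_carrier[OF S_carrier x]
      mult_mat_vec_carrier[OF D_facts(1)[OF \<omega>] x] quad_form_conj[OF P Lambda_carrier x, folded Q_def]
    by (simp add: minus_mult_distrib_mat_vec[of _ n n] add_mult_distrib_mat_vec[of _ n n]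
        scalar_prod_minus_distrib[of _ n] scalar_prod_add_distrib[of _ n])
  show ?thesis
  proof (rule dim_estimate_correct[OF bm dims(1) Lambda_carrier Lambda_sym Lambda_pos S_carrier S_sym S_psd D_facts(1,2)[OF \<omega>] _ _ \<delta> gap])
    fix x :: "real vec" assume x: "x \<in> carrier_vec n"
    show "0 \<le> x \<bullet> (Dw \<omega> *\<^sub>v x)" unfolding D_facts(4)[OF \<omega> x] by (intro mult_nonneg_nonneg sum_nonneg) auto
    show "\<bar>x \<bullet> (Dw \<omega> *\<^sub>v x) - ((P\<^sup>T *\<^sub>v x) \<bullet> (\<Lambda> *\<^sub>v (P\<^sup>T *\<^sub>v x)) + x \<bullet> (S *\<^sub>v x))\<bar> \<le> (\<delta> + 3 * sqrt b * q * lamp) * (x \<bullet> x)"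
      unfolding Bform[OF x, symmetric]
    proof (rule quad_form_unit_scale[OF B x])
      fix u :: "real vec" assume u: "u \<in> carrier_vec n" "u \<bullet> u = 1"
      let ?c = "\<lambda>t. cov (Ut t) 1 (Ut t) 1 u"
      have "u \<bullet> (B *\<^sub>v u) = 1 / real \<alpha> * (\<Sum>t\<in>I. (lin_form ((Ut t)\<^sup>T *\<^sub>v u) (1 \<cdot>\<^sub>v u) t \<omega>)\<^sup>2 - ?c t)
          + (1 / real \<alpha> * (\<Sum>t\<in>I. ?c t) - (cov P 0 P 0 u + u \<bullet> (S *\<^sub>v u)))"
        unfolding Bform[OF u(1)] D_facts(4)[OF \<omega> u(1)] cov_def[of P 0] by (simp add: sum_subtractf right_diff_distrib)
      moreover have "\<bar>1 / real \<alpha> * (\<Sum>t\<in>I. (lin_form ((Ut t)\<^sup>T *\<^sub>v u) (1 \<cdot>\<^sub>v u) t \<omega>)\<^sup>2 - ?c t)\<bar> \<le> \<delta>"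
        using dev[OF u] \<alpha> by (simp add: abs_mult pos_divide_le_eq mult.commute)
      ultimately show "\<bar>u \<bullet> (B *\<^sub>v u)\<bar> \<le> \<delta> + 3 * sqrt b * q * lamp"
        using bias_bound[OF u] by linarith
    qed
  qed
qed

lemma Delta_times_lam_min:
  "Delta dd d q b P \<Lambda> S * lamm = dd * lamm + d * lamm + 3 * sqrt b * q * lamp + lam_vrest P S"
  unfolding Delta_def cond_f_def using Lambda_pos by (simp add: field_simps)

text \<open>Every summand of \<Delta> is nonnegative, so each rate inherits the bound of
  \<open>gap_bound\<close> separately.\<close>

lemma Delta_smallness:
  assumes gap: "max_gap r (\<Lambda> + P\<^sup>T * S * P) \<le> (1 - 4 * Delta dd d q b P \<Lambda> S) * lamm + lam_vP P S"
    and nn: "0 \<le> dd" "0 \<le> d"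
  shows "dd \<le> (1 + V / lamm) / 4" "d \<le> (1 + V / lamm) / 4"
proof -
  have D: "4 * (dd * lamm + d * lamm + 3 * sqrt b * q * lamp + lam_vrest P S) \<le> lamm + V"
    using gap_bound[OF gap] unfolding mult.assoc Delta_times_lam_min .
  have "0 \<le> dd * lamm" "0 \<le> d * lamm" "0 \<le> 3 * sqrt b * q * lamp"
    using nn Lambda_pos lam_facts q0 b0 by auto
  then have "4 * (dd * lamm) \<le> lamm + V \<and> 4 * (d * lamm) \<le> lamm + V" using D lam_vrest_nonneg by argo
  then show "dd \<le> (1 + V / lamm) / 4" "d \<le> (1 + V / lamm) / 4" using Lambda_pos by (simp_all add: field_simps)
qed

lemma ln_n: "1 / 2 \<le> ln (real n)" "ln (real n) \<le> real n"
proof -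
  have "exp (1 / 2 :: real) \<le> 2" using exp_bound_half[of "1 / 2 :: real"] by simp
  then have "exp (1 / 2 :: real) \<le> real n" using dims by simp
  then show "1 / 2 \<le> ln (real n)" by (subst ln_ge_iff) (use dims in auto)
  show "ln (real n) \<le> real n" using ln_le_minus_one[of "real n"] dims by simp
qed

section \<open>Sub-Gaussian signal and noise\<close>

lemma even_power_add_le: "(x + y) ^ (2 * k) \<le> 4 ^ k * (x ^ (2 * k) + y ^ (2 * k))" for x y :: real
proof -
  define z where "z = max \<bar>x\<bar> \<bar>y\<bar>"
  have "(x + y) ^ (2 * k) = \<bar>x + y\<bar> ^ (2 * k)" by (simp add: power_even_abs)
  also have "\<dots> \<le> (2 * z) ^ (2 * k)" unfolding z_def by (intro power_mono) auto
  also have "\<dots> = 4 ^ k * z ^ (2 * k)" by (simp add: power_mult_distrib power_mult)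
  also have "z ^ (2 * k) \<le> x ^ (2 * k) + y ^ (2 * k)"
    unfolding z_def by (simp add: max_def power_even_abs)
  finally show ?thesis by simp
qed

text \<open>Here the whole observation is a sub-Gaussian vector in R^n, at the scale of the larger
  of \<open>lamp\<close> and V, so one net bound in dimension n controls all blocks at once.\<close>

lemma subgaussian_recovery:
  assumes C: "0 < C" and c: "6 \<le> c" "9216 * C\<^sup>2 \<le> c"
    and sg: "subgaussian_signal_noise C M n r \<alpha> a v \<Lambda> S"
    and gap: "max_gap r (\<Lambda> + P\<^sup>T * S * P)
      \<le> (1 - 4 * Delta (d_denom_subgaussian c n r \<alpha> (cond_f \<Lambda>)) (d_subgaussian c n \<alpha> \<Lambda> S) q b P \<Lambda> S) * lamm + lam_vP P S"
  shows "1 - 10 / real n ^ 10 \<le> prob {\<omega> \<in> space M. dim_estimate n (Dw \<omega>) = r}"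
proof -
  note P = dims(5)
  have \<alpha>: "0 < real \<alpha>" and n0: "0 < n" and n2: "2 \<le> n" using dims by auto
  define mx where "mx = max lamp V"
  have mx: "0 < mx" "lamp \<le> mx" "V \<le> mx" "0 \<le> mx" unfolding mx_def using lam_facts by auto
  \<comment> \<open>For the moments of x . y_t of order 2k, \<open>even_power_add_le\<close> costs
    4^k, the sum of two terms costs 2 <= 2^k, and |U_t' x|^2 <= 4 |x|^2 another 4^k; together 4 * 2
    * 4 = 32.\<close>
  define \<kappa> where "\<kappa> = 32 * C\<^sup>2 * mx"
  have \<kappa>: "0 < \<kappa>" unfolding \<kappa>_def using C mx by simp
  define h where "h = sqrt (real n / real \<alpha>)"
  have h: "0 \<le> h" unfolding h_def by simp
  have dsub: "d_subgaussian c n \<alpha> \<Lambda> S = c * (mx / lamm) * h"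
    unfolding d_subgaussian_def cond_f_def mx_def h_def using Lambda_pos
    by (auto simp: max_def divide_le_cancel)
  have dd0: "0 < d_denom_subgaussian c n r \<alpha> (cond_f \<Lambda>)"
    unfolding d_denom_subgaussian_def cond_f_def using c \<alpha> lam_facts Lambda_pos dims ln_n
    by (intro mult_pos_pos) auto
  have ds0: "0 \<le> d_subgaussian c n \<alpha> \<Lambda> S" unfolding dsub using c mx Lambda_pos h by simp
  \<comment> \<open>\<open>mx / lamm\<close> is at least 1 and at least \<open>V / lamm\<close>, so
    the right-hand side of the smallness bound is at most half of it and the ratio cancels. This
    leaves c h <= 1/2, and 1/12 is half of the 1/6 that the net bound requires.\<close>
  have hs: "h \<le> 1 / 12"
  proof -
    have "c * (mx / lamm) * h \<le> (1 + V / lamm) / 4"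
      using Delta_smallness(2)[OF gap _ ds0] dd0 unfolding dsub by simp
    also have "\<dots> \<le> (mx / lamm + mx / lamm) / 4"
      using mx lam_facts Lambda_pos by (intro divide_right_mono add_mono) (auto simp: field_simps)
    finally have "(mx / lamm) * (c * h) \<le> (mx / lamm) * (1 / 2)" by (simp add: mult_ac)
    then have "c * h \<le> 1 / 2" by (rule mult_left_le_imp_le) (use mx Lambda_pos in simp)
    moreover have "6 * h \<le> c * h" using c h by (intro mult_right_mono) auto
    ultimately show ?thesis by simp
  qed
  have hn: "sqrt ((real n + ln (real n)) / real \<alpha>) \<le> 2 * h"
  proof -
    have "(real n + ln (real n)) / real \<alpha> \<le> 2\<^sup>2 * (real n / real \<alpha>)"
      using ln_n(2) \<alpha> by (simp add: field_simps)
    then have "sqrt ((real n + ln (real n)) / real \<alpha>) \<le> sqrt (2\<^sup>2 * (real n / real \<alpha>))" by (rule real_sqrt_le_mono)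
    then show ?thesis unfolding h_def real_sqrt_mult by simp
  qed
  define Z where "Z t \<omega> = observation P Mt a v t \<omega>" for t \<omega>
  define Sg where "Sg t = Ut t * \<Lambda> * (Ut t)\<^sup>T + S" for t
  have UL: "Ut t * \<Lambda> \<in> carrier_mat n r" if "t \<in> I" for t using Ut_carrier[OF that] Lambda_carrier by (metis mult_carrier_mat)
  have ULU: "Ut t * \<Lambda> * (Ut t)\<^sup>T \<in> carrier_mat n n" if "t \<in> I" for t
    using UL[OF that] Ut_carrier[OF that] by (metis mult_carrier_mat transpose_carrier_mat)
  have Sg: "Sg t \<in> carrier_mat n n" if "t \<in> I" for t unfolding Sg_def using ULU[OF that] S_carrier by simp
  have SgT: "(Sg t)\<^sup>T = Sg t" if t: "t \<in> I" for t
  proof -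
    have "(Ut t * \<Lambda> * (Ut t)\<^sup>T)\<^sup>T = Ut t * (Ut t * \<Lambda>)\<^sup>T"
      using UL[OF t] Ut_carrier[OF t] by (subst transpose_mult[of _ n r _ n]) auto
    also have "(Ut t * \<Lambda>)\<^sup>T = \<Lambda> * (Ut t)\<^sup>T"
      using Lambda_carrier Lambda_sym Ut_carrier[OF t] by (subst transpose_mult[of _ n r _ r]) auto
    also have "Ut t * (\<Lambda> * (Ut t)\<^sup>T) = Ut t * \<Lambda> * (Ut t)\<^sup>T"
      using Lambda_carrier Ut_carrier[OF t] by (intro assoc_mult_mat[symmetric, of _ n r _ r _ n]) auto
    finally show ?thesis unfolding Sg_def using ULU[OF t] S_carrier S_sym by (simp add: transpose_add[of _ n n])
  qed
  have Sgform: "u \<bullet> (Sg t *\<^sub>v u) = cov (Ut t) 1 (Ut t) 1 u" if t: "t \<in> I" and u: "u \<in> carrier_vec n" for t u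
    unfolding Sg_def cov_def using ULU[OF t] S_carrier u quad_form_conj[OF Ut_carrier[OF t] Lambda_carrier u]
      mult_mat_vec_carrier[OF ULU[OF t] u] mult_mat_vec_carrier[OF S_carrier u]
    by (simp add: add_mult_distrib_mat_vec[of _ n n] scalar_prod_add_distrib[of _ n])
  have Zform: "u \<bullet> Z t \<omega> = lin_form ((Ut t)\<^sup>T *\<^sub>v u) (1 \<cdot>\<^sub>v u) t \<omega>" if "t \<in> I" "\<omega> \<in> space M" "u \<in> carrier_vec n" for t \<omega> u
    unfolding Z_def by (rule observation_form(2)[OF that])
  have Ka: "subgauss_norm_vec M r (a t) \<le> ereal (C * sqrt lamp)" and Kv: "subgauss_norm_vec M n (v t) \<le> ereal (C * sqrt V)"
    if "t \<in> I" for t using sg that unfolding subgaussian_signal_noise_def by auto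
  have K0: "0 \<le> C * sqrt lamp" "0 \<le> C * sqrt V" using C lam_facts by auto
  have mom: "integrable M (\<lambda>\<omega>. (u \<bullet> Z t \<omega>) ^ (2 * k)) \<and>
      expectation (\<lambda>\<omega>. (u \<bullet> Z t \<omega>) ^ (2 * k)) \<le> (2 * real k) ^ k * \<kappa> ^ k * (u \<bullet> u) ^ k"
    if t: "t \<in> I" and u: "u \<in> carrier_vec n" and k: "1 \<le> k" for t u k
  proof -
    define y where "y = (Ut t)\<^sup>T *\<^sub>v u"
    have y: "y \<in> carrier_vec r" unfolding y_def using Ut_carrier[OF t] u by simp
    have yy: "y \<bullet> y \<le> 4 * (u \<bullet> u)"
    proof -
      have "y \<bullet> y \<le> 2 * ((P\<^sup>T *\<^sub>v u) \<bullet> (P\<^sup>T *\<^sub>v u)) + 2 * (((Nt t)\<^sup>T *\<^sub>v u) \<bullet> ((Nt t)\<^sup>T *\<^sub>v u))"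
        unfolding y_def UtT[OF t u] using P Nt_carrier[OF t] u by (intro vec_add_norm_le[of _ r]) auto
      also have "\<dots> \<le> 2 * (u \<bullet> u) + 2 * (1 * (u \<bullet> u))"
      proof -
        have "q\<^sup>2 * (u \<bullet> u) \<le> 1 * (u \<bullet> u)" using q0 q1 scalar_prod_self_nonneg[of u]
          by (intro mult_right_mono power_le_one) auto
        then show ?thesis using transpose_isometry_contracts[OF dims(5,6) u] NtT_norm[OF t u] by linarith
      qed
      finally show ?thesis by simp
    qed
    note ma = subgauss_norm_vec_even_moment[OF Ka[OF t] K0(1) k a_carrier[OF t] y]
    note mv = subgauss_norm_vec_even_moment[OF Kv[OF t] K0(2) k v_carrier[OF t] u]
    have Kp: "(C * sqrt lamp)\<^sup>2 = C\<^sup>2 * lamp" "(C * sqrt V)\<^sup>2 = C\<^sup>2 * V" using lam_facts by (auto simp: power_mult_distrib)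
    have zeq: "u \<bullet> Z t \<omega> = y \<bullet> a t \<omega> + u \<bullet> v t \<omega>" if "\<omega> \<in> space M" for \<omega>
      unfolding Zform[OF t that u] lin_form_def y_def by simp
    have zm: "(\<lambda>\<omega>. u \<bullet> Z t \<omega>) \<in> borel_measurable M"
    proof -
        have "(\<lambda>\<omega>. y \<bullet> a t \<omega> + u \<bullet> v t \<omega>) \<in> borel_measurable M"
          by (intro borel_measurable_add la_measurable[OF t y] lv_measurable[OF t u])
        moreover have "(\<lambda>\<omega>. u \<bullet> Z t \<omega>) \<in> borel_measurable M \<longleftrightarrow> (\<lambda>\<omega>. y \<bullet> a t \<omega> + u \<bullet> v t \<omega>) \<in> borel_measurable M"
          by (rule measurable_cong) (rule zeq)
        ultimately show ?thesis by blast
      qed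
    have bi: "integrable M (\<lambda>\<omega>. 4 ^ k * ((y \<bullet> a t \<omega>) ^ (2 * k) + (u \<bullet> v t \<omega>) ^ (2 * k)))"
      using ma(1) mv(1) by simp
    have ptw: "(u \<bullet> Z t \<omega>) ^ (2 * k) \<le> 4 ^ k * ((y \<bullet> a t \<omega>) ^ (2 * k) + (u \<bullet> v t \<omega>) ^ (2 * k))" if "\<omega> \<in> space M" for \<omega>
      unfolding zeq[OF that] by (rule even_power_add_le)
    have zi: "integrable M (\<lambda>\<omega>. (u \<bullet> Z t \<omega>) ^ (2 * k))"
    proof (rule Bochner_Integration.integrable_bound[OF bi])
      show "(\<lambda>\<omega>. (u \<bullet> Z t \<omega>) ^ (2 * k)) \<in> borel_measurable M" using zm by (rule borel_measurable_power)
      show "AE \<omega> in M. norm ((u \<bullet> Z t \<omega>) ^ (2 * k)) \<le> norm (4 ^ k * ((y \<bullet> a t \<omega>) ^ (2 * k) + (u \<bullet> v t \<omega>) ^ (2 * k)))"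
      proof (rule AE_I2)
        fix \<omega> assume "\<omega> \<in> space M"
        from ptw[OF this] show "norm ((u \<bullet> Z t \<omega>) ^ (2 * k)) \<le> norm (4 ^ k * ((y \<bullet> a t \<omega>) ^ (2 * k) + (u \<bullet> v t \<omega>) ^ (2 * k)))"
          by simp
      qed
    qed
    have "expectation (\<lambda>\<omega>. (u \<bullet> Z t \<omega>) ^ (2 * k)) \<le> expectation (\<lambda>\<omega>. 4 ^ k * ((y \<bullet> a t \<omega>) ^ (2 * k) + (u \<bullet> v t \<omega>) ^ (2 * k)))"
      by (rule integral_mono[OF zi bi ptw])
    also have "\<dots> = 4 ^ k * (expectation (\<lambda>\<omega>. (y \<bullet> a t \<omega>) ^ (2 * k)) + expectation (\<lambda>\<omega>. (u \<bullet> v t \<omega>) ^ (2 * k)))"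
      using ma(1) mv(1) by simp
    also have "\<dots> \<le> 4 ^ k * ((2 * real k) ^ k * (4 * C\<^sup>2 * mx) ^ k * (u \<bullet> u) ^ k + (2 * real k) ^ k * (4 * C\<^sup>2 * mx) ^ k * (u \<bullet> u) ^ k)"
    proof (intro mult_left_mono add_mono)
      have "expectation (\<lambda>\<omega>. (y \<bullet> a t \<omega>) ^ (2 * k)) \<le> (2 * real k) ^ k * ((C\<^sup>2 * lamp) ^ k * (y \<bullet> y) ^ k)"
        using ma(2) unfolding Kp by (simp add: mult.assoc)
      also have "\<dots> \<le> (2 * real k) ^ k * ((C\<^sup>2 * mx) ^ k * (4 * (u \<bullet> u)) ^ k)"
        using mx lam_facts yy scalar_prod_self_nonneg[of y] by (intro mult_mono power_mono mult_left_mono) auto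
      finally show "expectation (\<lambda>\<omega>. (y \<bullet> a t \<omega>) ^ (2 * k)) \<le> (2 * real k) ^ k * (4 * C\<^sup>2 * mx) ^ k * (u \<bullet> u) ^ k"
        by (simp add: power_mult_distrib mult_ac)
      have "expectation (\<lambda>\<omega>. (u \<bullet> v t \<omega>) ^ (2 * k)) \<le> (2 * real k) ^ k * ((C\<^sup>2 * V) ^ k * (u \<bullet> u) ^ k)"
        using mv(2) unfolding Kp by (simp add: mult.assoc)
      also have "\<dots> \<le> (2 * real k) ^ k * ((4 * C\<^sup>2 * mx) ^ k * (u \<bullet> u) ^ k)"
      proof -
        have "C\<^sup>2 * V \<le> C\<^sup>2 * mx" using mx by (intro mult_left_mono) auto
        also have "\<dots> \<le> 4 * C\<^sup>2 * mx" using mx by simp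
        finally show ?thesis using lam_facts scalar_prod_self_nonneg[of u]
          by (intro mult_left_mono mult_right_mono power_mono) auto
      qed
      finally show "expectation (\<lambda>\<omega>. (u \<bullet> v t \<omega>) ^ (2 * k)) \<le> (2 * real k) ^ k * (4 * C\<^sup>2 * mx) ^ k * (u \<bullet> u) ^ k"
        by (simp add: mult.assoc)
    qed simp
    also have "\<dots> = 2 * ((2 * real k) ^ k * (16 * C\<^sup>2 * mx) ^ k * (u \<bullet> u) ^ k)"
    proof -
      have "16 * C\<^sup>2 * mx = 4 * (4 * C\<^sup>2 * mx)" by simp
      then have "(16 * C\<^sup>2 * mx) ^ k = 4 ^ k * (4 * C\<^sup>2 * mx) ^ k" by (simp only: power_mult_distrib)
      then show ?thesis by simp
    qed
    also have "\<dots> \<le> 2 ^ k * ((2 * real k) ^ k * (16 * C\<^sup>2 * mx) ^ k * (u \<bullet> u) ^ k)"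
      using mx scalar_prod_self_nonneg[of u] k power_increasing[of 1 k "2 :: real"]
      by (intro mult_right_mono) auto
    also have "\<dots> = (2 * real k) ^ k * \<kappa> ^ k * (u \<bullet> u) ^ k"
    proof -
      have "\<kappa> = 2 * (16 * C\<^sup>2 * mx)" unfolding \<kappa>_def by simp
      then have "\<kappa> ^ k = 2 ^ k * (16 * C\<^sup>2 * mx) ^ k" by (simp only: power_mult_distrib)
      then show ?thesis by simp
    qed
    finally show ?thesis using zi by simp
  qed
  have Ine: "I \<noteq> {}" "finite I" using dims by auto
  have ind: "indep_vars (\<lambda>_. borel) (\<lambda>t \<omega>. u \<bullet> Z t \<omega>) I" if u: "u \<in> carrier_vec n" for u
  proof (rule indep_vars_cong_space)
    show "indep_vars (\<lambda>_. borel) (\<lambda>t. lin_form ((Ut t)\<^sup>T *\<^sub>v u) (1 \<cdot>\<^sub>v u) t) I"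
    proof (rule lin_form_indep)
      show "(Ut t)\<^sup>T *\<^sub>v u \<in> carrier_vec r" if "t \<in> I" for t using Ut_carrier[OF that] u by simp
    qed (use u in simp)
    show "lin_form ((Ut t)\<^sup>T *\<^sub>v u) (1 \<cdot>\<^sub>v u) t \<omega> = u \<bullet> Z t \<omega>" if "t \<in> I" "\<omega> \<in> space M" for t \<omega>
      using Zform[OF that u] by simp
  qed
  have Zc: "Z t \<omega> \<in> carrier_vec n" if "t \<in> I" "\<omega> \<in> space M" for t \<omega>
    unfolding Z_def using observation_form(1)[OF that, of "0\<^sub>v n"] by simp
  have int: "integrable M (\<lambda>\<omega>. (u \<bullet> Z t \<omega>) ^ (2 * k))" if "t \<in> I" "u \<in> carrier_vec n" for t u k
    using mom[OF that, of k] by (cases "k = 0") auto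
  have mo: "expectation (\<lambda>\<omega>. (u \<bullet> Z t \<omega>) ^ (2 * k)) \<le> (2 * real k) ^ k * \<kappa> ^ k * (u \<bullet> u) ^ k"
    if "t \<in> I" "u \<in> carrier_vec n" "1 \<le> k" for t u k using mom[OF that] by simp
  have sec: "expectation (\<lambda>\<omega>. (u \<bullet> Z t \<omega>)\<^sup>2) = u \<bullet> (Sg t *\<^sub>v u)" if t: "t \<in> I" and u: "u \<in> carrier_vec n" for t u
  proof -
    have "expectation (\<lambda>\<omega>. (u \<bullet> Z t \<omega>)\<^sup>2)
        = expectation (\<lambda>\<omega>. lin_form ((Ut t)\<^sup>T *\<^sub>v u) (1 \<cdot>\<^sub>v u) t \<omega> * lin_form ((Ut t)\<^sup>T *\<^sub>v u) (1 \<cdot>\<^sub>v u) t \<omega>)"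
      by (rule Bochner_Integration.integral_cong) (auto simp: Zform[OF t _ u] power2_eq_square)
    then show ?thesis unfolding Sgform[OF t u] cov_moment(2)[OF Ut_carrier[OF t] Ut_carrier[OF t] t u] .
  qed
  have small: "sqrt ((real n + ln (real n)) / real (card I)) \<le> 1 / 6" using hn hs by simp
  obtain E where E: "E \<in> events" "prob E \<le> 1 / real n ^ 10"
    "\<And>\<omega> x. \<omega> \<in> space M - E \<Longrightarrow> x \<in> carrier_vec n \<Longrightarrow>
       \<bar>\<Sum>t\<in>I. (x \<bullet> Z t \<omega>)\<^sup>2 - x \<bullet> (Sg t *\<^sub>v x)\<bar>
         \<le> real (card I) * (144 * \<kappa> * sqrt ((real n + ln (real n)) / real (card I))) * (x \<bullet> x)"
    using subgaussian_deviation_event[OF Ine(2,1) n0 n2 \<kappa> ind Zc int mo Sg SgT sec small] by blast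
  show ?thesis
  proof (rule recovery_probability[OF E(1)])
    show "prob E \<le> 10 / real n ^ 10" by (rule order_trans[OF E(2)]) (simp add: divide_right_mono)
    fix \<omega> assume \<omega>: "\<omega> \<in> space M - E"
    then have \<omega>s: "\<omega> \<in> space M" by simp
    show "dim_estimate n (Dw \<omega>) = r"
    proof (rule recovery[OF \<omega>s _ _ gap, of "c * mx * h"])
      fix x :: "real vec" assume x: "x \<in> carrier_vec n" "x \<bullet> x = 1"
      have "\<bar>\<Sum>t\<in>I. (lin_form ((Ut t)\<^sup>T *\<^sub>v x) (1 \<cdot>\<^sub>v x) t \<omega>)\<^sup>2 - cov (Ut t) 1 (Ut t) 1 x\<bar>
          \<le> real \<alpha> * (144 * \<kappa> * sqrt ((real n + ln (real n)) / real \<alpha>))"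
      proof -
        have "(\<Sum>t\<in>I. (x \<bullet> Z t \<omega>)\<^sup>2 - x \<bullet> (Sg t *\<^sub>v x))
            = (\<Sum>t\<in>I. (lin_form ((Ut t)\<^sup>T *\<^sub>v x) (1 \<cdot>\<^sub>v x) t \<omega>)\<^sup>2 - cov (Ut t) 1 (Ut t) 1 x)"
          by (rule sum.cong[OF refl]) (simp only: Zform[OF _ \<omega>s x(1)] Sgform[OF _ x(1)])
        then show ?thesis using E(3)[OF \<omega> x(1)] x(2) by simp
      qed
      also have "\<dots> \<le> real \<alpha> * (144 * \<kappa> * (2 * h))" using hn \<kappa> by (intro mult_left_mono) auto
      also have "\<dots> \<le> real \<alpha> * (c * mx * h)"
      proof -
        \<comment> \<open>9216 = 144 * 32 * 2: the constant of the net bound, the one in \<kappa>,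
          and the passage from n + log n to n.\<close>
        have "9216 * C\<^sup>2 * (mx * h) \<le> c * (mx * h)" using c mx h by (intro mult_right_mono) auto
        then show ?thesis unfolding \<kappa>_def by (intro mult_left_mono) (auto simp: mult_ac)
      qed
      finally show "\<bar>\<Sum>t\<in>I. (lin_form ((Ut t)\<^sup>T *\<^sub>v x) (1 \<cdot>\<^sub>v x) t \<omega>)\<^sup>2 - cov (Ut t) 1 (Ut t) 1 x\<bar> \<le> real \<alpha> * (c * mx * h)" .
    next
      \<comment> \<open>The deviation bound is exactly the second summand of \<Delta>; the positive
        first summand supplies the strictness.\<close>
      have "c * mx * h = d_subgaussian c n \<alpha> \<Lambda> S * lamm" unfolding dsub using Lambda_pos by simp
      then show "c * mx * h + 3 * sqrt b * q * lamp + lam_vrest P S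
          < Delta (d_denom_subgaussian c n r \<alpha> (cond_f \<Lambda>)) (d_subgaussian c n \<alpha> \<Lambda> S) q b P \<Lambda> S * lamm"
        unfolding Delta_times_lam_min using mult_pos_pos[OF dd0 Lambda_pos] by simp
    qed
  qed
qed

end

section \<open>Bounded signal and noise\<close>

text \<open>\<open>signal_norm\<close> measures a_t at the scale sqrt(\<eta> \<open>lamp\<close>),
  at which its coordinates are bounded. The square of this scale enters the net bound and, divided
  by \<open>lamm\<close>, becomes the factor \<eta> f of \<open>d_denom_bounded\<close>.\<close>

locale bounded_model = dependent_model +
  fixes C \<eta> :: real and rv :: nat
  assumes C: "0 < C" and bounded: "bounded_signal_noise C M n r \<alpha> a v \<Lambda> S \<eta> rv"
    and signal_norm: "\<And>t. t \<in> I \<Longrightarrow> subgauss_norm_vec M r (a t) \<le> ereal (C * sqrt (\<eta> * lam_max \<Lambda>))"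
begin

lemma Lambda_diag: "j < r \<Longrightarrow> lamm \<le> \<Lambda> $$ (j,j)" "j < r \<Longrightarrow> \<Lambda> $$ (j,j) \<le> lamp"
proof -
  assume j: "j < r"
  have r0: "0 < r" using j by simp
  have "unit_vec r j \<bullet> (\<Lambda> *\<^sub>v unit_vec r j) = \<Lambda> $$ (j,j)"
    unfolding scalar_prod_left_unit[OF mult_mat_vec_carrier[OF Lambda_carrier unit_vec_carrier] j]
    by (subst index_mult_mat_vec) (use j carrier_matD[OF Lambda_carrier] scalar_prod_right_unit[OF j, of "row \<Lambda> j"] in auto)
  then show "lamm \<le> \<Lambda> $$ (j,j)" "\<Lambda> $$ (j,j) \<le> lamp"
    using rayleigh_bounds[OF Lambda_carrier Lambda_sym r0 unit_vec_carrier, of j] j by auto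
qed

text \<open>\<eta> is an almost sure bound for a random variable of mean 1.\<close>

lemma eta_ge_1: "1 \<le> \<eta>"
proof -
  have r0: "0 < r" using dims by simp
  have pos: "0 < \<Lambda> $$ (0,0)" using Lambda_diag(1)[OF r0] Lambda_pos by simp
  have "AE \<omega> in M. (a 1 \<omega> $ 0)\<^sup>2 / \<Lambda> $$ (0,0) \<le> \<eta>"
    using bounded r0 one_in_I unfolding bounded_signal_noise_def by blast
  then have "AE \<omega> in M. (a 1 \<omega> $ 0)\<^sup>2 \<le> \<eta> * \<Lambda> $$ (0,0)"
    by eventually_elim (use pos in \<open>simp add: pos_divide_le_eq\<close>)
  then have "expectation (\<lambda>\<omega>. (a 1 \<omega> $ 0)\<^sup>2) \<le> expectation (\<lambda>\<omega>. \<eta> * \<Lambda> $$ (0,0))"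
    by (intro integral_mono_AE a_sq one_in_I r0) auto
  then have "\<Lambda> $$ (0,0) \<le> \<eta> * \<Lambda> $$ (0,0)"
    using Lambda_index[OF one_in_I r0 r0] by (simp add: power2_eq_square prob_space)
  then show ?thesis using pos by simp
qed

lemma signal_bounded:
  assumes t: "t \<in> I"
  shows "AE \<omega> in M. a t \<omega> \<bullet> a t \<omega> \<le> \<eta> * real r * lamp"
proof -
  have "AE \<omega> in M. \<forall>j\<in>{..<r}. (a t \<omega> $ j)\<^sup>2 / \<Lambda> $$ (j,j) \<le> \<eta>"
    using bounded t unfolding bounded_signal_noise_def by (intro AE_finite_allI) auto
  then show ?thesis using AE_space
  proof eventually_elim
    fix \<omega> assume b: "\<forall>j\<in>{..<r}. (a t \<omega> $ j)\<^sup>2 / \<Lambda> $$ (j,j) \<le> \<eta>" and \<omega>: "\<omega> \<in> space M"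
    have "a t \<omega> \<bullet> a t \<omega> = (\<Sum>j<r. (a t \<omega> $ j)\<^sup>2)" by (rule scalar_prod_self_sum[OF a_carrier[OF t \<omega>]])
    also have "\<dots> \<le> (\<Sum>j<r. \<eta> * lamp)"
    proof (rule sum_mono)
      fix j assume j: "j \<in> {..<r}"
      then have jr: "j < r" by simp
      have "0 < \<Lambda> $$ (j,j)" using Lambda_diag(1)[OF jr] Lambda_pos by simp
      then have "(a t \<omega> $ j)\<^sup>2 \<le> \<eta> * \<Lambda> $$ (j,j)" using bspec[OF b j] by (simp only: pos_divide_le_eq)
      also have "\<dots> \<le> \<eta> * lamp" using Lambda_diag(2)[OF jr] eta_ge_1 by (intro mult_left_mono) auto
      finally show "(a t \<omega> $ j)\<^sup>2 \<le> \<eta> * lamp" .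
    qed
    finally show "a t \<omega> \<bullet> a t \<omega> \<le> \<eta> * real r * lamp" by (simp add: mult_ac)
  qed
qed

lemma noise_bounded: "t \<in> I \<Longrightarrow> AE \<omega> in M. v t \<omega> \<bullet> v t \<omega> \<le> real rv * V"
  using bounded unfolding bounded_signal_noise_def vec_norm2_square by blast

text \<open>Bridge to the normal form of \<open>covariance_deviation\<close>: for A of operator norm
  at most k the vector A a_t has scale k sqrt(\<open>lamp\<close>), and its ratio \<beta> is at
  least \<eta> r because |a_t|^2 <= \<eta> r \<open>lamp\<close>.\<close>

lemma signal_family:
  assumes A: "A \<in> carrier_mat n r" and le: "\<And>y. y \<in> carrier_vec r \<Longrightarrow> (A *\<^sub>v y) \<bullet> (A *\<^sub>v y) \<le> k\<^sup>2 * (y \<bullet> y)"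
    and \<beta>: "\<eta> * real r \<le> \<beta>" and t: "t \<in> I"
  shows "AE \<omega> in M. (A *\<^sub>v a t \<omega> + 0 \<cdot>\<^sub>v v t \<omega>) \<bullet> (A *\<^sub>v a t \<omega> + 0 \<cdot>\<^sub>v v t \<omega>) \<le> \<beta> * (k * sqrt lamp)\<^sup>2"
    and "x \<in> carrier_vec n \<Longrightarrow> cov A 0 A 0 x \<le> (k * sqrt lamp)\<^sup>2 * (x \<bullet> x)"
proof -
  have k2: "(k * sqrt lamp)\<^sup>2 = k\<^sup>2 * lamp" using lam_facts by (simp add: power_mult_distrib)
  show "AE \<omega> in M. (A *\<^sub>v a t \<omega> + 0 \<cdot>\<^sub>v v t \<omega>) \<bullet> (A *\<^sub>v a t \<omega> + 0 \<cdot>\<^sub>v v t \<omega>) \<le> \<beta> * (k * sqrt lamp)\<^sup>2"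
    using signal_bounded[OF t] AE_space
  proof eventually_elim
    fix \<omega> assume b: "a t \<omega> \<bullet> a t \<omega> \<le> \<eta> * real r * lamp" and \<omega>: "\<omega> \<in> space M"
    have "A *\<^sub>v a t \<omega> + 0 \<cdot>\<^sub>v v t \<omega> = A *\<^sub>v a t \<omega>"
      by (rule eq_vecI) (use A v_carrier[OF t \<omega>] in auto)
    then have "(A *\<^sub>v a t \<omega> + 0 \<cdot>\<^sub>v v t \<omega>) \<bullet> (A *\<^sub>v a t \<omega> + 0 \<cdot>\<^sub>v v t \<omega>) \<le> k\<^sup>2 * (a t \<omega> \<bullet> a t \<omega>)"
      using le[OF a_carrier[OF t \<omega>]] by simp
    also have "\<dots> \<le> k\<^sup>2 * (\<beta> * lamp)"
      using order_trans[OF b mult_right_mono[OF \<beta>]] lam_facts by (intro mult_left_mono) auto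
    finally show "(A *\<^sub>v a t \<omega> + 0 \<cdot>\<^sub>v v t \<omega>) \<bullet> (A *\<^sub>v a t \<omega> + 0 \<cdot>\<^sub>v v t \<omega>) \<le> \<beta> * (k * sqrt lamp)\<^sup>2"
      unfolding k2 by (simp only: mult_ac)
  qed
  assume x: "x \<in> carrier_vec n"
  have "cov A 0 A 0 x \<le> lamp * ((A\<^sup>T *\<^sub>v x) \<bullet> (A\<^sup>T *\<^sub>v x))"
    unfolding cov_def using Lambda_bounds(1)[of "A\<^sup>T *\<^sub>v x"] A x by simp
  also have "\<dots> \<le> lamp * (k\<^sup>2 * (x \<bullet> x))"
    using transpose_norm_bound[OF A le x] lam_facts by (intro mult_left_mono) auto
  finally show "cov A 0 A 0 x \<le> (k * sqrt lamp)\<^sup>2 * (x \<bullet> x)" unfolding k2 by (simp only: mult_ac)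
qed

lemma noise_family:
  assumes \<beta>: "real rv \<le> \<beta>" and t: "t \<in> I"
  shows "AE \<omega> in M. (0\<^sub>m n r *\<^sub>v a t \<omega> + 1 \<cdot>\<^sub>v v t \<omega>) \<bullet> (0\<^sub>m n r *\<^sub>v a t \<omega> + 1 \<cdot>\<^sub>v v t \<omega>) \<le> \<beta> * (sqrt V)\<^sup>2"
    and "x \<in> carrier_vec n \<Longrightarrow> cov (0\<^sub>m n r) 1 (0\<^sub>m n r) 1 x = x \<bullet> (S *\<^sub>v x)"
    and "x \<in> carrier_vec n \<Longrightarrow> cov (0\<^sub>m n r) 1 (0\<^sub>m n r) 1 x \<le> (sqrt V)\<^sup>2 * (x \<bullet> x)"
proof -
  have V2: "(sqrt V)\<^sup>2 = V" using lam_facts by simp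
  show "AE \<omega> in M. (0\<^sub>m n r *\<^sub>v a t \<omega> + 1 \<cdot>\<^sub>v v t \<omega>) \<bullet> (0\<^sub>m n r *\<^sub>v a t \<omega> + 1 \<cdot>\<^sub>v v t \<omega>) \<le> \<beta> * (sqrt V)\<^sup>2"
    using noise_bounded[OF t] AE_space
  proof eventually_elim
    fix \<omega> assume b: "v t \<omega> \<bullet> v t \<omega> \<le> real rv * V" and \<omega>: "\<omega> \<in> space M"
    have "0\<^sub>m n r *\<^sub>v a t \<omega> = 0\<^sub>v n" by (rule eq_vecI) (use a_carrier[OF t \<omega>] in auto)
    then have "0\<^sub>m n r *\<^sub>v a t \<omega> + 1 \<cdot>\<^sub>v v t \<omega> = v t \<omega>" using v_carrier[OF t \<omega>] by simp
    then show "(0\<^sub>m n r *\<^sub>v a t \<omega> + 1 \<cdot>\<^sub>v v t \<omega>) \<bullet> (0\<^sub>m n r *\<^sub>v a t \<omega> + 1 \<cdot>\<^sub>v v t \<omega>) \<le> \<beta> * (sqrt V)\<^sup>2"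
      using order_trans[OF b mult_right_mono[OF \<beta> lam_facts(3)]] unfolding V2 by simp
  qed
  assume x: "x \<in> carrier_vec n"
  have "(0\<^sub>m n r)\<^sup>T *\<^sub>v x = 0\<^sub>v r" by (rule eq_vecI) (use x in auto)
  then have "((0\<^sub>m n r)\<^sup>T *\<^sub>v x) \<bullet> (\<Lambda> *\<^sub>v ((0\<^sub>m n r)\<^sup>T *\<^sub>v x)) = 0"
    using mult_mat_vec_carrier[OF Lambda_carrier zero_carrier_vec] by simp
  then show e: "cov (0\<^sub>m n r) 1 (0\<^sub>m n r) 1 x = x \<bullet> (S *\<^sub>v x)" unfolding cov_def by simp
  show "cov (0\<^sub>m n r) 1 (0\<^sub>m n r) 1 x \<le> (sqrt V)\<^sup>2 * (x \<bullet> x)" unfolding e V2 by (rule S_bound[OF x])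
qed

lemma cov_signal_noise: "A \<in> carrier_mat n r \<Longrightarrow> x \<in> carrier_vec n \<Longrightarrow> cov A 0 (0\<^sub>m n r) 1 x = 0"
proof -
  assume A: "A \<in> carrier_mat n r" and x: "x \<in> carrier_vec n"
  have "(0\<^sub>m n r)\<^sup>T *\<^sub>v x = 0\<^sub>v r" by (rule eq_vecI) (use x in auto)
  moreover have "\<Lambda> *\<^sub>v 0\<^sub>v r = 0\<^sub>v r" by (rule eq_vecI) (use carrier_matD[OF Lambda_carrier] in auto)
  ultimately show ?thesis unfolding cov_def using A x by simp
qed

lemma signal_form_eq:
  assumes t: "t \<in> I" and \<omega>: "\<omega> \<in> space M" and y: "y \<in> carrier_vec r" and x: "x \<in> carrier_vec n"
  shows "lin_form y (0 \<cdot>\<^sub>v x) t \<omega> = y \<bullet> a t \<omega>"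
  unfolding lin_form_def using x v_carrier[OF t \<omega>] by simp

lemma noise_form_eq:
  assumes t: "t \<in> I" and \<omega>: "\<omega> \<in> space M" and x: "x \<in> carrier_vec n"
  shows "lin_form ((0\<^sub>m n r)\<^sup>T *\<^sub>v x) (1 \<cdot>\<^sub>v x) t \<omega> = x \<bullet> v t \<omega>"
proof -
  have "(0\<^sub>m n r)\<^sup>T *\<^sub>v x = 0\<^sub>v r" by (rule eq_vecI) (use x in auto)
  then show ?thesis unfolding lin_form_def using x a_carrier[OF t \<omega>] by simp
qed

lemma signal_deviation:
  assumes small: "sqrt ((real r + ln (real n)) / real \<alpha>) \<le> 1 / 6"
  obtains E where "E \<in> events" "prob E \<le> 1 / real n ^ 10"
    "\<And>\<omega> y. \<omega> \<in> space M - E \<Longrightarrow> y \<in> carrier_vec r \<Longrightarrow>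
       \<bar>\<Sum>t\<in>I. (y \<bullet> a t \<omega>)\<^sup>2 - y \<bullet> (\<Lambda> *\<^sub>v y)\<bar>
         \<le> real \<alpha> * (144 * (C\<^sup>2 * (\<eta> * lamp)) * sqrt ((real r + ln (real n)) / real \<alpha>)) * (y \<bullet> y)"
proof -
  have Ine: "I \<noteq> {}" "finite I" and r0: "0 < r" using dims by auto
  define K where "K = C * sqrt (\<eta> * lamp)"
  have K: "0 < K" unfolding K_def using C eta_ge_1 lam_facts by simp
  have K2: "K\<^sup>2 = C\<^sup>2 * (\<eta> * lamp)" unfolding K_def using eta_ge_1 lam_facts by (simp add: power_mult_distrib)
  have \<kappa>: "0 < K\<^sup>2" using K by simp
  have z: "lin_form u (0\<^sub>v n) t \<omega> = u \<bullet> a t \<omega>" if "t \<in> I" "\<omega> \<in> space M" for u t \<omega>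
    unfolding lin_form_def using v_carrier[OF that] by simp
  have ind: "indep_vars (\<lambda>_. borel) (\<lambda>t \<omega>. u \<bullet> a t \<omega>) I" if u: "u \<in> carrier_vec r" for u
  proof (rule indep_vars_cong_space)
    show "indep_vars (\<lambda>_. borel) (\<lambda>t. lin_form u (0\<^sub>v n) t) I" by (rule lin_form_indep[OF u]) simp
  qed (rule z)
  note mo = subgauss_norm_vec_even_moment[OF signal_norm[folded K_def] less_imp_le[OF K] _ a_carrier]
  have int: "integrable M (\<lambda>\<omega>. (u \<bullet> a t \<omega>) ^ (2 * k))" if "t \<in> I" "u \<in> carrier_vec r" for t u k
    using mo(1)[OF that(1) _ that(1) _ that(2), of k] by (cases "k = 0") auto
  have mom: "expectation (\<lambda>\<omega>. (u \<bullet> a t \<omega>) ^ (2 * k)) \<le> (2 * real k) ^ k * (K\<^sup>2) ^ k * (u \<bullet> u) ^ k"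
    if "t \<in> I" "u \<in> carrier_vec r" "1 \<le> k" for t u k
    using mo(2)[OF that(1,3,1) _ that(2)] by simp
  have sec: "expectation (\<lambda>\<omega>. (u \<bullet> a t \<omega>)\<^sup>2) = u \<bullet> (\<Lambda> *\<^sub>v u)" if t: "t \<in> I" and u: "u \<in> carrier_vec r" for t u
  proof -
    have "expectation (\<lambda>\<omega>. (u \<bullet> a t \<omega>)\<^sup>2) = expectation (\<lambda>\<omega>. lin_form u (0\<^sub>v n) t \<omega> * lin_form u (0\<^sub>v n) t \<omega>)"
      by (rule Bochner_Integration.integral_cong) (auto simp: z[OF t] power2_eq_square)
    also have "\<dots> = u \<bullet> (\<Lambda> *\<^sub>v u) + 0\<^sub>v n \<bullet> (S *\<^sub>v 0\<^sub>v n)" by (rule lin_form_moment(2)[OF t u u]) auto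
    also have "0\<^sub>v n \<bullet> (S *\<^sub>v 0\<^sub>v n) = 0" using mult_mat_vec_carrier[OF S_carrier zero_carrier_vec] by simp
    finally show ?thesis by simp
  qed
  have sm: "sqrt ((real r + ln (real n)) / real (card I)) \<le> 1 / 6" using small by simp
  obtain E where E: "E \<in> events" "prob E \<le> 1 / real n ^ 10"
    "\<And>\<omega> x. \<omega> \<in> space M - E \<Longrightarrow> x \<in> carrier_vec r \<Longrightarrow>
       \<bar>\<Sum>t\<in>I. (x \<bullet> a t \<omega>)\<^sup>2 - x \<bullet> (\<Lambda> *\<^sub>v x)\<bar>
         \<le> real (card I) * (144 * K\<^sup>2 * sqrt ((real r + ln (real n)) / real (card I))) * (x \<bullet> x)"
    using subgaussian_deviation_event[where Z = a and S = "\<lambda>_. \<Lambda>", OF Ine(2,1) r0 dims(4) \<kappa> ind a_carrier int mom Lambda_carrier Lambda_sym sec sm] by blast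
  show thesis by (rule that[OF E(1,2)]) (use E(3) in \<open>simp add: K2\<close>)
qed

text \<open>g fits the noise blocks: its second branch is sqrt(\<open>lamp\<close> V) /
  \<open>lamm\<close>, the scale of the block of ell + w with v, and its first branch belongs to v
  v'. The bound of V by \<open>lamm\<close> g^2 comes from the second branch because f >= 1.\<close>

lemma noise_g_facts:
  "0 \<le> noise_g \<Lambda> S" "V \<le> lamm * noise_g \<Lambda> S" "V \<le> lamm * (noise_g \<Lambda> S)\<^sup>2" "sqrt (lamp * V) \<le> lamm * noise_g \<Lambda> S"
  "V / lamm \<le> noise_g \<Lambda> S"
proof -
  let ?x = "V / lamm" and ?g = "noise_g \<Lambda> S"
  have f: "1 \<le> cond_f \<Lambda>" unfolding cond_f_def using lam_facts Lambda_pos by simp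
  have x: "0 \<le> ?x" using lam_facts Lambda_pos by simp
  show gx: "?x \<le> ?g" unfolding noise_g_def by simp
  have gs: "sqrt (?x * cond_f \<Lambda>) \<le> ?g" unfolding noise_g_def by simp
  show g0: "0 \<le> ?g" using x gx by simp
  show "V \<le> lamm * ?g" using gx Lambda_pos by (simp add: pos_divide_le_eq mult.commute)
  have xf: "?x * 1 \<le> ?x * cond_f \<Lambda>" using f x by (intro mult_left_mono) auto
  have "(sqrt (?x * cond_f \<Lambda>))\<^sup>2 \<le> ?g\<^sup>2" using gs xf x by (intro power_mono) auto
  then have "?x \<le> ?g\<^sup>2" using xf x by simp
  then show "V \<le> lamm * ?g\<^sup>2" using Lambda_pos by (simp add: pos_divide_le_eq mult.commute)
  have "lamp * V = lamm\<^sup>2 * (?x * cond_f \<Lambda>)" unfolding cond_f_def using Lambda_pos by (simp add: power2_eq_square)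
  then have "sqrt (lamp * V) = sqrt (lamm\<^sup>2) * sqrt (?x * cond_f \<Lambda>)" by (simp only: real_sqrt_mult)
  then have "sqrt (lamp * V) = lamm * sqrt (?x * cond_f \<Lambda>)" using Lambda_pos by simp
  then show "sqrt (lamp * V) \<le> lamm * ?g" using gs Lambda_pos by simp
qed

end

section \<open>The rates and their smallness\<close>

context bounded_model
begin

definition h :: real where "h = sqrt ((real r + ln (real n)) / real \<alpha>)"
text \<open>Chosen so that \<open>p1\<^sup>2\<close> is \<beta> \<open>lr\<close> with \<beta> =
  \<eta> r, and likewise for \<open>p2\<close> with the noise included; the Bernstein rate then
  reads p^2 + p, and \<open>d_bounded\<close> is c times the maximum of q f p1 and g p2.\<close>

definition p1 :: real where "p1 = sqrt (\<eta> * real r * lr)"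
definition p2 :: real where "p2 = sqrt (\<eta> * real (max rv r) * lr)"

lemma rates: "0 < h" "0 \<le> p1" "p1 \<le> p2" "p1\<^sup>2 = \<eta> * real r * lr" "p2\<^sup>2 = \<eta> * real (max rv r) * lr"
proof -
  have \<alpha>: "0 < real \<alpha>" and r1: "1 \<le> r" using dims by auto
  show "0 < h" unfolding h_def using \<alpha> r1 ln_n(1) by (intro real_sqrt_gt_zero divide_pos_pos) auto
  show "0 \<le> p1" unfolding p1_def using eta_ge_1 lr_nonneg by simp
  show "p1 \<le> p2" unfolding p1_def p2_def using eta_ge_1 lr_nonneg
    by (intro real_sqrt_le_mono mult_right_mono mult_left_mono) auto
  show "p1\<^sup>2 = \<eta> * real r * lr" "p2\<^sup>2 = \<eta> * real (max rv r) * lr"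
    unfolding p1_def p2_def using eta_ge_1 lr_nonneg by auto
qed

lemma d_eqs:
  "d_denom_bounded c \<eta> n r \<alpha> (cond_f \<Lambda>) = c * (\<eta> * cond_f \<Lambda> * h)"
  "d_bounded c \<eta> n r rv \<alpha> q (cond_f \<Lambda>) (noise_g \<Lambda> S) = c * max (q * cond_f \<Lambda> * p1) (noise_g \<Lambda> S * p2)"
proof -
  show "d_denom_bounded c \<eta> n r \<alpha> (cond_f \<Lambda>) = c * (\<eta> * cond_f \<Lambda> * h)"
    unfolding d_denom_bounded_def h_def by (simp only: mult.assoc)
  have split: "sqrt (\<eta> * real k * lr) = sqrt \<eta> * sqrt (real k * ln (real n) / real \<alpha>)" for k
    unfolding lr_def real_sqrt_mult[symmetric] by simp
  have s0: "0 \<le> sqrt \<eta>" using eta_ge_1 by simp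
  have mx: "sqrt \<eta> * max x y = max (sqrt \<eta> * x) (sqrt \<eta> * y)" for x y
    using mult_left_mono[OF _ s0, of x y] mult_left_mono[OF _ s0, of y x] by (auto simp: max_def)
  show "d_bounded c \<eta> n r rv \<alpha> q (cond_f \<Lambda>) (noise_g \<Lambda> S) = c * max (q * cond_f \<Lambda> * p1) (noise_g \<Lambda> S * p2)"
    unfolding d_bounded_def p1_def p2_def split mult.assoc[of c "sqrt \<eta>"] mx by (simp only: mult_ac)
qed

lemma cond_f_ge_1: "1 \<le> cond_f \<Lambda>"
  unfolding cond_f_def using lam_facts Lambda_pos by simp

lemma smallness:
  assumes c: "6 \<le> c"
    and gap: "max_gap r (\<Lambda> + P\<^sup>T * S * P)
      \<le> (1 - 4 * Delta (d_denom_bounded c \<eta> n r \<alpha> (cond_f \<Lambda>))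
            (d_bounded c \<eta> n r rv \<alpha> q (cond_f \<Lambda>) (noise_g \<Lambda> S)) q b P \<Lambda> S) * lamm + lam_vP P S"
  shows "\<eta> * cond_f \<Lambda> * h \<le> (1 + V / lamm) / 4" "q * cond_f \<Lambda> * p1 \<le> (1 + V / lamm) / 4"
    "noise_g \<Lambda> S * p2 \<le> (1 + V / lamm) / 4" "h \<le> 1 / 6"
proof -
  let ?f = "cond_f \<Lambda>" and ?g = "noise_g \<Lambda> S"
  define x where "x = V / lamm"
  note f = cond_f_ge_1 and e = eta_ge_1 and g = noise_g_facts
  have \<alpha>: "0 < real \<alpha>" using dims by simp
  have p2: "0 \<le> p2" using rates by linarith
  have nn: "0 \<le> \<eta> * ?f * h" "0 \<le> q * ?f * p1" "0 \<le> ?g * p2"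
    using rates f e q0 g(1) p2 by auto
  let ?mx = "max (q * ?f * p1) (?g * p2)"
  have c0: "0 \<le> c * (\<eta> * ?f * h)" "0 \<le> c * ?mx"
    using nn c by (auto simp: le_max_iff_disj intro!: mult_nonneg_nonneg)
  have s: "c * (\<eta> * ?f * h) \<le> (1 + x) / 4" "c * ?mx \<le> (1 + x) / 4"
    using Delta_smallness[OF gap] c0 unfolding d_eqs x_def by blast+
  have up: "6 * y \<le> c * y" if "0 \<le> y" for y using c that by (intro mult_right_mono) auto
  have mx0: "0 \<le> ?mx" using nn by (simp add: le_max_iff_disj)
  show "\<eta> * ?f * h \<le> (1 + V / lamm) / 4" unfolding x_def[symmetric] using order_trans[OF up[OF nn(1)] s(1)] nn(1) by linarith
  have "?mx \<le> (1 + x) / 4" using order_trans[OF up[OF mx0] s(2)] mx0 by linarith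
  then show "q * ?f * p1 \<le> (1 + V / lamm) / 4" "?g * p2 \<le> (1 + V / lamm) / 4" unfolding x_def by simp_all
  show "h \<le> 1 / 6"
  proof (cases "x < 1")
    case True
    have "1 * 1 \<le> \<eta> * ?f" using e f by (intro mult_mono) auto
    then have "1 * h \<le> \<eta> * ?f * h" using rates by (intro mult_right_mono) auto
    moreover have "(1 + x) / 4 \<le> 1 / 2" using True by simp
    note order_trans[OF order_trans[OF up[OF nn(1)] s(1)] this]
    ultimately show ?thesis by linarith
  next
    case False
    \<comment> \<open>For V >= \<open>lamm\<close> the bound on \<eta> f h is too weak, and h is
      compared with p2: 6 g p2 <= (1 + x)/4 <= g/2 gives p2 <= 1/12, and r + log n <= 3 r log n
      gives h^2 <= 3 p2^2 <= 3/144.\<close>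
    have g1: "1 \<le> ?g" "x \<le> ?g" using False g(5)[folded x_def] by linarith+
    have "6 * (?g * p2) \<le> (1 + x) / 4" using order_trans[OF up[OF mx0] s(2)] max.cobounded2[of "?g * p2" "q * ?f * p1"] by linarith
    also have "\<dots> \<le> ?g * (1 / 2)" using g1 by simp
    finally have "?g * (6 * p2) \<le> ?g * (1 / 2)" by (simp only: mult.left_commute)
    then have "6 * p2 \<le> 1 / 2" by (rule mult_left_le_imp_le) (use g1 in linarith)
    then have "p2\<^sup>2 \<le> (1 / 12)\<^sup>2" using p2 by (intro power_mono) auto
    then have b: "p2\<^sup>2 \<le> 1 / 144" by (simp add: power2_eq_square)
    have r1: "1 \<le> real r" using dims by simp
    have "real r * (1 / 2) \<le> real r * ln (real n)" using ln_n(1) by (intro mult_left_mono) auto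
    moreover have "1 * ln (real n) \<le> real r * ln (real n)" using r1 ln_n(1) by (intro mult_right_mono) auto
    ultimately have "real r + ln (real n) \<le> 3 * (real r * ln (real n))" by linarith
    then have "h\<^sup>2 \<le> 3 * (real r * ln (real n)) / real \<alpha>" unfolding h_def using \<alpha> r1 ln_n(1)
      by (simp add: divide_right_mono)
    also have "\<dots> = 3 * (1 * real r * lr)" unfolding lr_def by simp
    also have "\<dots> \<le> 3 * (\<eta> * real (max rv r) * lr)" using e lr_nonneg by (intro mult_left_mono mult_right_mono mult_mono) auto
    also have "\<dots> \<le> (1 / 6)\<^sup>2" using b unfolding rates(5) by (simp add: power2_eq_square)
    finally show ?thesis by (rule power2_le_imp_le) simp
  qed
qed

definition avg :: "(nat \<Rightarrow> real) \<Rightarrow> real" where "avg F = 1 / real \<alpha> * (\<Sum>t\<in>I. F t)"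

lemma avg_diff_bound: "\<bar>\<Sum>t\<in>I. F t - G t\<bar> \<le> real \<alpha> * y \<Longrightarrow> \<bar>avg F - avg G\<bar> \<le> y"
  unfolding avg_def right_diff_distrib[symmetric] sum_subtractf[symmetric] using dims
  by (simp add: abs_mult pos_divide_le_eq mult.commute)

lemma avg_const: "avg (\<lambda>t. y) = y"
  unfolding avg_def using dims by simp

lemma avg_mono: "(\<And>t. t \<in> I \<Longrightarrow> F t \<le> G t) \<Longrightarrow> avg F \<le> avg G"
  unfolding avg_def by (intro mult_left_mono sum_mono) auto

lemma avg_nonneg: "(\<And>t. t \<in> I \<Longrightarrow> 0 \<le> F t) \<Longrightarrow> 0 \<le> avg F"
  unfolding avg_def by (intro mult_nonneg_nonneg sum_nonneg) auto

lemma avg_abs: "\<bar>avg F\<bar> \<le> avg (\<lambda>t. \<bar>F t\<bar>)"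
  unfolding avg_def by (simp add: abs_mult divide_right_mono sum_abs)

lemma avg_Cauchy_Schwarz: "(avg (\<lambda>t. F t * G t))\<^sup>2 \<le> avg (\<lambda>t. (F t)\<^sup>2) * avg (\<lambda>t. (G t)\<^sup>2)"
  using Cauchy_Schwarz_ineq_sum[of F G I] divide_right_mono[of _ _ "(real \<alpha>)\<^sup>2"]
  unfolding avg_def by (simp add: power_divide power2_eq_square divide_right_mono)

lemma avg_add: "avg (\<lambda>t. F t + G t) = avg F + avg G" and avg_scale: "avg (\<lambda>t. k * F t) = k * avg F"
  unfolding avg_def sum.distrib sum_distrib_left[symmetric] by (simp_all add: distrib_left)

lemma kappa1_ge_1: "1 \<le> \<kappa>1"
  unfolding \<kappa>1_def using one_le_exp_iff[of "6 :: real"] by linarith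

text \<open>One event for each of the five blocks. In the block with v the sum ell + w stays
  together, at the price of ||U_t|| <= 2, because the bound for this block carries no factor
  q.\<close>

lemma deviation_events:
  assumes small: "h \<le> 1 / 6"
  obtains E where "E \<in> events" "prob E \<le> 10 / real n ^ 10"
    "\<And>\<omega> y. \<omega> \<in> space M - E \<Longrightarrow> y \<in> carrier_vec r \<Longrightarrow>
       \<bar>\<Sum>t\<in>I. (y \<bullet> a t \<omega>)\<^sup>2 - y \<bullet> (\<Lambda> *\<^sub>v y)\<bar> \<le> real \<alpha> * (144 * (C\<^sup>2 * (\<eta> * lamp)) * h) * (y \<bullet> y)"
    "\<And>\<omega> x. \<omega> \<in> space M - E \<Longrightarrow> x \<in> carrier_vec n \<Longrightarrow>
       \<bar>\<Sum>t\<in>I. lin_form (P\<^sup>T *\<^sub>v x) (0 \<cdot>\<^sub>v x) t \<omega> * lin_form ((Nt t)\<^sup>T *\<^sub>v x) (0 \<cdot>\<^sub>v x) t \<omega> - cov P 0 (Nt t) 0 x\<bar>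
       \<le> real \<alpha> * (2 * \<kappa>1 * (q * lamp) * (p1\<^sup>2 + p1)) * (x \<bullet> x)"
    "\<And>\<omega> x. \<omega> \<in> space M - E \<Longrightarrow> x \<in> carrier_vec n \<Longrightarrow>
       \<bar>\<Sum>t\<in>I. (lin_form ((Nt t)\<^sup>T *\<^sub>v x) (0 \<cdot>\<^sub>v x) t \<omega>)\<^sup>2 - cov (Nt t) 0 (Nt t) 0 x\<bar>
       \<le> real \<alpha> * (\<kappa>1 * (q\<^sup>2 * lamp) * (p1\<^sup>2 + p1)) * (x \<bullet> x)"
    "\<And>\<omega> x. \<omega> \<in> space M - E \<Longrightarrow> x \<in> carrier_vec n \<Longrightarrow>
       \<bar>\<Sum>t\<in>I. lin_form ((Ut t)\<^sup>T *\<^sub>v x) (0 \<cdot>\<^sub>v x) t \<omega> * lin_form ((0\<^sub>m n r)\<^sup>T *\<^sub>v x) (1 \<cdot>\<^sub>v x) t \<omega> - cov (Ut t) 0 (0\<^sub>m n r) 1 x\<bar>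
       \<le> real \<alpha> * (2 * \<kappa>1 * (2 * sqrt (lamp * V)) * (p2\<^sup>2 + p2)) * (x \<bullet> x)"
    "\<And>\<omega> x. \<omega> \<in> space M - E \<Longrightarrow> x \<in> carrier_vec n \<Longrightarrow>
       \<bar>\<Sum>t\<in>I. (lin_form ((0\<^sub>m n r)\<^sup>T *\<^sub>v x) (1 \<cdot>\<^sub>v x) t \<omega>)\<^sup>2 - cov (0\<^sub>m n r) 1 (0\<^sub>m n r) 1 x\<bar>
       \<le> real \<alpha> * (\<kappa>1 * V * (p2\<^sup>2 + p2)) * (x \<bullet> x)"
proof -
  let ?\<beta> = "\<eta> * real r" and ?\<beta>' = "\<eta> * real (max rv r)" and ?O = "0\<^sub>m n r :: real mat"
  have r1: "1 \<le> real r" using dims by simp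
  have b1: "1 \<le> ?\<beta>" using mult_mono[OF eta_ge_1 r1] eta_ge_1 by simp
  have bb: "?\<beta> \<le> ?\<beta>'" using eta_ge_1 by (intro mult_left_mono) auto
  have b1': "1 \<le> ?\<beta>'" using b1 bb by linarith
  have brv: "real rv \<le> ?\<beta>'" using mult_mono[OF eta_ge_1, of "real rv" "real (max rv r)"] eta_ge_1 by simp
  have l: "0 \<le> lamp" using lam_facts by simp
  have NP: "(P *\<^sub>v y) \<bullet> (P *\<^sub>v y) \<le> 1\<^sup>2 * (y \<bullet> y)" if "y \<in> carrier_vec r" for y
    using isometry_scalar_prod[OF dims(5,6) that that] by simp
  have NU: "(Ut t *\<^sub>v y) \<bullet> (Ut t *\<^sub>v y) \<le> 2\<^sup>2 * (y \<bullet> y)" if t: "t \<in> I" and y: "y \<in> carrier_vec r" for t y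
  proof -
    have "Ut t *\<^sub>v y = P *\<^sub>v y + Nt t *\<^sub>v y"
      unfolding Ut_def by (rule add_mult_distrib_mat_vec[OF dims(5) Nt_carrier[OF t] y])
    then have "(Ut t *\<^sub>v y) \<bullet> (Ut t *\<^sub>v y) \<le> 2 * ((P *\<^sub>v y) \<bullet> (P *\<^sub>v y)) + 2 * ((Nt t *\<^sub>v y) \<bullet> (Nt t *\<^sub>v y))"
      using vec_add_norm_le[OF mult_mat_vec_carrier[OF dims(5) y] mult_mat_vec_carrier[OF Nt_carrier[OF t] y]] by simp
    moreover have "q\<^sup>2 * (y \<bullet> y) \<le> 1 * (y \<bullet> y)" using q0 q1 scalar_prod_self_nonneg[of y]
      by (intro mult_right_mono power_le_one) auto
    ultimately show ?thesis using NP[OF y] Nt_norm[OF t y] by simp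
  qed
  have fP: "AE \<omega> in M. (P *\<^sub>v a t \<omega> + 0 \<cdot>\<^sub>v v t \<omega>) \<bullet> (P *\<^sub>v a t \<omega> + 0 \<cdot>\<^sub>v v t \<omega>) \<le> ?\<beta> * (1 * sqrt lamp)\<^sup>2"
      "x \<in> carrier_vec n \<Longrightarrow> cov P 0 P 0 x \<le> (1 * sqrt lamp)\<^sup>2 * (x \<bullet> x)" if t: "t \<in> I" for t x
    using signal_family[OF dims(5) NP order_refl t] by simp_all
  have fN: "AE \<omega> in M. (Nt t *\<^sub>v a t \<omega> + 0 \<cdot>\<^sub>v v t \<omega>) \<bullet> (Nt t *\<^sub>v a t \<omega> + 0 \<cdot>\<^sub>v v t \<omega>) \<le> ?\<beta> * (q * sqrt lamp)\<^sup>2"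
      "x \<in> carrier_vec n \<Longrightarrow> cov (Nt t) 0 (Nt t) 0 x \<le> (q * sqrt lamp)\<^sup>2 * (x \<bullet> x)" if t: "t \<in> I" for t x
    using signal_family[OF Nt_carrier[OF t] Nt_norm[OF t] order_refl t] by simp_all
  have fU: "AE \<omega> in M. (Ut t *\<^sub>v a t \<omega> + 0 \<cdot>\<^sub>v v t \<omega>) \<bullet> (Ut t *\<^sub>v a t \<omega> + 0 \<cdot>\<^sub>v v t \<omega>) \<le> ?\<beta>' * (2 * sqrt lamp)\<^sup>2"
      "x \<in> carrier_vec n \<Longrightarrow> cov (Ut t) 0 (Ut t) 0 x \<le> (2 * sqrt lamp)\<^sup>2 * (x \<bullet> x)" if t: "t \<in> I" for t x
    using signal_family[OF Ut_carrier[OF t] NU[OF t] bb t] by simp_all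
  have fv: "AE \<omega> in M. (?O *\<^sub>v a t \<omega> + 1 \<cdot>\<^sub>v v t \<omega>) \<bullet> (?O *\<^sub>v a t \<omega> + 1 \<cdot>\<^sub>v v t \<omega>) \<le> ?\<beta>' * (sqrt V)\<^sup>2"
      "x \<in> carrier_vec n \<Longrightarrow> cov ?O 1 ?O 1 x \<le> (sqrt V)\<^sup>2 * (x \<bullet> x)" if t: "t \<in> I" for t x
    by (rule noise_family(1)[OF brv t], rule noise_family(3)[OF brv t])
  have rt: "sqrt (p1\<^sup>2) = p1" "sqrt (p2\<^sup>2) = p2" using rates(2,3) by simp_all
  note pw = rates(4,5)[symmetric]
  have rs: "0 \<le> 1 * sqrt lamp" "0 \<le> q * sqrt lamp" "0 \<le> 2 * sqrt lamp" "0 \<le> sqrt V" using l q0 lam_facts by auto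
  have pr: "(1 * sqrt lamp) * (q * sqrt lamp) = q * lamp" "(q * sqrt lamp)\<^sup>2 = q\<^sup>2 * lamp"
      "(2 * sqrt lamp) * sqrt V = 2 * sqrt (lamp * V)" "(sqrt V)\<^sup>2 = V"
    using l lam_facts by (auto simp: power_mult_distrib real_sqrt_mult)
  obtain E0 where E0: "E0 \<in> events" "prob E0 \<le> 1 / real n ^ 10"
    "\<And>\<omega> y. \<omega> \<in> space M - E0 \<Longrightarrow> y \<in> carrier_vec r \<Longrightarrow>
       \<bar>\<Sum>t\<in>I. (y \<bullet> a t \<omega>)\<^sup>2 - y \<bullet> (\<Lambda> *\<^sub>v y)\<bar> \<le> real \<alpha> * (144 * (C\<^sup>2 * (\<eta> * lamp)) * h) * (y \<bullet> y)"
    using signal_deviation[OF small[unfolded h_def], folded h_def] by blast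
  obtain E1 where E1: "E1 \<in> events" "prob E1 \<le> 2 / real n ^ 10"
    "\<And>\<omega> x. \<omega> \<in> space M - E1 \<Longrightarrow> x \<in> carrier_vec n \<Longrightarrow>
       \<bar>\<Sum>t\<in>I. lin_form (P\<^sup>T *\<^sub>v x) (0 \<cdot>\<^sub>v x) t \<omega> * lin_form ((Nt t)\<^sup>T *\<^sub>v x) (0 \<cdot>\<^sub>v x) t \<omega> - cov P 0 (Nt t) 0 x\<bar>
       \<le> real \<alpha> * (2 * \<kappa>1 * (q * lamp) * (p1\<^sup>2 + p1)) * (x \<bullet> x)"
    by (rule product_deviation[where A = "\<lambda>_. P" and A' = Nt and c = 0 and c' = 0,
      OF dims(5) Nt_carrier b1 rs(1,2) fP(1) fN(1) fP(2) fN(2), unfolded pw, unfolded rt pr]) (assumption | rule that | blast)+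
  obtain E2 where E2: "E2 \<in> events" "prob E2 \<le> 1 / real n ^ 10"
    "\<And>\<omega> x. \<omega> \<in> space M - E2 \<Longrightarrow> x \<in> carrier_vec n \<Longrightarrow>
       \<bar>\<Sum>t\<in>I. (lin_form ((Nt t)\<^sup>T *\<^sub>v x) (0 \<cdot>\<^sub>v x) t \<omega>)\<^sup>2 - cov (Nt t) 0 (Nt t) 0 x\<bar>
       \<le> real \<alpha> * (\<kappa>1 * (q\<^sup>2 * lamp) * (p1\<^sup>2 + p1)) * (x \<bullet> x)"
    by (rule covariance_deviation[where A = Nt and c = 0, OF Nt_carrier b1 rs(2) fN(1) fN(2), unfolded pw, unfolded rt pr]) (assumption | rule that | blast)+
  obtain E3 where E3: "E3 \<in> events" "prob E3 \<le> 2 / real n ^ 10"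
    "\<And>\<omega> x. \<omega> \<in> space M - E3 \<Longrightarrow> x \<in> carrier_vec n \<Longrightarrow>
       \<bar>\<Sum>t\<in>I. lin_form ((Ut t)\<^sup>T *\<^sub>v x) (0 \<cdot>\<^sub>v x) t \<omega> * lin_form (?O\<^sup>T *\<^sub>v x) (1 \<cdot>\<^sub>v x) t \<omega> - cov (Ut t) 0 ?O 1 x\<bar>
       \<le> real \<alpha> * (2 * \<kappa>1 * (2 * sqrt (lamp * V)) * (p2\<^sup>2 + p2)) * (x \<bullet> x)"
    by (rule product_deviation[where A = Ut and A' = "\<lambda>_. ?O" and c = 0 and c' = 1,
      OF Ut_carrier zero_carrier_mat b1' rs(3,4) fU(1) fv(1) fU(2) fv(2), unfolded pw, unfolded rt pr]) (assumption | rule that | blast)+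
  obtain E4 where E4: "E4 \<in> events" "prob E4 \<le> 1 / real n ^ 10"
    "\<And>\<omega> x. \<omega> \<in> space M - E4 \<Longrightarrow> x \<in> carrier_vec n \<Longrightarrow>
       \<bar>\<Sum>t\<in>I. (lin_form (?O\<^sup>T *\<^sub>v x) (1 \<cdot>\<^sub>v x) t \<omega>)\<^sup>2 - cov ?O 1 ?O 1 x\<bar>
       \<le> real \<alpha> * (\<kappa>1 * V * (p2\<^sup>2 + p2)) * (x \<bullet> x)"
    by (rule covariance_deviation[where A = "\<lambda>_. ?O" and c = 1, OF zero_carrier_mat b1' rs(4) fv(1) fv(2), unfolded pw, unfolded rt pr]) (assumption | rule that | blast)+
  show thesis
  proof (rule that[of "E0 \<union> (E1 \<union> (E2 \<union> (E3 \<union> E4)))"])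
    have "prob (E0 \<union> (E1 \<union> (E2 \<union> (E3 \<union> E4)))) \<le> prob E0 + (prob E1 + (prob E2 + (prob E3 + prob E4)))"
      by (intro order_trans[OF measure_Un_le] add_left_mono) (use E0(1) E1(1) E2(1) E3(1) E4(1) in auto)
    \<comment> \<open>1 + 2 + 1 + 2 + 1: the two product blocks count twice because polarization
      uses two events.\<close>
    also have "\<dots> \<le> 7 / real n ^ 10" using E0(2) E1(2) E2(2) E3(2) E4(2) by simp
    also have "\<dots> \<le> 10 / real n ^ 10" by (intro divide_right_mono) auto
    finally show "prob (E0 \<union> (E1 \<union> (E2 \<union> (E3 \<union> E4)))) \<le> 10 / real n ^ 10" .
  next
    show "E0 \<union> (E1 \<union> (E2 \<union> (E3 \<union> E4))) \<in> events" using E0(1) E1(1) E2(1) E3(1) E4(1) by blast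
  qed (use E0(3) E1(3) E2(3) E3(3) E4(3) in auto)
qed

end

section \<open>Assembling the five blocks\<close>

context bounded_model
begin

lemma bounded_recovery:
  assumes c: "14 + 6 * max 1 (144 * C\<^sup>2) + 768 * exp 6 < c"
    and gap: "max_gap r (\<Lambda> + P\<^sup>T * S * P)
      \<le> (1 - 4 * Delta (d_denom_bounded c \<eta> n r \<alpha> (cond_f \<Lambda>))
            (d_bounded c \<eta> n r rv \<alpha> q (cond_f \<Lambda>) (noise_g \<Lambda> S)) q b P \<Lambda> S) * lamm + lam_vP P S"
  shows "1 - 10 / real n ^ 10 \<le> prob {\<omega> \<in> space M. dim_estimate n (Dw \<omega>) = r}"
proof -
  let ?f = "cond_f \<Lambda>" and ?g = "noise_g \<Lambda> S" and ?O = "0\<^sub>m n r :: real mat"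
  \<comment> \<open>A0 is the net constant of the signal block. The largest Bernstein constant is
    that of ell + w with v, namely 2 \<kappa>1 times the norm bound 2; with \<kappa>1 = 12 exp 6
    this gives 16 A = 768 exp 6 in K.\<close>
  define A0 A where "A0 = max 1 (144 * C\<^sup>2)" and "A = 4 * \<kappa>1"
  define K where "K = 14 + 6 * A0 + 16 * A"
  define mx where "mx = max (q * ?f * p1) (?g * p2)"
  have A: "1 \<le> A" "1 \<le> A0" unfolding A_def A0_def using kappa1_ge_1 by auto
  have Kc: "K < c" "6 \<le> c" using c A unfolding K_def A0_def[symmetric] unfolding A_def \<kappa>1_def by auto
  note sm = smallness[OF Kc(2) gap]
  have lam_f: "lamm * ?f = lamp" unfolding cond_f_def using Lambda_pos by simp
  have p2: "0 \<le> p2" using rates by linarith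
  have m: "0 \<le> sqrt (lamp * V)" "(sqrt (lamp * V))\<^sup>2 = lamm * ?f * V" unfolding lam_f using lam_facts by auto
  have mx0: "0 \<le> mx" unfolding mx_def using noise_g_facts(1) p2 by (simp add: le_max_iff_disj)
  have efh: "0 < \<eta> * ?f * h" using rates(1) eta_ge_1 cond_f_ge_1 by (intro mult_pos_pos) auto
  obtain E where E: "E \<in> events" "prob E \<le> 10 / real n ^ 10"
    "\<And>\<omega> y. \<omega> \<in> space M - E \<Longrightarrow> y \<in> carrier_vec r \<Longrightarrow>
       \<bar>\<Sum>t\<in>I. (y \<bullet> a t \<omega>)\<^sup>2 - y \<bullet> (\<Lambda> *\<^sub>v y)\<bar> \<le> real \<alpha> * (144 * (C\<^sup>2 * (\<eta> * lamp)) * h) * (y \<bullet> y)"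
    "\<And>\<omega> x. \<omega> \<in> space M - E \<Longrightarrow> x \<in> carrier_vec n \<Longrightarrow>
       \<bar>\<Sum>t\<in>I. lin_form (P\<^sup>T *\<^sub>v x) (0 \<cdot>\<^sub>v x) t \<omega> * lin_form ((Nt t)\<^sup>T *\<^sub>v x) (0 \<cdot>\<^sub>v x) t \<omega> - cov P 0 (Nt t) 0 x\<bar>
       \<le> real \<alpha> * (2 * \<kappa>1 * (q * lamp) * (p1\<^sup>2 + p1)) * (x \<bullet> x)"
    "\<And>\<omega> x. \<omega> \<in> space M - E \<Longrightarrow> x \<in> carrier_vec n \<Longrightarrow>
       \<bar>\<Sum>t\<in>I. (lin_form ((Nt t)\<^sup>T *\<^sub>v x) (0 \<cdot>\<^sub>v x) t \<omega>)\<^sup>2 - cov (Nt t) 0 (Nt t) 0 x\<bar>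
       \<le> real \<alpha> * (\<kappa>1 * (q\<^sup>2 * lamp) * (p1\<^sup>2 + p1)) * (x \<bullet> x)"
    "\<And>\<omega> x. \<omega> \<in> space M - E \<Longrightarrow> x \<in> carrier_vec n \<Longrightarrow>
       \<bar>\<Sum>t\<in>I. lin_form ((Ut t)\<^sup>T *\<^sub>v x) (0 \<cdot>\<^sub>v x) t \<omega> * lin_form (?O\<^sup>T *\<^sub>v x) (1 \<cdot>\<^sub>v x) t \<omega> - cov (Ut t) 0 ?O 1 x\<bar>
       \<le> real \<alpha> * (2 * \<kappa>1 * (2 * sqrt (lamp * V)) * (p2\<^sup>2 + p2)) * (x \<bullet> x)"
    "\<And>\<omega> x. \<omega> \<in> space M - E \<Longrightarrow> x \<in> carrier_vec n \<Longrightarrow>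
       \<bar>\<Sum>t\<in>I. (lin_form (?O\<^sup>T *\<^sub>v x) (1 \<cdot>\<^sub>v x) t \<omega>)\<^sup>2 - cov ?O 1 ?O 1 x\<bar>
       \<le> real \<alpha> * (\<kappa>1 * V * (p2\<^sup>2 + p2)) * (x \<bullet> x)"
    by (rule deviation_events[OF sm(4)]) (rule that; assumption)
  show ?thesis
  proof (rule recovery_probability[OF E(1,2)])
    fix \<omega> assume \<omega>: "\<omega> \<in> space M - E"
    then have \<omega>s: "\<omega> \<in> space M" by simp
    show "dim_estimate n (Dw \<omega>) = r"
    proof (rule recovery[OF \<omega>s _ _ gap, of "K * lamm * (\<eta> * ?f * h + mx)"])
      fix x :: "real vec" assume x: "x \<in> carrier_vec n" "x \<bullet> x = 1"
      define y where "y = P\<^sup>T *\<^sub>v x"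
      define s w u e where "s t = lin_form y (0 \<cdot>\<^sub>v x) t \<omega>" and "w t = lin_form ((Nt t)\<^sup>T *\<^sub>v x) (0 \<cdot>\<^sub>v x) t \<omega>"
        and "u t = lin_form ((Ut t)\<^sup>T *\<^sub>v x) (0 \<cdot>\<^sub>v x) t \<omega>" and "e t = lin_form (?O\<^sup>T *\<^sub>v x) (1 \<cdot>\<^sub>v x) t \<omega>" for t
      define Ess where "Ess = cov P 0 P 0 x"
      define c1 c2 where "c1 t = cov P 0 (Nt t) 0 x" and "c2 t = cov (Nt t) 0 (Nt t) 0 x" for t
      define Evv where "Evv = x \<bullet> (S *\<^sub>v x)"
      have y: "y \<in> carrier_vec r" unfolding y_def using dims(5) x by simp
      have yy: "y \<bullet> y \<le> 1" unfolding y_def using transpose_isometry_contracts[OF dims(5,6) x(1)] x(2) by simp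
      have z: "(Nt t)\<^sup>T *\<^sub>v x \<in> carrier_vec r" if "t \<in> I" for t using Nt_carrier[OF that] x by simp
      have us: "u t = s t + w t" if t: "t \<in> I" for t
      proof -
        have "u t = (y + (Nt t)\<^sup>T *\<^sub>v x) \<bullet> a t \<omega>" unfolding u_def UtT[OF t x(1)] y_def[symmetric]
          using signal_form_eq[OF t \<omega>s add_carrier_vec[OF y z[OF t]] x(1)] .
        also have "\<dots> = s t + w t" unfolding s_def w_def signal_form_eq[OF t \<omega>s y x(1)] signal_form_eq[OF t \<omega>s z[OF t] x(1)]
          by (rule add_scalar_prod_distrib[OF y z[OF t] a_carrier[OF t \<omega>s]])
        finally show ?thesis .
      qed
      have tot: "lin_form ((Ut t)\<^sup>T *\<^sub>v x) (1 \<cdot>\<^sub>v x) t \<omega> = u t + e t" if t: "t \<in> I" for t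
      proof -
        have "(Ut t)\<^sup>T *\<^sub>v x \<in> carrier_vec r" using Ut_carrier[OF t] x by simp
        then show ?thesis unfolding u_def e_def signal_form_eq[OF t \<omega>s _ x(1)] noise_form_eq[OF t \<omega>s x(1)]
          using signal_form_eq[OF t \<omega>s _ x(1)] by (simp add: lin_form_def)
      qed
      have cvv: "cov ?O 1 ?O 1 x = Evv" unfolding Evv_def using noise_family(2)[OF order_refl one_in_I x(1)] .
      have c0: "cov (Ut t) 0 ?O 1 x = 0" if "t \<in> I" for t by (rule cov_signal_noise[OF Ut_carrier[OF that] x(1)])
      have e0: "\<bar>avg (\<lambda>t. (s t)\<^sup>2) - Ess\<bar> \<le> A0 * \<eta> * (lamm * ?f) * h"
      proof -
        have "\<bar>\<Sum>t\<in>I. (s t)\<^sup>2 - Ess\<bar> \<le> real \<alpha> * (144 * (C\<^sup>2 * (\<eta> * lamp)) * h) * (y \<bullet> y)"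
        proof -
          have "(\<Sum>t\<in>I. (s t)\<^sup>2 - Ess) = (\<Sum>t\<in>I. (y \<bullet> a t \<omega>)\<^sup>2 - y \<bullet> (\<Lambda> *\<^sub>v y))"
            by (rule sum.cong[OF refl]) (simp add: s_def signal_form_eq[OF _ \<omega>s y x(1)] Ess_def cov_def y_def[symmetric])
          then show ?thesis using E(3)[OF \<omega> y] by simp
        qed
        also have "\<dots> \<le> real \<alpha> * (144 * (C\<^sup>2 * (\<eta> * lamp)) * h) * 1"
          using yy eta_ge_1 lam_facts rates(1) by (intro mult_left_mono) auto
        also have "\<dots> \<le> real \<alpha> * (A0 * (\<eta> * lamp * h))"
        proof -
          have "144 * C\<^sup>2 * (\<eta> * lamp * h) \<le> A0 * (\<eta> * lamp * h)"
            unfolding A0_def using eta_ge_1 lam_facts rates(1) by (intro mult_right_mono) auto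
          then have "real \<alpha> * (144 * C\<^sup>2 * (\<eta> * lamp * h)) \<le> real \<alpha> * (A0 * (\<eta> * lamp * h))"
            by (rule mult_left_mono) simp
          then show ?thesis by (simp only: mult_ac mult_1_right)
        qed
        finally have "\<bar>avg (\<lambda>t. (s t)\<^sup>2) - avg (\<lambda>t. Ess)\<bar> \<le> A0 * (\<eta> * lamp * h)" by (rule avg_diff_bound)
        then show ?thesis unfolding avg_const lam_f by (simp only: mult_ac)
      qed
      have weaken: "B * X * Y \<le> A * X * Y" if "B \<le> A" "0 \<le> X" "0 \<le> Y" for B X Y :: real
        using that by (intro mult_right_mono) auto
      have pp: "0 \<le> p1\<^sup>2 + p1" "0 \<le> p2\<^sup>2 + p2" using rates(2) p2 by auto
      have q2: "0 \<le> q * lamp" "0 \<le> q\<^sup>2 * lamp" using q0 lam_facts by auto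
      have k: "2 * \<kappa>1 \<le> A" "\<kappa>1 \<le> A" unfolding A_def using kappa1_ge_1 by auto
      have e1: "\<bar>avg (\<lambda>t. s t * w t) - avg c1\<bar> \<le> A * (q * (lamm * ?f)) * (p1\<^sup>2 + p1)"
        unfolding lam_f by (rule order_trans[OF avg_diff_bound weaken[OF k(1) q2(1) pp(1)]])
          (use E(4)[OF \<omega> x(1)] x(2) in \<open>simp add: s_def w_def c1_def y_def\<close>)
      have e2: "\<bar>avg (\<lambda>t. (w t)\<^sup>2) - avg c2\<bar> \<le> A * (q\<^sup>2 * (lamm * ?f)) * (p1\<^sup>2 + p1)"
        unfolding lam_f by (rule order_trans[OF avg_diff_bound weaken[OF k(2) q2(2) pp(1)]])
          (use E(5)[OF \<omega> x(1)] x(2) in \<open>simp add: w_def c2_def\<close>)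
      have e3: "\<bar>avg (\<lambda>t. u t * e t)\<bar> \<le> A * sqrt (lamp * V) * (p2\<^sup>2 + p2)"
      proof -
        have "(\<Sum>t\<in>I. u t * e t - 0) = (\<Sum>t\<in>I. u t * e t - cov (Ut t) 0 ?O 1 x)"
          by (rule sum.cong[OF refl]) (simp only: c0)
        then have "\<bar>avg (\<lambda>t. u t * e t) - avg (\<lambda>t. 0)\<bar> \<le> 2 * \<kappa>1 * (2 * sqrt (lamp * V)) * (p2\<^sup>2 + p2)"
          using E(6)[OF \<omega> x(1)] x(2) by (intro avg_diff_bound) (simp add: u_def e_def)
        then show ?thesis unfolding avg_const A_def by simp
      qed
      have e4: "\<bar>avg (\<lambda>t. (e t)\<^sup>2) - Evv\<bar> \<le> A * V * (p2\<^sup>2 + p2)"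
      proof -
        have "\<bar>avg (\<lambda>t. (e t)\<^sup>2) - avg (\<lambda>t. Evv)\<bar> \<le> \<kappa>1 * V * (p2\<^sup>2 + p2)"
          using E(7)[OF \<omega> x(1)] x(2) unfolding cvv by (intro avg_diff_bound) (simp add: e_def)
        then show ?thesis unfolding avg_const using weaken[OF k(2) lam_facts(3) pp(2)] by linarith
      qed
      have Ess: "0 \<le> Ess" "Ess \<le> lamm * ?f"
      proof -
        show "0 \<le> Ess" unfolding Ess_def by (rule cov_self_nonneg[OF dims(5) x(1)])
        have "Ess \<le> lamp * (y \<bullet> y)" unfolding Ess_def cov_def y_def[symmetric] using Lambda_bounds(1)[OF y] by simp
        also have "\<dots> \<le> lamp * 1" using yy lam_facts by (intro mult_left_mono) auto
        finally show "Ess \<le> lamm * ?f" unfolding lam_f by simp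
      qed
      have Esw: "\<bar>avg c1\<bar> \<le> q * (lamm * ?f)"
      proof -
        have "\<bar>avg c1\<bar> \<le> avg (\<lambda>t. \<bar>c1 t\<bar>)" by (rule avg_abs)
        also have "\<dots> \<le> avg (\<lambda>t. q * lamp)"
        proof (rule avg_mono)
          fix t assume t: "t \<in> I"
          have "\<bar>c1 t\<bar> \<le> lamp * (vec_norm2 y * vec_norm2 ((Nt t)\<^sup>T *\<^sub>v x))"
            unfolding c1_def cov_def y_def[symmetric] using Lambda_bounds(2)[OF y z[OF t]] by simp
          also have "\<dots> \<le> lamp * (1 * q)"
            using form_norms[OF t x, folded y_def] lam_facts vec_norm2_nonneg by (intro mult_left_mono mult_mono) auto
          finally show "\<bar>c1 t\<bar> \<le> q * lamp" by (simp add: mult.commute)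
        qed
        finally show ?thesis unfolding avg_const lam_f .
      qed
      have Eww: "0 \<le> avg c2" "avg c2 \<le> q\<^sup>2 * (lamm * ?f)"
      proof -
        show "0 \<le> avg c2" unfolding c2_def by (intro avg_nonneg cov_self_nonneg Nt_carrier x(1))
        have "avg c2 \<le> avg (\<lambda>t. q\<^sup>2 * lamp)"
        proof (rule avg_mono)
          fix t assume t: "t \<in> I"
          show "c2 t \<le> q\<^sup>2 * lamp"
            unfolding c2_def using signal_family(2)[OF Nt_carrier[OF t] Nt_norm[OF t] order_refl t x(1)] x(2) lam_facts
            by (simp add: power_mult_distrib)
        qed
        then show "avg c2 \<le> q\<^sup>2 * (lamm * ?f)" unfolding avg_const lam_f .
      qed
      have Evv: "0 \<le> Evv" "Evv \<le> V" unfolding Evv_def using S_psd[OF x(1)] S_bound[OF x(1)] x(2) by auto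
      \<comment> \<open>The events give the averages of s^2 and w^2 but not of u^2, so the first
        Cauchy-Schwarz factor is split along u = s + w.\<close>
      have cs2: "(avg (\<lambda>t. u t * e t))\<^sup>2 \<le> (2 * avg (\<lambda>t. (s t)\<^sup>2) + 2 * avg (\<lambda>t. (w t)\<^sup>2)) * avg (\<lambda>t. (e t)\<^sup>2)"
      proof (rule order_trans[OF avg_Cauchy_Schwarz mult_right_mono])
        show "0 \<le> avg (\<lambda>t. (e t)\<^sup>2)" by (rule avg_nonneg) simp
        have "avg (\<lambda>t. (u t)\<^sup>2) \<le> avg (\<lambda>t. 2 * (s t)\<^sup>2 + 2 * (w t)\<^sup>2)"
        proof (rule avg_mono)
          fix t assume "t \<in> I"
          then show "(u t)\<^sup>2 \<le> 2 * (s t)\<^sup>2 + 2 * (w t)\<^sup>2" using zero_le_power2[of "s t - w t"]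
            by (simp add: us power2_eq_square algebra_simps)
        qed
        then show "avg (\<lambda>t. (u t)\<^sup>2) \<le> 2 * avg (\<lambda>t. (s t)\<^sup>2) + 2 * avg (\<lambda>t. (w t)\<^sup>2)" unfolding avg_add avg_scale .
      qed
      have tri: "\<bar>x1 + 2 * x2 + x3 + 2 * x4 + x5\<bar> \<le> \<bar>x1\<bar> + 2 * \<bar>x2\<bar> + \<bar>x3\<bar> + 2 * \<bar>x4\<bar> + \<bar>x5\<bar>" for x1 x2 x3 x4 x5 :: real
        by (smt (verit))
      have nn: "0 \<le> avg (\<lambda>t. (s t)\<^sup>2)" "0 \<le> avg (\<lambda>t. (w t)\<^sup>2)" "0 \<le> avg (\<lambda>t. (e t)\<^sup>2)" by (rule avg_nonneg, simp)+
      have "avg (\<lambda>t. (lin_form ((Ut t)\<^sup>T *\<^sub>v x) (1 \<cdot>\<^sub>v x) t \<omega>)\<^sup>2 - cov (Ut t) 1 (Ut t) 1 x)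
        = avg (\<lambda>t. (s t)\<^sup>2 + 2 * (s t * w t) + (w t)\<^sup>2 + 2 * (u t * e t) + (e t)\<^sup>2 + - 1 * (Ess + 2 * c1 t + c2 t + Evv))"
        unfolding avg_def
      proof (intro arg_cong[where f = "\<lambda>z. 1 / real \<alpha> * z"] sum.cong refl)
        fix t assume t: "t \<in> I"
        have "(u t + e t)\<^sup>2 = (u t)\<^sup>2 + 2 * (u t * e t) + (e t)\<^sup>2" "(u t)\<^sup>2 = (s t)\<^sup>2 + 2 * (s t * w t) + (w t)\<^sup>2"
          unfolding us[OF t] by (simp_all add: power2_eq_square algebra_simps)
        then show "(lin_form ((Ut t)\<^sup>T *\<^sub>v x) (1 \<cdot>\<^sub>v x) t \<omega>)\<^sup>2 - cov (Ut t) 1 (Ut t) 1 x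
          = (s t)\<^sup>2 + 2 * (s t * w t) + (w t)\<^sup>2 + 2 * (u t * e t) + (e t)\<^sup>2 + - 1 * (Ess + 2 * c1 t + c2 t + Evv)"
          unfolding tot[OF t] cov_Ut[OF t x(1)] Ess_def[symmetric] c1_def[symmetric] c2_def[symmetric] Evv_def[symmetric] by simp
      qed
      also have "\<dots> = (avg (\<lambda>t. (s t)\<^sup>2) - Ess) + 2 * (avg (\<lambda>t. s t * w t) - avg c1) + (avg (\<lambda>t. (w t)\<^sup>2) - avg c2)
          + 2 * avg (\<lambda>t. u t * e t) + (avg (\<lambda>t. (e t)\<^sup>2) - Evv)"
        unfolding avg_add avg_scale avg_const by simp
      finally have "\<bar>avg (\<lambda>t. (lin_form ((Ut t)\<^sup>T *\<^sub>v x) (1 \<cdot>\<^sub>v x) t \<omega>)\<^sup>2 - cov (Ut t) 1 (Ut t) 1 x)\<bar>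
          \<le> \<bar>avg (\<lambda>t. (s t)\<^sup>2) - Ess\<bar> + 2 * \<bar>avg (\<lambda>t. s t * w t) - avg c1\<bar> + \<bar>avg (\<lambda>t. (w t)\<^sup>2) - avg c2\<bar>
          + 2 * \<bar>avg (\<lambda>t. u t * e t)\<bar> + \<bar>avg (\<lambda>t. (e t)\<^sup>2) - Evv\<bar>"
        using tri by presburger
      also have "\<dots> \<le> (14 + 6 * A0 + 16 * A) * lamm * (\<eta> * ?f * h + max (q * ?f * p1) (?g * p2))"
        by (rule total_deviation_bound[OF Lambda_pos cond_f_ge_1 lam_facts(3) q0 less_imp_le[OF q1] less_imp_le[OF rates(1)] eta_ge_1
              rates(2,3) A noise_g_facts(1) m noise_g_facts(4,2,3) sm(1-3) Ess Esw Eww Evv e0 e1 e2 e3 e4 nn avg_Cauchy_Schwarz cs2])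
      finally show "\<bar>\<Sum>t\<in>I. (lin_form ((Ut t)\<^sup>T *\<^sub>v x) (1 \<cdot>\<^sub>v x) t \<omega>)\<^sup>2 - cov (Ut t) 1 (Ut t) 1 x\<bar>
          \<le> real \<alpha> * (K * lamm * (\<eta> * ?f * h + mx))"
        unfolding avg_def K_def[symmetric] mx_def[symmetric] abs_mult using dims by (simp add: pos_divide_le_eq mult.commute)
    next
      \<comment> \<open>The strict inequality of the recovery criterion comes from K < c together
        with \<eta> f h > 0.\<close>
      have "K * (lamm * (\<eta> * ?f * h + mx)) < c * (lamm * (\<eta> * ?f * h + mx))"
        using Kc(1) efh mx0 Lambda_pos by (intro mult_strict_right_mono mult_pos_pos) auto
      then have "K * lamm * (\<eta> * ?f * h + mx) < c * (\<eta> * ?f * h) * lamm + c * mx * lamm"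
        by (simp only: mult.assoc distrib_left mult.commute[of lamm])
      then show "K * lamm * (\<eta> * ?f * h + mx) + 3 * sqrt b * q * lamp + lam_vrest P S
          < Delta (d_denom_bounded c \<eta> n r \<alpha> ?f) (d_bounded c \<eta> n r rv \<alpha> q ?f ?g) q b P \<Lambda> S * lamm"
        unfolding Delta_times_lam_min unfolding d_eqs mx_def[symmetric] by linarith
    qed
  qed
qed

end

theorem theorem2p16:
  fixes C :: real
  assumes "C > 0"
  shows "\<exists>c > 0. \<forall>(M :: 'w measure) n r \<alpha> P a v \<Lambda> \<Sigma>v Mt q b.
    basic_model M n r \<alpha> P a v \<Lambda> \<Sigma>v \<and> lam_max \<Lambda> \<le> C \<and> lam_v \<Sigma>v \<le> C \<and>
    b < 1 \<and> q < 1 \<and> data_dependency n \<alpha> P Mt q b \<longrightarrow>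
    (\<forall>\<eta> rv.
       bounded_signal_noise C M n r \<alpha> a v \<Lambda> \<Sigma>v \<eta> rv \<and>
       (\<forall>t \<in> {1..\<alpha>}. subgauss_norm_vec M r (a t) \<le> ereal (C * sqrt (\<eta> * lam_max \<Lambda>))) \<and>
       max_gap r (\<Lambda> + P\<^sup>T * \<Sigma>v * P)
         \<le> (1 - 4 * Delta (d_denom_bounded c \<eta> n r \<alpha> (cond_f \<Lambda>))
                          (d_bounded c \<eta> n r rv \<alpha> q (cond_f \<Lambda>) (noise_g \<Lambda> \<Sigma>v)) q b P \<Lambda> \<Sigma>v)
             * lam_min \<Lambda> + lam_vP P \<Sigma>v \<longrightarrow>
       measure M {\<omega> \<in> space M. dim_estimate n (sample_cov n \<alpha> (observation P Mt a v) \<omega>) = r}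
         \<ge> 1 - 10 / real n ^ 10) \<and>
    (subgaussian_signal_noise C M n r \<alpha> a v \<Lambda> \<Sigma>v \<and>
       max_gap r (\<Lambda> + P\<^sup>T * \<Sigma>v * P)
         \<le> (1 - 4 * Delta (d_denom_subgaussian c n r \<alpha> (cond_f \<Lambda>))
                          (d_subgaussian c n \<alpha> \<Lambda> \<Sigma>v) q b P \<Lambda> \<Sigma>v)
             * lam_min \<Lambda> + lam_vP P \<Sigma>v \<longrightarrow>
       measure M {\<omega> \<in> space M. dim_estimate n (sample_cov n \<alpha> (observation P Mt a v) \<omega>) = r}
         \<ge> 1 - 10 / real n ^ 10)"
proof -
  \<comment> \<open>One constant for both cases: 15 in place of 14 makes the inequality of the
    bounded case strict, and 9216 C^2 is what the sub-Gaussian case asks for. All summands are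
    nonnegative, so they can simply be added.\<close>
  define c where "c = 15 + 6 * max 1 (144 * C\<^sup>2) + 768 * exp 6 + 9216 * C\<^sup>2"
  have c: "0 < c" "6 \<le> c" "9216 * C\<^sup>2 \<le> c" "14 + 6 * max 1 (144 * C\<^sup>2) + 768 * exp 6 < c"
    unfolding c_def using exp_gt_zero[of "6 :: real"] zero_le_power2[of C] by linarith+
  show ?thesis
  proof (intro exI[of _ c] conjI c(1) allI impI; elim conjE)
    fix M :: "'w measure" and n r \<alpha> :: nat and P :: "real mat" and a v :: "nat \<Rightarrow> 'w \<Rightarrow> real vec"
      and \<Lambda> \<Sigma>v :: "real mat" and Mt :: "nat \<Rightarrow> real mat" and q b \<eta> :: real and rv :: nat
    assume basic: "basic_model M n r \<alpha> P a v \<Lambda> \<Sigma>v" and dep: "b < 1" "q < 1" "data_dependency n \<alpha> P Mt q b"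
    have "prob_space M" "0 < lam_min \<Lambda>" using basic unfolding basic_model_def by auto
    with basic dep have model: "dependent_model M n r \<alpha> P a v \<Lambda> \<Sigma>v Mt q b"
      by (simp add: dependent_model_def dependent_model_axioms_def signal_model_def signal_model_axioms_def)
    {
      assume "bounded_signal_noise C M n r \<alpha> a v \<Lambda> \<Sigma>v \<eta> rv"
        "\<forall>t \<in> {1..\<alpha>}. subgauss_norm_vec M r (a t) \<le> ereal (C * sqrt (\<eta> * lam_max \<Lambda>))"
      with model assms have bounded: "bounded_model M n r \<alpha> P a v \<Lambda> \<Sigma>v Mt q b C \<eta> rv"
        by (simp add: bounded_model_def bounded_model_axioms_def)
      assume "max_gap r (\<Lambda> + P\<^sup>T * \<Sigma>v * P)
         \<le> (1 - 4 * Delta (d_denom_bounded c \<eta> n r \<alpha> (cond_f \<Lambda>))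
                          (d_bounded c \<eta> n r rv \<alpha> q (cond_f \<Lambda>) (noise_g \<Lambda> \<Sigma>v)) q b P \<Lambda> \<Sigma>v)
             * lam_min \<Lambda> + lam_vP P \<Sigma>v"
      then show "measure M {\<omega> \<in> space M. dim_estimate n (sample_cov n \<alpha> (observation P Mt a v) \<omega>) = r}
         \<ge> 1 - 10 / real n ^ 10" by (rule bounded_model.bounded_recovery[OF bounded c(4)])
    next
      assume "subgaussian_signal_noise C M n r \<alpha> a v \<Lambda> \<Sigma>v"
        "max_gap r (\<Lambda> + P\<^sup>T * \<Sigma>v * P)
         \<le> (1 - 4 * Delta (d_denom_subgaussian c n r \<alpha> (cond_f \<Lambda>))
                          (d_subgaussian c n \<alpha> \<Lambda> \<Sigma>v) q b P \<Lambda> \<Sigma>v)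
             * lam_min \<Lambda> + lam_vP P \<Sigma>v"
      then show "measure M {\<omega> \<in> space M. dim_estimate n (sample_cov n \<alpha> (observation P Mt a v) \<omega>) = r}
         \<ge> 1 - 10 / real n ^ 10" by (rule dependent_model.subgaussian_recovery[OF model assms c(2,3)])
    }
  qed
qed

end
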